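(* Let $\Gamma$ be a countable abelian group, $X$ an infinite, second countable compact Hausdorff space, and $\Gamma\curvearrowright X$ a faithful and almost minimal action by homeomorphisms. Then the set $\mathcal{C}$ of finite orbits is countable, and there is a bijective correspondence between $$\left(\bigsqcup_{[x]\in \mathcal{C}}\{[x]\}\times\widehat{\Gamma_x}\right)\sqcup\{\mu\in\partial\mathcal{P}_\Gamma(X):\mu\text{ has full support}\}$$ and $\partial T(C(X)\rtimes \Gamma)$, which maps $\mu\in\partial\mathcal{P}_\Gamma(X)$ with full support to the tracial state $\tau_\mu$, and, for $[x]\in\mathcal{C}$, maps $([x],\chi)\in\{[x]\}\times\widehat{\Gamma_x}$ to the tracial state $\tau_{x,\chi}$, where $\tau_\mu$ and $\tau_{x,\chi}$ are the states on $C(X)\rtimes\Gamma$ determined, for $f\in C(X)$ and $g\in\Gamma$, by $$\tau_\mu(fu_g)=\begin{cases}\int_X f\,d\mu &\text{if } g=e,\\ 0&\text{otherwise,}\end{cases}\qquad \tau_{x,\chi}(fu_g)=\begin{cases}\frac{\chi(g)}{|[x]|}\sum_{y\in[x]} f(y) &\text{if } g\in\Gamma_x,\\ 0&\text{otherwise.}\end{cases}$$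
   Context: $\Gamma$ is a discrete group. For $x\in X$, $[x]=\{gx:g\in\Gamma\}$ is the orbit and $\Gamma_x=\{g\in\Gamma:gx=x\}$ the stabilizer (which, as $\Gamma$ is abelian, depends only on the orbit $[x]$); $\widehat{\Gamma_x}$ is the Pontryagin dual of $\Gamma_x$. The action is faithful if for every $g\in\Gamma\setminus\{e\}$ there is $x\in X$ with $gx\neq x$. The action is almost minimal if every closed $\Gamma$-invariant set $F\subsetneq X$ is finite. $\mathcal{P}_\Gamma(X)$ is the convex set of $\Gamma$-invariant regular Borel probability measures on $X$. For a convex set $K$, $\partial K$ denotes its set of extreme points. $T(A)$ is the set of tracial states on a $C^*$-algebra $A$. $C(X)\rtimes\Gamma$ is the crossed product $C^*$-algebra and $u_g$, $g\in\Gamma$, its canonical unitaries. *)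

theory Defs
  imports
    "HOL-Probability.Probability_Measure"
    "HOL-Algebra.Group_Action"
    "HOL-Algebra.Module"
begin

section \<open>*-algebras and enveloping C*-algebras\<close>

text \<open>Complex *-algebras are records over a carrier, extending the library's \<^type>\<open>module\<close>
  record, whose fields already include the ring operations.\<close>

record 'a star_algebra = "(complex, 'a) module" +
  adj :: "'a \<Rightarrow> 'a"

record 'a normed_star_algebra = "'a star_algebra" +
  nrm :: "'a \<Rightarrow> real"

definition star_diff :: "('a, 'm) star_algebra_scheme \<Rightarrow> 'a \<Rightarrow> 'a \<Rightarrow> 'a" where
  "star_diff B a b = a \<oplus>\<^bsub>B\<^esub> (- 1) \<odot>\<^bsub>B\<^esub> b"

definition cstar_seminorm :: "('a, 'm) star_algebra_scheme \<Rightarrow> ('a \<Rightarrow> real) \<Rightarrow> bool" where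
  "cstar_seminorm B p \<longleftrightarrow>
     (\<forall>a\<in>carrier B. 0 \<le> p a) \<and>
     (\<forall>a\<in>carrier B. \<forall>b\<in>carrier B. p (a \<oplus>\<^bsub>B\<^esub> b) \<le> p a + p b) \<and>
     (\<forall>c. \<forall>a\<in>carrier B. p (c \<odot>\<^bsub>B\<^esub> a) = cmod c * p a) \<and>
     (\<forall>a\<in>carrier B. \<forall>b\<in>carrier B. p (a \<otimes>\<^bsub>B\<^esub> b) \<le> p a * p b) \<and>
     (\<forall>a\<in>carrier B. p (adj B a \<otimes>\<^bsub>B\<^esub> a) = (p a)\<^sup>2)"

text \<open>The C*-seminorms on \<open>B\<close> are exactly the functions \<open>a \<mapsto> \<parallel>\<pi>(a)\<parallel>\<close> for *-homomorphisms \<open>\<pi>\<close>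
  from \<open>B\<close> to a C*-algebra, so this is the usual universal norm; taking seminorms avoids a
  supremum over all Hilbert spaces. For the algebras used below the supremum is over a
  bounded set, since \<open>B\<close> is spanned by products of elements of \<open>C(X)\<close> and unitaries.\<close>

definition universal_norm :: "('a, 'm) star_algebra_scheme \<Rightarrow> 'a \<Rightarrow> real" where
  "universal_norm B a = Sup {p a | p. cstar_seminorm B p}"

definition cauchy_seqs :: "('a, 'm) star_algebra_scheme \<Rightarrow> ('a \<Rightarrow> real) \<Rightarrow> (nat \<Rightarrow> 'a) set" where
  "cauchy_seqs B p =
     {s. (\<forall>n. s n \<in> carrier B) \<and>
         (\<forall>e>0. \<exists>N. \<forall>m\<ge>N. \<forall>n\<ge>N. p (star_diff B (s m) (s n)) < e)}"

definition null_rel :: "('a, 'm) star_algebra_scheme \<Rightarrow> ('a \<Rightarrow> real) \<Rightarrow> ((nat \<Rightarrow> 'a) \<times> (nat \<Rightarrow> 'a)) set" where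
  "null_rel B p =
     {(s, t). s \<in> cauchy_seqs B p \<and> t \<in> cauchy_seqs B p \<and>
              (\<lambda>n. p (star_diff B (s n) (t n))) \<longlonglongrightarrow> 0}"

text \<open>Separated completion of \<open>B\<close> in a seminorm: Cauchy sequences modulo null sequences, with the
  operations induced termwise.\<close>

definition star_completion ::
    "('a, 'm) star_algebra_scheme \<Rightarrow> ('a \<Rightarrow> real) \<Rightarrow> (nat \<Rightarrow> 'a) set normed_star_algebra" where
  "star_completion B p =
     \<lparr>carrier = cauchy_seqs B p // null_rel B p,
      mult = (\<lambda>U V. \<Union>s\<in>U. \<Union>t\<in>V. null_rel B p `` {\<lambda>n. s n \<otimes>\<^bsub>B\<^esub> t n}),
      one = null_rel B p `` {\<lambda>n. \<one>\<^bsub>B\<^esub>},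
      zero = null_rel B p `` {\<lambda>n. \<zero>\<^bsub>B\<^esub>},
      add = (\<lambda>U V. \<Union>s\<in>U. \<Union>t\<in>V. null_rel B p `` {\<lambda>n. s n \<oplus>\<^bsub>B\<^esub> t n}),
      smult = (\<lambda>c U. \<Union>s\<in>U. null_rel B p `` {\<lambda>n. c \<odot>\<^bsub>B\<^esub> s n}),
      adj = (\<lambda>U. \<Union>s\<in>U. null_rel B p `` {\<lambda>n. adj B (s n)}),
      nrm = (\<lambda>U. THE r. \<forall>s\<in>U. (\<lambda>n. p (s n)) \<longlonglongrightarrow> r)\<rparr>"

definition completion_embed ::
    "('a, 'm) star_algebra_scheme \<Rightarrow> ('a \<Rightarrow> real) \<Rightarrow> 'a \<Rightarrow> (nat \<Rightarrow> 'a) set" where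
  "completion_embed B p a = null_rel B p `` {\<lambda>n. a}"


section \<open>States, traces and extreme points\<close>

text \<open>Functionals are extensional, so that equal functionals on the carrier are equal.\<close>

definition states :: "('a, 'm) normed_star_algebra_scheme \<Rightarrow> ('a \<Rightarrow> complex) set" where
  "states A = {\<tau> \<in> extensional (carrier A).
     (\<forall>a\<in>carrier A. \<forall>b\<in>carrier A. \<tau> (a \<oplus>\<^bsub>A\<^esub> b) = \<tau> a + \<tau> b) \<and>
     (\<forall>c. \<forall>a\<in>carrier A. \<tau> (c \<odot>\<^bsub>A\<^esub> a) = c * \<tau> a) \<and>
     (\<forall>a\<in>carrier A. \<tau> (adj A a \<otimes>\<^bsub>A\<^esub> a) \<in> \<real>\<^sub>\<ge>\<^sub>0) \<and>
     bdd_above {cmod (\<tau> a) | a. a \<in> carrier A \<and> nrm A a \<le> 1} \<and>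
     Sup {cmod (\<tau> a) | a. a \<in> carrier A \<and> nrm A a \<le> 1} = 1}"

definition tracial_states :: "('a, 'm) normed_star_algebra_scheme \<Rightarrow> ('a \<Rightarrow> complex) set" where
  "tracial_states A = {\<tau> \<in> states A.
     \<forall>a\<in>carrier A. \<forall>b\<in>carrier A. \<tau> (a \<otimes>\<^bsub>A\<^esub> b) = \<tau> (b \<otimes>\<^bsub>A\<^esub> a)}"

text \<open>Measures and functionals do not form a \<^class>\<open>real_vector\<close> type, so the library's
  \<^const>\<open>extreme_point_of\<close> does not apply. Here \<open>val k s\<close> is the value of \<open>k\<close> at \<open>s\<close>, and convex
  combinations are formed pointwise.\<close>

definition extreme_points :: "('k \<Rightarrow> 's \<Rightarrow> 'v::real_vector) \<Rightarrow> 'k set \<Rightarrow> 'k set" where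
  "extreme_points val K = {k \<in> K. \<forall>a\<in>K. \<forall>b\<in>K. \<forall>t::real.
     0 < t \<and> t < 1 \<and> (\<forall>s. val k s = (1 - t) *\<^sub>R val a s + t *\<^sub>R val b s) \<longrightarrow> a = k \<and> b = k}"


section \<open>Topological actions and invariant measures\<close>

definition action_by_homeos :: "('g, 'm) monoid_scheme \<Rightarrow> ('g \<Rightarrow> 'x::topological_space \<Rightarrow> 'x) \<Rightarrow> bool" where
  "action_by_homeos G \<phi> \<longleftrightarrow> group_action G UNIV \<phi> \<and>
     (\<forall>g\<in>carrier G. homeomorphism UNIV UNIV (\<phi> g) (\<phi> (inv\<^bsub>G\<^esub> g)))"

definition faithful :: "('g, 'm) monoid_scheme \<Rightarrow> ('g \<Rightarrow> 'x \<Rightarrow> 'x) \<Rightarrow> bool" where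
  "faithful G \<phi> \<longleftrightarrow> (\<forall>g\<in>carrier G - {\<one>\<^bsub>G\<^esub>}. \<exists>x. \<phi> g x \<noteq> x)"

definition almost_minimal :: "('g, 'm) monoid_scheme \<Rightarrow> ('g \<Rightarrow> 'x::topological_space \<Rightarrow> 'x) \<Rightarrow> bool" where
  "almost_minimal G \<phi> \<longleftrightarrow>
     (\<forall>F. closed F \<and> (\<forall>g\<in>carrier G. \<phi> g ` F \<subseteq> F) \<and> F \<noteq> UNIV \<longrightarrow> finite F)"

definition finite_orbits :: "('g, 'm) monoid_scheme \<Rightarrow> ('g \<Rightarrow> 'x \<Rightarrow> 'x) \<Rightarrow> 'x set set" where
  "finite_orbits G \<phi> = {Q \<in> orbits G UNIV \<phi>. finite Q}"

definition regular_borel :: "'x::topological_space measure \<Rightarrow> bool" where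
  "regular_borel M \<longleftrightarrow> sets M = sets borel \<and>
     (\<forall>B\<in>sets borel.
        emeasure M B = (INF U\<in>{U. open U \<and> B \<subseteq> U}. emeasure M U) \<and>
        emeasure M B = (SUP K\<in>{K. compact K \<and> K \<subseteq> B}. emeasure M K))"

definition invariant_measures ::
    "('g, 'm) monoid_scheme \<Rightarrow> ('g \<Rightarrow> 'x::topological_space \<Rightarrow> 'x) \<Rightarrow> 'x measure set" where
  "invariant_measures G \<phi> = {M. prob_space M \<and> regular_borel M \<and>
     (\<forall>g\<in>carrier G. distr M borel (\<phi> g) = M)}"

definition measure_support :: "'x::topological_space measure \<Rightarrow> 'x set" where
  "measure_support M = {x. \<forall>U. open U \<and> x \<in> U \<longrightarrow> 0 < emeasure M U}"

definition full_support_extreme_measures ::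
    "('g, 'm) monoid_scheme \<Rightarrow> ('g \<Rightarrow> 'x::topological_space \<Rightarrow> 'x) \<Rightarrow> 'x measure set" where
  "full_support_extreme_measures G \<phi> =
     {\<mu> \<in> extreme_points measure (invariant_measures G \<phi>). measure_support \<mu> = UNIV}"

definition circle_group :: "complex monoid" where
  "circle_group = \<lparr>carrier = sphere 0 1, mult = (*), one = 1\<rparr>"

text \<open>Pontryagin dual, as a set, of a discrete abelian group: every homomorphism to the circle is
  continuous.\<close>

definition discrete_dual :: "('g, 'm) monoid_scheme \<Rightarrow> ('g \<Rightarrow> complex) set" where
  "discrete_dual H = hom H circle_group \<inter> extensional (carrier H)"

abbreviation stabilizer_group ::
    "('g, 'm) monoid_scheme \<Rightarrow> ('g \<Rightarrow> 'x \<Rightarrow> 'x) \<Rightarrow> 'x \<Rightarrow> ('g, 'm) monoid_scheme" where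
  "stabilizer_group G \<phi> x \<equiv> G\<lparr>carrier := stabilizer G \<phi> x\<rparr>"


section \<open>The crossed product\<close>

text \<open>The finitely supported family \<open>a\<close> stands for the finite sum of the \<open>a\<^sub>g u\<^sub>g\<close>; the operations
  come from \<open>u\<^sub>g f u\<^sub>g\<^sup>* = f \<circ> \<phi>(g\<^sup>-\<^sup>1)\<close>.\<close>

definition convolution_algebra ::
    "('g, 'm) monoid_scheme \<Rightarrow> ('g \<Rightarrow> 'x::topological_space \<Rightarrow> 'x) \<Rightarrow> ('g \<Rightarrow> 'x \<Rightarrow> complex) star_algebra" where
  "convolution_algebra G \<phi> =
     \<lparr>carrier = {a. finite {g. a g \<noteq> (\<lambda>x. 0)} \<and> {g. a g \<noteq> (\<lambda>x. 0)} \<subseteq> carrier G \<and>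
                    (\<forall>g. continuous_on UNIV (a g))},
      mult = (\<lambda>a b g x. if g \<in> carrier G
                 then \<Sum>h\<in>{h. a h \<noteq> (\<lambda>x. 0)}.
                        a h x * b (inv\<^bsub>G\<^esub> h \<otimes>\<^bsub>G\<^esub> g) (\<phi> (inv\<^bsub>G\<^esub> h) x)
                 else 0),
      one = (\<lambda>g x. if g = \<one>\<^bsub>G\<^esub> then 1 else 0),
      zero = (\<lambda>g x. 0),
      add = (\<lambda>a b g x. a g x + b g x),
      smult = (\<lambda>c a g x. c * a g x),
      adj = (\<lambda>a g x. if g \<in> carrier G then cnj (a (inv\<^bsub>G\<^esub> g) (\<phi> (inv\<^bsub>G\<^esub> g) x)) else 0)\<rparr>"

definition crossed_product ::
    "('g, 'm) monoid_scheme \<Rightarrow> ('g \<Rightarrow> 'x::topological_space \<Rightarrow> 'x) \<Rightarrow>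
     (nat \<Rightarrow> 'g \<Rightarrow> 'x \<Rightarrow> complex) set normed_star_algebra" where
  "crossed_product G \<phi> =
     star_completion (convolution_algebra G \<phi>) (universal_norm (convolution_algebra G \<phi>))"

definition cp_embed ::
    "('g, 'm) monoid_scheme \<Rightarrow> ('g \<Rightarrow> 'x::topological_space \<Rightarrow> 'x) \<Rightarrow>
     ('g \<Rightarrow> 'x \<Rightarrow> complex) \<Rightarrow> (nat \<Rightarrow> 'g \<Rightarrow> 'x \<Rightarrow> complex) set" where
  "cp_embed G \<phi> =
     completion_embed (convolution_algebra G \<phi>) (universal_norm (convolution_algebra G \<phi>))"

definition cp_fun ::
    "('g, 'm) monoid_scheme \<Rightarrow> ('g \<Rightarrow> 'x::topological_space \<Rightarrow> 'x) \<Rightarrow>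
     ('x \<Rightarrow> complex) \<Rightarrow> (nat \<Rightarrow> 'g \<Rightarrow> 'x \<Rightarrow> complex) set" where
  "cp_fun G \<phi> f = cp_embed G \<phi> (\<lambda>h x. if h = \<one>\<^bsub>G\<^esub> then f x else 0)"

definition cp_unitary ::
    "('g, 'm) monoid_scheme \<Rightarrow> ('g \<Rightarrow> 'x::topological_space \<Rightarrow> 'x) \<Rightarrow>
     'g \<Rightarrow> (nat \<Rightarrow> 'g \<Rightarrow> 'x \<Rightarrow> complex) set" where
  "cp_unitary G \<phi> g = cp_embed G \<phi> (\<lambda>h x. if h = g then 1 else 0)"

definition is_tau_measure ::
    "('g, 'm) monoid_scheme \<Rightarrow> ('g \<Rightarrow> 'x::topological_space \<Rightarrow> 'x) \<Rightarrow> 'x measure \<Rightarrow>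
     ((nat \<Rightarrow> 'g \<Rightarrow> 'x \<Rightarrow> complex) set \<Rightarrow> complex) \<Rightarrow> bool" where
  "is_tau_measure G \<phi> \<mu> \<tau> \<longleftrightarrow> \<tau> \<in> states (crossed_product G \<phi>) \<and>
     (\<forall>f g. continuous_on UNIV f \<and> g \<in> carrier G \<longrightarrow>
        \<tau> (cp_fun G \<phi> f \<otimes>\<^bsub>crossed_product G \<phi>\<^esub> cp_unitary G \<phi> g) =
          (if g = \<one>\<^bsub>G\<^esub> then \<integral>x. f x \<partial>\<mu> else 0))"

definition is_tau_orbit ::
    "('g, 'm) monoid_scheme \<Rightarrow> ('g \<Rightarrow> 'x::topological_space \<Rightarrow> 'x) \<Rightarrow> 'x \<Rightarrow> ('g \<Rightarrow> complex) \<Rightarrow>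
     ((nat \<Rightarrow> 'g \<Rightarrow> 'x \<Rightarrow> complex) set \<Rightarrow> complex) \<Rightarrow> bool" where
  "is_tau_orbit G \<phi> x \<xi> \<tau> \<longleftrightarrow> \<tau> \<in> states (crossed_product G \<phi>) \<and>
     (\<forall>f g. continuous_on UNIV f \<and> g \<in> carrier G \<longrightarrow>
        \<tau> (cp_fun G \<phi> f \<otimes>\<^bsub>crossed_product G \<phi>\<^esub> cp_unitary G \<phi> g) =
          (if g \<in> stabilizer G \<phi> x
           then \<xi> g / of_nat (card (orbit G \<phi> x)) * (\<Sum>y\<in>orbit G \<phi> x. f y)
           else 0))"

end

theory Submission
  imports Defs
begin

text \<open>Let \<open>B\<close> be the convolution algebra. A state of the crossed product is the same as a positive unital
  functional on \<open>B\<close>: the GNS seminorm of such a functional is a C*-seminorm, so the functional is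
  bounded by the universal norm. A trace \<open>\<tau>\<close> restricts to \<open>C(X)\<close> as an invariant probability measure
  \<open>\<mu>\<close>, and \<open>f \<mapsto> \<tau>(f u\<^sub>g)\<close> is concentrated on the fixed points of \<open>g\<close>, a finite invariant set for
  \<open>g \<noteq> e\<close> by faithfulness and almost minimality. If \<open>\<tau>\<close> is extreme, every finite invariant set has
  \<open>\<mu>\<close>-measure 0 or 1. In the first case \<open>\<tau>\<close> vanishes on \<open>f u\<^sub>g\<close> for \<open>g \<noteq> e\<close>; otherwise \<open>\<mu>\<close> is uniform on a
  finite orbit, and extremality makes \<open>g \<mapsto> \<tau>(u\<^sub>g)\<close> a character of the stabilizer.\<close>

section \<open>Positive functionals on complex *-algebras\<close>

text \<open>The algebra holds only continuous functions, while the argument wants to multiply a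
  trace by the indicator of a finite invariant set, a projection of the von Neumann closure. No such
  closure is formed: increasing sequences of continuous functions replace indicators, and their
  limits are controlled by bounding \<tau>(k c) through the L2(\<mu>)-norm of k. Extremality is
  always used in one form: a positive tracial functional below \<tau> is a multiple of \<tau>.
  Conversely, the two formulas must be shown to define positive traces. One construction, from an
  invariant mean and a character of a subgroup, serves both. Extremality then rests on that of \<mu>
  in one case, and in the other on the points of the unit circle being extreme in the disc. Full
  support is a consequence of almost minimality: off the saturation of a null open set there would
  remain a finite invariant set of measure 1. Finite orbits are countable because the group must be
  infinite, so that each point of a finite orbit is fixed by some g \<noteq> e.\<close>

locale complex_star_algebra = ring B for B :: "('a, 'm) star_algebra_scheme" (structure) +
  assumes smult_closed [simp, intro]: "a \<in> carrier B \<Longrightarrow> c \<odot> a \<in> carrier B"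
    and smult_add_right: "a \<in> carrier B \<Longrightarrow> b \<in> carrier B \<Longrightarrow> c \<odot> (a \<oplus> b) = c \<odot> a \<oplus> c \<odot> b"
    and smult_add_left: "a \<in> carrier B \<Longrightarrow> (c + d) \<odot> a = c \<odot> a \<oplus> d \<odot> a"
    and smult_smult: "a \<in> carrier B \<Longrightarrow> c \<odot> (d \<odot> a) = (c * d) \<odot> a"
    and smult_one [simp]: "a \<in> carrier B \<Longrightarrow> 1 \<odot> a = a"
    and smult_mult_left: "a \<in> carrier B \<Longrightarrow> b \<in> carrier B \<Longrightarrow> (c \<odot> a) \<otimes> b = c \<odot> (a \<otimes> b)"
    and smult_mult_right: "a \<in> carrier B \<Longrightarrow> b \<in> carrier B \<Longrightarrow> a \<otimes> (c \<odot> b) = c \<odot> (a \<otimes> b)"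
    and adj_closed [simp, intro]: "a \<in> carrier B \<Longrightarrow> adj B a \<in> carrier B"
    and adj_add: "a \<in> carrier B \<Longrightarrow> b \<in> carrier B \<Longrightarrow> adj B (a \<oplus> b) = adj B a \<oplus> adj B b"
    and adj_smult: "a \<in> carrier B \<Longrightarrow> adj B (c \<odot> a) = cnj c \<odot> adj B a"
    and adj_mult: "a \<in> carrier B \<Longrightarrow> b \<in> carrier B \<Longrightarrow> adj B (a \<otimes> b) = adj B b \<otimes> adj B a"
    and adj_adj [simp]: "a \<in> carrier B \<Longrightarrow> adj B (adj B a) = a"
begin

lemma smult_zero_left: "a \<in> carrier B \<Longrightarrow> 0 \<odot> a = \<zero>"
  using smult_add_left[of a 0 0] by (simp add: add.l_cancel_one)

lemma smult_minus_one: assumes "a \<in> carrier B" shows "(- 1) \<odot> a = \<ominus> a"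
proof -
  have "(- 1) \<odot> a \<oplus> a = (- 1 + 1) \<odot> a" using assms by (simp only: smult_add_left smult_one)
  also have "\<dots> = \<zero>" using assms by (simp add: smult_zero_left)
  finally show ?thesis using assms by (intro minus_equality[symmetric]) auto
qed

lemma star_diff_eq_minus: "b \<in> carrier B \<Longrightarrow> star_diff B a b = a \<ominus> b"
  by (simp add: star_diff_def smult_minus_one a_minus_def)

lemma adj_one [simp]: "adj B \<one> = \<one>"
proof -
  have "adj B \<one> = adj B (adj B \<one>)"
    using adj_mult[of "adj B \<one>" \<one>] by simp
  thus ?thesis by simp
qed

lemma adj_minus: "a \<in> carrier B \<Longrightarrow> adj B (\<ominus> a) = \<ominus> adj B a"
  using adj_smult[of a "- 1"] by (simp add: smult_minus_one)

lemma smult_a_minus: "a \<in> carrier B \<Longrightarrow> \<ominus> (c \<odot> a) = (- c) \<odot> a"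
  using smult_smult[of a "-1" c] by (simp add: smult_minus_one)

end

text \<open>Purely algebraic: a bound on \<tau> is derived from positivity by way of the GNS
  seminorm, so none is built in.\<close>

definition positive_functional :: "('a, 'm) star_algebra_scheme \<Rightarrow> ('a \<Rightarrow> complex) \<Rightarrow> bool" where
  "positive_functional B \<tau> \<longleftrightarrow>
     (\<forall>a\<in>carrier B. \<forall>b\<in>carrier B. \<tau> (a \<oplus>\<^bsub>B\<^esub> b) = \<tau> a + \<tau> b) \<and>
     (\<forall>c. \<forall>a\<in>carrier B. \<tau> (c \<odot>\<^bsub>B\<^esub> a) = c * \<tau> a) \<and>
     (\<forall>a\<in>carrier B. \<tau> (adj B a \<otimes>\<^bsub>B\<^esub> a) \<in> \<real>\<^sub>\<ge>\<^sub>0)"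

definition is_tracial :: "('a, 'm) star_algebra_scheme \<Rightarrow> ('a \<Rightarrow> complex) \<Rightarrow> bool" where
  "is_tracial B \<tau> \<longleftrightarrow> (\<forall>a\<in>carrier B. \<forall>b\<in>carrier B. \<tau> (a \<otimes>\<^bsub>B\<^esub> b) = \<tau> (b \<otimes>\<^bsub>B\<^esub> a))"

definition normalized_trace :: "('a, 'm) star_algebra_scheme \<Rightarrow> ('a \<Rightarrow> complex) \<Rightarrow> bool" where
  "normalized_trace B \<tau> \<longleftrightarrow> positive_functional B \<tau> \<and> is_tracial B \<tau> \<and> \<tau> \<one>\<^bsub>B\<^esub> = 1"

text \<open>Extremality inside the traces on \<open>B\<close> itself. Functionals are compared on
  the carrier only, since here they are not extensional.\<close>

definition extreme_trace :: "('a, 'm) star_algebra_scheme \<Rightarrow> ('a \<Rightarrow> complex) \<Rightarrow> bool" where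
  "extreme_trace B \<tau> \<longleftrightarrow> normalized_trace B \<tau> \<and>
     (\<forall>\<sigma> \<rho> t. normalized_trace B \<sigma> \<and> normalized_trace B \<rho> \<and> 0 < t \<and> t < 1 \<and>
        (\<forall>a\<in>carrier B. \<tau> a = of_real (1 - t) * \<sigma> a + of_real t * \<rho> a) \<longrightarrow>
        (\<forall>a\<in>carrier B. \<sigma> a = \<tau> a \<and> \<rho> a = \<tau> a))"

lemma extreme_traceD:
  assumes "extreme_trace B \<tau>" "normalized_trace B \<sigma>" "normalized_trace B \<rho>" "0 < t" "t < 1"
    and "\<And>a. a \<in> carrier B \<Longrightarrow> \<tau> a = of_real (1 - t) * \<sigma> a + of_real t * \<rho> a"
    and "a \<in> carrier B"
  shows "\<sigma> a = \<tau> a" "\<rho> a = \<tau> a"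
  using assms unfolding extreme_trace_def by blast+

text \<open>The form is \<tau>(adj(a + c b) (a + c b)) as a function of the scalar c, with A =
  \<tau>(adj a a), z = \<tau>(adj a b), w = \<tau>(adj b a), D = \<tau>(adj b b). Real values at c =
  1 and c = \<i> force the Hermitian symmetry; the discriminant argument then gives
  Cauchy-Schwarz.\<close>

lemma nonneg_hermitian_form_2:
  fixes A z w D :: complex
  assumes nonneg: "\<And>c. A + c * z + cnj c * w + cnj c * c * D \<in> \<real>\<^sub>\<ge>\<^sub>0"
    and A: "A \<in> \<real>\<^sub>\<ge>\<^sub>0" and D: "D \<in> \<real>\<^sub>\<ge>\<^sub>0"
  shows "w = cnj z" and "(cmod z)\<^sup>2 \<le> Re A * Re D"
proof -
  have [simp]: "Im A = 0" "Im D = 0" and pos: "Re A \<ge> 0" "Re D \<ge> 0"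
    using A D by (auto simp: complex_nonneg_Reals_iff)
  show w: "w = cnj z"
    using nonneg[of 1] nonneg[of \<i>] by (auto simp: complex_nonneg_Reals_iff complex_eq_iff)
  have Re_pos: "Re A + 2 * Re (c * z) + (cmod c)\<^sup>2 * Re D \<ge> 0" for c
  proof -
    have "Re (A + c * z + cnj c * w + cnj c * c * D) = Re A + 2 * Re (c * z) + (cmod c)\<^sup>2 * Re D"
      unfolding w cmod_power2 by (simp add: algebra_simps power2_eq_square)
    thus ?thesis using nonneg[of c] by (simp add: complex_nonneg_Reals_iff)
  qed
  \<comment> \<open>The choice c = - t cnj z turns the cross term into a real multiple of t.\<close>
  have quad: "Re A - 2 * t * (cmod z)\<^sup>2 + t\<^sup>2 * (cmod z)\<^sup>2 * Re D \<ge> 0" for t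
  proof -
    have "Re (of_real (- t) * cnj z * z) = - t * (cmod z)\<^sup>2"
      unfolding cmod_power2 by (simp add: algebra_simps power2_eq_square)
    moreover have "(cmod (of_real (- t) * cnj z))\<^sup>2 = t\<^sup>2 * (cmod z)\<^sup>2"
      by (simp add: norm_mult power_mult_distrib)
    ultimately show ?thesis using Re_pos[of "of_real (- t) * cnj z"] by simp
  qed
  show "(cmod z)\<^sup>2 \<le> Re A * Re D"
  proof (cases "Re D = 0")
    case True
    have "(cmod z)\<^sup>2 = 0"
    proof (rule ccontr)
      assume nz: "(cmod z)\<^sup>2 \<noteq> 0"
      \<comment> \<open>For D = 0 the quadratic is affine in t, and t = (Re A + 1) / |z|^2 gives it
        the value - Re A - 2, which is negative.\<close>
      have "(Re A + 1) / (cmod z)\<^sup>2 * (cmod z)\<^sup>2 = Re A + 1" using nz by simp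
      hence "Re A - 2 * (Re A + 1) \<ge> 0"
        using quad[of "(Re A + 1) / (cmod z)\<^sup>2"] True unfolding mult.assoc by (metis add_0_right mult_zero_right)
      thus False using pos by simp
    qed
    thus ?thesis using True by simp
  next
    case False
    hence "Re D > 0" using pos by simp
    have "Re A - 2 * (1 / Re D) * (cmod z)\<^sup>2 + (1 / Re D)\<^sup>2 * (cmod z)\<^sup>2 * Re D
        = Re A - (cmod z)\<^sup>2 / Re D"
      using \<open>Re D > 0\<close> by (simp add: field_simps power2_eq_square)
    hence "Re A - (cmod z)\<^sup>2 / Re D \<ge> 0" using quad[of "1 / Re D"] by simp
    thus ?thesis using \<open>Re D > 0\<close> by (simp add: field_simps)
  qed
qed

lemma le_cmod_inverse_mult:
  assumes le: "x \<le> cmod (inverse c) * y" and "c \<noteq> 0"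
  shows "cmod c * x \<le> y"
proof -
  have "cmod c * x \<le> cmod c * (inverse (cmod c) * y)"
    using le unfolding norm_inverse by (rule mult_left_mono) (rule norm_ge_zero)
  also have "\<dots> = y" using assms(2) by simp
  finally show ?thesis .
qed

section \<open>The GNS seminorm of a positive functional\<close>

definition gns_length :: "('a, 'm) star_algebra_scheme \<Rightarrow> ('a \<Rightarrow> complex) \<Rightarrow> 'a \<Rightarrow> real" where
  "gns_length B \<tau> b = sqrt (Re (\<tau> (adj B b \<otimes>\<^bsub>B\<^esub> b)))"

text \<open>The operator norm of left multiplication by a on the pre-Hilbert space of \<tau>,
  written down without forming that space or its quotient.\<close>

definition gns_seminorm :: "('a, 'm) star_algebra_scheme \<Rightarrow> ('a \<Rightarrow> complex) \<Rightarrow> 'a \<Rightarrow> real" where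
  "gns_seminorm B \<tau> a =
     Inf {K. 0 \<le> K \<and> (\<forall>b\<in>carrier B. gns_length B \<tau> (a \<otimes>\<^bsub>B\<^esub> b) \<le> K * gns_length B \<tau> b)}"

context complex_star_algebra begin

context
  fixes \<tau> assumes pos: "positive_functional B \<tau>"
begin

lemma functional_add: "a \<in> carrier B \<Longrightarrow> b \<in> carrier B \<Longrightarrow> \<tau> (a \<oplus> b) = \<tau> a + \<tau> b"
  and functional_smult: "a \<in> carrier B \<Longrightarrow> \<tau> (c \<odot> a) = c * \<tau> a"
  and functional_nonneg: "a \<in> carrier B \<Longrightarrow> \<tau> (adj B a \<otimes> a) \<in> \<real>\<^sub>\<ge>\<^sub>0"
  using pos by (auto simp: positive_functional_def)

lemma functional_uminus: "a \<in> carrier B \<Longrightarrow> \<tau> (\<ominus> a) = - \<tau> a"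
  using functional_smult[of a "-1"] by (simp add: smult_minus_one)

lemma functional_minus: "a \<in> carrier B \<Longrightarrow> b \<in> carrier B \<Longrightarrow> \<tau> (a \<ominus> b) = \<tau> a - \<tau> b"
  by (simp add: a_minus_def functional_add functional_uminus)

lemma functional_Re_nonneg: "a \<in> carrier B \<Longrightarrow> 0 \<le> Re (\<tau> (adj B a \<otimes> a))"
  and functional_Im_zero: "a \<in> carrier B \<Longrightarrow> Im (\<tau> (adj B a \<otimes> a)) = 0"
  using functional_nonneg[of a] by (auto simp: complex_nonneg_Reals_iff)

lemma functional_form_expand:
  assumes "a \<in> carrier B" "b \<in> carrier B"
  shows "\<tau> (adj B (a \<oplus> c \<odot> b) \<otimes> (a \<oplus> c \<odot> b)) =
    \<tau> (adj B a \<otimes> a) + c * \<tau> (adj B a \<otimes> b) + cnj c * \<tau> (adj B b \<otimes> a)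
      + cnj c * c * \<tau> (adj B b \<otimes> b)"
  using assms by (simp add: adj_add adj_smult l_distr r_distr smult_mult_left smult_mult_right
      functional_add functional_smult smult_smult) (simp add: algebra_simps)

lemma functional_hermitian:
    "a \<in> carrier B \<Longrightarrow> b \<in> carrier B \<Longrightarrow> \<tau> (adj B b \<otimes> a) = cnj (\<tau> (adj B a \<otimes> b))"
  and Cauchy_Schwarz_functional:
    "a \<in> carrier B \<Longrightarrow> b \<in> carrier B \<Longrightarrow>
       (cmod (\<tau> (adj B a \<otimes> b)))\<^sup>2 \<le> Re (\<tau> (adj B a \<otimes> a)) * Re (\<tau> (adj B b \<otimes> b))"
  using functional_nonneg functional_form_expand
    nonneg_hermitian_form_2[of "\<tau> (adj B a \<otimes> a)" "\<tau> (adj B a \<otimes> b)" "\<tau> (adj B b \<otimes> a)" "\<tau> (adj B b \<otimes> b)"]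
  by (metis a_closed smult_closed)+

lemma functional_adj: "a \<in> carrier B \<Longrightarrow> \<tau> (adj B a) = cnj (\<tau> a)"
  using functional_hermitian[of \<one> a] by simp

lemma Cauchy_Schwarz_functional_one:
  "a \<in> carrier B \<Longrightarrow> (cmod (\<tau> a))\<^sup>2 \<le> Re (\<tau> \<one>) * Re (\<tau> (adj B a \<otimes> a))"
  using Cauchy_Schwarz_functional[of \<one> a] by simp

text \<open>Cauchy-Schwarz against the unit. It settles the degenerate weights 0 and 1 when a trace
  is split into two positive parts.\<close>

lemma functional_eq_0_if_one_eq_0:
  assumes "\<tau> \<one> = 0" "a \<in> carrier B" shows "\<tau> a = 0"
  using Cauchy_Schwarz_functional_one[of a] assms by simp

lemma gns_length_nonneg: "a \<in> carrier B \<Longrightarrow> 0 \<le> gns_length B \<tau> a"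
  by (simp add: gns_length_def functional_Re_nonneg)

lemma gns_length_sq: "a \<in> carrier B \<Longrightarrow> (gns_length B \<tau> a)\<^sup>2 = Re (\<tau> (adj B a \<otimes> a))"
  by (simp add: gns_length_def functional_Re_nonneg)

lemma gns_Cauchy_Schwarz:
  assumes "a \<in> carrier B" "b \<in> carrier B"
  shows "cmod (\<tau> (adj B a \<otimes> b)) \<le> gns_length B \<tau> a * gns_length B \<tau> b"
  by (rule power2_le_imp_le)
    (use assms in \<open>simp_all add: power_mult_distrib gns_length_sq Cauchy_Schwarz_functional gns_length_nonneg\<close>)

lemma gns_length_smult: "a \<in> carrier B \<Longrightarrow> gns_length B \<tau> (c \<odot> a) = cmod c * gns_length B \<tau> a"
proof -
  assume a: "a \<in> carrier B"
  have "\<tau> (adj B (c \<odot> a) \<otimes> (c \<odot> a)) = of_real ((cmod c)\<^sup>2) * \<tau> (adj B a \<otimes> a)"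
    using a by (simp add: adj_smult smult_mult_left smult_mult_right functional_smult smult_smult
       complex_norm_square mult.commute del: of_real_power)
  thus ?thesis by (simp add: gns_length_def real_sqrt_mult)
qed

lemma gns_length_add:
  assumes a: "a \<in> carrier B" and b: "b \<in> carrier B"
  shows "gns_length B \<tau> (a \<oplus> b) \<le> gns_length B \<tau> a + gns_length B \<tau> b"
proof (rule power2_le_imp_le)
  have "\<tau> (adj B (a \<oplus> b) \<otimes> (a \<oplus> b)) = \<tau> (adj B a \<otimes> a) + \<tau> (adj B a \<otimes> b)
      + cnj (\<tau> (adj B a \<otimes> b)) + \<tau> (adj B b \<otimes> b)"
    using functional_form_expand[OF a b, of 1] functional_hermitian[OF a b] a b by simp
  hence "(gns_length B \<tau> (a \<oplus> b))\<^sup>2 =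
      (gns_length B \<tau> a)\<^sup>2 + 2 * Re (\<tau> (adj B a \<otimes> b)) + (gns_length B \<tau> b)\<^sup>2"
    using a b by (simp add: gns_length_sq)
  also have "\<dots> \<le> (gns_length B \<tau> a)\<^sup>2 + 2 * (gns_length B \<tau> a * gns_length B \<tau> b) + (gns_length B \<tau> b)\<^sup>2"
    using gns_Cauchy_Schwarz[OF a b] complex_Re_le_cmod[of "\<tau> (adj B a \<otimes> b)"] by linarith
  finally show "(gns_length B \<tau> (a \<oplus> b))\<^sup>2 \<le> (gns_length B \<tau> a + gns_length B \<tau> b)\<^sup>2"
    by (simp add: power2_sum)
  show "0 \<le> gns_length B \<tau> a + gns_length B \<tau> b" using a b by (simp add: gns_length_nonneg)
qed

context
  assumes bdd: "\<And>a. a \<in> carrier B \<Longrightarrow>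
    \<exists>K. \<forall>b\<in>carrier B. gns_length B \<tau> (a \<otimes> b) \<le> K * gns_length B \<tau> b"
begin

lemma gns_seminorm_set:
  assumes a: "a \<in> carrier B"
  shows "{K. 0 \<le> K \<and> (\<forall>b\<in>carrier B. gns_length B \<tau> (a \<otimes> b) \<le> K * gns_length B \<tau> b)} \<noteq> {}"
proof -
  obtain K where K: "\<And>b. b\<in>carrier B \<Longrightarrow> gns_length B \<tau> (a \<otimes> b) \<le> K * gns_length B \<tau> b"
    using bdd[OF a] by blast
  \<comment> \<open>The constant supplied by \<open>bdd\<close> may be negative, whereas members of
    the set are required to be nonnegative.\<close>
  have "gns_length B \<tau> (a \<otimes> b) \<le> \<bar>K\<bar> * gns_length B \<tau> b" if "b \<in> carrier B" for b
    using K[OF that] gns_length_nonneg[OF that] by (smt (verit) mult_right_mono)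
  hence "\<bar>K\<bar> \<in> {K. 0 \<le> K \<and> (\<forall>b\<in>carrier B. gns_length B \<tau> (a \<otimes> b) \<le> K * gns_length B \<tau> b)}"
    by simp
  thus ?thesis by blast
qed

lemma gns_seminorm_nonneg: "a \<in> carrier B \<Longrightarrow> 0 \<le> gns_seminorm B \<tau> a"
  unfolding gns_seminorm_def by (rule cInf_greatest[OF gns_seminorm_set]) auto

lemma gns_seminorm_least:
  assumes "0 \<le> K" "\<And>b. b \<in> carrier B \<Longrightarrow> gns_length B \<tau> (a \<otimes> b) \<le> K * gns_length B \<tau> b"
  shows "gns_seminorm B \<tau> a \<le> K"
  unfolding gns_seminorm_def by (rule cInf_lower) (use assms in \<open>auto intro: bdd_belowI[of _ 0]\<close>)

text \<open>The infimum is attained. Vectors b of length 0 need the boundedness assumption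
  separately: it forces a b to have length 0 as well.\<close>

lemma gns_length_mult_le:
  assumes a: "a \<in> carrier B" and b: "b \<in> carrier B"
  shows "gns_length B \<tau> (a \<otimes> b) \<le> gns_seminorm B \<tau> a * gns_length B \<tau> b"
proof (cases "gns_length B \<tau> b = 0")
  case True
  thus ?thesis using bdd[OF a] b by auto
next
  case False
  hence b0: "gns_length B \<tau> b > 0" using gns_length_nonneg[OF b] by simp
  have "gns_length B \<tau> (a \<otimes> b) / gns_length B \<tau> b \<le> gns_seminorm B \<tau> a"
    unfolding gns_seminorm_def
    by (rule cInf_greatest[OF gns_seminorm_set[OF a]]) (use b b0 in \<open>auto simp: field_simps\<close>)
  thus ?thesis using b0 by (simp add: field_simps)
qed

lemma gns_seminorm_mult:
  assumes "a \<in> carrier B" "b \<in> carrier B"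
  shows "gns_seminorm B \<tau> (a \<otimes> b) \<le> gns_seminorm B \<tau> a * gns_seminorm B \<tau> b"
proof (rule gns_seminorm_least)
  fix c assume c: "c \<in> carrier B"
  have "gns_length B \<tau> (a \<otimes> b \<otimes> c) \<le> gns_seminorm B \<tau> a * gns_length B \<tau> (b \<otimes> c)"
    using gns_length_mult_le[of a "b \<otimes> c"] assms c by (simp add: m_assoc)
  also have "\<dots> \<le> gns_seminorm B \<tau> a * (gns_seminorm B \<tau> b * gns_length B \<tau> c)"
    using gns_length_mult_le assms c by (intro mult_left_mono gns_seminorm_nonneg) auto
  finally show "gns_length B \<tau> (a \<otimes> b \<otimes> c) \<le> gns_seminorm B \<tau> a * gns_seminorm B \<tau> b * gns_length B \<tau> c"
    by (simp add: mult.assoc)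
qed (use assms in \<open>simp add: gns_seminorm_nonneg\<close>)

lemma gns_seminorm_add:
  assumes "a \<in> carrier B" "b \<in> carrier B"
  shows "gns_seminorm B \<tau> (a \<oplus> b) \<le> gns_seminorm B \<tau> a + gns_seminorm B \<tau> b"
proof (rule gns_seminorm_least)
  fix c assume c: "c \<in> carrier B"
  have "gns_length B \<tau> ((a \<oplus> b) \<otimes> c) \<le> gns_length B \<tau> (a \<otimes> c) + gns_length B \<tau> (b \<otimes> c)"
    using assms c by (simp add: l_distr gns_length_add)
  thus "gns_length B \<tau> ((a \<oplus> b) \<otimes> c) \<le> (gns_seminorm B \<tau> a + gns_seminorm B \<tau> b) * gns_length B \<tau> c"
    using gns_length_mult_le[of a c] gns_length_mult_le[of b c] assms c
    unfolding distrib_right by linarith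
qed (use assms in \<open>simp add: gns_seminorm_nonneg\<close>)

lemma gns_seminorm_smult_le:
  assumes "a \<in> carrier B"
  shows "gns_seminorm B \<tau> (c \<odot> a) \<le> cmod c * gns_seminorm B \<tau> a"
proof (rule gns_seminorm_least)
  fix b assume b: "b \<in> carrier B"
  show "gns_length B \<tau> (c \<odot> a \<otimes> b) \<le> cmod c * gns_seminorm B \<tau> a * gns_length B \<tau> b"
    using gns_length_mult_le[OF assms b] assms b
    by (simp add: smult_mult_left gns_length_smult mult.assoc mult_left_mono)
qed (use assms in \<open>simp add: gns_seminorm_nonneg\<close>)

lemma gns_seminorm_smult:
  assumes a: "a \<in> carrier B"
  shows "gns_seminorm B \<tau> (c \<odot> a) = cmod c * gns_seminorm B \<tau> a"
proof (cases "c = 0")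
  case True
  thus ?thesis using gns_seminorm_smult_le[OF a, of c] gns_seminorm_nonneg[of "c \<odot> a"] a by simp
next
  case False
  have "gns_seminorm B \<tau> (inverse c \<odot> (c \<odot> a)) \<le> cmod (inverse c) * gns_seminorm B \<tau> (c \<odot> a)"
    using a by (intro gns_seminorm_smult_le) auto
  hence "gns_seminorm B \<tau> a \<le> cmod (inverse c) * gns_seminorm B \<tau> (c \<odot> a)"
    using a False by (simp add: smult_smult)
  hence "cmod c * gns_seminorm B \<tau> a \<le> gns_seminorm B \<tau> (c \<odot> a)"
    using False by (rule le_cmod_inverse_mult)
  thus ?thesis using gns_seminorm_smult_le[OF a, of c] by simp
qed

text \<open>The squared length of a b is the inner product of b with adj a a b. This one inequality
  yields both the bound for adjoints and the hard half of the C*-identity.\<close>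

lemma gns_length_mult_sq_le:
  assumes a: "a \<in> carrier B" and b: "b \<in> carrier B"
  shows "(gns_length B \<tau> (a \<otimes> b))\<^sup>2 \<le> gns_length B \<tau> b * gns_length B \<tau> (adj B a \<otimes> (a \<otimes> b))"
proof -
  have "(gns_length B \<tau> (a \<otimes> b))\<^sup>2 = Re (\<tau> (adj B b \<otimes> (adj B a \<otimes> (a \<otimes> b))))"
    using a b by (simp add: gns_length_sq adj_mult m_assoc)
  also have "\<dots> \<le> gns_length B \<tau> b * gns_length B \<tau> (adj B a \<otimes> (a \<otimes> b))"
    using gns_Cauchy_Schwarz[of b "adj B a \<otimes> (a \<otimes> b)"] complex_Re_le_cmod a b
    by (meson adj_closed m_closed order_trans)
  finally show ?thesis .
qed

text \<open>With l the length of adj a b, the previous bound gives l^2 \<le> |b| p(a) l, where p is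
  the seminorm, and l cancels. No adjoint operator on a Hilbert space is involved.\<close>

lemma gns_seminorm_adj_le:
  assumes a: "a \<in> carrier B"
  shows "gns_seminorm B \<tau> (adj B a) \<le> gns_seminorm B \<tau> a"
proof (rule gns_seminorm_least)
  fix b assume b: "b \<in> carrier B"
  let ?l = "gns_length B \<tau> (adj B a \<otimes> b)"
  have "?l\<^sup>2 \<le> gns_length B \<tau> b * gns_length B \<tau> (a \<otimes> (adj B a \<otimes> b))"
    using gns_length_mult_sq_le[of "adj B a" b] a b by simp
  also have "\<dots> \<le> gns_length B \<tau> b * (gns_seminorm B \<tau> a * ?l)"
    using a b by (intro mult_left_mono gns_length_mult_le gns_length_nonneg) auto
  finally have "?l * ?l \<le> (gns_seminorm B \<tau> a * gns_length B \<tau> b) * ?l"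
    by (simp add: power2_eq_square mult_ac)
  moreover have "0 \<le> gns_seminorm B \<tau> a * gns_length B \<tau> b"
    using a b by (simp add: gns_length_nonneg gns_seminorm_nonneg)
  ultimately show "?l \<le> gns_seminorm B \<tau> a * gns_length B \<tau> b"
    using gns_length_nonneg[of "adj B a \<otimes> b"] a b by (cases "?l = 0") auto
qed (use a in \<open>simp add: gns_seminorm_nonneg\<close>)

lemma gns_seminorm_cstar:
  assumes a: "a \<in> carrier B"
  shows "gns_seminorm B \<tau> (adj B a \<otimes> a) = (gns_seminorm B \<tau> a)\<^sup>2"
proof (rule antisym)
  have "gns_seminorm B \<tau> (adj B a \<otimes> a) \<le> gns_seminorm B \<tau> (adj B a) * gns_seminorm B \<tau> a"
    using a by (simp add: gns_seminorm_mult)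
  also have "\<dots> \<le> gns_seminorm B \<tau> a * gns_seminorm B \<tau> a"
    using a by (intro mult_right_mono gns_seminorm_adj_le gns_seminorm_nonneg)
  finally show "gns_seminorm B \<tau> (adj B a \<otimes> a) \<le> (gns_seminorm B \<tau> a)\<^sup>2" by (simp add: power2_eq_square)
  have "gns_seminorm B \<tau> a \<le> sqrt (gns_seminorm B \<tau> (adj B a \<otimes> a))"
  proof (rule gns_seminorm_least)
    fix b assume b: "b \<in> carrier B"
    have "(gns_length B \<tau> (a \<otimes> b))\<^sup>2 \<le> gns_length B \<tau> b * gns_length B \<tau> (adj B a \<otimes> (a \<otimes> b))"
      using a b by (rule gns_length_mult_sq_le)
    also have "\<dots> \<le> gns_length B \<tau> b * (gns_seminorm B \<tau> (adj B a \<otimes> a) * gns_length B \<tau> b)"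
      using gns_length_mult_le[of "adj B a \<otimes> a" b] a b
      by (intro mult_left_mono) (auto simp: gns_length_nonneg m_assoc)
    also have "\<dots> = (sqrt (gns_seminorm B \<tau> (adj B a \<otimes> a)) * gns_length B \<tau> b)\<^sup>2"
      using gns_seminorm_nonneg[of "adj B a \<otimes> a"] a
      by (simp add: power_mult_distrib) (simp add: power2_eq_square)
    finally show "gns_length B \<tau> (a \<otimes> b) \<le> sqrt (gns_seminorm B \<tau> (adj B a \<otimes> a)) * gns_length B \<tau> b"
      using a b by (auto intro!: power2_le_imp_le simp: gns_length_nonneg gns_seminorm_nonneg)
  qed (use a in \<open>simp add: gns_seminorm_nonneg\<close>)
  thus "(gns_seminorm B \<tau> a)\<^sup>2 \<le> gns_seminorm B \<tau> (adj B a \<otimes> a)"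
    using a by (metis adj_closed gns_seminorm_nonneg m_closed power_mono real_sqrt_pow2)
qed

lemma cstar_seminorm_gns: "cstar_seminorm B (gns_seminorm B \<tau>)"
  unfolding cstar_seminorm_def
  by (simp add: gns_seminorm_nonneg gns_seminorm_add gns_seminorm_smult gns_seminorm_mult gns_seminorm_cstar)

text \<open>\<tau>(a) is the inner product of the unit vector given by 1 with its image under
  a.\<close>

lemma functional_le_gns_seminorm:
  assumes one: "\<tau> \<one> = 1" and a: "a \<in> carrier B"
  shows "cmod (\<tau> a) \<le> gns_seminorm B \<tau> a"
  using gns_Cauchy_Schwarz[of \<one> a] gns_length_mult_le[of a \<one>] a one
  by (simp add: gns_length_def)

end

end

section \<open>The universal C*-seminorm\<close>

lemma cstar_seminorm_zero: "cstar_seminorm B (\<lambda>a. 0)"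
  by (simp add: cstar_seminorm_def)

text \<open>Each defining inequality passes to a pointwise supremum. For homogeneity this gives only
  one direction; the other comes from rescaling by the inverse scalar. The zero seminorm keeps the
  supremum over a nonempty set and bounded below by 0.\<close>

lemma cstar_seminorm_universal_norm:
  assumes bdd: "\<And>a. a \<in> carrier B \<Longrightarrow> bdd_above {p a | p. cstar_seminorm B p}"
  shows "cstar_seminorm B (universal_norm B)"
proof -
  note S = cstar_seminorm_def[THEN iffD1]
  have ne: "{p a | p. cstar_seminorm B p} \<noteq> {}" for a
    using cstar_seminorm_zero by blast
  have up: "p a \<le> universal_norm B a" if "a \<in> carrier B" "cstar_seminorm B p" for a p
    unfolding universal_norm_def by (rule cSup_upper) (use that bdd in auto)
  have least: "universal_norm B a \<le> K" if "\<And>p. cstar_seminorm B p \<Longrightarrow> p a \<le> K" for a K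
    unfolding universal_norm_def by (rule cSup_least[OF ne]) (use that in auto)
  have nonneg: "0 \<le> universal_norm B a" if "a \<in> carrier B" for a
    using up[OF that cstar_seminorm_zero] .
  have scale_le: "universal_norm B (c \<odot> a) \<le> cmod c * universal_norm B a" if a: "a \<in> carrier B" for c a
    by (rule least) (use a up S in \<open>fastforce intro: mult_left_mono\<close>)
  have scale: "universal_norm B (c \<odot> a) = cmod c * universal_norm B a" if a: "a \<in> carrier B" for c a
  proof (cases "c = 0")
    case True
    thus ?thesis using scale_le[OF a, of c] nonneg[of "c \<odot> a"] a by simp
  next
    case False
    have "universal_norm B (inverse c \<odot> (c \<odot> a)) \<le> cmod (inverse c) * universal_norm B (c \<odot> a)"
      using a by (intro scale_le) auto
    hence "universal_norm B a \<le> cmod (inverse c) * universal_norm B (c \<odot> a)"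
      using a False by (simp add: smult_smult)
    hence "cmod c * universal_norm B a \<le> universal_norm B (c \<odot> a)"
      using False by (rule le_cmod_inverse_mult)
    thus ?thesis using scale_le[OF a, of c] by simp
  qed
  have cstar: "universal_norm B (adj B a \<otimes> a) = (universal_norm B a)\<^sup>2" if a: "a \<in> carrier B" for a
  proof (rule antisym)
    show "universal_norm B (adj B a \<otimes> a) \<le> (universal_norm B a)\<^sup>2"
    proof (rule least)
      fix p assume p: "cstar_seminorm B p"
      have "p (adj B a \<otimes> a) = (p a)\<^sup>2" "0 \<le> p a" using p a by (auto simp: cstar_seminorm_def)
      thus "p (adj B a \<otimes> a) \<le> (universal_norm B a)\<^sup>2" using up[OF a p] by (simp add: power_mono)
    qed
    have "universal_norm B a \<le> sqrt (universal_norm B (adj B a \<otimes> a))"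
    proof (rule least)
      fix p assume p: "cstar_seminorm B p"
      have "p (adj B a \<otimes> a) = (p a)\<^sup>2" using p a by (auto simp: cstar_seminorm_def)
      moreover have "p (adj B a \<otimes> a) \<le> universal_norm B (adj B a \<otimes> a)" using up p a by auto
      ultimately show "p a \<le> sqrt (universal_norm B (adj B a \<otimes> a))" by (metis real_le_rsqrt)
    qed
    thus "(universal_norm B a)\<^sup>2 \<le> universal_norm B (adj B a \<otimes> a)"
      using nonneg a by (metis adj_closed m_closed power_mono real_sqrt_pow2)
  qed
  have add: "universal_norm B (a \<oplus> b) \<le> universal_norm B a + universal_norm B b"
    if "a \<in> carrier B" "b \<in> carrier B" for a b
  proof (rule least)
    fix p assume p: "cstar_seminorm B p"
    have "p (a \<oplus> b) \<le> p a + p b" using p that by (auto simp: cstar_seminorm_def)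
    thus "p (a \<oplus> b) \<le> universal_norm B a + universal_norm B b"
      using up[OF that(1) p] up[OF that(2) p] by linarith
  qed
  have mult: "universal_norm B (a \<otimes> b) \<le> universal_norm B a * universal_norm B b"
    if "a \<in> carrier B" "b \<in> carrier B" for a b
  proof (rule least)
    fix p assume p: "cstar_seminorm B p"
    have "p (a \<otimes> b) \<le> p a * p b" "0 \<le> p b" using p that by (auto simp: cstar_seminorm_def)
    thus "p (a \<otimes> b) \<le> universal_norm B a * universal_norm B b"
      using mult_mono[OF up[OF that(1) p] up[OF that(2) p]] nonneg that by fastforce
  qed
  show ?thesis unfolding cstar_seminorm_def
    by (intro conjI ballI allI) (simp_all only: nonneg add mult scale cstar)
qed

lemma cstar_seminorm_le_universal_norm:
  assumes "\<And>a. a \<in> carrier B \<Longrightarrow> bdd_above {p a | p. cstar_seminorm B p}"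
    "cstar_seminorm B p" "a \<in> carrier B"
  shows "p a \<le> universal_norm B a"
  unfolding universal_norm_def by (rule cSup_upper) (use assms in auto)

end


section \<open>States of the completion\<close>

text \<open>The operations of the completion are unions over all representatives of the classes.
  Once the resulting class is independent of the representatives, such a union collapses to
  it.\<close>

lemma UN_eq_const: "a \<in> U \<Longrightarrow> (\<And>x. x \<in> U \<Longrightarrow> f x = c) \<Longrightarrow> (\<Union>x\<in>U. f x) = c"
  by (rule SUP_eq_const) auto

lemma UN2_eq_const:
  assumes "a \<in> U" "b \<in> V" "\<And>x y. x \<in> U \<Longrightarrow> y \<in> V \<Longrightarrow> f x y = c"
  shows "(\<Union>x\<in>U. \<Union>y\<in>V. f x y) = c"
  by (rule UN_eq_const[OF assms(1)], rule UN_eq_const[OF assms(2)]) (rule assms(3))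

locale cstar_seminormed_algebra = complex_star_algebra +
  fixes p :: "'a \<Rightarrow> real"
  assumes cstar: "cstar_seminorm B p"
begin

lemma seminorm_nonneg: "a \<in> carrier B \<Longrightarrow> 0 \<le> p a"
  and seminorm_add: "a \<in> carrier B \<Longrightarrow> b \<in> carrier B \<Longrightarrow> p (a \<oplus> b) \<le> p a + p b"
  and seminorm_smult: "a \<in> carrier B \<Longrightarrow> p (c \<odot> a) = cmod c * p a"
  and seminorm_mult: "a \<in> carrier B \<Longrightarrow> b \<in> carrier B \<Longrightarrow> p (a \<otimes> b) \<le> p a * p b"
  and seminorm_cstar: "a \<in> carrier B \<Longrightarrow> p (adj B a \<otimes> a) = (p a)\<^sup>2"
  using cstar by (auto simp: cstar_seminorm_def)

lemma seminorm_zero: "p \<zero> = 0"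
  using seminorm_smult[of \<one> 0] by (simp add: smult_zero_left)

lemma seminorm_uminus: "a \<in> carrier B \<Longrightarrow> p (\<ominus> a) = p a"
  using seminorm_smult[of a "-1"] by (simp add: smult_minus_one)

text \<open>The C*-identity makes p(1) idempotent, hence 0 or 1. The value 0 is possible, since p
  may vanish identically, so only the inequality is available.\<close>

lemma seminorm_one_le: "p \<one> \<le> 1"
proof -
  have "p \<one> = (p \<one>)\<^sup>2" using seminorm_cstar[of \<one>] by simp
  hence "p \<one> * (p \<one> - 1) = 0" by (simp add: algebra_simps power2_eq_square)
  thus ?thesis by auto
qed

lemma seminorm_adj_le: assumes a: "a \<in> carrier B" shows "p a \<le> p (adj B a)"
proof (cases "p a = 0")
  case False
  hence "p a > 0" using seminorm_nonneg[OF a] by simp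
  moreover have "p a * p a \<le> p (adj B a) * p a"
    using seminorm_cstar[OF a] seminorm_mult[of "adj B a" a] a by (simp add: power2_eq_square)
  ultimately show ?thesis by simp
qed (use a in \<open>simp add: seminorm_nonneg\<close>)

lemma seminorm_adj: "a \<in> carrier B \<Longrightarrow> p (adj B a) = p a"
  using seminorm_adj_le[of a] seminorm_adj_le[of "adj B a"] by simp

lemma seminorm_minus_commute:
  assumes "a \<in> carrier B" "b \<in> carrier B" shows "p (a \<ominus> b) = p (b \<ominus> a)"
proof -
  have "a \<ominus> b = \<ominus> (b \<ominus> a)" using assms by (simp add: a_minus_def minus_add a_comm)
  thus ?thesis using assms by (simp add: seminorm_uminus)
qed

lemma seminorm_triangle:
  assumes "a \<in> carrier B" "b \<in> carrier B" "c \<in> carrier B"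
  shows "p (a \<ominus> c) \<le> p (a \<ominus> b) + p (b \<ominus> c)"
proof -
  have "a \<ominus> c = (a \<ominus> b) \<oplus> (b \<ominus> c)" using assms by algebra
  thus ?thesis using assms seminorm_add[of "a \<ominus> b" "b \<ominus> c"] by simp
qed

lemma seminorm_diff_le:
  assumes "a \<in> carrier B" "b \<in> carrier B"
  shows "\<bar>p a - p b\<bar> \<le> p (a \<ominus> b)"
  using seminorm_triangle[of a b \<zero>] seminorm_triangle[of b a \<zero>] seminorm_minus_commute[OF assms] assms
  by (simp add: a_minus_def)

lemma seminorm_mult_diff:
  assumes "a \<in> carrier B" "b \<in> carrier B" "c \<in> carrier B" "d \<in> carrier B"
  shows "p (a \<otimes> b \<ominus> c \<otimes> d) \<le> p a * p (b \<ominus> d) + p (a \<ominus> c) * p d"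
proof -
  have "a \<otimes> b \<ominus> c \<otimes> d = a \<otimes> (b \<ominus> d) \<oplus> (a \<ominus> c) \<otimes> d" using assms by algebra
  also have "p \<dots> \<le> p (a \<otimes> (b \<ominus> d)) + p ((a \<ominus> c) \<otimes> d)" using assms by (intro seminorm_add) auto
  also have "\<dots> \<le> p a * p (b \<ominus> d) + p (a \<ominus> c) * p d" using assms by (intro add_mono seminorm_mult) auto
  finally show ?thesis .
qed

lemma seminorm_add_diff:
  assumes "a \<in> carrier B" "b \<in> carrier B" "c \<in> carrier B" "d \<in> carrier B"
  shows "p ((a \<oplus> b) \<ominus> (c \<oplus> d)) \<le> p (a \<ominus> c) + p (b \<ominus> d)"
proof -
  have "(a \<oplus> b) \<ominus> (c \<oplus> d) = (a \<ominus> c) \<oplus> (b \<ominus> d)" using assms by algebra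
  thus ?thesis using assms seminorm_add[of "a \<ominus> c" "b \<ominus> d"] by simp
qed

lemma seminorm_smult_diff:
  assumes "a \<in> carrier B" "b \<in> carrier B"
  shows "p (c \<odot> a \<ominus> c \<odot> b) = cmod c * p (a \<ominus> b)"
proof -
  have "c \<odot> a \<ominus> c \<odot> b = c \<odot> (a \<ominus> b)"
    using assms by (simp add: a_minus_def smult_add_right smult_a_minus)
      (simp flip: smult_minus_one add: smult_smult)
  thus ?thesis using assms by (simp add: seminorm_smult)
qed

lemma seminorm_adj_diff:
  assumes "a \<in> carrier B" "b \<in> carrier B"
  shows "p (adj B a \<ominus> adj B b) = p (a \<ominus> b)"
proof -
  have "adj B a \<ominus> adj B b = adj B (a \<ominus> b)" using assms by (simp add: a_minus_def adj_add adj_minus)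
  thus ?thesis using assms by (simp add: seminorm_adj)
qed

section \<open>Cauchy sequences and the operations on their classes\<close>

abbreviation "Cau \<equiv> cauchy_seqs B p"
abbreviation "A \<equiv> star_completion B p"

definition cls :: "(nat \<Rightarrow> 'a) \<Rightarrow> (nat \<Rightarrow> 'a) set" where
  "cls s = null_rel B p `` {s}"

lemma Cau_carrier [simp]: "s \<in> Cau \<Longrightarrow> s n \<in> carrier B"
  by (simp add: cauchy_seqs_def)

lemma Cau_iff: "s \<in> Cau \<longleftrightarrow> (\<forall>n. s n \<in> carrier B) \<and> (\<forall>e>0. \<exists>N. \<forall>m\<ge>N. \<forall>n\<ge>N. p (s m \<ominus> s n) < e)"
  unfolding cauchy_seqs_def by (auto simp: star_diff_eq_minus)

lemma CauD: "s \<in> Cau \<Longrightarrow> e > 0 \<Longrightarrow> \<exists>N. \<forall>m\<ge>N. \<forall>n\<ge>N. p (s m \<ominus> s n) < e"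
  by (simp add: Cau_iff)

lemma null_rel_iff:
  "(s, t) \<in> null_rel B p \<longleftrightarrow> s \<in> Cau \<and> t \<in> Cau \<and> (\<lambda>n. p (s n \<ominus> t n)) \<longlonglongrightarrow> 0"
  unfolding null_rel_def by (auto simp: star_diff_eq_minus cong: conj_cong)

lemma equiv_null_rel: "equiv Cau (null_rel B p)"
proof (rule equivI)
  show "refl_on Cau (null_rel B p)"
    by (rule refl_onI) (simp add: null_rel_iff a_minus_def r_neg seminorm_zero)
  show "null_rel B p \<subseteq> Cau \<times> Cau" by (auto simp: null_rel_iff)
  show "sym (null_rel B p)"
    by (rule symI) (auto simp: null_rel_iff seminorm_minus_commute)
  show "trans (null_rel B p)"
  proof (rule transI)
    fix s t u assume st: "(s, t) \<in> null_rel B p" and tu: "(t, u) \<in> null_rel B p"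
    hence c: "s \<in> Cau" "t \<in> Cau" "u \<in> Cau" by (auto simp: null_rel_iff)
    have "(\<lambda>n. p (s n \<ominus> u n)) \<longlonglongrightarrow> 0"
    proof (rule Lim_null_comparison)
      show "\<forall>\<^sub>F n in sequentially. norm (p (s n \<ominus> u n)) \<le> p (s n \<ominus> t n) + p (t n \<ominus> u n)"
        using c by (intro always_eventually allI) (simp add: seminorm_nonneg seminorm_triangle)
      show "(\<lambda>n. p (s n \<ominus> t n) + p (t n \<ominus> u n)) \<longlonglongrightarrow> 0"
        using st tu by (auto simp: null_rel_iff intro: tendsto_add_zero)
    qed
    thus "(s, u) \<in> null_rel B p" using c by (simp add: null_rel_iff)
  qed
qed

lemma cls_eq_iff: "s \<in> Cau \<Longrightarrow> t \<in> Cau \<Longrightarrow> cls s = cls t \<longleftrightarrow> (s, t) \<in> null_rel B p"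
  unfolding cls_def by (rule eq_equiv_class_iff[OF equiv_null_rel])

lemma carrier_completion: "carrier A = cls ` Cau"
  by (auto simp: star_completion_def quotient_def cls_def)

lemma cls_in_carrier [simp]: "s \<in> Cau \<Longrightarrow> cls s \<in> carrier A"
  by (simp add: carrier_completion)

lemma in_cls_iff: "t \<in> cls s \<longleftrightarrow> (s, t) \<in> null_rel B p"
  by (simp add: cls_def)

lemma self_in_cls: "s \<in> Cau \<Longrightarrow> s \<in> cls s"
  unfolding cls_def by (rule equiv_class_self[OF equiv_null_rel])

lemma Cau_const [simp]: "a \<in> carrier B \<Longrightarrow> (\<lambda>n. a) \<in> Cau"
  by (simp add: Cau_iff a_minus_def r_neg seminorm_zero)

lemma Cau_convergent: assumes s: "s \<in> Cau" shows "convergent (\<lambda>n. p (s n))"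
proof (rule Cauchy_convergent, rule CauchyI)
  fix e :: real assume "e > 0"
  then obtain N where N: "\<forall>m\<ge>N. \<forall>n\<ge>N. p (s m \<ominus> s n) < e" using CauD[OF s, of e] by auto
  show "\<exists>M. \<forall>m\<ge>M. \<forall>n\<ge>M. norm (p (s m) - p (s n)) < e"
    using N s seminorm_diff_le[OF Cau_carrier[OF s] Cau_carrier[OF s]]
    by (metis le_less_trans real_norm_def)
qed

lemma Cau_bounded: assumes s: "s \<in> Cau" obtains K where "K > 0" "\<And>n. p (s n) \<le> K"
proof -
  have "Bseq (\<lambda>n. p (s n))" using Cau_convergent[OF s] by (rule convergent_imp_Bseq)
  then obtain K where "K > 0" "\<forall>n. norm (p (s n)) \<le> K" by (auto simp: Bseq_def)
  thus ?thesis by (intro that[of K]) (auto simp: abs_le_iff real_norm_def)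
qed

lemma Cau_add [simp]: assumes s: "s \<in> Cau" and t: "t \<in> Cau" shows "(\<lambda>n. s n \<oplus> t n) \<in> Cau"
  unfolding Cau_iff
proof (intro conjI allI impI)
  fix e :: real assume e: "e > 0"
  obtain N where N: "\<forall>m\<ge>N. \<forall>n\<ge>N. p (s m \<ominus> s n) < e / 2" using CauD[OF s, of "e / 2"] e by auto
  obtain M where M: "\<forall>m\<ge>M. \<forall>n\<ge>M. p (t m \<ominus> t n) < e / 2" using CauD[OF t, of "e / 2"] e by auto
  have "p (s m \<oplus> t m \<ominus> (s n \<oplus> t n)) < e" if "m \<ge> max N M" "n \<ge> max N M" for m n
    using seminorm_add_diff[of "s m" "t m" "s n" "t n"] N[rule_format, of m n] M[rule_format, of m n] that s t
    by simp
  thus "\<exists>N. \<forall>m\<ge>N. \<forall>n\<ge>N. p (s m \<oplus> t m \<ominus> (s n \<oplus> t n)) < e" by blast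
qed (use s t in simp)

lemma Cau_smult [simp]: assumes s: "s \<in> Cau" shows "(\<lambda>n. c \<odot> s n) \<in> Cau"
  unfolding Cau_iff
proof (intro conjI allI impI)
  fix e :: real assume e: "e > 0"
  \<comment> \<open>Adding 1 keeps the denominator positive when c = 0.\<close>
  obtain N where N: "\<forall>m\<ge>N. \<forall>n\<ge>N. p (s m \<ominus> s n) < e / (cmod c + 1)"
    using CauD[OF s, of "e / (cmod c + 1)"] e by (auto simp: add_nonneg_pos)
  have "p (c \<odot> s m \<ominus> c \<odot> s n) < e" if "m \<ge> N" "n \<ge> N" for m n
  proof -
    have "p (c \<odot> s m \<ominus> c \<odot> s n) \<le> (cmod c + 1) * p (s m \<ominus> s n)"
      using s by (simp add: seminorm_smult_diff seminorm_nonneg mult_right_mono)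
    also have "\<dots> < (cmod c + 1) * (e / (cmod c + 1))"
      using N that by (intro mult_strict_left_mono) (auto intro: add_nonneg_pos)
    also have "\<dots> = e"
      using norm_ge_zero[of c] by (subst times_divide_eq_right, intro nonzero_mult_div_cancel_left) linarith
    finally show ?thesis .
  qed
  thus "\<exists>N. \<forall>m\<ge>N. \<forall>n\<ge>N. p (c \<odot> s m \<ominus> c \<odot> s n) < e" by blast
qed (use s in simp)

lemma Cau_adj [simp]: assumes s: "s \<in> Cau" shows "(\<lambda>n. adj B (s n)) \<in> Cau"
  using s unfolding Cau_iff by (simp add: seminorm_adj_diff)

lemma Cau_mult [simp]: assumes s: "s \<in> Cau" and t: "t \<in> Cau" shows "(\<lambda>n. s n \<otimes> t n) \<in> Cau"
  unfolding Cau_iff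
proof (intro conjI allI impI)
  fix e :: real assume e: "e > 0"
  obtain K where K: "K > 0" "\<And>n. p (s n) \<le> K" using Cau_bounded[OF s] by blast
  obtain L where L: "L > 0" "\<And>n. p (t n) \<le> L" using Cau_bounded[OF t] by blast
  obtain N where N: "\<forall>m\<ge>N. \<forall>n\<ge>N. p (s m \<ominus> s n) < e / (2 * L)"
    using CauD[OF s, of "e / (2 * L)"] e L by auto
  obtain M where M: "\<forall>m\<ge>M. \<forall>n\<ge>M. p (t m \<ominus> t n) < e / (2 * K)"
    using CauD[OF t, of "e / (2 * K)"] e K by auto
  have "p (s m \<otimes> t m \<ominus> s n \<otimes> t n) < e" if mn: "m \<ge> max N M" "n \<ge> max N M" for m n
  proof -
    have "p (s m \<otimes> t m \<ominus> s n \<otimes> t n) \<le> p (s m) * p (t m \<ominus> t n) + p (s m \<ominus> s n) * p (t n)"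
      using s t by (simp add: seminorm_mult_diff)
    also have "\<dots> \<le> K * p (t m \<ominus> t n) + p (s m \<ominus> s n) * L"
      using K L s t by (intro add_mono mult_right_mono mult_left_mono seminorm_nonneg) auto
    also have "\<dots> < K * (e / (2 * K)) + (e / (2 * L)) * L"
      using K L M N mn by (intro add_strict_mono mult_strict_left_mono mult_strict_right_mono) auto
    also have "\<dots> = e" using K L by simp
    finally show ?thesis .
  qed
  thus "\<exists>N. \<forall>m\<ge>N. \<forall>n\<ge>N. p (s m \<otimes> t m \<ominus> s n \<otimes> t n) < e" by blast
qed (use s t in simp)

lemma completion_add_eq: "cls s \<oplus>\<^bsub>A\<^esub> cls t = (\<Union>s'\<in>cls s. \<Union>t'\<in>cls t. cls (\<lambda>n. s' n \<oplus> t' n))"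
  and completion_mult_eq: "cls s \<otimes>\<^bsub>A\<^esub> cls t = (\<Union>s'\<in>cls s. \<Union>t'\<in>cls t. cls (\<lambda>n. s' n \<otimes> t' n))"
  and completion_smult_eq: "c \<odot>\<^bsub>A\<^esub> cls s = (\<Union>s'\<in>cls s. cls (\<lambda>n. c \<odot> s' n))"
  and completion_adj_eq: "adj A (cls s) = (\<Union>s'\<in>cls s. cls (\<lambda>n. adj B (s' n)))"
  by (simp_all only: star_completion_def cls_def monoid.select_convs ring.select_convs
      module.select_convs star_algebra.select_convs)

lemma add_cls: assumes s: "s \<in> Cau" and t: "t \<in> Cau"
  shows "cls s \<oplus>\<^bsub>A\<^esub> cls t = cls (\<lambda>n. s n \<oplus> t n)"
proof -
  have "cls (\<lambda>n. s' n \<oplus> t' n) = cls (\<lambda>n. s n \<oplus> t n)" if "s' \<in> cls s" "t' \<in> cls t" for s' t'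
  proof -
    have st: "(s, s') \<in> null_rel B p" "(t, t') \<in> null_rel B p" using that by (auto simp: in_cls_iff)
    hence c: "s' \<in> Cau" "t' \<in> Cau" by (auto simp: null_rel_iff)
    have "(\<lambda>n. p (s n \<oplus> t n \<ominus> (s' n \<oplus> t' n))) \<longlonglongrightarrow> 0"
    proof (rule Lim_null_comparison)
      show "\<forall>\<^sub>F n in sequentially. norm (p (s n \<oplus> t n \<ominus> (s' n \<oplus> t' n))) \<le> p (s n \<ominus> s' n) + p (t n \<ominus> t' n)"
        using s t c by (intro always_eventually allI) (simp add: seminorm_nonneg seminorm_add_diff)
      show "(\<lambda>n. p (s n \<ominus> s' n) + p (t n \<ominus> t' n)) \<longlonglongrightarrow> 0"
        using st by (auto simp: null_rel_iff intro: tendsto_add_zero)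
    qed
    hence "(\<lambda>n. s n \<oplus> t n, \<lambda>n. s' n \<oplus> t' n) \<in> null_rel B p" using s t c by (simp add: null_rel_iff)
    thus ?thesis using s t c by (metis cls_eq_iff Cau_add)
  qed
  with self_in_cls[OF s] self_in_cls[OF t] show ?thesis
    unfolding completion_add_eq by (rule UN2_eq_const)
qed

lemma smult_cls: assumes s: "s \<in> Cau"
  shows "c \<odot>\<^bsub>A\<^esub> cls s = cls (\<lambda>n. c \<odot> s n)"
proof -
  have "cls (\<lambda>n. c \<odot> s' n) = cls (\<lambda>n. c \<odot> s n)" if "s' \<in> cls s" for s'
  proof -
    have st: "(s, s') \<in> null_rel B p" using that by (auto simp: in_cls_iff)
    hence c': "s' \<in> Cau" by (auto simp: null_rel_iff)
    have "(\<lambda>n. p (c \<odot> s n \<ominus> c \<odot> s' n)) \<longlonglongrightarrow> 0"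
      using st s c' by (simp add: null_rel_iff seminorm_smult_diff tendsto_mult_right_zero)
    hence "(\<lambda>n. c \<odot> s n, \<lambda>n. c \<odot> s' n) \<in> null_rel B p" using s c' by (simp add: null_rel_iff)
    thus ?thesis using s c' by (metis cls_eq_iff Cau_smult)
  qed
  with self_in_cls[OF s] show ?thesis
    unfolding completion_smult_eq by (rule UN_eq_const)
qed

lemma adj_cls: assumes s: "s \<in> Cau"
  shows "adj A (cls s) = cls (\<lambda>n. adj B (s n))"
proof -
  have "cls (\<lambda>n. adj B (s' n)) = cls (\<lambda>n. adj B (s n))" if "s' \<in> cls s" for s'
  proof -
    have st: "(s, s') \<in> null_rel B p" using that by (auto simp: in_cls_iff)
    hence c': "s' \<in> Cau" by (auto simp: null_rel_iff)
    have "(\<lambda>n. adj B (s n), \<lambda>n. adj B (s' n)) \<in> null_rel B p"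
      using st s c' by (simp add: null_rel_iff seminorm_adj_diff)
    thus ?thesis using s c' by (metis cls_eq_iff Cau_adj)
  qed
  with self_in_cls[OF s] show ?thesis
    unfolding completion_adj_eq by (rule UN_eq_const)
qed

lemma mult_cls: assumes s: "s \<in> Cau" and t: "t \<in> Cau"
  shows "cls s \<otimes>\<^bsub>A\<^esub> cls t = cls (\<lambda>n. s n \<otimes> t n)"
proof -
  have "cls (\<lambda>n. s' n \<otimes> t' n) = cls (\<lambda>n. s n \<otimes> t n)" if "s' \<in> cls s" "t' \<in> cls t" for s' t'
  proof -
    have st: "(s, s') \<in> null_rel B p" "(t, t') \<in> null_rel B p" using that by (auto simp: in_cls_iff)
    hence c: "s' \<in> Cau" "t' \<in> Cau" by (auto simp: null_rel_iff)
    obtain K where K: "K > 0" "\<And>n. p (s n) \<le> K" using Cau_bounded[OF s] by blast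
    obtain L where L: "L > 0" "\<And>n. p (t' n) \<le> L" using Cau_bounded[OF c(2)] by blast
    have "(\<lambda>n. p (s n \<otimes> t n \<ominus> s' n \<otimes> t' n)) \<longlonglongrightarrow> 0"
    proof (rule Lim_null_comparison)
      have "p (s n \<otimes> t n \<ominus> s' n \<otimes> t' n) \<le> K * p (t n \<ominus> t' n) + p (s n \<ominus> s' n) * L" for n
      proof -
        have "p (s n \<otimes> t n \<ominus> s' n \<otimes> t' n) \<le> p (s n) * p (t n \<ominus> t' n) + p (s n \<ominus> s' n) * p (t' n)"
          using s t c by (simp add: seminorm_mult_diff)
        also have "\<dots> \<le> K * p (t n \<ominus> t' n) + p (s n \<ominus> s' n) * L"
          using K L s t c by (intro add_mono mult_right_mono mult_left_mono seminorm_nonneg) auto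
        finally show ?thesis .
      qed
      thus "\<forall>\<^sub>F n in sequentially. norm (p (s n \<otimes> t n \<ominus> s' n \<otimes> t' n))
          \<le> K * p (t n \<ominus> t' n) + p (s n \<ominus> s' n) * L"
        using s t c by (intro always_eventually allI) (simp add: seminorm_nonneg)
      show "(\<lambda>n. K * p (t n \<ominus> t' n) + p (s n \<ominus> s' n) * L) \<longlonglongrightarrow> 0"
        using st by (auto simp: null_rel_iff intro!: tendsto_add_zero tendsto_mult_right_zero tendsto_mult_left_zero)
    qed
    hence "(\<lambda>n. s n \<otimes> t n, \<lambda>n. s' n \<otimes> t' n) \<in> null_rel B p" using s t c by (simp add: null_rel_iff)
    thus ?thesis using s t c by (metis cls_eq_iff Cau_mult)
  qed
  with self_in_cls[OF s] self_in_cls[OF t] show ?thesis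
    unfolding completion_mult_eq by (rule UN2_eq_const)
qed

lemma seminorm_tendsto_cls:
  assumes "s \<in> Cau" "t \<in> cls s" "(\<lambda>n. p (s n)) \<longlonglongrightarrow> r" shows "(\<lambda>n. p (t n)) \<longlonglongrightarrow> r"
proof -
  have st: "(s, t) \<in> null_rel B p" using assms by (simp add: in_cls_iff)
  hence t: "t \<in> Cau" by (simp add: null_rel_iff)
  have "(\<lambda>n. p (t n) - p (s n)) \<longlonglongrightarrow> 0"
  proof (rule Lim_null_comparison)
    show "\<forall>\<^sub>F n in sequentially. norm (p (t n) - p (s n)) \<le> p (s n \<ominus> t n)"
      using seminorm_diff_le assms t by (intro always_eventually allI)
        (simp add: abs_minus_commute)
  qed (use st in \<open>simp add: null_rel_iff\<close>)
  from tendsto_add[OF this assms(3)] show ?thesis by simp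
qed

lemma nrm_cls: assumes s: "s \<in> Cau" shows "(\<lambda>n. p (s n)) \<longlonglongrightarrow> nrm A (cls s)"
proof -
  obtain r where r: "(\<lambda>n. p (s n)) \<longlonglongrightarrow> r" using Cau_convergent[OF s] by (auto simp: convergent_def)
  note self = self_in_cls[OF s]
  have "nrm A (cls s) = (THE r. \<forall>t\<in>cls s. (\<lambda>n. p (t n)) \<longlonglongrightarrow> r)" by (simp add: star_completion_def)
  also have "\<dots> = r"
    using seminorm_tendsto_cls[OF s _ r] self by (intro the_equality) (auto intro: LIMSEQ_unique)
  finally show ?thesis using r by simp
qed

abbreviation "emb \<equiv> completion_embed B p"

lemma emb_eq_cls: "emb a = cls (\<lambda>n. a)"
  by (simp add: completion_embed_def cls_def)

lemma emb_closed [simp]: "a \<in> carrier B \<Longrightarrow> emb a \<in> carrier A"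
  by (simp add: emb_eq_cls)

lemma emb_hom:
  assumes "a \<in> carrier B" "b \<in> carrier B"
  shows "emb a \<oplus>\<^bsub>A\<^esub> emb b = emb (a \<oplus> b)" "emb a \<otimes>\<^bsub>A\<^esub> emb b = emb (a \<otimes> b)"
    "c \<odot>\<^bsub>A\<^esub> emb a = emb (c \<odot> a)" "adj A (emb a) = emb (adj B a)"
  using assms by (simp_all add: emb_eq_cls add_cls mult_cls smult_cls adj_cls)

lemma nrm_emb: "a \<in> carrier B \<Longrightarrow> nrm A (emb a) = p a"
  using nrm_cls[of "\<lambda>n. a"] by (simp add: emb_eq_cls LIMSEQ_const_iff)

lemma nrm_nonneg: "s \<in> Cau \<Longrightarrow> 0 \<le> nrm A (cls s)"
  using nrm_cls[of s] by (rule LIMSEQ_le_const) (auto simp: seminorm_nonneg)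

lemma nrm_smult_cls: assumes "s \<in> Cau" shows "nrm A (c \<odot>\<^bsub>A\<^esub> cls s) = cmod c * nrm A (cls s)"
proof -
  have "(\<lambda>n. p (c \<odot> s n)) \<longlonglongrightarrow> nrm A (c \<odot>\<^bsub>A\<^esub> cls s)"
    using nrm_cls[of "\<lambda>n. c \<odot> s n"] assms by (simp add: smult_cls)
  moreover have "(\<lambda>n. p (c \<odot> s n)) \<longlonglongrightarrow> cmod c * nrm A (cls s)"
    using tendsto_mult_left[OF nrm_cls[OF assms]] assms by (simp add: seminorm_smult)
  ultimately show ?thesis by (rule LIMSEQ_unique)
qed

text \<open>A norm-bounded linear functional is determined by its values on the image of
  \<open>B\<close>. The difference of \<open>emb (s m)\<close> and \<open>cls s\<close> is the class
  of the sequence n \<mapsto> s m - s n, whose norm is small for large m.\<close>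

lemma functional_cls_tendsto:
  assumes add: "\<And>a b. a \<in> carrier A \<Longrightarrow> b \<in> carrier A \<Longrightarrow> \<tau> (a \<oplus>\<^bsub>A\<^esub> b) = \<tau> a + \<tau> b"
    and smult: "\<And>c a. a \<in> carrier A \<Longrightarrow> \<tau> (c \<odot>\<^bsub>A\<^esub> a) = c * \<tau> a"
    and bdd: "\<And>a. a \<in> carrier A \<Longrightarrow> cmod (\<tau> a) \<le> nrm A a"
    and s: "s \<in> Cau"
  shows "(\<lambda>n. \<tau> (emb (s n))) \<longlonglongrightarrow> \<tau> (cls s)"
proof (rule LIMSEQ_I)
  fix e :: real assume "e > 0"
  then obtain N where N: "\<forall>m\<ge>N. \<forall>n\<ge>N. p (s m \<ominus> s n) < e / 2"
    using CauD[OF s, of "e / 2"] by auto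
  have "norm (\<tau> (emb (s m)) - \<tau> (cls s)) < e" if m: "m \<ge> N" for m
  proof -
    have c: "(\<lambda>n. s m \<ominus> s n) \<in> Cau"
      using Cau_add[OF Cau_const[OF Cau_carrier[OF s]] Cau_smult[OF s, of "-1"]] s
      by (simp add: smult_minus_one a_minus_def)
    have "cls (\<lambda>n. s m \<ominus> s n) = emb (s m) \<oplus>\<^bsub>A\<^esub> (-1) \<odot>\<^bsub>A\<^esub> cls s"
      using add_cls[OF Cau_const[OF Cau_carrier[OF s]] Cau_smult[OF s, of "-1"]] s
      by (simp add: emb_eq_cls smult_cls smult_minus_one a_minus_def)
    hence "\<tau> (cls (\<lambda>n. s m \<ominus> s n)) = \<tau> (emb (s m)) + \<tau> ((-1) \<odot>\<^bsub>A\<^esub> cls s)"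
      using s Cau_smult[OF s, of "-1"] by (simp add: add smult_cls)
    hence "\<tau> (cls (\<lambda>n. s m \<ominus> s n)) = \<tau> (emb (s m)) - \<tau> (cls s)"
      using s by (simp add: smult)
    moreover have "nrm A (cls (\<lambda>n. s m \<ominus> s n)) \<le> e / 2"
      by (rule LIMSEQ_le_const2[OF nrm_cls[OF c]]) (use N m less_imp_le in blast)
    ultimately show ?thesis using bdd[of "cls (\<lambda>n. s m \<ominus> s n)"] c \<open>e > 0\<close> by simp
  qed
  thus "\<exists>no. \<forall>n\<ge>no. norm (\<tau> (emb (s n)) - \<tau> (cls s)) < e" by blast
qed

section \<open>States of the completion and their restrictions to the dense subalgebra\<close>

lemma states_add: "\<tau> \<in> states A \<Longrightarrow> a \<in> carrier A \<Longrightarrow> b \<in> carrier A \<Longrightarrow> \<tau> (a \<oplus>\<^bsub>A\<^esub> b) = \<tau> a + \<tau> b"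
  and states_smult: "\<tau> \<in> states A \<Longrightarrow> a \<in> carrier A \<Longrightarrow> \<tau> (c \<odot>\<^bsub>A\<^esub> a) = c * \<tau> a"
  and states_nonneg: "\<tau> \<in> states A \<Longrightarrow> a \<in> carrier A \<Longrightarrow> \<tau> (adj A a \<otimes>\<^bsub>A\<^esub> a) \<in> \<real>\<^sub>\<ge>\<^sub>0"
  by (auto simp: states_def)

lemma states_le_nrm:
  assumes \<tau>: "\<tau> \<in> states A" and a: "a \<in> carrier A"
  shows "cmod (\<tau> a) \<le> nrm A a"
proof -
  obtain s where s: "s \<in> Cau" "a = cls s" using a by (auto simp: carrier_completion)
  have unit: "cmod (\<tau> b) \<le> 1" if "b \<in> carrier A" "nrm A b \<le> 1" for b
  proof -
    have "cmod (\<tau> b) \<le> Sup {cmod (\<tau> a) | a. a \<in> carrier A \<and> nrm A a \<le> 1}"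
      by (rule cSup_upper) (use that \<tau> in \<open>auto simp: states_def\<close>)
    thus ?thesis using \<tau> by (simp add: states_def)
  qed
  show ?thesis
  \<comment> \<open>The element is rescaled into the unit ball by nrm a + e rather than by nrm a, so
    that norm 0 needs no case of its own.\<close>
  proof (rule field_le_epsilon)
    fix e :: real assume e: "e > 0"
    let ?r = "nrm A a + e"
    have r: "?r > 0" using nrm_nonneg[OF s(1)] s(2) e by simp
    have c: "complex_of_real (1 / ?r) \<odot>\<^bsub>A\<^esub> a \<in> carrier A"
      using s by (simp add: smult_cls)
    have "nrm A (complex_of_real (1 / ?r) \<odot>\<^bsub>A\<^esub> a) = (1 / ?r) * nrm A a"
      using s r by (simp only: nrm_smult_cls norm_of_real) simp
    also have "\<dots> \<le> 1" using r e by simp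
    finally have "cmod (\<tau> (complex_of_real (1 / ?r) \<odot>\<^bsub>A\<^esub> a)) \<le> 1" using unit c by blast
    hence "(1 / ?r) * cmod (\<tau> a) \<le> 1"
      using r a \<tau> by (simp only: states_smult norm_mult norm_of_real) simp
    thus "cmod (\<tau> a) \<le> nrm A a + e" using r by (simp add: field_simps)
  qed
qed

lemma states_cls_tendsto: "\<tau> \<in> states A \<Longrightarrow> s \<in> Cau \<Longrightarrow> (\<lambda>n. \<tau> (emb (s n))) \<longlonglongrightarrow> \<tau> (cls s)"
  by (rule functional_cls_tendsto) (auto simp: states_add states_smult states_le_nrm)

lemma states_eqI:
  assumes \<tau>: "\<tau> \<in> states A" "\<sigma> \<in> states A" and eq: "\<And>a. a \<in> carrier B \<Longrightarrow> \<tau> (emb a) = \<sigma> (emb a)"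
  shows "\<tau> = \<sigma>"
proof (rule extensionalityI)
  show "\<tau> \<in> extensional (carrier A)" "\<sigma> \<in> extensional (carrier A)" using \<tau> by (auto simp: states_def)
  fix a assume "a \<in> carrier A"
  then obtain s where s: "s \<in> Cau" "a = cls s" by (auto simp: carrier_completion)
  have "(\<lambda>n. \<tau> (emb (s n))) \<longlonglongrightarrow> \<tau> a" "(\<lambda>n. \<tau> (emb (s n))) \<longlonglongrightarrow> \<sigma> a"
    using states_cls_tendsto[OF \<tau>(1) s(1)] states_cls_tendsto[OF \<tau>(2) s(1)] s eq by simp_all
  thus "\<tau> a = \<sigma> a" by (rule LIMSEQ_unique)
qed

lemma states_emb_positive:
  assumes "\<tau> \<in> states A" shows "positive_functional B (\<lambda>a. \<tau> (emb a))"
  using assms states_add[OF assms emb_closed emb_closed] states_smult[OF assms emb_closed]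
    states_nonneg[OF assms emb_closed]
  by (simp add: positive_functional_def emb_hom)

text \<open>Norm 1 forces \<open>\<tau>(1) = 1\<close>, since \<open>\<bar>\<tau>(a)\<bar>\<^sup>2 \<le> \<tau>(1) \<tau>(a\<^sup>*a) \<le> \<tau>(1) \<parallel>a\<parallel>\<^sup>2\<close>.\<close>

lemma states_emb_one:
  assumes \<tau>: "\<tau> \<in> states A" shows "\<tau> (emb \<one>) = 1"
proof -
  note pos = states_emb_positive[OF \<tau>]
  let ?t = "\<tau> (emb \<one>)"
  have t: "Re ?t \<ge> 0" "Im ?t = 0"
    using functional_Re_nonneg[OF pos, of \<one>] functional_Im_zero[OF pos, of \<one>] by simp_all
  have "cmod ?t \<le> 1"
    using states_le_nrm[OF \<tau>, of "emb \<one>"] seminorm_one_le by (simp add: nrm_emb)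
  hence t1: "Re ?t \<le> 1" using complex_Re_le_cmod order_trans by blast
  have "cmod (\<tau> a) \<le> sqrt (Re ?t)" if a: "a \<in> carrier A" "nrm A a \<le> 1" for a
  proof -
    obtain s where s: "s \<in> Cau" "a = cls s" using a by (auto simp: carrier_completion)
    have le: "cmod (\<tau> (emb (s n))) \<le> sqrt (Re ?t) * p (s n)" for n
    proof (rule power2_le_imp_le)
      have "(cmod (\<tau> (emb (s n))))\<^sup>2 \<le> Re ?t * Re (\<tau> (emb (adj B (s n) \<otimes> s n)))"
        using Cauchy_Schwarz_functional_one[OF pos, of "s n"] s by simp
      also have "Re (\<tau> (emb (adj B (s n) \<otimes> s n))) \<le> (p (s n))\<^sup>2"
        using states_le_nrm[OF \<tau>, of "emb (adj B (s n) \<otimes> s n)"] s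
          complex_Re_le_cmod[of "\<tau> (emb (adj B (s n) \<otimes> s n))"] by (simp add: nrm_emb seminorm_cstar)
      finally show "(cmod (\<tau> (emb (s n))))\<^sup>2 \<le> (sqrt (Re ?t) * p (s n))\<^sup>2"
        using t by (simp add: power_mult_distrib mult_left_mono)
      show "0 \<le> sqrt (Re ?t) * p (s n)" using t s by (simp add: seminorm_nonneg)
    qed
    have "cmod (\<tau> a) \<le> sqrt (Re ?t) * nrm A a"
      by (rule LIMSEQ_le[OF tendsto_norm[OF states_cls_tendsto[OF \<tau> s(1)], folded s(2)]
            tendsto_mult_left[OF nrm_cls[OF s(1)], folded s(2)]]) (use le in blast)
    also have "\<dots> \<le> sqrt (Re ?t)" using a t mult_left_mono[of "nrm A a" 1 "sqrt (Re ?t)"] by simp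
    finally show ?thesis .
  qed
  moreover have "emb \<one> \<in> carrier A" "nrm A (emb \<one>) \<le> 1" using seminorm_one_le by (simp_all add: nrm_emb)
  ultimately have "Sup {cmod (\<tau> a) | a. a \<in> carrier A \<and> nrm A a \<le> 1} \<le> sqrt (Re ?t)"
    by (intro cSup_least) blast+
  hence "1 \<le> sqrt (Re ?t)" using \<tau> by (simp add: states_def)
  hence "Re ?t = 1" using t1 by simp
  thus ?thesis using t by (simp add: complex_eq_iff)
qed

section \<open>Extending dominated positive functionals to the completion\<close>

definition extend_functional :: "('a \<Rightarrow> complex) \<Rightarrow> (nat \<Rightarrow> 'a) set \<Rightarrow> complex" where
  "extend_functional \<tau> = restrict (\<lambda>U. THE z. \<forall>s\<in>U. (\<lambda>n. \<tau> (s n)) \<longlonglongrightarrow> z) (carrier A)"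

context
  fixes \<tau> assumes pos: "positive_functional B \<tau>" and one: "\<tau> \<one> = 1"
    and le: "\<And>a. a \<in> carrier B \<Longrightarrow> cmod (\<tau> a) \<le> p a"
begin

lemma functional_Cau_convergent: assumes s: "s \<in> Cau" shows "convergent (\<lambda>n. \<tau> (s n))"
proof (rule Cauchy_convergent, rule CauchyI)
  fix e :: real assume "e > 0"
  then obtain N where N: "\<forall>m\<ge>N. \<forall>n\<ge>N. p (s m \<ominus> s n) < e" using CauD[OF s, of e] by auto
  have "norm (\<tau> (s m) - \<tau> (s n)) \<le> p (s m \<ominus> s n)" for m n
    using le[of "s m \<ominus> s n"] s by (simp add: functional_minus[OF pos])
  thus "\<exists>M. \<forall>m\<ge>M. \<forall>n\<ge>M. norm (\<tau> (s m) - \<tau> (s n)) < e"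
    using N by (meson le_less_trans)
qed

lemma extend_functional_tendsto:
  assumes s: "s \<in> Cau" shows "(\<lambda>n. \<tau> (s n)) \<longlonglongrightarrow> extend_functional \<tau> (cls s)"
proof -
  obtain z where z: "(\<lambda>n. \<tau> (s n)) \<longlonglongrightarrow> z" using functional_Cau_convergent[OF s] by (auto simp: convergent_def)
  note self = self_in_cls[OF s]
  have conv: "(\<lambda>n. \<tau> (t n)) \<longlonglongrightarrow> z" if "t \<in> cls s" for t
  proof -
    have st: "(s, t) \<in> null_rel B p" using that by (simp add: in_cls_iff)
    hence t: "t \<in> Cau" by (simp add: null_rel_iff)
    have "(\<lambda>n. \<tau> (s n) - \<tau> (t n)) \<longlonglongrightarrow> 0"
    proof (rule Lim_null_comparison)
      show "\<forall>\<^sub>F n in sequentially. norm (\<tau> (s n) - \<tau> (t n)) \<le> p (s n \<ominus> t n)"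
      proof (intro always_eventually allI)
        fix n show "norm (\<tau> (s n) - \<tau> (t n)) \<le> p (s n \<ominus> t n)"
          using le[of "s n \<ominus> t n"] s t by (simp add: functional_minus[OF pos])
      qed
    qed (use st in \<open>simp add: null_rel_iff\<close>)
    from tendsto_diff[OF z this] show ?thesis by simp
  qed
  have "(THE z. \<forall>s\<in>cls s. (\<lambda>n. \<tau> (s n)) \<longlonglongrightarrow> z) = z"
    using conv self by (intro the_equality) (auto intro: LIMSEQ_unique)
  thus ?thesis using z s by (simp add: extend_functional_def)
qed

lemma extend_functional_emb: "a \<in> carrier B \<Longrightarrow> extend_functional \<tau> (emb a) = \<tau> a"
  using extend_functional_tendsto[of "\<lambda>n. a"] by (simp add: emb_eq_cls LIMSEQ_const_iff)

lemma extend_functional_le_nrm: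
  assumes "a \<in> carrier A" shows "cmod (extend_functional \<tau> a) \<le> nrm A a"
proof -
  obtain s where s: "s \<in> Cau" "a = cls s" using assms by (auto simp: carrier_completion)
  show ?thesis
    using LIMSEQ_le[OF tendsto_norm[OF extend_functional_tendsto[OF s(1)]] nrm_cls[OF s(1)]] le s by auto
qed

lemma extend_functional_state: "extend_functional \<tau> \<in> states A"
proof -
  let ?\<tau> = "extend_functional \<tau>"
  have add: "?\<tau> (a \<oplus>\<^bsub>A\<^esub> b) = ?\<tau> a + ?\<tau> b" if ab: "a \<in> carrier A" "b \<in> carrier A" for a b
  proof -
    obtain s t where s: "s \<in> Cau" "a = cls s" and t: "t \<in> Cau" "b = cls t"
      using ab unfolding carrier_completion by blast
    have "(\<lambda>n. \<tau> (s n \<oplus> t n)) \<longlonglongrightarrow> ?\<tau> a + ?\<tau> b"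
      using tendsto_add[OF extend_functional_tendsto[OF s(1)] extend_functional_tendsto[OF t(1)]] s t
      by (simp add: functional_add[OF pos])
    thus ?thesis using extend_functional_tendsto[of "\<lambda>n. s n \<oplus> t n"] s t
      by (auto simp: add_cls intro: LIMSEQ_unique)
  qed
  have smult: "?\<tau> (c \<odot>\<^bsub>A\<^esub> a) = c * ?\<tau> a" if ab: "a \<in> carrier A" for a c
  proof -
    obtain s where s: "s \<in> Cau" "a = cls s" using ab unfolding carrier_completion by blast
    have "(\<lambda>n. \<tau> (c \<odot> s n)) \<longlonglongrightarrow> c * ?\<tau> a"
      using tendsto_mult_left[OF extend_functional_tendsto[OF s(1)]] s by (simp add: functional_smult[OF pos])
    thus ?thesis using extend_functional_tendsto[of "\<lambda>n. c \<odot> s n"] s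
      by (auto simp: smult_cls intro: LIMSEQ_unique)
  qed
  have nonneg: "?\<tau> (adj A a \<otimes>\<^bsub>A\<^esub> a) \<in> \<real>\<^sub>\<ge>\<^sub>0" if ab: "a \<in> carrier A" for a
  proof -
    obtain s where s: "s \<in> Cau" "a = cls s" using ab unfolding carrier_completion by blast
    have "(\<lambda>n. \<tau> (adj B (s n) \<otimes> s n)) \<longlonglongrightarrow> ?\<tau> (adj A a \<otimes>\<^bsub>A\<^esub> a)"
      using extend_functional_tendsto[of "\<lambda>n. adj B (s n) \<otimes> s n"] s by (simp add: adj_cls mult_cls)
    thus ?thesis using s
      by (intro Lim_in_closed_set[OF closed_nonneg_Reals_complex])
         (auto simp: functional_nonneg[OF pos])
  qed
  let ?S = "{cmod (?\<tau> a) | a. a \<in> carrier A \<and> nrm A a \<le> 1}"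
  have bdd: "\<And>x. x \<in> ?S \<Longrightarrow> x \<le> 1" using extend_functional_le_nrm by fastforce
  have "emb \<one> \<in> carrier A \<and> nrm A (emb \<one>) \<le> 1" "1 = cmod (?\<tau> (emb \<one>))"
    using extend_functional_emb[of \<one>] one seminorm_one_le by (simp_all add: nrm_emb)
  hence "1 \<in> ?S" by blast
  hence "Sup ?S = 1" using bdd by (rule cSup_eq_maximum)
  moreover have "bdd_above ?S" using bdd by (rule bdd_aboveI)
  moreover have "?\<tau> \<in> extensional (carrier A)" by (simp add: extend_functional_def)
  ultimately show ?thesis unfolding states_def using add smult nonneg by blast
qed

lemma extend_functional_tracial:
  assumes tr: "is_tracial B \<tau>" shows "extend_functional \<tau> \<in> tracial_states A"
proof -
  have "extend_functional \<tau> (a \<otimes>\<^bsub>A\<^esub> b) = extend_functional \<tau> (b \<otimes>\<^bsub>A\<^esub> a)"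
    if ab: "a \<in> carrier A" "b \<in> carrier A" for a b
  proof -
    obtain s t where s: "s \<in> Cau" "a = cls s" and t: "t \<in> Cau" "b = cls t"
      using ab unfolding carrier_completion by blast
    have "(\<lambda>n. \<tau> (s n \<otimes> t n)) \<longlonglongrightarrow> extend_functional \<tau> (a \<otimes>\<^bsub>A\<^esub> b)"
      using extend_functional_tendsto[of "\<lambda>n. s n \<otimes> t n"] s t by (simp add: mult_cls)
    moreover have "(\<lambda>n. \<tau> (s n \<otimes> t n)) = (\<lambda>n. \<tau> (t n \<otimes> s n))"
      using tr s t by (auto simp: is_tracial_def)
    moreover have "(\<lambda>n. \<tau> (t n \<otimes> s n)) \<longlonglongrightarrow> extend_functional \<tau> (b \<otimes>\<^bsub>A\<^esub> a)"
      using extend_functional_tendsto[of "\<lambda>n. t n \<otimes> s n"] s t by (simp add: mult_cls)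
    ultimately show ?thesis by (metis LIMSEQ_unique)
  qed
  thus ?thesis using extend_functional_state by (simp add: tracial_states_def)
qed

end

lemma tracial_states_emb:
  assumes \<tau>: "\<tau> \<in> tracial_states A" shows "normalized_trace B (\<lambda>a. \<tau> (emb a))"
  using assms states_emb_positive[of \<tau>] states_emb_one[of \<tau>]
  by (auto simp: normalized_trace_def is_tracial_def tracial_states_def emb_hom(2)[symmetric])

end

section \<open>Traces on the dense subalgebra and tracial states of the completion\<close>

locale cstar_enveloped_algebra = cstar_seminormed_algebra +
  assumes dominated: "positive_functional B \<tau> \<Longrightarrow> \<tau> \<one> = 1 \<Longrightarrow> a \<in> carrier B \<Longrightarrow> cmod (\<tau> a) \<le> p a"
begin

lemma extend_trace:
  assumes "normalized_trace B \<tau>"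
  shows "extend_functional \<tau> \<in> tracial_states A"
    and "a \<in> carrier B \<Longrightarrow> extend_functional \<tau> (emb a) = \<tau> a"
    and "s \<in> Cau \<Longrightarrow> (\<lambda>n. \<tau> (s n)) \<longlonglongrightarrow> extend_functional \<tau> (cls s)"
  using assms dominated[of \<tau>]
  by (auto simp: normalized_trace_def intro!: extend_functional_tracial extend_functional_emb
      extend_functional_tendsto)

text \<open>Restriction along \<open>emb\<close> and continuous extension are mutually inverse and
  respect convex combinations, so a decomposition on either side produces one on the other. From
  here on, extremality can be studied on \<open>B\<close> alone.\<close>

lemma extreme_tracial_states_iff:
  "\<tau> \<in> extreme_points (\<lambda>\<tau>. \<tau>) (tracial_states A) \<longleftrightarrow>
     \<tau> \<in> tracial_states A \<and> extreme_trace B (\<lambda>a. \<tau> (emb a))"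
proof (intro iffI conjI)
  assume ext: "\<tau> \<in> extreme_points (\<lambda>\<tau>. \<tau>) (tracial_states A)"
  then show \<tau>: "\<tau> \<in> tracial_states A" by (simp add: extreme_points_def)
  show "extreme_trace B (\<lambda>a. \<tau> (emb a))"
    unfolding extreme_trace_def
  proof (intro conjI allI impI)
    show "normalized_trace B (\<lambda>a. \<tau> (emb a))" by (rule tracial_states_emb[OF \<tau>])
    fix \<sigma> \<rho> :: "'a \<Rightarrow> complex" and t :: real
    assume "normalized_trace B \<sigma> \<and> normalized_trace B \<rho> \<and> 0 < t \<and> t < 1 \<and>
      (\<forall>a\<in>carrier B. \<tau> (emb a) = of_real (1 - t) * \<sigma> a + of_real t * \<rho> a)"
    hence \<sigma>: "normalized_trace B \<sigma>" and \<rho>: "normalized_trace B \<rho>" and t: "0 < t" "t < 1"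
      and eq: "\<And>a. a \<in> carrier B \<Longrightarrow> \<tau> (emb a) = of_real (1 - t) * \<sigma> a + of_real t * \<rho> a"
      by blast+
    have "\<tau> U = (1 - t) *\<^sub>R extend_functional \<sigma> U + t *\<^sub>R extend_functional \<rho> U" for U
    proof (cases "U \<in> carrier A")
      case True
      then obtain s where s: "s \<in> Cau" "U = cls s" unfolding carrier_completion by blast
      have "(\<lambda>n. of_real (1 - t) * \<sigma> (s n) + of_real t * \<rho> (s n)) \<longlonglongrightarrow>
          of_real (1 - t) * extend_functional \<sigma> U + of_real t * extend_functional \<rho> U"
        unfolding s(2) by (intro tendsto_intros extend_trace(3) \<sigma> \<rho> s)
      moreover have "(\<lambda>n. of_real (1 - t) * \<sigma> (s n) + of_real t * \<rho> (s n)) \<longlonglongrightarrow> \<tau> U"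
        using states_cls_tendsto[of \<tau> s] \<tau> s eq by (simp add: tracial_states_def)
      ultimately have "\<tau> U = of_real (1 - t) * extend_functional \<sigma> U + of_real t * extend_functional \<rho> U"
        by (metis LIMSEQ_unique)
      thus ?thesis by (simp add: scaleR_conv_of_real)
    next
      case False
      \<comment> \<open>\<open>extreme_points\<close> demands the convex combination at every
        argument. Outside the carrier all three functionals take the value \<open>undefined\<close>,
        and the weights add up to 1.\<close>
      have "\<tau> U = undefined"
        using \<tau> False by (simp add: tracial_states_def states_def extensional_def)
      thus ?thesis using False by (simp add: extend_functional_def flip: scaleR_add_left)
    qed
    hence "extend_functional \<sigma> = \<tau> \<and> extend_functional \<rho> = \<tau>"
      using ext t extend_trace(1)[OF \<sigma>] extend_trace(1)[OF \<rho>] unfolding extreme_points_def by blast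
    thus "\<forall>a\<in>carrier B. \<sigma> a = \<tau> (emb a) \<and> \<rho> a = \<tau> (emb a)"
      using extend_trace(2)[OF \<sigma>] extend_trace(2)[OF \<rho>] by metis
  qed
next
  assume asm: "\<tau> \<in> tracial_states A \<and> extreme_trace B (\<lambda>a. \<tau> (emb a))"
  have "\<sigma> = \<tau> \<and> \<rho> = \<tau>"
    if "\<sigma> \<in> tracial_states A" "\<rho> \<in> tracial_states A" "0 < t" "t < 1"
      "\<forall>U. \<tau> U = (1 - t) *\<^sub>R \<sigma> U + t *\<^sub>R \<rho> U" for \<sigma> \<rho> and t :: real
  proof -
    have "\<tau> (emb a) = of_real (1 - t) * \<sigma> (emb a) + of_real t * \<rho> (emb a)" for a
      by (rule trans[OF spec[OF that(5)]]) (simp add: scaleR_conv_of_real)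
    note eq = extreme_traceD[OF conjunct2[OF asm] tracial_states_emb[OF that(1)]
        tracial_states_emb[OF that(2)] that(3,4) this]
    have "\<tau> \<in> states A" "\<sigma> \<in> states A" "\<rho> \<in> states A"
      using that(1,2) asm by (simp_all add: tracial_states_def)
    thus ?thesis using eq by (intro conjI states_eqI)
  qed
  thus "\<tau> \<in> extreme_points (\<lambda>\<tau>. \<tau>) (tracial_states A)"
    using asm unfolding extreme_points_def by blast
qed

end

section \<open>Measures on second countable compact Hausdorff spaces\<close>

text \<open>Continuous stand-ins for the indicator of an open set. On U the value 1 is reached and
  kept, not merely approached, which provides functions separating a point from a closed set;
  starting at 0 lets the increments telescope to the whole function.\<close>

definition increases_to_indicator :: "(nat \<Rightarrow> 'x::topological_space \<Rightarrow> real) \<Rightarrow> 'x set \<Rightarrow> bool" where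
  "increases_to_indicator k U \<longleftrightarrow>
     (\<forall>n. continuous_on UNIV (k n)) \<and> (\<forall>n x. 0 \<le> k n x \<and> k n x \<le> 1 \<and> k n x \<le> k (Suc n) x) \<and>
     (\<forall>x. k 0 x = 0) \<and> (\<forall>n. \<forall>x. x \<notin> U \<longrightarrow> k n x = 0) \<and>
     (\<forall>x\<in>U. eventually (\<lambda>n. k n x = 1) sequentially)"

lemma increases_to_indicatorD:
  assumes "increases_to_indicator k U"
  shows "\<And>n. continuous_on UNIV (k n)" "\<And>n x. 0 \<le> k n x" "\<And>n x. k n x \<le> 1"
    "\<And>n x. x \<notin> U \<Longrightarrow> k n x = 0" "\<And>x. x \<in> U \<Longrightarrow> eventually (\<lambda>n. k n x = 1) sequentially"
    "\<And>n x. k n x \<le> k (Suc n) x" "\<And>x. k 0 x = 0"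
  using assms unfolding increases_to_indicator_def by blast+

lemma increases_to_indicator_tendsto:
  assumes k: "increases_to_indicator k U" shows "(\<lambda>n. k n x) \<longlonglongrightarrow> indicator U x"
proof (cases "x \<in> U")
  case True
  thus ?thesis using increases_to_indicatorD(5)[OF k True] by (simp add: tendsto_eventually)
qed (use increases_to_indicatorD(4)[OF k] in simp)

text \<open>Normality and second countability write U as a countable union of basic open sets whose
  closures lie in U. Take Urysohn functions f_i that are 1 on the i-th closure and 0 off U, and let
  k_n = 1 - (1 - f_0) ... (1 - f_(n-1)). This increases with n and equals 1 as soon as one factor
  vanishes.\<close>

lemma continuous_increasing_to_indicator_open:
  fixes U :: "'x::{t2_space, second_countable_topology} set"
  assumes cpt: "compact (UNIV :: 'x set)" and U: "open U"
  obtains k :: "nat \<Rightarrow> 'x \<Rightarrow> real" where "increases_to_indicator k U"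
proof -
  have normal: "normal_space (euclidean :: 'x topology)"
    using cpt hausdorff[where 'a = 'x]
    by (intro compact_Hausdorff_or_regular_imp_normal_space)
       (auto simp: compact_space_def Hausdorff_space_def disjnt_def)
  obtain \<B> :: "'x set set" where \<B>: "countable \<B>" "topological_basis \<B>"
    using ex_countable_basis by blast
  define W where "W = {V \<in> \<B>. closure V \<subseteq> U}"
  have cov: "\<exists>V\<in>W. x \<in> V" if xU: "x \<in> U" for x
  proof -
    obtain V where V: "open V" "x \<in> V" "closure V \<subseteq> U"
      using normal[unfolded normal_space_alt, rule_format, of "{x}" U] U xU by auto
    obtain V' where "V' \<in> \<B>" "x \<in> V'" "V' \<subseteq> V"
      using topological_basisE[OF \<B>(2) V(1,2)] by blast
    thus ?thesis using V closure_mono[of V' V] by (auto simp: W_def)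
  qed
  have cW: "countable W" using \<B>(1) by (simp add: W_def)
  \<comment> \<open>The empty set is the value when no basic set qualifies, as may happen for U =
    {}; an enumeration by \<open>from_nat_into\<close> is meaningful only for a nonempty
    family.\<close>
  define C where "C i = (if W = {} then {} else closure (from_nat_into W i))" for i
  have C: "closed (C i)" "C i \<subseteq> U" for i
    using from_nat_into[of W i] by (auto simp: C_def W_def)
  have "\<exists>f::'x \<Rightarrow> real. continuous_on UNIV f \<and> range f \<subseteq> {0..1} \<and> f ` (- U) \<subseteq> {0} \<and> f ` C i \<subseteq> {1}" for i
  proof -
    have "closedin euclidean (- U)" "closedin euclidean (C i)" "disjnt (- U) (C i)"
      using U C[of i] by (auto simp: disjnt_def)
    from Urysohn_lemma[OF normal this, of 0 1] obtain f :: "'x \<Rightarrow> real"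
      where "continuous_map euclidean (top_of_set {0..1}) f" "f ` (- U) \<subseteq> {0}" "f ` C i \<subseteq> {1}"
      by auto
    thus ?thesis by (intro exI[of _ f]) (auto simp: continuous_map_in_subtopology)
  qed
  then obtain f :: "nat \<Rightarrow> 'x \<Rightarrow> real" where f: "\<And>i. continuous_on UNIV (f i)"
      "\<And>i. range (f i) \<subseteq> {0..1}" "\<And>i. f i ` (- U) \<subseteq> {0}" "\<And>i. f i ` C i \<subseteq> {1}"
    by metis
  have f01: "0 \<le> f i x" "f i x \<le> 1" for i x using f(2)[of i] by (auto simp: image_subset_iff)
  define k where "k n x = 1 - (\<Prod>i<n. 1 - f i x)" for n x
  have p01: "0 \<le> (\<Prod>i<n. 1 - f i x)" "(\<Prod>i<n. 1 - f i x) \<le> 1" for n x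
    using f01 by (auto intro!: prod_nonneg prod_le_1)
  show ?thesis
  proof (rule that[of k], unfold increases_to_indicator_def, intro conjI allI ballI impI)
    show "continuous_on UNIV (k n)" for n
      unfolding k_def using f(1) by (intro continuous_intros) auto
    show "0 \<le> k n x" "k n x \<le> 1" for n x using p01 by (auto simp: k_def)
    show "k n x = 0" if "x \<notin> U" for n x
    proof -
      have "f i x = 0" for i using f(3)[of i] that by auto
      thus ?thesis by (simp add: k_def)
    qed
    show "eventually (\<lambda>n. k n x = 1) sequentially" if xU: "x \<in> U" for x
    proof -
      obtain V where V: "V \<in> W" "x \<in> V" using cov[OF xU] by blast
      then obtain i where i: "from_nat_into W i = V" using from_nat_into_surj[OF cW] by blast
      have "x \<in> C i" using V i closure_subset by (auto simp: C_def)
      hence fx: "f i x = 1" using f(4)[of i] by auto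
      have "k n x = 1" if "n > i" for n
      proof -
        have "(\<Prod>j<n. 1 - f j x) = 0" using fx that by (intro prod_zero) auto
        thus ?thesis by (simp add: k_def)
      qed
      thus ?thesis using eventually_gt_at_top[of i] by (rule eventually_mono[rotated])
    qed
    show "k n x \<le> k (Suc n) x" for n x
      using mult_left_mono[of "1 - f n x" 1 "\<Prod>i<n. 1 - f i x"] p01[where n = n and x = x] f01[of n x] by (simp add: k_def)
    show "k 0 x = 0" for x by (simp add: k_def)
  qed
qed

text \<open>Take all functions of the increasing sequences attached to a countable basis, the two
  indices being paired into one. A basic set around x that misses y provides a function with value 1
  at x and 0 at y. The family replaces a metric in later approximations.\<close>

lemma countable_separating_family:
  assumes cpt: "compact (UNIV :: 'x::{t2_space, second_countable_topology} set)"
  obtains \<kappa> :: "nat \<Rightarrow> 'x::{t2_space, second_countable_topology} \<Rightarrow> real" where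
    "\<And>i. continuous_on UNIV (\<kappa> i)" "\<And>x y. x \<noteq> y \<Longrightarrow> \<exists>i. \<kappa> i x \<noteq> \<kappa> i y"
proof -
  obtain \<B> :: "'x set set" where \<B>: "countable \<B>" "topological_basis \<B>"
    using ex_countable_basis by blast
  define V where "V n = (if \<B> = {} then {} else from_nat_into \<B> n)" for n
  have openV: "open (V n)" for n
    using from_nat_into[of \<B> n] topological_basis_open[OF \<B>(2)] by (auto simp: V_def)
  have "\<exists>k :: nat \<Rightarrow> 'x \<Rightarrow> real. increases_to_indicator k (V n)" for n
    by (rule continuous_increasing_to_indicator_open[OF cpt openV[of n]]) blast
  then obtain k :: "nat \<Rightarrow> nat \<Rightarrow> 'x \<Rightarrow> real" where k: "\<And>n. increases_to_indicator (k n) (V n)"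
    by metis
  show ?thesis
  proof (rule that[of "\<lambda>i. k (fst (prod_decode i)) (snd (prod_decode i))"])
    show "continuous_on UNIV (k (fst (prod_decode i)) (snd (prod_decode i)))" for i
      using increases_to_indicatorD(1)[OF k] by blast
    fix x y :: 'x assume "x \<noteq> y"
    then obtain U where U: "open U" "x \<in> U" "y \<notin> U" using hausdorff[of x y] by blast
    obtain W where W: "W \<in> \<B>" "x \<in> W" "W \<subseteq> U" by (rule topological_basisE[OF \<B>(2) U(1,2)])
    obtain n where "from_nat_into \<B> n = W" using from_nat_into_surj[OF \<B>(1) W(1)] by blast
    hence n: "V n = W" using W(1) by (auto simp: V_def)
    have "eventually (\<lambda>m. k n m x = 1) sequentially"
      using increases_to_indicatorD(5)[OF k[of n]] n W(2) by blast
    then obtain m where "k n m x = 1" by (auto simp: eventually_sequentially)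
    moreover have "k n m y = 0" using increases_to_indicatorD(4)[OF k[of n]] n W(3) U(3) by blast
    ultimately show "\<exists>i. k (fst (prod_decode i)) (snd (prod_decode i)) x \<noteq> k (fst (prod_decode i)) (snd (prod_decode i)) y"
      by (intro exI[of _ "prod_encode (n, m)"]) simp
  qed
qed

lemma bounded_continuous_compact_UNIV:
  fixes f :: "'x::topological_space \<Rightarrow> 'b::real_normed_vector"
  assumes "compact (UNIV :: 'x set)" "continuous_on UNIV f"
  obtains K where "K > 0" "\<And>x. norm (f x) \<le> K"
proof -
  have "bounded (range f)" using assms by (intro compact_imp_bounded compact_continuous_image)
  then obtain K where "\<And>x. norm (f x) \<le> K" by (auto simp: bounded_iff)
  hence "norm (f x) \<le> \<bar>K\<bar> + 1" for x by (smt (verit))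
  thus ?thesis by (intro that[of "\<bar>K\<bar> + 1"]) auto
qed

lemma borel_measurable_continuous_UNIV:
  assumes "sets M = sets borel" "continuous_on UNIV f" shows "f \<in> borel_measurable M"
  using borel_measurable_continuous_onI[OF assms(2)] assms(1) by (simp cong: measurable_cong_sets)

lemma integrable_continuous_compact_UNIV:
  fixes f :: "'a::topological_space \<Rightarrow> 'b::{banach, second_countable_topology}"
  assumes M: "finite_measure M"
    and "sets M = sets borel" "compact (UNIV :: 'a set)" "continuous_on UNIV f"
  shows "integrable M f"
proof -
  interpret finite_measure M by fact
  obtain K where "\<And>x. norm (f x) \<le> K" using bounded_continuous_compact_UNIV[OF assms(3,4)] by blast
  thus ?thesis using borel_measurable_continuous_UNIV[OF assms(2,4)]
    by (intro integrable_const_bound[of _ K]) auto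
qed

lemma prob_borel_eqI:
  fixes M N :: "'x::topological_space measure"
  assumes "prob_space M" "prob_space N" and s: "sets M = sets borel" "sets N = sets borel"
    and eq: "\<And>U. open U \<Longrightarrow> measure M U = measure N U"
  shows "M = N"
proof (rule measure_eqI_generator_eq[where E = "Collect open" and \<Omega> = UNIV and A = "\<lambda>_. UNIV"])
  interpret M: prob_space M by fact
  interpret N: prob_space N by fact
  show "Int_stable (Collect (open :: 'x set \<Rightarrow> bool))" by (auto simp: Int_stable_def)
  show "emeasure M U = emeasure N U" if "U \<in> Collect open" for U
    using eq that by (simp add: M.emeasure_eq_measure N.emeasure_eq_measure)
  show "emeasure M UNIV \<noteq> \<infinity>" using M.emeasure_finite by simp
qed (use s in \<open>auto simp: borel_def\<close>)

lemma integral_tendsto_continuous: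
  fixes k :: "nat \<Rightarrow> 'a::topological_space \<Rightarrow> 'b::{banach, second_countable_topology}"
  assumes "prob_space M" and M: "sets M = sets borel" and k: "\<And>n. continuous_on UNIV (k n)" "\<And>n x. norm (k n x) \<le> K"
    and lim: "\<And>x. (\<lambda>n. k n x) \<longlonglongrightarrow> l x"
  shows "(\<lambda>n. \<integral>x. k n x \<partial>M) \<longlonglongrightarrow> (\<integral>x. l x \<partial>M)"
proof (rule integral_dominated_convergence[where w = "\<lambda>_. K"])
  interpret prob_space M by fact
  have meas: "k n \<in> borel_measurable M" for n by (rule borel_measurable_continuous_UNIV[OF M k(1)])
  show "l \<in> borel_measurable M" by (rule borel_measurable_LIMSEQ_metric[OF meas lim])
  show "k n \<in> borel_measurable M" for n by (rule meas)
  show "integrable M (\<lambda>_. K)" by simp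
qed (use k lim in auto)

lemma integral_tendsto_measure_open:
  fixes k :: "nat \<Rightarrow> 'a::topological_space \<Rightarrow> real"
  assumes P: "prob_space M" and M: "sets M = sets borel" and k: "increases_to_indicator k U"
    and U: "open U"
  shows "(\<lambda>n. \<integral>x. k n x \<partial>M) \<longlonglongrightarrow> measure M U"
proof -
  have "(\<lambda>n. \<integral>x. k n x \<partial>M) \<longlonglongrightarrow> (\<integral>x. indicator U x \<partial>M)"
    using increases_to_indicatorD[OF k]
    by (intro integral_tendsto_continuous[OF P M, where K = 1] increases_to_indicator_tendsto[OF k]) auto
  moreover have "U \<in> sets M" using M U by simp
  ultimately show ?thesis by simp
qed

lemma prob_borel_eqI_integral:
  fixes M N :: "'x::{t2_space, second_countable_topology} measure"
  assumes cpt: "compact (UNIV :: 'x set)" and MN: "prob_space M" "prob_space N"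
    and s: "sets M = sets borel" "sets N = sets borel"
    and eq: "\<And>f :: 'x \<Rightarrow> real. continuous_on UNIV f \<Longrightarrow> (\<integral>x. f x \<partial>M) = (\<integral>x. f x \<partial>N)"
  shows "M = N"
proof (rule prob_borel_eqI[OF MN s])
  fix U :: "'x set" assume U: "open U"
  obtain k :: "nat \<Rightarrow> 'x \<Rightarrow> real" where k: "increases_to_indicator k U"
    by (rule continuous_increasing_to_indicator_open[OF cpt U])
  show "measure M U = measure N U"
    using integral_tendsto_measure_open[OF MN(1) s(1) k U]
      integral_tendsto_measure_open[OF MN(2) s(2) k U] eq[OF increases_to_indicatorD(1)[OF k]]
    by (simp add: LIMSEQ_unique)
qed

text \<open>The sets that can be squeezed between a closed and an open set with arbitrarily small
  gap form a sigma-algebra, and it contains the open sets because each is an increasing union of the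
  closed sets where \<open>k n\<close> reaches 1. By compactness of the space, closed inner sets are
  compact.\<close>

lemma regular_borel_prob:
  fixes M :: "'x::{t2_space, second_countable_topology} measure"
  assumes cpt: "compact (UNIV :: 'x set)" and "prob_space M" and s: "sets M = sets borel"
  shows "regular_borel M"
proof -
  interpret prob_space M by fact
  have space [simp]: "space M = UNIV" unfolding sets_eq_imp_space_eq[OF s] by simp
  define approx where "approx B \<longleftrightarrow> (\<forall>e>0. \<exists>K U. closed K \<and> open U \<and> K \<subseteq> B \<and> B \<subseteq> U \<and>
      measure M (U - K) < e)" for B
  have approxD: "\<exists>K U. closed K \<and> open U \<and> K \<subseteq> B \<and> B \<subseteq> U \<and> measure M (U - K) < e"
    if "approx B" "e > 0" for B e
    using that unfolding approx_def by simp
  have meas: "S \<in> sets M" if "open S \<or> closed S" for S using that unfolding s by auto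
  have main: "approx B" if "B \<in> sigma_sets UNIV (Collect open)" for B
    using that
  proof (induction rule: sigma_sets.induct)
    case (Basic U)
    hence U: "open U" by simp
    obtain k :: "nat \<Rightarrow> 'x \<Rightarrow> real" where k: "increases_to_indicator k U"
    by (rule continuous_increasing_to_indicator_open[OF cpt U])
    define C where "C n = {x. 1 \<le> k n x}" for n
    have closedC: "closed (C n)" for n
      unfolding C_def using increases_to_indicatorD(1)[OF k] by (intro closed_Collect_le) auto
    have "x \<in> (\<Union>n. C n) \<longleftrightarrow> x \<in> U" for x
    proof (cases "x \<in> U")
      case True
      then obtain n where "k n x = 1"
        using increases_to_indicatorD(5)[OF k True] by (auto simp: eventually_sequentially)
      thus ?thesis using True by (auto simp: C_def intro!: exI[of _ n])
    next
      case False
      thus ?thesis using increases_to_indicatorD(4)[OF k False] by (simp add: C_def)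
    qed
    hence CU: "(\<Union>n. C n) = U" by blast
    have inc: "incseq C" using increases_to_indicatorD(6)[OF k] by (intro incseq_SucI) (auto simp: C_def intro: order_trans)
    have "(\<lambda>n. measure M (C n)) \<longlonglongrightarrow> measure M (\<Union>n. C n)"
      using meas closedC inc by (intro finite_Lim_measure_incseq) auto
    hence lim: "(\<lambda>n. measure M (C n)) \<longlonglongrightarrow> measure M U" by (simp add: CU)
    show ?case unfolding approx_def
    proof (intro allI impI)
      fix e :: real assume "e > 0"
      then obtain n where n: "\<bar>measure M (C n) - measure M U\<bar> < e"
        using LIMSEQ_D[OF lim] by (metis le_refl real_norm_def)
      have "measure M (U - C n) = measure M U - measure M (C n)"
        using CU U closedC meas by (intro finite_measure_Diff) auto
      hence "measure M (U - C n) < e" using n by linarith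
      thus "\<exists>K V. closed K \<and> open V \<and> K \<subseteq> U \<and> U \<subseteq> V \<and> measure M (V - K) < e"
        using U closedC CU by blast
    qed
  next
    case Empty
    show ?case unfolding approx_def by (intro allI impI exI[of _ "{}"]) auto
  next
    case (Compl B)
    show ?case unfolding approx_def
    proof (intro allI impI)
      fix e :: real assume "e > 0"
      then obtain K U where "closed K" "open U" "K \<subseteq> B" "B \<subseteq> U" "measure M (U - K) < e"
        using approxD[OF Compl.IH] by metis
      moreover have "- K - - U = U - K" by blast
      ultimately have "closed (- U) \<and> open (- K) \<and> - U \<subseteq> UNIV - B \<and> UNIV - B \<subseteq> - K \<and>
          measure M (- K - - U) < e"
        by auto
      thus "\<exists>K U. closed K \<and> open U \<and> K \<subseteq> UNIV - B \<and> UNIV - B \<subseteq> U \<and> measure M (U - K) < e"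
        by blast
    qed
  next
    case (Union B)
    show ?case unfolding approx_def
    proof (intro allI impI)
      fix e :: real assume e: "e > 0"
      \<comment> \<open>The gaps sum to e/2. The other half of e pays for replacing the union of all
        inner closed sets, which need not be closed, by a finite subunion.\<close>
      have "\<exists>KU. closed (fst KU) \<and> open (snd KU) \<and> fst KU \<subseteq> B i \<and> B i \<subseteq> snd KU \<and>
          measure M (snd KU - fst KU) < e / 2 * (1/2)^Suc i" for i
      proof -
        have "e / 2 * (1/2)^Suc i > 0" using e by simp
        from approxD[OF Union.IH[of i] this] show ?thesis by simp
      qed
      then obtain KU where KU': "\<And>i. closed (fst (KU i)) \<and> open (snd (KU i)) \<and> fst (KU i) \<subseteq> B i \<and>
          B i \<subseteq> snd (KU i) \<and> measure M (snd (KU i) - fst (KU i)) < e / 2 * (1/2)^Suc i"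
        by metis
      define K U where "K i = fst (KU i)" and "U i = snd (KU i)" for i
      have KU: "closed (K i)" "open (U i)" "K i \<subseteq> B i" "B i \<subseteq> U i"
          "measure M (U i - K i) < e / 2 * (1/2)^Suc i" for i
        using KU'[of i] by (simp_all add: K_def U_def)
      have mK: "K i \<in> sets M" and mU: "U i \<in> sets M" for i by (auto intro: meas KU(1,2))
      have "(\<lambda>n. measure M (\<Union>i<n. K i)) \<longlonglongrightarrow> measure M (\<Union>n. \<Union>i<n. K i)"
        using mK by (intro finite_Lim_measure_incseq incseq_SucI UN_mono) auto
      moreover have "(\<Union>n. \<Union>i<n. K i) = (\<Union>i. K i)" by auto
      ultimately have "(\<lambda>n. measure M (\<Union>i<n. K i)) \<longlonglongrightarrow> measure M (\<Union>i. K i)" by simp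
      from LIMSEQ_D[OF this, of "e / 2"] e obtain n where
        n: "\<bar>measure M (\<Union>i<n. K i) - measure M (\<Union>i. K i)\<bar> < e / 2"
        by (metis half_gt_zero le_refl real_norm_def)
      let ?K = "\<Union>i<n. K i" and ?U = "\<Union>i. U i"
      have sums: "(\<lambda>i. e / 2 * (1/2)^Suc i) sums (e / 2)"
        using sums_mult[OF power_half_series, of "e / 2"] by simp
      have "measure M (?U - (\<Union>i. K i)) \<le> measure M (\<Union>i. U i - K i)"
        using mU mK by (intro finite_measure_mono) auto
      also have "\<dots> \<le> (\<Sum>i. measure M (U i - K i))"
      proof (rule finite_measure_subadditive_countably)
        show "summable (\<lambda>i. measure M (U i - K i))"
          by (rule summable_comparison_test'[OF sums_summable[OF sums], of 0]) (use KU(5) less_imp_le in auto)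
      qed (use mU mK in auto)
      also have "\<dots> \<le> (\<Sum>i. e / 2 * (1/2)^Suc i)"
      proof (rule suminf_le)
        show "summable (\<lambda>i. measure M (U i - K i))"
          by (rule summable_comparison_test'[OF sums_summable[OF sums], of 0]) (use KU(5) less_imp_le in auto)
      qed (use KU(5) less_imp_le sums_summable[OF sums] in auto)
      also have "\<dots> = e / 2" using sums by (simp add: sums_iff)
      finally have 1: "measure M (?U - (\<Union>i. K i)) \<le> e / 2" .
      have 2: "measure M ((\<Union>i. K i) - ?K) < e / 2"
      proof -
        have "measure M ((\<Union>i. K i) - ?K) = measure M (\<Union>i. K i) - measure M ?K"
          using mK by (intro finite_measure_Diff) auto
        thus ?thesis using n by linarith
      qed
      have "?U - ?K \<subseteq> (?U - (\<Union>i. K i)) \<union> ((\<Union>i. K i) - ?K)" by auto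
      hence "measure M (?U - ?K) \<le> measure M ((?U - (\<Union>i. K i)) \<union> ((\<Union>i. K i) - ?K))"
        using mU mK by (intro finite_measure_mono) auto
      also have "\<dots> \<le> measure M (?U - (\<Union>i. K i)) + measure M ((\<Union>i. K i) - ?K)"
        using mU mK by (intro measure_Un_le) auto
      finally have "measure M (?U - ?K) < e" using 1 2 by linarith
      moreover have "closed ?K" "open ?U" "?K \<subseteq> (\<Union>i. B i)" "(\<Union>i. B i) \<subseteq> ?U"
        using KU by (auto intro!: closed_UN) blast+
      ultimately show "\<exists>K U. closed K \<and> open U \<and> K \<subseteq> (\<Union>i. B i) \<and> (\<Union>i. B i) \<subseteq> U \<and> measure M (U - K) < e"
        by blast
    qed
  qed
  have approx: "\<exists>K U. closed K \<and> open U \<and> K \<subseteq> B \<and> B \<subseteq> U \<and>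
      measure M U \<le> measure M B + e \<and> measure M B \<le> measure M K + e"
    if B: "B \<in> sets borel" and e: "e > 0" for B e
  proof -
    have "approx B" using B main by (simp add: borel_def)
    then obtain K U where KU: "closed K" "open U" "K \<subseteq> B" "B \<subseteq> U" "measure M (U - K) < e"
      using approxD[OF _ e] by metis
    have m: "B \<in> sets M" "K \<in> sets M" "U \<in> sets M" using KU B meas unfolding s by auto
    have "measure M (U - B) \<le> measure M (U - K)" "measure M (B - K) \<le> measure M (U - K)"
      using KU m by (auto intro!: finite_measure_mono)
    moreover have "measure M (U - B) = measure M U - measure M B" "measure M (B - K) = measure M B - measure M K"
      using KU m by (auto intro!: finite_measure_Diff)
    ultimately show ?thesis using KU by (intro exI[of _ K] exI[of _ U]) auto
  qed
  show ?thesis unfolding regular_borel_def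
  proof (intro conjI ballI s)
    fix B :: "'x set" assume B: "B \<in> sets borel"
    have mB: "B \<in> sets M" using B s by simp
    show "emeasure M B = (INF U\<in>{U. open U \<and> B \<subseteq> U}. emeasure M U)"
    proof (rule antisym)
      show "emeasure M B \<le> (INF U\<in>{U. open U \<and> B \<subseteq> U}. emeasure M U)"
        using meas by (intro INF_greatest emeasure_mono) auto
      show "(INF U\<in>{U. open U \<and> B \<subseteq> U}. emeasure M U) \<le> emeasure M B"
      proof (rule ennreal_le_epsilon)
        fix e :: real assume e: "0 < e"
        obtain U where U: "open U" "B \<subseteq> U" "measure M U \<le> measure M B + e"
          using approx[OF B e] by blast
        have "(INF U\<in>{U. open U \<and> B \<subseteq> U}. emeasure M U) \<le> emeasure M U"
          using U by (intro INF_lower) auto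
        also have "\<dots> \<le> emeasure M B + ennreal e"
          using U e by (simp add: emeasure_eq_measure flip: ennreal_plus)
        finally show "(INF U\<in>{U. open U \<and> B \<subseteq> U}. emeasure M U) \<le> emeasure M B + ennreal e" .
      qed
    qed
    show "emeasure M B = (SUP K\<in>{K. compact K \<and> K \<subseteq> B}. emeasure M K)"
    proof (rule antisym)
      show "(SUP K\<in>{K. compact K \<and> K \<subseteq> B}. emeasure M K) \<le> emeasure M B"
        using mB by (intro SUP_least emeasure_mono) auto
      show "emeasure M B \<le> (SUP K\<in>{K. compact K \<and> K \<subseteq> B}. emeasure M K)"
      proof (rule ennreal_le_epsilon)
        fix e :: real assume e: "0 < e"
        obtain K where K: "closed K" "K \<subseteq> B" "measure M B \<le> measure M K + e"
          using approx[OF B e] by blast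
        have "compact K" using compact_Int_closed[OF cpt K(1)] by simp
        have "emeasure M B \<le> emeasure M K + ennreal e"
          using K e by (simp add: emeasure_eq_measure flip: ennreal_plus)
        also have "\<dots> \<le> (SUP K\<in>{K. compact K \<and> K \<subseteq> B}. emeasure M K) + ennreal e"
          using K \<open>compact K\<close> by (intro add_right_mono SUP_upper) auto
        finally show "emeasure M B \<le> (SUP K\<in>{K. compact K \<and> K \<subseteq> B}. emeasure M K) + ennreal e" .
      qed
    qed
  qed
qed

section \<open>The Riesz representation theorem\<close>

text \<open>The outer measure is \<open>\<mu>(A) = inf (\<Sum>n. \<Lambda> f\<^sub>n)\<close> over the countable families of nonnegative
  continuous \<open>f\<^sub>n\<close> whose sum is at least 1 on \<open>A\<close>. An open set \<open>U\<close> with \<open>g\<^sub>j\<close> increasing to its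
  indicator splits such a family into the \<open>f\<^sub>n (g\<^sub>j\<^sub>+\<^sub>1 - g\<^sub>j)\<close>, covering \<open>A \<inter> U\<close>, and, for each \<open>j\<close>,
  the \<open>f\<^sub>n (1 - g\<^sub>j)\<close>, covering \<open>A - U\<close>; this is why open sets are Caratheodory measurable.\<close>

locale positive_mean =
  fixes \<Lambda> :: "('x::{t2_space, second_countable_topology} \<Rightarrow> real) \<Rightarrow> real"
  assumes compact_space: "compact (UNIV :: 'x set)"
    and mean_add: "continuous_on UNIV f \<Longrightarrow> continuous_on UNIV g \<Longrightarrow> \<Lambda> (\<lambda>x. f x + g x) = \<Lambda> f + \<Lambda> g"
    and mean_scale: "continuous_on UNIV f \<Longrightarrow> \<Lambda> (\<lambda>x. c * f x) = c * \<Lambda> f"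
    and mean_nonneg: "continuous_on UNIV f \<Longrightarrow> (\<And>x. 0 \<le> f x) \<Longrightarrow> 0 \<le> \<Lambda> f"
    and mean_one: "\<Lambda> (\<lambda>x. 1) = 1"
begin

lemma mean_zero: "\<Lambda> (\<lambda>x. 0) = 0"
  using mean_scale[of "\<lambda>x. 0" 0] by simp

lemma mean_const: "\<Lambda> (\<lambda>x. c) = c"
  using mean_scale[of "\<lambda>x. 1" c] by (simp add: mean_one)

lemma mean_diff:
  assumes "continuous_on UNIV f" "continuous_on UNIV g"
  shows "\<Lambda> (\<lambda>x. f x - g x) = \<Lambda> f - \<Lambda> g"
proof -
  have "\<Lambda> (\<lambda>x. f x + (-1) * g x) = \<Lambda> f + \<Lambda> (\<lambda>x. (-1) * g x)"
    using assms by (intro mean_add continuous_intros)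
  thus ?thesis using mean_scale[OF assms(2), of "-1"] by simp
qed

lemma mean_mono:
  assumes "continuous_on UNIV f" "continuous_on UNIV g" "\<And>x. f x \<le> g x"
  shows "\<Lambda> f \<le> \<Lambda> g"
  using mean_diff[OF assms(2,1)] mean_nonneg[OF continuous_on_diff[OF assms(2,1)]] assms(3) by simp

lemma mean_sum:
  assumes "\<And>i. i \<in> I \<Longrightarrow> continuous_on UNIV (f i)"
  shows "\<Lambda> (\<lambda>x. \<Sum>i\<in>I. f i x) = (\<Sum>i\<in>I. \<Lambda> (f i))"
proof (cases "finite I")
  case True
  thus ?thesis using assms
    by (induction I rule: finite_induct) (simp_all add: mean_zero mean_add continuous_on_sum)
qed (simp add: mean_zero)

section \<open>The outer measure of a positive mean\<close>

definition nonneg_continuous :: "('x \<Rightarrow> real) \<Rightarrow> bool" where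
  "nonneg_continuous f \<longleftrightarrow> continuous_on UNIV f \<and> (\<forall>x. 0 \<le> f x)"

definition covers :: "(nat \<Rightarrow> 'x \<Rightarrow> real) \<Rightarrow> 'x set \<Rightarrow> bool" where
  "covers f A \<longleftrightarrow> (\<forall>n. nonneg_continuous (f n)) \<and> (\<forall>x\<in>A. 1 \<le> (\<Sum>n. ennreal (f n x)))"

definition outer :: "'x set \<Rightarrow> ennreal" where
  "outer A = (INF f\<in>{f. covers f A}. \<Sum>n. ennreal (\<Lambda> (f n)))"

lemma outer_le: "covers f A \<Longrightarrow> outer A \<le> (\<Sum>n. ennreal (\<Lambda> (f n)))"
  unfolding outer_def by (rule INF_lower) simp

lemma suminf_ennreal_single: "(\<Sum>n. ennreal (if n = 0 then c else 0)) = ennreal c"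
  by (subst suminf_finite[of "{0}"]) auto

lemma outer_le_mean:
  assumes "nonneg_continuous f" "\<And>x. x \<in> A \<Longrightarrow> 1 \<le> f x"
  shows "outer A \<le> ennreal (\<Lambda> f)"
proof -
  let ?f = "\<lambda>n::nat. if n = 0 then f else (\<lambda>x. 0)"
  have "(\<Sum>n. ennreal (?f n x)) = ennreal (f x)" for x
    using suminf_ennreal_single[of "f x"] by (simp add: if_distrib[of "\<lambda>g. g x"] cong: if_cong)
  hence "covers ?f A" using assms by (auto simp: covers_def nonneg_continuous_def)
  moreover have "(\<Sum>n. ennreal (\<Lambda> (?f n))) = ennreal (\<Lambda> f)"
    using suminf_ennreal_single[of "\<Lambda> f"] by (simp add: if_distrib[of \<Lambda>] mean_zero cong: if_cong)
  ultimately show ?thesis using outer_le[of ?f A] by simp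
qed

lemma outer_le_1: "outer A \<le> 1"
  using outer_le_mean[of "\<lambda>x. 1" A] by (simp add: nonneg_continuous_def mean_one)

text \<open>Pairing of indices turns a double family into a single one. Subadditivity and the
  splitting along open sets both produce double families.\<close>

lemma outer_le_double:
  assumes f: "\<And>m n. nonneg_continuous (f m n)"
    and cov: "\<And>x. x \<in> A \<Longrightarrow> 1 \<le> (\<Sum>m. \<Sum>n. ennreal (f m n x))"
  shows "outer A \<le> (\<Sum>m. \<Sum>n. ennreal (\<Lambda> (f m n)))"
proof -
  define h where "h i = f (fst (prod_decode i)) (snd (prod_decode i))" for i
  have "(\<Sum>i. ennreal (h i x)) = (\<Sum>m. \<Sum>n. ennreal (f m n x))" for x
    unfolding h_def
    using suminf_ennreal_2dimen[of "\<lambda>m. \<Sum>n. ennreal (f m n x)" "\<lambda>p. ennreal (f (fst p) (snd p) x)"] by simp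
  hence "covers h A" using f cov by (simp add: covers_def h_def)
  moreover have "(\<Sum>i. ennreal (\<Lambda> (h i))) = (\<Sum>m. \<Sum>n. ennreal (\<Lambda> (f m n)))"
    unfolding h_def
    using suminf_ennreal_2dimen[of "\<lambda>m. \<Sum>n. ennreal (\<Lambda> (f m n))" "\<lambda>p. ennreal (\<Lambda> (f (fst p) (snd p)))"] by simp
  ultimately show ?thesis using outer_le[of h A] by simp
qed

lemma outer_subadditive: "outer (\<Union>i. A i) \<le> (\<Sum>i. outer (A i))"
proof (rule ennreal_le_epsilon)
  fix e :: real assume e: "e > 0"
  have "\<exists>f. covers f (A i) \<and> (\<Sum>n. ennreal (\<Lambda> (f n))) < outer (A i) + ennreal (e * (1/2)^Suc i)" for i
  proof -
    have "e * (1/2)^Suc i > 0" using e by simp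
    moreover have "outer (A i) \<noteq> \<infinity>" using outer_le_1[of "A i"] by (auto simp: top_unique)
    ultimately show ?thesis
      using INF_approx_ennreal[of "e * (1/2)^Suc i" "outer (A i)" "\<lambda>f. \<Sum>n. ennreal (\<Lambda> (f n))" "{f. covers f (A i)}"]
      unfolding outer_def by auto
  qed
  then obtain f where f: "\<And>i. covers (f i) (A i)"
      "\<And>i. (\<Sum>n. ennreal (\<Lambda> (f i n))) < outer (A i) + ennreal (e * (1/2)^Suc i)" by metis
  have "outer (\<Union>i. A i) \<le> (\<Sum>i. \<Sum>n. ennreal (\<Lambda> (f i n)))"
  proof (rule outer_le_double)
    show "nonneg_continuous (f m n)" for m n using f(1)[of m] by (simp add: covers_def)
    fix x assume "x \<in> (\<Union>i. A i)"
    then obtain i where i: "x \<in> A i" by blast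
    have "1 \<le> (\<Sum>n. ennreal (f i n x))" using f(1)[of i] i by (simp add: covers_def)
    also have "\<dots> = (\<Sum>m\<in>{i}. \<Sum>n. ennreal (f m n x))" by simp
    also have "\<dots> \<le> (\<Sum>m. \<Sum>n. ennreal (f m n x))" by (rule sum_le_suminf) auto
    finally show "1 \<le> (\<Sum>m. \<Sum>n. ennreal (f m n x))" .
  qed
  also have "\<dots> \<le> (\<Sum>i. outer (A i) + ennreal (e * (1/2)^Suc i))"
    using f(2) less_imp_le by (intro suminf_le) auto
  also have "\<dots> = (\<Sum>i. outer (A i)) + (\<Sum>i. ennreal (e * (1/2)^Suc i))"
    by (rule suminf_add[symmetric]) auto
  also have "(\<Sum>i. ennreal (e * (1/2)^Suc i)) = ennreal e"
    using sums_mult[OF power_half_series, of e] e by (intro suminf_ennreal_eq) auto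
  finally show "outer (\<Union>i. A i) \<le> (\<Sum>i. outer (A i)) + ennreal e" .
qed

lemma outer_mono: "A \<subseteq> B \<Longrightarrow> outer A \<le> outer B"
  unfolding outer_def by (rule INF_superset_mono) (auto simp: covers_def)

lemma outer_empty: "outer {} = 0"
  using outer_le_mean[of "\<lambda>x. 0" "{}"] by (simp add: nonneg_continuous_def mean_zero)

lemma outer_measure_space_outer: "outer_measure_space UNIV outer"
  unfolding outer_measure_space_def positive_def increasing_def countably_subadditive_def
  by (auto simp: outer_empty outer_mono outer_subadditive)

lemma outer_split_open:
  assumes U: "open U"
  shows "outer (A \<inter> U) + outer (A - U) \<le> outer A"
proof -
  obtain g :: "nat \<Rightarrow> 'x \<Rightarrow> real" where g: "increases_to_indicator g U"
    by (rule continuous_increasing_to_indicator_open[OF compact_space U])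
  note g = increases_to_indicatorD[OF g] increases_to_indicator_tendsto[OF g]
  have "outer (A \<inter> U) + outer (A - U) \<le> (\<Sum>n. ennreal (\<Lambda> (f n)))" if cov: "covers f A" for f
  proof -
    have cf: "continuous_on UNIV (f n)" and f0: "0 \<le> f n x" for n x
      using cov by (auto simp: covers_def nonneg_continuous_def)
    have sumA: "1 \<le> (\<Sum>n. ennreal (f n x))" if "x \<in> A" for x using cov that by (auto simp: covers_def)
    define d where "d n j x = f n x * (g (Suc j) x - g j x)" for n j x
    have d: "nonneg_continuous (d n j)" for n j
      unfolding nonneg_continuous_def d_def using cf f0 g(1,6)
      by (auto intro!: continuous_intros mult_nonneg_nonneg)
    have fg: "nonneg_continuous (\<lambda>x. f n x * g j x)" "nonneg_continuous (\<lambda>x. f n x * (1 - g j x))" for n j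
      unfolding nonneg_continuous_def using cf f0 g(1,2,3)
      by (auto intro!: continuous_intros mult_nonneg_nonneg)
    have d_sum: "(\<Sum>j<J. \<Lambda> (d n j)) = \<Lambda> (\<lambda>x. f n x * g J x)" for n J
    proof -
      have "(\<Sum>j<J. \<Lambda> (d n j)) = \<Lambda> (\<lambda>x. \<Sum>j<J. d n j x)"
        using d by (intro mean_sum[symmetric]) (simp add: nonneg_continuous_def)
      also have "(\<lambda>x. \<Sum>j<J. d n j x) = (\<lambda>x. f n x * g J x)"
        using sum_lessThan_telescope[of "\<lambda>j. g j _" J] by (simp add: d_def g(7) flip: sum_distrib_left)
      finally show ?thesis .
    qed
    have "outer (A \<inter> U) \<le> (\<Sum>n. \<Sum>j. ennreal (\<Lambda> (d n j)))"
    proof (rule outer_le_double[OF d])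
      fix x assume x: "x \<in> A \<inter> U"
      have "(\<Sum>j. ennreal (d n j x)) = ennreal (f n x)" for n
      proof (rule suminf_ennreal_eq)
        show "0 \<le> d n j x" for j using d by (simp add: nonneg_continuous_def)
        have "(\<lambda>j. g (Suc j) x - g j x) sums (1 - g 0 x)"
          using g(8)[of x] x by (intro telescope_sums) simp
        from sums_mult[OF this, of "f n x"] show "(\<lambda>j. d n j x) sums f n x"
          by (simp add: d_def g(7))
      qed
      thus "1 \<le> (\<Sum>n. \<Sum>j. ennreal (d n j x))" using sumA x by simp
    qed
    also have "(\<Sum>n. \<Sum>j. ennreal (\<Lambda> (d n j))) = (\<Sum>n. SUP J. ennreal (\<Lambda> (\<lambda>x. f n x * g J x)))"
    proof (rule suminf_cong)
      fix n
      have "(\<Sum>j. ennreal (\<Lambda> (d n j))) = (SUP J. \<Sum>j<J. ennreal (\<Lambda> (d n j)))" by (rule suminf_eq_SUP)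
      also have "\<dots> = (SUP J. ennreal (\<Lambda> (\<lambda>x. f n x * g J x)))"
        using d mean_nonneg by (intro SUP_cong) (auto simp: nonneg_continuous_def sum_ennreal d_sum)
      finally show "(\<Sum>j. ennreal (\<Lambda> (d n j))) = (SUP J. ennreal (\<Lambda> (\<lambda>x. f n x * g J x)))" .
    qed
    \<comment> \<open>The supremum is moved out of the sum over n by monotone convergence, so that
      one J serves all n. Then f_n g_J and f_n (1 - g_J) add up to f_n, and the two covers together
      cost no more than f.\<close>
    also have "\<dots> = (SUP J. \<Sum>n. ennreal (\<Lambda> (\<lambda>x. f n x * g J x)))"
      using fg g(6) f0 by (intro ennreal_suminf_SUP_eq incseq_SucI ennreal_leI mean_mono)
        (auto simp: nonneg_continuous_def intro: mult_left_mono)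
    finally have "outer (A \<inter> U) + outer (A - U) \<le>
        (SUP J. \<Sum>n. ennreal (\<Lambda> (\<lambda>x. f n x * g J x))) + outer (A - U)"
      by (rule add_right_mono)
    also have "\<dots> = (SUP J. (\<Sum>n. ennreal (\<Lambda> (\<lambda>x. f n x * g J x))) + outer (A - U))"
      by (rule ennreal_SUP_add_left[symmetric]) simp
    also have "\<dots> \<le> (\<Sum>n. ennreal (\<Lambda> (f n)))"
    proof (rule SUP_least)
      fix J
      have "outer (A - U) \<le> (\<Sum>n. ennreal (\<Lambda> (\<lambda>x. f n x * (1 - g J x))))"
      proof (rule outer_le)
        show "covers (\<lambda>n x. f n x * (1 - g J x)) (A - U)"
          using fg(2) sumA g(4) by (auto simp: covers_def)
      qed
      hence "(\<Sum>n. ennreal (\<Lambda> (\<lambda>x. f n x * g J x))) + outer (A - U) \<le>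
          (\<Sum>n. ennreal (\<Lambda> (\<lambda>x. f n x * g J x))) + (\<Sum>n. ennreal (\<Lambda> (\<lambda>x. f n x * (1 - g J x))))"
        by (rule add_left_mono)
      also have "\<dots> = (\<Sum>n. ennreal (\<Lambda> (\<lambda>x. f n x * g J x)) + ennreal (\<Lambda> (\<lambda>x. f n x * (1 - g J x))))"
        by (rule suminf_add) auto
      also have "\<dots> = (\<Sum>n. ennreal (\<Lambda> (f n)))"
      proof (rule suminf_cong)
        fix n
        have "\<Lambda> (\<lambda>x. f n x * g J x) + \<Lambda> (\<lambda>x. f n x * (1 - g J x)) = \<Lambda> (f n)"
          using mean_add[of "\<lambda>x. f n x * g J x" "\<lambda>x. f n x * (1 - g J x)"] fg
          by (simp add: nonneg_continuous_def flip: distrib_left)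
        moreover have "0 \<le> \<Lambda> (\<lambda>x. f n x * g J x)" "0 \<le> \<Lambda> (\<lambda>x. f n x * (1 - g J x))"
          using fg by (auto simp: nonneg_continuous_def intro!: mean_nonneg)
        ultimately show "ennreal (\<Lambda> (\<lambda>x. f n x * g J x)) + ennreal (\<Lambda> (\<lambda>x. f n x * (1 - g J x))) = ennreal (\<Lambda> (f n))"
          by (simp flip: ennreal_plus)
      qed
      finally show "(\<Sum>n. ennreal (\<Lambda> (\<lambda>x. f n x * g J x))) + outer (A - U) \<le> (\<Sum>n. ennreal (\<Lambda> (f n)))" .
    qed
    finally show ?thesis .
  qed
  thus ?thesis unfolding outer_def[of A] by (intro INF_greatest) simp
qed

section \<open>The representing measure and its integrals\<close>

definition representing_measure :: "'x measure" where
  "representing_measure = measure_of UNIV (sets borel) outer"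

lemma sets_representing_measure [simp]: "sets representing_measure = sets borel"
  unfolding representing_measure_def using sets.sigma_sets_eq[of "borel :: 'x measure"] by simp

text \<open>Caratheodory: the sets along which \<open>outer\<close> splits additively form a
  sigma-algebra on which it is a measure, and this sigma-algebra contains the open sets by
  \<open>outer_split_open\<close>.\<close>

lemma emeasure_representing_measure:
  assumes "A \<in> sets borel" shows "emeasure representing_measure A = outer A"
proof -
  interpret P: sigma_algebra "UNIV :: 'x set" UNIV
    using sigma_algebra_Pow[of "UNIV :: 'x set"] by simp
  let ?L = "lambda_system UNIV UNIV outer"
  have L: "measure_space UNIV ?L outer" by (rule P.caratheodory_lemma[OF outer_measure_space_outer])
  then interpret L: sigma_algebra UNIV ?L by (simp add: measure_space_def)
  have "U \<in> ?L" if "open U" for U :: "'x set"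
  proof -
    have "outer A \<le> outer (A \<inter> U) + outer (A - U)" for A
    proof -
      have "subadditive UNIV outer"
        using outer_measure_space_outer P.countably_subadditive_subadditive
        by (auto simp: outer_measure_space_def)
      from subadditiveD[OF this, of "A \<inter> U" "A - U"] have
        "outer ((A \<inter> U) \<union> (A - U)) \<le> outer (A \<inter> U) + outer (A - U)" by auto
      thus ?thesis by (simp add: Int_Diff_Un)
    qed
    thus ?thesis using outer_split_open[OF that] by (auto simp: P.lambda_system_eq intro: antisym)
  qed
  hence "sigma_sets UNIV (Collect open) \<subseteq> ?L" by (intro L.sigma_sets_subset) auto
  hence sub: "sets (borel :: 'x measure) \<subseteq> ?L" by (simp add: borel_def)
  have "positive (sets borel) outer" by (simp add: positive_def outer_empty)
  moreover have "countably_additive (sets borel) outer"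
    using L sub unfolding measure_space_def countably_additive_def by blast
  ultimately show ?thesis
    unfolding representing_measure_def
    using assms sets.sigma_algebra_axioms[of "borel :: 'x measure"]
    by (intro emeasure_measure_of_sigma) auto
qed

text \<open>A Dini argument. The partial sums of a cover exceed 1 - e on open sets that exhaust the
  space; by compactness a single partial sum does so everywhere, and its mean is then at least 1 -
  e.\<close>

lemma outer_UNIV: "outer UNIV = 1"
proof (rule antisym[OF outer_le_1])
  show "1 \<le> outer UNIV" unfolding outer_def
  proof (rule INF_greatest)
    fix f assume "f \<in> {f. covers f UNIV}"
    hence cf: "\<And>n. continuous_on UNIV (f n)" and f0: "\<And>n x. 0 \<le> f n x"
      and cov: "\<And>x. 1 \<le> (\<Sum>n. ennreal (f n x))"
      by (auto simp: covers_def nonneg_continuous_def)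
    show "1 \<le> (\<Sum>n. ennreal (\<Lambda> (f n)))"
    proof (rule ennreal_le_epsilon)
      fix e :: real assume e: "e > 0"
      define V where "V N = {x. 1 - e < (\<Sum>n<N. f n x)}" for N
      have oV: "open (V N)" for N
        unfolding V_def using cf by (intro open_Collect_less continuous_intros) auto
      have "x \<in> (\<Union>N. V N)" for x
      proof -
        have "ennreal (1 - e) < 1" using e by (simp add: ennreal_less_one_iff)
        also have "1 \<le> (SUP N. \<Sum>n<N. ennreal (f n x))" using cov[of x] by (simp add: suminf_eq_SUP)
        finally obtain N where "ennreal (1 - e) < (\<Sum>n<N. ennreal (f n x))" by (auto simp: less_SUP_iff)
        hence "1 - e < (\<Sum>n<N. f n x)" using f0 by (simp add: sum_ennreal ennreal_less_iff sum_nonneg ennreal_lessI)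
          (meson ennreal_leI leD leI)
        thus ?thesis by (auto simp: V_def)
      qed
      hence "UNIV \<subseteq> (\<Union>N\<in>UNIV. V N)" by blast
      then obtain F where F: "finite F" "UNIV \<subseteq> (\<Union>N\<in>F. V N)"
        using compactE_image[OF compact_space, of UNIV V] oV by metis
      define N where "N = Max (insert 0 F)"
      have big: "1 - e \<le> (\<Sum>n<N. f n x)" for x
      proof -
        obtain M where M: "M \<in> F" "x \<in> V M" using F by blast
        have "(\<Sum>n<M. f n x) \<le> (\<Sum>n<N. f n x)"
          using M F f0 by (intro sum_mono2) (auto simp: N_def)
        thus ?thesis using M by (simp add: V_def)
      qed
      have "1 - e \<le> \<Lambda> (\<lambda>x. \<Sum>n<N. f n x)"
        using mean_mono[of "\<lambda>x. 1 - e" "\<lambda>x. \<Sum>n<N. f n x"] big cf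
        by (simp add: mean_const continuous_on_sum)
      also have "\<dots> = (\<Sum>n<N. \<Lambda> (f n))" using cf by (intro mean_sum) auto
      finally have "1 \<le> ennreal ((\<Sum>n<N. \<Lambda> (f n)) + e)" by simp
      also have "\<dots> = (\<Sum>n<N. ennreal (\<Lambda> (f n))) + ennreal e"
        using cf f0 e by (simp add: sum_ennreal mean_nonneg sum_nonneg)
      also have "\<dots> \<le> (\<Sum>n. ennreal (\<Lambda> (f n))) + ennreal e"
        by (intro add_right_mono sum_le_suminf) auto
      finally show "1 \<le> (\<Sum>n. ennreal (\<Lambda> (f n))) + ennreal e" .
    qed
  qed
qed

lemma prob_space_representing_measure: "prob_space representing_measure"
proof
  have "space representing_measure = UNIV" by (simp add: sets_eq_imp_space_eq[OF sets_representing_measure])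
  thus "emeasure representing_measure (space representing_measure) = 1"
    by (simp add: emeasure_representing_measure outer_UNIV)
qed

text \<open>The graph of f is cut into layers h_i of height e. The set S where f \<ge> (i+1) e
  carries h_(i+1), while h_i / e is at least 1 on S; hence the integral of h_(i+1) is at most e
  \<mu>(S), and this is at most \<Lambda>(h_i). The shift by one layer leaves only h_0 over, with
  integral at most e.\<close>

lemma integral_le_mean:
  assumes cf: "continuous_on UNIV f" and f0: "\<And>x. 0 \<le> f x"
  shows "(\<integral>x. f x \<partial>representing_measure) \<le> \<Lambda> f"
proof (rule field_le_epsilon)
  interpret prob_space representing_measure by (rule prob_space_representing_measure)
  note int = integrable_continuous_compact_UNIV[OF finite_measure_axioms sets_representing_measure compact_space]
  fix e :: real assume e: "e > 0"
  obtain K where K: "\<And>x. norm (f x) \<le> K" using bounded_continuous_compact_UNIV[OF compact_space cf] by blast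
  obtain m :: nat where m: "K < of_nat m * e" using e reals_Archimedean3 by blast
  define h where "h i x = min (max (f x - of_nat i * e) 0) e" for i x
  have ch: "continuous_on UNIV (h i)" for i unfolding h_def using cf by (intro continuous_intros)
  have h: "0 \<le> h i x" "h i x \<le> e" for i x using e by (auto simp: h_def)
  have layers: "(\<Sum>i<n. h i x) = min (f x) (of_nat n * e)" for n x
  proof (induction n)
    case 0
    show ?case using f0 by simp
  next
    case (Suc n)
    show ?case
      unfolding sum.lessThan_Suc Suc.IH unfolding h_def
      using e f0[of x] by (simp add: min_def max_def algebra_simps)
  qed
  have sum_h: "(\<Sum>i<n. h i x) = f x" if "n \<ge> m" for n x
  proof -
    have "of_nat m * e \<le> of_nat n * e" using that e by simp
    hence "f x \<le> of_nat n * e" using K[of x] m by simp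
    moreover have "(\<Sum>i<n. h i x) = min (f x) (of_nat n * e)" by (rule layers)
    ultimately show ?thesis by simp
  qed
  have step: "(\<integral>x. h (Suc i) x \<partial>representing_measure) \<le> \<Lambda> (h i)" for i
  proof -
    let ?S = "{x. of_nat (Suc i) * e \<le> f x}"
    have "closed ?S" using cf by (intro closed_Collect_le continuous_intros)
    hence S: "?S \<in> sets representing_measure" by simp
    have "outer ?S \<le> ennreal (\<Lambda> (\<lambda>x. (1 / e) * h i x))"
    proof (rule outer_le_mean)
      show "nonneg_continuous (\<lambda>x. 1 / e * h i x)"
        using ch h e by (auto simp: nonneg_continuous_def intro!: continuous_intros)
      show "1 \<le> 1 / e * h i x" if "x \<in> ?S" for x using that e by (simp add: h_def field_simps)
    qed
    hence "ennreal (measure representing_measure ?S) \<le> ennreal (\<Lambda> (\<lambda>x. (1 / e) * h i x))"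
      using S by (simp add: emeasure_representing_measure[symmetric] emeasure_eq_measure)
    moreover have "0 \<le> \<Lambda> (\<lambda>x. (1 / e) * h i x)"
      using ch h e by (intro mean_nonneg continuous_intros) auto
    ultimately have "measure representing_measure ?S \<le> \<Lambda> (\<lambda>x. (1 / e) * h i x)"
      by (simp only: ennreal_le_iff)
    from mult_left_mono[OF this, of e]
    have meas: "e * measure representing_measure ?S \<le> \<Lambda> (h i)"
      unfolding mean_scale[OF ch] using e by simp
    have "(\<integral>x. h (Suc i) x \<partial>representing_measure) \<le> (\<integral>x. e * indicator ?S x \<partial>representing_measure)"
    proof (rule integral_mono)
      show "h (Suc i) x \<le> e * indicator ?S x" for x
        using e by (auto simp: h_def indicator_def min_def max_def)
      have "integrable representing_measure (indicator ?S :: 'x \<Rightarrow> real)"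
        using S by (intro integrable_real_indicator) (auto simp: less_top[symmetric])
      thus "integrable representing_measure (\<lambda>x. e * indicator ?S x)" by simp
    qed (rule int[OF ch])
    also have "\<dots> = e * measure representing_measure ?S" using S by simp
    finally show ?thesis using meas by linarith
  qed
  have "(\<integral>x. f x \<partial>representing_measure) = (\<integral>x. (\<Sum>i<Suc m. h i x) \<partial>representing_measure)"
    using sum_h[of "Suc m"] by simp
  also have "\<dots> = (\<Sum>i<Suc m. \<integral>x. h i x \<partial>representing_measure)"
    by (rule Bochner_Integration.integral_sum) (rule int[OF ch])
  also have "\<dots> = (\<integral>x. h 0 x \<partial>representing_measure) + (\<Sum>i<m. \<integral>x. h (Suc i) x \<partial>representing_measure)"
    by (rule sum.lessThan_Suc_shift)
  also have "\<dots> \<le> e + (\<Sum>i<m. \<Lambda> (h i))"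
  proof (intro add_mono sum_mono step)
    have "(\<integral>x. h 0 x \<partial>representing_measure) \<le> (\<integral>x. e \<partial>representing_measure)"
      using h by (intro integral_mono int[OF ch]) auto
    thus "(\<integral>x. h 0 x \<partial>representing_measure) \<le> e" by (simp add: prob_space)
  qed
  also have "(\<Sum>i<m. \<Lambda> (h i)) = \<Lambda> f"
    using mean_sum[of "{..<m}" h] ch sum_h[of m] by simp
  finally show "(\<integral>x. f x \<partial>representing_measure) \<le> \<Lambda> f + e" by simp
qed

lemma integral_representing_measure:
  assumes cf: "continuous_on UNIV f"
  shows "(\<integral>x. f x \<partial>representing_measure) = \<Lambda> f"
proof -
  interpret prob_space representing_measure by (rule prob_space_representing_measure)
  have int: "integrable representing_measure f"
    using cf by (rule integrable_continuous_compact_UNIV[OF finite_measure_axioms sets_representing_measure compact_space])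
  obtain K where K: "\<And>x. norm (f x) \<le> K" using bounded_continuous_compact_UNIV[OF compact_space cf] by blast
  \<comment> \<open>The one-sided bound is applied to the nonnegative functions f + K and K - f,
    which yields both inequalities for f.\<close>
  have K': "0 \<le> f x + K" "0 \<le> K - f x" for x using K[of x] by (auto simp: abs_le_iff)
  have "(\<integral>x. f x + K \<partial>representing_measure) \<le> \<Lambda> (\<lambda>x. f x + K)"
    using K' cf by (intro integral_le_mean continuous_intros) auto
  moreover have "(\<integral>x. K - f x \<partial>representing_measure) \<le> \<Lambda> (\<lambda>x. K - f x)"
    using K' cf by (intro integral_le_mean continuous_intros) auto
  ultimately show ?thesis
    using int cf by (simp add: mean_add mean_diff mean_const prob_space)
qed

end

lemma Riesz_representation:
  fixes \<Lambda> :: "('x::{t2_space, second_countable_topology} \<Rightarrow> real) \<Rightarrow> real"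
  assumes "positive_mean \<Lambda>"
  obtains M where "prob_space M" "sets M = sets borel"
    "\<And>f. continuous_on UNIV f \<Longrightarrow> (\<integral>x. f x \<partial>M) = \<Lambda> f"
  using positive_mean.prob_space_representing_measure[OF assms]
    positive_mean.sets_representing_measure[OF assms]
    positive_mean.integral_representing_measure[OF assms] by (rule that)

text \<open>Extreme points of the invariant measures are defined by convex combinations of values on
  sets, whereas traces see only integrals of continuous functions. This lemma translates between the
  two. In each direction a mixed measure is produced and identified with R on open sets.\<close>

lemma measure_mixture_iff_integral:
  fixes M N R :: "'x::{t2_space, second_countable_topology} measure"
  assumes cpt: "compact (UNIV :: 'x set)"
    and M: "prob_space M" "sets M = sets borel" and N: "prob_space N" "sets N = sets borel"
    and R: "prob_space R" "sets R = sets borel" and t: "0 \<le> t" "t \<le> 1"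
  shows "(\<forall>S. measure R S = (1 - t) * measure M S + t * measure N S) \<longleftrightarrow>
    (\<forall>f :: 'x \<Rightarrow> real. continuous_on UNIV f \<longrightarrow>
       (\<integral>x. f x \<partial>R) = (1 - t) * (\<integral>x. f x \<partial>M) + t * (\<integral>x. f x \<partial>N))"
    (is "?meas \<longleftrightarrow> ?int")
proof
  interpret M: prob_space M by fact
  interpret N: prob_space N by fact
  interpret R: prob_space R by fact
  note int = integrable_continuous_compact_UNIV[OF M.finite_measure_axioms M(2) cpt]
    integrable_continuous_compact_UNIV[OF N.finite_measure_axioms N(2) cpt]
  {
    assume ?meas
    \<comment> \<open>The mixed integrals form a positive mean, so the Riesz theorem supplies a
      measure having them as its integrals; it agrees with R on open sets.\<close>
    let ?\<Lambda> = "\<lambda>f. (1 - t) * (\<integral>x. f x \<partial>M) + t * (\<integral>x. f x \<partial>N)"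
    have "positive_mean ?\<Lambda>"
    proof
      show "0 \<le> ?\<Lambda> f" if "continuous_on UNIV f" "\<And>x. 0 \<le> f x" for f
        using t that by (intro add_nonneg_nonneg mult_nonneg_nonneg Bochner_Integration.integral_nonneg) auto
      show "?\<Lambda> (\<lambda>x. f x + g x) = ?\<Lambda> f + ?\<Lambda> g"
        if "continuous_on UNIV f" "continuous_on UNIV g" for f g
        unfolding Bochner_Integration.integral_add[OF int(1)[OF that(1)] int(1)[OF that(2)]]
          Bochner_Integration.integral_add[OF int(2)[OF that(1)] int(2)[OF that(2)]]
        by (simp add: algebra_simps)
    qed (use cpt in \<open>simp_all add: algebra_simps M.prob_space N.prob_space\<close>)
    then obtain P where P: "prob_space P" "sets P = sets borel"
      and P_int: "\<And>f. continuous_on UNIV f \<Longrightarrow> (\<integral>x. f x \<partial>P) = ?\<Lambda> f"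
      by (rule Riesz_representation) blast
    have "R = P"
    proof (rule prob_borel_eqI[OF R(1) P(1) R(2) P(2)])
      fix U :: "'x set" assume U: "open U"
      obtain k :: "nat \<Rightarrow> 'x \<Rightarrow> real" where k: "increases_to_indicator k U"
        by (rule continuous_increasing_to_indicator_open[OF cpt U])
      have "(\<lambda>n. ?\<Lambda> (k n)) \<longlonglongrightarrow> (1 - t) * measure M U + t * measure N U"
        by (intro tendsto_intros integral_tendsto_measure_open[OF _ _ k U] M N)
      moreover have "(\<lambda>n. ?\<Lambda> (k n)) \<longlonglongrightarrow> measure P U"
        using integral_tendsto_measure_open[OF P k U] P_int increases_to_indicatorD(1)[OF k] by simp
      ultimately have "measure P U = (1 - t) * measure M U + t * measure N U" by (metis LIMSEQ_unique)
      thus "measure R U = measure P U" using \<open>?meas\<close> by simp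
    qed
    thus ?int using P_int by blast
  next
    assume ?int
    define P where "P = measure_of UNIV (sets borel) (\<lambda>S. ennreal (1 - t) * emeasure M S + ennreal t * emeasure N S)"
    have sP: "sets P = sets borel"
      unfolding P_def using sets.sigma_sets_eq[of "borel :: 'x measure"] by simp
    have eP: "emeasure P S = ennreal (1 - t) * emeasure M S + ennreal t * emeasure N S"
      if S: "S \<in> sets borel" for S
      unfolding P_def
    proof (rule emeasure_measure_of_sigma[OF _ _ _ S])
      show "sigma_algebra UNIV (sets (borel :: 'x measure))"
        using sets.sigma_algebra_axioms[of "borel :: 'x measure"] by simp
      show "positive (sets borel) (\<lambda>S. ennreal (1 - t) * emeasure M S + ennreal t * emeasure N S)"
        by (simp add: positive_def)
      show "countably_additive (sets borel) (\<lambda>S. ennreal (1 - t) * emeasure M S + ennreal t * emeasure N S)"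
        unfolding countably_additive_def using M(2) N(2)
        by (auto simp: suminf_add[symmetric] suminf_emeasure)
    qed
    have P: "prob_space P"
    proof
      have "space P = UNIV" "space M = UNIV" "space N = UNIV"
        using sP M(2) N(2) by (auto dest: sets_eq_imp_space_eq)
      thus "emeasure P (space P) = 1"
        using M.emeasure_space_1 N.emeasure_space_1 t by (simp add: eP flip: ennreal_plus)
    qed
    interpret P: prob_space P by fact
    have mP: "measure P S = (1 - t) * measure M S + t * measure N S" for S
    proof (cases "S \<in> sets borel")
      case True
      have "ennreal (measure P S) = ennreal ((1 - t) * measure M S + t * measure N S)"
        using eP[OF True] t
        by (simp add: P.emeasure_eq_measure M.emeasure_eq_measure N.emeasure_eq_measure ennreal_mult')
      thus ?thesis using t by (subst (asm) ennreal_inj) auto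
    next
      case False
      \<comment> \<open>\<open>measure\<close> is 0 on non-measurable sets, so the identity may be
        quantified over all S.\<close>
      thus ?thesis using sP M(2) N(2) by (simp add: measure_notin_sets)
    qed
    have "R = P"
    proof (rule prob_borel_eqI[OF R(1) P R(2) sP])
      fix U :: "'x set" assume U: "open U"
      obtain k :: "nat \<Rightarrow> 'x \<Rightarrow> real" where k: "increases_to_indicator k U"
        by (rule continuous_increasing_to_indicator_open[OF cpt U])
      have "(\<lambda>n. (1 - t) * (\<integral>x. k n x \<partial>M) + t * (\<integral>x. k n x \<partial>N)) \<longlonglongrightarrow> (1 - t) * measure M U + t * measure N U"
        by (intro tendsto_intros integral_tendsto_measure_open[OF _ _ k U] M N)
      moreover have "(\<lambda>n. (1 - t) * (\<integral>x. k n x \<partial>M) + t * (\<integral>x. k n x \<partial>N)) \<longlonglongrightarrow> measure R U"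
        using integral_tendsto_measure_open[OF R k U] \<open>?int\<close> increases_to_indicatorD(1)[OF k] by simp
      ultimately show "measure R U = measure P U" unfolding mP by (metis LIMSEQ_unique)
    qed
    thus ?meas using mP by blast
  }
qed

section \<open>The convolution algebra of an action\<close>

text \<open>The element \<open>f u\<^sub>g\<close>. These elements span the convolution algebra, and
  every identity in it is checked on them.\<close>

definition monomial :: "('x \<Rightarrow> complex) \<Rightarrow> 'g \<Rightarrow> 'g \<Rightarrow> 'x \<Rightarrow> complex" where
  "monomial f g = (\<lambda>h x. if h = g then f x else 0)"

locale compact_abelian_system = comm_group G for G :: "('g, 'm) monoid_scheme" (structure) +
  fixes \<phi> :: "'g \<Rightarrow> 'x::{t2_space, second_countable_topology} \<Rightarrow> 'x"
  assumes compact_space: "compact (UNIV :: 'x set)" and action: "action_by_homeos G \<phi>"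
begin

abbreviation "B \<equiv> convolution_algebra G \<phi>"

lemma act_mult: "g \<in> carrier G \<Longrightarrow> h \<in> carrier G \<Longrightarrow> \<phi> (g \<otimes> h) x = \<phi> g (\<phi> h x)"
  using action group_action.composition_rule[of G UNIV \<phi> x g h] by (simp add: action_by_homeos_def)

lemma act_one [simp]: "\<phi> \<one> x = x"
  using action group_action.id_eq_one[of G UNIV \<phi>] by (metis action_by_homeos_def UNIV_I restrict_apply')

lemma act_inv [simp]: "g \<in> carrier G \<Longrightarrow> \<phi> (inv g) (\<phi> g x) = x" "g \<in> carrier G \<Longrightarrow> \<phi> g (\<phi> (inv g) x) = x"
  by (simp_all flip: act_mult)

text \<open>Commutativity of the group in the form used for the action: it makes fixed-point sets
  invariant and stabilizers constant along orbits.\<close>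

lemma act_commute: "g \<in> carrier G \<Longrightarrow> h \<in> carrier G \<Longrightarrow> \<phi> g (\<phi> h x) = \<phi> h (\<phi> g x)"
  by (metis act_mult m_comm)

lemma continuous_act: "g \<in> carrier G \<Longrightarrow> continuous_on UNIV (\<phi> g)"
  using action by (simp add: action_by_homeos_def homeomorphism_def)

lemma continuous_comp_act: "g \<in> carrier G \<Longrightarrow> continuous_on UNIV f \<Longrightarrow> continuous_on UNIV (\<lambda>x. f (\<phi> g x))"
  using continuous_on_compose2[OF _ continuous_act, of UNIV f g] by auto

lemma act_eq_iff: "g \<in> carrier G \<Longrightarrow> \<phi> g x = \<phi> g y \<longleftrightarrow> x = y"
  by (metis act_inv(1))

abbreviation support :: "('g \<Rightarrow> 'x \<Rightarrow> complex) \<Rightarrow> 'g set" where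
  "support a \<equiv> {g. a g \<noteq> (\<lambda>x. 0)}"

lemma conv_carrier_iff:
  "a \<in> carrier B \<longleftrightarrow> finite (support a) \<and> support a \<subseteq> carrier G \<and> (\<forall>g. continuous_on UNIV (a g))"
  by (simp add: convolution_algebra_def)

lemma conv_simps:
  "a \<oplus>\<^bsub>B\<^esub> b = (\<lambda>g x. a g x + b g x)" "c \<odot>\<^bsub>B\<^esub> a = (\<lambda>g x. c * a g x)" "\<zero>\<^bsub>B\<^esub> = (\<lambda>g x. 0)"
  "\<one>\<^bsub>B\<^esub> = monomial (\<lambda>x. 1) \<one>"
  "adj B a = (\<lambda>g x. if g \<in> carrier G then cnj (a (inv g) (\<phi> (inv g) x)) else 0)"
  by (auto simp: convolution_algebra_def monomial_def fun_eq_iff)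

text \<open>Enlarging the summation range beyond the support adds only zeros, and allows products
  with different left factors to be summed over a common set.\<close>

lemma conv_mult:
  assumes "finite S" "support a \<subseteq> S"
  shows "(a \<otimes>\<^bsub>B\<^esub> b) g x = (if g \<in> carrier G then \<Sum>h\<in>S. a h x * b (inv h \<otimes> g) (\<phi> (inv h) x) else 0)"
proof -
  have "(\<Sum>h\<in>support a. a h x * b (inv h \<otimes> g) (\<phi> (inv h) x)) = (\<Sum>h\<in>S. a h x * b (inv h \<otimes> g) (\<phi> (inv h) x))"
    using assms by (intro sum.mono_neutral_left) auto
  thus ?thesis by (simp add: convolution_algebra_def)
qed

lemma conv_carrierD:
  assumes "a \<in> carrier B"
  shows "finite (support a)" "support a \<subseteq> carrier G" "\<And>g. continuous_on UNIV (a g)"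
    "\<And>g. g \<notin> carrier G \<Longrightarrow> a g = (\<lambda>x. 0)"
  using assms by (auto simp: conv_carrier_iff)

lemma conv_carrierI:
  assumes "finite S" "S \<subseteq> carrier G" "\<And>g. g \<notin> S \<Longrightarrow> a g = (\<lambda>x. 0)" "\<And>g. continuous_on UNIV (a g)"
  shows "a \<in> carrier B"
proof -
  have "support a \<subseteq> S" using assms(3) by blast
  thus ?thesis using assms finite_subset unfolding conv_carrier_iff by blast
qed

lemma monomial_closed [simp]: "continuous_on UNIV f \<Longrightarrow> g \<in> carrier G \<Longrightarrow> monomial f g \<in> carrier B"
proof (rule conv_carrierI[of "{g}"])
  show "continuous_on UNIV (monomial f g h)" if "continuous_on UNIV f" for h
    using that by (cases "h = g") (simp_all add: monomial_def)
qed (auto simp: monomial_def)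

lemma conv_add_closed: assumes "a \<in> carrier B" "b \<in> carrier B" shows "a \<oplus>\<^bsub>B\<^esub> b \<in> carrier B"
proof (rule conv_carrierI[of "support a \<union> support b"])
  show "(a \<oplus>\<^bsub>B\<^esub> b) g = (\<lambda>x. 0)" if g: "g \<notin> support a \<union> support b" for g
  proof -
    have "a g = (\<lambda>x. 0)" "b g = (\<lambda>x. 0)" using g by auto
    thus ?thesis by (simp add: conv_simps)
  qed
qed (use conv_carrierD[OF assms(1)] conv_carrierD[OF assms(2)] in \<open>auto simp: conv_simps intro!: continuous_intros\<close>)

lemma conv_smult_closed: assumes "a \<in> carrier B" shows "c \<odot>\<^bsub>B\<^esub> a \<in> carrier B"
proof (rule conv_carrierI[of "support a"])
  show "(c \<odot>\<^bsub>B\<^esub> a) g = (\<lambda>x. 0)" if g: "g \<notin> support a" for g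
  proof -
    have "a g = (\<lambda>x. 0)" using g by auto
    thus ?thesis by (simp add: conv_simps)
  qed
qed (use conv_carrierD[OF assms] in \<open>auto simp: conv_simps intro!: continuous_intros\<close>)

text \<open>The support is peeled off one group element at a time; zero is the monomial of the zero
  function at the identity. Additive identities, and bounds stable under sums, thereby reduce to
  monomials.\<close>

lemma conv_induct [consumes 1, case_names monomial add]:
  assumes "a \<in> carrier B"
    and monomial: "\<And>f g. continuous_on UNIV f \<Longrightarrow> g \<in> carrier G \<Longrightarrow> P (monomial f g)"
    and add: "\<And>a b. a \<in> carrier B \<Longrightarrow> b \<in> carrier B \<Longrightarrow> P a \<Longrightarrow> P b \<Longrightarrow> P (a \<oplus>\<^bsub>B\<^esub> b)"
  shows "P a"
proof -
  have "P a" if "finite S" "S \<subseteq> carrier G" "\<And>g. g \<notin> S \<Longrightarrow> a g = (\<lambda>x. 0)" "\<And>g. continuous_on UNIV (a g)" for S a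
    using that
  proof (induction S arbitrary: a rule: finite_induct)
    case empty
    have "a = monomial (\<lambda>x. 0) \<one>" using empty by (auto simp: fun_eq_iff monomial_def)
    thus ?case using monomial[of "\<lambda>x. 0" \<one>] by simp
  next
    case (insert g S)
    define b where "b = a(g := (\<lambda>x. 0))"
    have bS: "\<And>h. h \<notin> S \<Longrightarrow> b h = (\<lambda>x. 0)" and bc: "\<And>h. continuous_on UNIV (b h)"
      using insert.prems by (auto simp: b_def)
    have "P b" using insert.prems bS bc by (intro insert.IH) auto
    moreover have "b \<in> carrier B" using insert.prems insert.hyps bS bc by (intro conv_carrierI[of S]) auto
    moreover have "P (monomial (a g) g)" using insert.prems by (intro monomial) auto
    moreover have "monomial (a g) g \<in> carrier B" using insert.prems by (intro monomial_closed) auto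
    moreover have "a = monomial (a g) g \<oplus>\<^bsub>B\<^esub> b"
      by (auto simp: fun_eq_iff conv_simps monomial_def b_def)
    ultimately show ?case using add by metis
  qed
  from this[of "support a" a, OF conv_carrierD(1,2)[OF assms(1)] _ conv_carrierD(3)[OF assms(1)]]
  show ?thesis by simp
qed

lemma monomial_mult:
  assumes "g \<in> carrier G" "h \<in> carrier G"
  shows "monomial f g \<otimes>\<^bsub>B\<^esub> monomial k h = monomial (\<lambda>x. f x * k (\<phi> (inv g) x)) (g \<otimes> h)"
proof (intro ext)
  fix l x
  have "support (monomial f g) \<subseteq> {g}" by (auto simp: monomial_def)
  from conv_mult[OF _ this, of "monomial k h" l x]
  have "(monomial f g \<otimes>\<^bsub>B\<^esub> monomial k h) l x =
      (if l \<in> carrier G then f x * monomial k h (inv g \<otimes> l) (\<phi> (inv g) x) else 0)"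
    by (simp add: monomial_def)
  moreover have "l \<in> carrier G \<Longrightarrow> inv g \<otimes> l = h \<longleftrightarrow> l = g \<otimes> h"
    using assms by (metis inv_solve_left m_assoc)
  ultimately show "(monomial f g \<otimes>\<^bsub>B\<^esub> monomial k h) l x = monomial (\<lambda>x. f x * k (\<phi> (inv g) x)) (g \<otimes> h) l x"
    using assms by (auto simp: monomial_def)
qed

lemma monomial_adj:
  assumes "g \<in> carrier G" shows "adj B (monomial f g) = monomial (\<lambda>x. cnj (f (\<phi> g x))) (inv g)"
proof (intro ext)
  fix h x
  have "h \<in> carrier G \<Longrightarrow> inv h = g \<longleftrightarrow> h = inv g" using assms by (metis inv_inv)
  thus "adj B (monomial f g) h x = monomial (\<lambda>x. cnj (f (\<phi> g x))) (inv g) h x"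
    using assms by (auto simp: conv_simps monomial_def)
qed

lemma monomial_add: "monomial f g \<oplus>\<^bsub>B\<^esub> monomial k g = monomial (\<lambda>x. f x + k x) g"
  by (auto simp: conv_simps monomial_def fun_eq_iff)

lemma monomial_smult: "c \<odot>\<^bsub>B\<^esub> monomial f g = monomial (\<lambda>x. c * f x) g"
  by (auto simp: conv_simps monomial_def fun_eq_iff)

lemma conv_add_left_mult:
  assumes "a \<in> carrier B" "b \<in> carrier B"
  shows "(a \<oplus>\<^bsub>B\<^esub> b) \<otimes>\<^bsub>B\<^esub> c = (a \<otimes>\<^bsub>B\<^esub> c) \<oplus>\<^bsub>B\<^esub> (b \<otimes>\<^bsub>B\<^esub> c)"
proof (intro ext)
  fix g x
  let ?S = "support a \<union> support b"
  have S: "finite ?S" "support a \<subseteq> ?S" "support b \<subseteq> ?S" "support (a \<oplus>\<^bsub>B\<^esub> b) \<subseteq> ?S"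
    using assms by (auto simp: conv_carrier_iff conv_simps)
  show "((a \<oplus>\<^bsub>B\<^esub> b) \<otimes>\<^bsub>B\<^esub> c) g x = ((a \<otimes>\<^bsub>B\<^esub> c) \<oplus>\<^bsub>B\<^esub> (b \<otimes>\<^bsub>B\<^esub> c)) g x"
    unfolding conv_mult[OF S(1,4)] conv_simps(1)[of "a \<otimes>\<^bsub>B\<^esub> c"] conv_mult[OF S(1,2)] conv_mult[OF S(1,3)]
    by (simp add: conv_simps sum.distrib distrib_right)
qed

lemma conv_add_right_mult:
  "a \<in> carrier B \<Longrightarrow> a \<otimes>\<^bsub>B\<^esub> (b \<oplus>\<^bsub>B\<^esub> c) = (a \<otimes>\<^bsub>B\<^esub> b) \<oplus>\<^bsub>B\<^esub> (a \<otimes>\<^bsub>B\<^esub> c)"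
  by (intro ext) (simp add: conv_simps conv_mult[OF _ order_refl] conv_carrier_iff sum.distrib distrib_left)

lemma conv_smult_left_mult:
  assumes "a \<in> carrier B"
  shows "(c \<odot>\<^bsub>B\<^esub> a) \<otimes>\<^bsub>B\<^esub> b = c \<odot>\<^bsub>B\<^esub> (a \<otimes>\<^bsub>B\<^esub> b)"
proof (intro ext)
  fix g x
  have S: "finite (support a)" "support (c \<odot>\<^bsub>B\<^esub> a) \<subseteq> support a"
    using assms by (auto simp: conv_carrier_iff conv_simps)
  show "((c \<odot>\<^bsub>B\<^esub> a) \<otimes>\<^bsub>B\<^esub> b) g x = (c \<odot>\<^bsub>B\<^esub> (a \<otimes>\<^bsub>B\<^esub> b)) g x"
    unfolding conv_mult[OF S] conv_simps(2)[of c "a \<otimes>\<^bsub>B\<^esub> b"] conv_mult[OF S(1) order_refl]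
    by (simp add: conv_simps sum_distrib_left mult.assoc)
qed

lemma conv_smult_right_mult:
  "a \<in> carrier B \<Longrightarrow> a \<otimes>\<^bsub>B\<^esub> (c \<odot>\<^bsub>B\<^esub> b) = c \<odot>\<^bsub>B\<^esub> (a \<otimes>\<^bsub>B\<^esub> b)"
  by (intro ext) (simp add: conv_simps conv_mult[OF _ order_refl] conv_carrier_iff sum_distrib_left mult_ac)

lemma conv_adj_add: "adj B (a \<oplus>\<^bsub>B\<^esub> b) = adj B a \<oplus>\<^bsub>B\<^esub> adj B b"
  by (auto simp: conv_simps fun_eq_iff)

lemma conv_mult_closed:
  assumes "a \<in> carrier B" "b \<in> carrier B" shows "a \<otimes>\<^bsub>B\<^esub> b \<in> carrier B"
  using assms(1)
proof (induction rule: conv_induct)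
  case (monomial f g)
  from assms(2) show ?case
  proof (induction rule: conv_induct)
    case (monomial k h)
    thus ?case using \<open>continuous_on UNIV f\<close> \<open>g \<in> carrier G\<close>
      by (simp add: monomial_mult continuous_comp_act continuous_on_mult)
  next
    case (add a b)
    thus ?case using monomial by (simp add: conv_add_right_mult conv_add_closed)
  qed
next
  case (add a b)
  thus ?case by (simp add: conv_add_left_mult conv_add_closed)
qed

lemma conv_adj_closed: "a \<in> carrier B \<Longrightarrow> adj B a \<in> carrier B"
proof (induction rule: conv_induct)
  case (monomial f g)
  thus ?case by (simp add: monomial_adj continuous_comp_act continuous_on_cnj)
next
  case (add a b)
  thus ?case by (simp add: conv_adj_add conv_add_closed)
qed

lemma conv_assoc:
  assumes a: "a \<in> carrier B" and b: "b \<in> carrier B" and c: "c \<in> carrier B"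
  shows "a \<otimes>\<^bsub>B\<^esub> b \<otimes>\<^bsub>B\<^esub> c = a \<otimes>\<^bsub>B\<^esub> (b \<otimes>\<^bsub>B\<^esub> c)"
  using a
proof (induction rule: conv_induct)
  case f: (monomial f g)
  from b show ?case
  proof (induction rule: conv_induct)
    case k: (monomial k h)
    from c show ?case
    proof (induction rule: conv_induct)
      case (monomial l i)
      thus ?case using f k
        by (simp add: monomial_mult inv_mult act_mult m_assoc mult.assoc act_commute[of "inv g" "inv h"])
    next
      case (add c d)
      thus ?case using f k by (simp add: conv_add_right_mult conv_mult_closed)
    qed
  next
    case (add b d)
    thus ?case using f c by (simp add: conv_add_right_mult conv_add_left_mult conv_mult_closed)
  qed
next
  case (add a d)
  thus ?case using b c by (simp add: conv_add_left_mult conv_mult_closed)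
qed

lemma conv_adj_mult:
  assumes a: "a \<in> carrier B" and b: "b \<in> carrier B"
  shows "adj B (a \<otimes>\<^bsub>B\<^esub> b) = adj B b \<otimes>\<^bsub>B\<^esub> adj B a"
  using a
proof (induction rule: conv_induct)
  case f: (monomial f g)
  from b show ?case
  proof (induction rule: conv_induct)
    case (monomial k h)
    thus ?case using f
      by (simp add: monomial_mult monomial_adj inv_mult act_mult m_comm mult.commute act_commute[of h g])
  next
    case (add b c)
    thus ?case using f by (simp add: conv_add_right_mult conv_add_left_mult conv_adj_add conv_adj_closed)
  qed
next
  case (add a c)
  thus ?case using b by (simp add: conv_add_right_mult conv_add_left_mult conv_adj_add conv_adj_closed)
qed

lemma conv_one_left: assumes "a \<in> carrier B" shows "\<one>\<^bsub>B\<^esub> \<otimes>\<^bsub>B\<^esub> a = a"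
  using assms
proof (induction rule: conv_induct)
  case (add a b)
  moreover have "\<one>\<^bsub>B\<^esub> \<in> carrier B" by (simp add: conv_simps)
  ultimately show ?case by (simp add: conv_add_right_mult)
qed (simp add: conv_simps monomial_mult)

lemma conv_one_right: assumes "a \<in> carrier B" shows "a \<otimes>\<^bsub>B\<^esub> \<one>\<^bsub>B\<^esub> = a"
  using assms
proof (induction rule: conv_induct)
  case (add a b)
  thus ?case by (simp add: conv_add_left_mult)
qed (simp add: conv_simps monomial_mult)

lemma complex_star_algebra_conv: "complex_star_algebra B"
proof -
  have "abelian_group B"
  proof (rule abelian_groupI)
    show "\<zero>\<^bsub>B\<^esub> \<in> carrier B" by (rule conv_carrierI[of "{}"]) (auto simp: conv_simps)
    show "\<exists>b\<in>carrier B. b \<oplus>\<^bsub>B\<^esub> a = \<zero>\<^bsub>B\<^esub>" if "a \<in> carrier B" for a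
      using conv_smult_closed[OF that, of "-1"]
      by (intro bexI[of _ "(-1) \<odot>\<^bsub>B\<^esub> a"]) (auto simp: conv_simps)
  qed (auto simp: conv_add_closed, auto simp: conv_simps add_ac)
  moreover have "Group.monoid B"
    by (rule monoidI) (simp_all add: conv_mult_closed conv_assoc conv_one_left conv_one_right,
        simp add: conv_simps(4))
  ultimately have "ring B"
    by (intro ringI) (auto simp: conv_add_left_mult conv_add_right_mult abelian_group_def)
  moreover have "complex_star_algebra_axioms B"
  proof
    show "adj B (adj B a) = a" if "a \<in> carrier B" for a
      using conv_carrierD(4)[OF that] by (auto simp: conv_simps fun_eq_iff)
  qed (auto simp: conv_smult_closed conv_smult_left_mult conv_smult_right_mult conv_adj_closed
      conv_adj_add conv_adj_mult, auto simp: conv_simps algebra_simps fun_eq_iff)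
  ultimately show ?thesis by (rule complex_star_algebra.intro)
qed

end

sublocale compact_abelian_system \<subseteq> conv: complex_star_algebra B
  by (rule complex_star_algebra_conv)

section \<open>Uniform bounds for C*-seminorms and for GNS lengths\<close>

context compact_abelian_system begin

text \<open>Elements u with adj u u = 1 have seminorm at most 1. This covers u_g and, through the
  unitaries constructed below, real functions of modulus at most 1; the C*-identity reduces a
  general f to |f|^2 / K^2. The bound does not depend on p, which makes the universal norm
  finite.\<close>

lemma seminorm_monomial_le:
  assumes p: "cstar_seminorm B p" and f: "continuous_on UNIV f" and K: "\<And>x. cmod (f x) \<le> K" and K0: "K > 0"
    and g: "g \<in> carrier G"
  shows "p (monomial f g) \<le> K"
proof -
  interpret N: cstar_seminormed_algebra B p by unfold_locales (rule p)
  have unitary: "p u \<le> 1" if "u \<in> carrier B" "adj B u \<otimes>\<^bsub>B\<^esub> u = \<one>\<^bsub>B\<^esub>" for u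
  proof -
    have "(p u)\<^sup>2 \<le> 1\<^sup>2" using N.seminorm_cstar[of u] N.seminorm_one_le that by simp
    thus ?thesis by (rule power2_le_imp_le) simp
  qed
  text \<open>A real function \<open>k\<close> with \<open>\<bar>k\<bar> \<le> 1\<close> is the real part of the unitary \<open>k + \<i> \<surd>(1 - k\<^sup>2)\<close>.\<close>
  have real_le: "p (monomial (\<lambda>x. of_real (k x)) \<one>) \<le> 1"
    if k: "continuous_on UNIV k" "\<And>x. \<bar>k x\<bar> \<le> 1" for k :: "'x \<Rightarrow> real"
  proof -
    define u where "u x = Complex (k x) (sqrt (1 - (k x)\<^sup>2))" for x
    have cu: "continuous_on UNIV u" unfolding u_def Complex_eq using k(1) by (intro continuous_intros)
    have k1: "(k x)\<^sup>2 \<le> 1" for x using k(2)[of x] by (simp add: abs_square_le_1)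
    have uu: "cnj (u x) * u x = 1" for x
      using k1[of x] by (simp add: u_def complex_eq_iff power2_eq_square)
    have uB: "monomial u \<one> \<in> carrier B" using cu by simp
    have pu: "p (monomial u \<one>) \<le> 1"
      using uB uu by (intro unitary) (simp_all add: monomial_adj monomial_mult conv_simps(4))
    have "monomial (\<lambda>x. of_real (k x)) \<one> = (1/2) \<odot>\<^bsub>B\<^esub> (monomial u \<one> \<oplus>\<^bsub>B\<^esub> adj B (monomial u \<one>))"
      by (simp add: monomial_adj monomial_add monomial_smult)
         (simp add: monomial_def fun_eq_iff u_def complex_eq_iff)
    hence "p (monomial (\<lambda>x. of_real (k x)) \<one>) = (1/2) * p (monomial u \<one> \<oplus>\<^bsub>B\<^esub> adj B (monomial u \<one>))"
      using N.seminorm_smult[of "monomial u \<one> \<oplus>\<^bsub>B\<^esub> adj B (monomial u \<one>)" "1/2"] uB by simp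
    also have "\<dots> \<le> (1/2) * (1 + 1)"
      using N.seminorm_add[of "monomial u \<one>" "adj B (monomial u \<one>)"] N.seminorm_adj[OF uB] uB pu by simp
    finally show ?thesis by simp
  qed
  have f1: "p (monomial f \<one>) \<le> K"
  proof (rule power2_le_imp_le)
    define k where "k x = (cmod (f x))\<^sup>2 / K\<^sup>2" for x
    have ck: "continuous_on UNIV k" unfolding k_def using f K0 by (intro continuous_intros) auto
    have k1: "\<bar>k x\<bar> \<le> 1" for x
      using power_mono[OF K[of x], of 2] K0 by (simp add: k_def)
    have "(p (monomial f \<one>))\<^sup>2 = p (adj B (monomial f \<one>) \<otimes>\<^bsub>B\<^esub> monomial f \<one>)"
      using N.seminorm_cstar[of "monomial f \<one>"] f by simp
    also have "adj B (monomial f \<one>) \<otimes>\<^bsub>B\<^esub> monomial f \<one> = of_real (K\<^sup>2) \<odot>\<^bsub>B\<^esub> monomial (\<lambda>x. of_real (k x)) \<one>"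
    proof -
      have "cnj (f x) * f x = of_real (K\<^sup>2) * of_real (k x)" for x
        using K0 complex_norm_square[of "f x"] by (simp add: k_def mult.commute)
      thus ?thesis by (simp add: monomial_adj monomial_mult monomial_smult)
    qed
    also have "p \<dots> = K\<^sup>2 * p (monomial (\<lambda>x. of_real (k x)) \<one>)"
      using ck by (subst N.seminorm_smult) (auto intro!: monomial_closed continuous_intros simp: norm_power)
    also have "\<dots> \<le> K\<^sup>2" using real_le[OF ck k1] by (simp add: mult_left_le)
    finally show "(p (monomial f \<one>))\<^sup>2 \<le> K\<^sup>2" .
  qed (use K0 in simp)
  have ug: "p (monomial (\<lambda>x. 1) g) \<le> 1"
    using g by (intro unitary) (simp_all add: monomial_adj monomial_mult conv_simps(4))
  have "p (monomial f g) = p (monomial f \<one> \<otimes>\<^bsub>B\<^esub> monomial (\<lambda>x. 1) g)"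
    using g by (simp add: monomial_mult)
  also have "\<dots> \<le> p (monomial f \<one>) * p (monomial (\<lambda>x. 1) g)"
    using f g by (intro N.seminorm_mult) auto
  also have "\<dots> \<le> K * 1" using f1 ug f g K0 by (intro mult_mono N.seminorm_nonneg) auto
  finally show ?thesis by simp
qed

lemma seminorms_bounded:
  assumes "a \<in> carrier B" shows "bdd_above {p a | p. cstar_seminorm B p}"
proof -
  have "\<exists>K. \<forall>p. cstar_seminorm B p \<longrightarrow> p a \<le> K"
    using assms
  proof (induction rule: conv_induct)
    case (monomial f g)
    obtain K where "K > 0" "\<And>x. cmod (f x) \<le> K"
    proof -
      have "bounded (range f)" using monomial compact_space by (intro compact_imp_bounded compact_continuous_image)
      then obtain K where "K > 0" "\<And>x. cmod (f x) \<le> K" by (auto simp: bounded_pos)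
      thus ?thesis using that by blast
    qed
    thus ?case using seminorm_monomial_le monomial by metis
  next
    case (add a b)
    then obtain K L where KL: "\<forall>p. cstar_seminorm B p \<longrightarrow> p a \<le> K" "\<forall>p. cstar_seminorm B p \<longrightarrow> p b \<le> L" by blast
    have "p (a \<oplus>\<^bsub>B\<^esub> b) \<le> K + L" if p: "cstar_seminorm B p" for p
    proof -
      have "p (a \<oplus>\<^bsub>B\<^esub> b) \<le> p a + p b" using p add.hyps by (simp add: cstar_seminorm_def)
      also have "\<dots> \<le> K + L" using KL p by (intro add_mono) auto
      finally show ?thesis .
    qed
    thus ?case by blast
  qed
  then obtain K where "\<forall>p. cstar_seminorm B p \<longrightarrow> p a \<le> K" by blast
  thus ?thesis by (intro bdd_aboveI[of _ K]) auto
qed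

text \<open>With K a bound for |f| and s the square root of K^2 - |f|^2, the relation adj f f + adj
  s s = K^2 says that the squared lengths of f b and s b add up to K^2 times that of b.
  Multiplication by u_g preserves lengths.\<close>

lemma gns_bounded:
  assumes pos: "positive_functional B \<tau>" and "a \<in> carrier B"
  shows "\<exists>K. \<forall>b\<in>carrier B. gns_length B \<tau> (a \<otimes>\<^bsub>B\<^esub> b) \<le> K * gns_length B \<tau> b"
  using assms(2)
proof (induction rule: conv_induct)
  case (monomial f g)
  obtain K where K: "K > 0" "\<And>x. cmod (f x) \<le> K"
  proof -
    have "bounded (range f)" using monomial compact_space by (intro compact_imp_bounded compact_continuous_image)
    then obtain K where "K > 0" "\<And>x. cmod (f x) \<le> K" by (auto simp: bounded_pos)
    thus ?thesis using that by blast
  qed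
  define s where "s x = complex_of_real (sqrt (K\<^sup>2 - (cmod (f x))\<^sup>2))" for x
  have cs: "continuous_on UNIV s" unfolding s_def using monomial(1) by (intro continuous_intros)
  have s2: "s x * s x = of_real (K\<^sup>2) - f x * cnj (f x)" for x
  proof -
    have "(cmod (f x))\<^sup>2 \<le> K\<^sup>2" using K(2)[of x] by (intro power_mono) auto
    thus ?thesis by (simp add: s_def complex_norm_square flip: of_real_mult) (simp flip: complex_norm_square of_real_power of_real_diff)
  qed
  have f_len: "gns_length B \<tau> (monomial f \<one> \<otimes>\<^bsub>B\<^esub> b) \<le> K * gns_length B \<tau> b" if b: "b \<in> carrier B" for b
  proof (rule power2_le_imp_le)
    have mf: "monomial f \<one> \<in> carrier B" "monomial s \<one> \<in> carrier B" using monomial cs by auto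
    have "(adj B (monomial f \<one>) \<otimes>\<^bsub>B\<^esub> monomial f \<one>) \<oplus>\<^bsub>B\<^esub> (adj B (monomial s \<one>) \<otimes>\<^bsub>B\<^esub> monomial s \<one>)
        = of_real (K\<^sup>2) \<odot>\<^bsub>B\<^esub> \<one>\<^bsub>B\<^esub>"
    proof -
      have "cnj (f x) * f x + cnj (s x) * s x = of_real (K\<^sup>2)" for x
        using s2[of x] by (simp add: s_def mult.commute)
      thus ?thesis
        by (simp add: monomial_adj monomial_mult monomial_add monomial_smult conv_simps(4) del: of_real_power)
    qed
    hence "adj B b \<otimes>\<^bsub>B\<^esub> ((adj B (monomial f \<one>) \<otimes>\<^bsub>B\<^esub> monomial f \<one>) \<oplus>\<^bsub>B\<^esub> (adj B (monomial s \<one>) \<otimes>\<^bsub>B\<^esub> monomial s \<one>)) \<otimes>\<^bsub>B\<^esub> b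
        = of_real (K\<^sup>2) \<odot>\<^bsub>B\<^esub> (adj B b \<otimes>\<^bsub>B\<^esub> b)"
      using b by (simp add: conv.smult_mult_left conv.smult_mult_right)
    hence "(adj B (monomial f \<one> \<otimes>\<^bsub>B\<^esub> b) \<otimes>\<^bsub>B\<^esub> (monomial f \<one> \<otimes>\<^bsub>B\<^esub> b)) \<oplus>\<^bsub>B\<^esub>
        (adj B (monomial s \<one> \<otimes>\<^bsub>B\<^esub> b) \<otimes>\<^bsub>B\<^esub> (monomial s \<one> \<otimes>\<^bsub>B\<^esub> b)) = of_real (K\<^sup>2) \<odot>\<^bsub>B\<^esub> (adj B b \<otimes>\<^bsub>B\<^esub> b)"
      using b mf by (simp add: conv.adj_mult conv.m_assoc conv.l_distr conv.r_distr)
    from arg_cong[OF this, of \<tau>]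
    have "\<tau> (adj B (monomial f \<one> \<otimes>\<^bsub>B\<^esub> b) \<otimes>\<^bsub>B\<^esub> (monomial f \<one> \<otimes>\<^bsub>B\<^esub> b)) +
        \<tau> (adj B (monomial s \<one> \<otimes>\<^bsub>B\<^esub> b) \<otimes>\<^bsub>B\<^esub> (monomial s \<one> \<otimes>\<^bsub>B\<^esub> b)) = of_real (K\<^sup>2) * \<tau> (adj B b \<otimes>\<^bsub>B\<^esub> b)"
      using b mf by (simp add: conv.functional_add[OF pos] conv.functional_smult[OF pos])
    from arg_cong[OF this, of Re]
    have "(gns_length B \<tau> (monomial f \<one> \<otimes>\<^bsub>B\<^esub> b))\<^sup>2 + (gns_length B \<tau> (monomial s \<one> \<otimes>\<^bsub>B\<^esub> b))\<^sup>2
        = K\<^sup>2 * (gns_length B \<tau> b)\<^sup>2"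
      using b mf by (simp add: conv.gns_length_sq[OF pos] del: of_real_power)
    thus "(gns_length B \<tau> (monomial f \<one> \<otimes>\<^bsub>B\<^esub> b))\<^sup>2 \<le> (K * gns_length B \<tau> b)\<^sup>2"
      unfolding power_mult_distrib using zero_le_power2[of "gns_length B \<tau> (monomial s \<one> \<otimes>\<^bsub>B\<^esub> b)"] by linarith
    show "0 \<le> K * gns_length B \<tau> b" using K b by (simp add: conv.gns_length_nonneg[OF pos])
  qed
  have "gns_length B \<tau> (monomial f g \<otimes>\<^bsub>B\<^esub> b) \<le> K * gns_length B \<tau> b" if b: "b \<in> carrier B" for b
  proof -
    let ?u = "monomial (\<lambda>x. 1) g"
    have u: "?u \<in> carrier B" "adj B ?u \<otimes>\<^bsub>B\<^esub> ?u = \<one>\<^bsub>B\<^esub>"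
      using monomial by (simp_all add: monomial_adj monomial_mult conv_simps(4))
    have "adj B (?u \<otimes>\<^bsub>B\<^esub> b) \<otimes>\<^bsub>B\<^esub> (?u \<otimes>\<^bsub>B\<^esub> b) = adj B b \<otimes>\<^bsub>B\<^esub> (adj B ?u \<otimes>\<^bsub>B\<^esub> ?u) \<otimes>\<^bsub>B\<^esub> b"
      using u(1) b by (simp add: conv.adj_mult conv.m_assoc)
    hence "gns_length B \<tau> (?u \<otimes>\<^bsub>B\<^esub> b) = gns_length B \<tau> b"
      using b by (simp add: gns_length_def u(2))
    moreover have "monomial f g \<otimes>\<^bsub>B\<^esub> b = monomial f \<one> \<otimes>\<^bsub>B\<^esub> (?u \<otimes>\<^bsub>B\<^esub> b)"
      using conv.m_assoc[of "monomial f \<one>" ?u b] monomial b u by (simp add: monomial_mult)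
    ultimately show ?thesis using f_len[of "?u \<otimes>\<^bsub>B\<^esub> b"] u b by simp
  qed
  thus ?case by blast
next
  case (add a c)
  then obtain K L where KL: "\<forall>b\<in>carrier B. gns_length B \<tau> (a \<otimes>\<^bsub>B\<^esub> b) \<le> K * gns_length B \<tau> b"
    "\<forall>b\<in>carrier B. gns_length B \<tau> (c \<otimes>\<^bsub>B\<^esub> b) \<le> L * gns_length B \<tau> b" by blast
  have "gns_length B \<tau> ((a \<oplus>\<^bsub>B\<^esub> c) \<otimes>\<^bsub>B\<^esub> b) \<le> (K + L) * gns_length B \<tau> b" if b: "b \<in> carrier B" for b
  proof -
    have "gns_length B \<tau> ((a \<oplus>\<^bsub>B\<^esub> c) \<otimes>\<^bsub>B\<^esub> b) \<le> gns_length B \<tau> (a \<otimes>\<^bsub>B\<^esub> b) + gns_length B \<tau> (c \<otimes>\<^bsub>B\<^esub> b)"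
      using add.hyps b by (simp add: conv.l_distr conv.gns_length_add[OF pos])
    thus ?thesis using KL b unfolding distrib_right by (meson add_mono order_trans)
  qed
  thus ?case by blast
qed

lemma cstar_enveloped_algebra_conv: "cstar_enveloped_algebra B (universal_norm B)"
proof -
  have "cstar_seminorm B (universal_norm B)"
    by (rule conv.cstar_seminorm_universal_norm) (rule seminorms_bounded)
  then interpret cstar_seminormed_algebra B "universal_norm B" by unfold_locales
  show ?thesis
  proof
    fix \<tau> a assume \<tau>: "positive_functional B \<tau>" "\<tau> \<one>\<^bsub>B\<^esub> = 1" and a: "a \<in> carrier B"
    have "cmod (\<tau> a) \<le> gns_seminorm B \<tau> a"
      using gns_bounded[OF \<tau>(1)] \<tau> a by (intro conv.functional_le_gns_seminorm) auto
    also have "\<dots> \<le> universal_norm B a"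
      using gns_bounded[OF \<tau>(1)]
      by (intro conv.cstar_seminorm_le_universal_norm conv.cstar_seminorm_gns \<tau>(1) a seminorms_bounded) auto
    finally show "cmod (\<tau> a) \<le> universal_norm B a" .
  qed
qed

end

sublocale compact_abelian_system \<subseteq> env: cstar_enveloped_algebra B "universal_norm B"
  by (rule cstar_enveloped_algebra_conv)

section \<open>Traces from characters of subgroups\<close>

text \<open>Stated for additive maps only, because it is also applied to the conjugate-linear map
  sending b to \<tau>(adj b c).\<close>

lemma (in compact_abelian_system) additive_eq_sum_monomials:
  fixes L :: "('g \<Rightarrow> 'x \<Rightarrow> complex) \<Rightarrow> complex"
  assumes add: "\<And>a b. a \<in> carrier B \<Longrightarrow> b \<in> carrier B \<Longrightarrow> L (a \<oplus>\<^bsub>B\<^esub> b) = L a + L b"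
    and "finite S" "S \<subseteq> carrier G" "\<And>g. g \<notin> S \<Longrightarrow> a g = (\<lambda>x. 0)" "\<And>g. continuous_on UNIV (a g)"
  shows "L a = (\<Sum>g\<in>S. L (monomial (a g) g))"
  using assms(2-)
proof (induction S arbitrary: a rule: finite_induct)
  case empty
  have "a = \<zero>\<^bsub>B\<^esub>" using empty by (auto simp: fun_eq_iff conv_simps(3))
  moreover have "L \<zero>\<^bsub>B\<^esub> = 0" using add[of "\<zero>\<^bsub>B\<^esub>" "\<zero>\<^bsub>B\<^esub>"] by simp
  ultimately show ?case by simp
next
  case (insert g S)
  define b where "b = a(g := (\<lambda>x. 0))"
  have bS: "\<And>h. h \<notin> S \<Longrightarrow> b h = (\<lambda>x. 0)" and bc: "\<And>h. continuous_on UNIV (b h)"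
    using insert.prems by (auto simp: b_def)
  have b: "b \<in> carrier B" using insert.prems insert.hyps bS bc by (intro conv_carrierI[of S]) auto
  have m: "monomial (a g) g \<in> carrier B" using insert.prems by (intro monomial_closed) auto
  have "a = monomial (a g) g \<oplus>\<^bsub>B\<^esub> b"
    by (auto simp: fun_eq_iff conv_simps(1) monomial_def b_def)
  hence "L a = L (monomial (a g) g) + L b" using add[OF m b] by simp
  also have "L b = (\<Sum>h\<in>S. L (monomial (b h) h))"
    using insert.prems bS bc by (intro insert.IH) auto
  also have "\<dots> = (\<Sum>h\<in>S. L (monomial (a h) h))"
    using insert.hyps by (intro sum.cong) (auto simp: b_def)
  finally show ?case using insert.hyps by simp
qed

text \<open>The common form of both families of traces. For \<open>\<tau>\<^sub>\<mu>\<close>, E is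
  integration, H is trivial and \<xi> = 1; for \<open>\<tau>\<^sub>x\<^sub>,\<^sub>\<chi>\<close>, E
  is the average over the orbit, H the stabilizer and \<xi> the character. \<open>mean_fixed\<close>
  says that H acts trivially on whatever E can see.\<close>

locale twisted_mean = compact_abelian_system G \<phi>
  for G :: "('g, 'm) monoid_scheme" (structure)
    and \<phi> :: "'g \<Rightarrow> 'x::{t2_space, second_countable_topology} \<Rightarrow> 'x" +
  fixes E :: "('x \<Rightarrow> complex) \<Rightarrow> complex" and H :: "'g set" and \<xi> :: "'g \<Rightarrow> complex"
  assumes mean_add: "continuous_on UNIV f \<Longrightarrow> continuous_on UNIV k \<Longrightarrow> E (\<lambda>x. f x + k x) = E f + E k"
    and mean_scale: "continuous_on UNIV f \<Longrightarrow> E (\<lambda>x. c * f x) = c * E f"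
    and mean_nonneg: "continuous_on UNIV f \<Longrightarrow> E (\<lambda>x. cnj (f x) * f x) \<in> \<real>\<^sub>\<ge>\<^sub>0"
    and mean_one: "E (\<lambda>x. 1) = 1"
    and mean_invariant: "g \<in> carrier G \<Longrightarrow> continuous_on UNIV f \<Longrightarrow> E (\<lambda>x. f (\<phi> g x)) = E f"
    and subgroup: "subgroup H G"
    and character: "g \<in> H \<Longrightarrow> h \<in> H \<Longrightarrow> \<xi> (g \<otimes> h) = \<xi> g * \<xi> h" "g \<in> H \<Longrightarrow> cmod (\<xi> g) = 1"
    and mean_fixed: "g \<in> H \<Longrightarrow> continuous_on UNIV f \<Longrightarrow> continuous_on UNIV k \<Longrightarrow>
      E (\<lambda>x. f x * k (\<phi> g x)) = E (\<lambda>x. f x * k x)"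
begin

definition trace :: "('g \<Rightarrow> 'x \<Rightarrow> complex) \<Rightarrow> complex" where
  "trace a = (\<Sum>g\<in>support a \<inter> H. \<xi> g * E (a g))"

lemma H_carrier: "g \<in> H \<Longrightarrow> g \<in> carrier G"
  using subgroup.mem_carrier[OF subgroup] .

lemma mean_zero: "E (\<lambda>x. 0) = 0"
  using mean_scale[of "\<lambda>x. 0" 0] by simp

lemma mean_sum:
  assumes "finite I" "\<And>i. i \<in> I \<Longrightarrow> continuous_on UNIV (f i)"
  shows "E (\<lambda>x. \<Sum>i\<in>I. f i x) = (\<Sum>i\<in>I. E (f i))"
  using assms by (induction I rule: finite_induct) (simp_all add: mean_zero mean_add continuous_on_sum)

lemma trace_eq:
  assumes "finite S" "support a \<subseteq> S" shows "trace a = (\<Sum>g\<in>S \<inter> H. \<xi> g * E (a g))"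
  unfolding trace_def using assms by (intro sum.mono_neutral_left) (auto simp: mean_zero)

lemma trace_monomial: "trace (monomial f g) = (if g \<in> H then \<xi> g * E f else 0)"
proof -
  have "support (monomial f g) \<subseteq> {g}" by (auto simp: monomial_def)
  hence "trace (monomial f g) = (\<Sum>h\<in>{g} \<inter> H. \<xi> h * E (monomial f g h))" by (intro trace_eq) auto
  thus ?thesis by (simp add: monomial_def)
qed

lemma trace_add:
  assumes "a \<in> carrier B" "b \<in> carrier B" shows "trace (a \<oplus>\<^bsub>B\<^esub> b) = trace a + trace b"
proof -
  let ?S = "support a \<union> support b"
  have S: "finite ?S" "support a \<subseteq> ?S" "support b \<subseteq> ?S" "support (a \<oplus>\<^bsub>B\<^esub> b) \<subseteq> ?S"
    using assms by (auto simp: conv_carrier_iff conv_simps)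
  show ?thesis
    unfolding trace_eq[OF S(1,2)] trace_eq[OF S(1,3)] trace_eq[OF S(1,4)]
    using conv_carrierD(3)[OF assms(1)] conv_carrierD(3)[OF assms(2)]
    by (simp add: conv_simps mean_add distrib_left sum.distrib)
qed

lemma trace_smult:
  assumes "a \<in> carrier B" shows "trace (c \<odot>\<^bsub>B\<^esub> a) = c * trace a"
proof -
  have S: "finite (support a)" "support (c \<odot>\<^bsub>B\<^esub> a) \<subseteq> support a"
    using assms by (auto simp: conv_carrier_iff conv_simps)
  show ?thesis
    unfolding trace_eq[OF S] trace_eq[OF S(1) order_refl]
    using conv_carrierD(3)[OF assms] by (simp add: conv_simps mean_scale sum_distrib_left mult_ac)
qed

text \<open>Both products sit at g h. Invariance under g moves the translation from k to f, giving f
  composed with the action of g. Since g = (inv h)(g h) and g h lies in H, \<open>mean_fixed\<close>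
  lets g be replaced by inv h, which is the other product.\<close>

lemma trace_commute_monomial:
  assumes f: "continuous_on UNIV f" "g \<in> carrier G" and k: "continuous_on UNIV k" "h \<in> carrier G"
  shows "trace (monomial f g \<otimes>\<^bsub>B\<^esub> monomial k h) = trace (monomial k h \<otimes>\<^bsub>B\<^esub> monomial f g)"
proof (cases "g \<otimes> h \<in> H")
  case True
  have "E (\<lambda>x. f x * k (\<phi> (inv g) x)) = E (\<lambda>x. f (\<phi> g x) * k x)"
    using mean_invariant[of g "\<lambda>x. f x * k (\<phi> (inv g) x)"] f k
    by (simp add: continuous_comp_act continuous_on_mult)
  also have "\<dots> = E (\<lambda>x. k x * f (\<phi> (inv h) (\<phi> (g \<otimes> h) x)))"
    using f k by (simp add: mult.commute act_mult act_commute[of g h])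
  also have "\<dots> = E (\<lambda>x. k x * f (\<phi> (inv h) x))"
    using True k f by (intro mean_fixed[of _ _ "\<lambda>x. f (\<phi> (inv h) x)"]) (auto intro: continuous_comp_act)
  finally show ?thesis using True f k m_comm[of h g] by (simp add: monomial_mult trace_monomial)
qed (use f k m_comm[of h g] in \<open>simp add: monomial_mult trace_monomial\<close>)

lemma trace_tracial: "is_tracial B trace"
  unfolding is_tracial_def
proof (intro ballI)
  fix a b assume a: "a \<in> carrier B" and b: "b \<in> carrier B"
  from a show "trace (a \<otimes>\<^bsub>B\<^esub> b) = trace (b \<otimes>\<^bsub>B\<^esub> a)"
  proof (induction rule: conv_induct)
    case f: (monomial f g)
    from b show ?case
    proof (induction rule: conv_induct)
      case (monomial k h)
      thus ?case using f by (intro trace_commute_monomial)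
    next
      case (add b c)
      thus ?case using f by (simp add: conv.l_distr conv.r_distr trace_add)
    qed
  next
    case (add a c)
    thus ?case using b by (simp add: conv.l_distr conv.r_distr trace_add)
  qed
qed

section \<open>Positivity by grouping along cosets\<close>

lemma inv_mult_cancel_left:
  assumes "c \<in> carrier G" "k \<in> carrier G" "l \<in> carrier G"
  shows "inv (inv c \<otimes> k) \<otimes> (inv c \<otimes> l) = inv k \<otimes> l"
proof -
  have "c \<otimes> (inv c \<otimes> l) = l" using assms by (simp flip: m_assoc)
  thus ?thesis using assms by (simp add: inv_mult_group m_assoc)
qed

text \<open>A representative of the coset k H. The predicate that selects it depends only on the
  coset, so all members receive the same one.\<close>

definition coset_rep :: "'g \<Rightarrow> 'g" where
  "coset_rep k = (SOME c. c \<in> carrier G \<and> inv c \<otimes> k \<in> H)"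

lemma coset_rep:
  assumes "k \<in> carrier G" shows "coset_rep k \<in> carrier G" "inv (coset_rep k) \<otimes> k \<in> H"
proof -
  have "k \<in> carrier G \<and> inv k \<otimes> k \<in> H" using assms subgroup.one_closed[OF subgroup] by simp
  from someI[of "\<lambda>c. c \<in> carrier G \<and> inv c \<otimes> k \<in> H", OF this]
  show "coset_rep k \<in> carrier G" "inv (coset_rep k) \<otimes> k \<in> H" unfolding coset_rep_def by auto
qed

lemma coset_rep_eq_iff:
  assumes k: "k \<in> carrier G" and l: "l \<in> carrier G"
  shows "coset_rep k = coset_rep l \<longleftrightarrow> inv k \<otimes> l \<in> H"
proof
  assume "inv k \<otimes> l \<in> H"
  have "inv c \<otimes> k \<in> H \<longleftrightarrow> inv c \<otimes> l \<in> H" if c: "c \<in> carrier G" for c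
  proof -
    have "inv c \<otimes> l = (inv c \<otimes> k) \<otimes> (inv k \<otimes> l)"
      using c k l by (metis inv_closed m_assoc m_closed r_inv r_one)
    moreover have "inv c \<otimes> k = (inv c \<otimes> l) \<otimes> inv (inv k \<otimes> l)"
      using c k l by (metis inv_closed inv_inv inv_mult_group m_assoc m_closed r_inv r_one)
    ultimately show ?thesis
      using \<open>inv k \<otimes> l \<in> H\<close> subgroup.m_closed[OF subgroup] subgroup.m_inv_closed[OF subgroup] by metis
  qed
  thus "coset_rep k = coset_rep l" unfolding coset_rep_def by (metis (no_types, lifting))
next
  assume eq: "coset_rep k = coset_rep l"
  have "inv (inv (coset_rep k) \<otimes> k) \<otimes> (inv (coset_rep k) \<otimes> l) = inv k \<otimes> l"
    using coset_rep(1)[OF k] k l by (rule inv_mult_cancel_left)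
  thus "inv k \<otimes> l \<in> H"
    using coset_rep(2)[OF k] coset_rep(2)[OF l] eq
      subgroup.m_closed[OF subgroup] subgroup.m_inv_closed[OF subgroup] by metis
qed

lemma character_one: "\<xi> \<one> = 1"
  using character(1)[of \<one> \<one>] character(2)[of \<one>] subgroup.one_closed[OF subgroup] by auto

lemma character_inv: assumes "g \<in> H" shows "\<xi> (inv g) = cnj (\<xi> g)"
proof -
  have "\<xi> g * \<xi> (inv g) = 1"
    using character(1)[of g "inv g"] assms subgroup.m_inv_closed[OF subgroup assms] H_carrier[OF assms]
    by (simp add: character_one)
  moreover have "\<xi> g * cnj (\<xi> g) = 1" using character(2)[OF assms] by (simp flip: complex_norm_square)
  moreover have "\<xi> g \<noteq> 0" using character(2)[OF assms] by auto
  ultimately show ?thesis by (metis mult_cancel_left)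
qed

text \<open>If k = c h with c the chosen representative and h in H, this is \<xi>(h). It carries
  \<xi> over to the whole group, though not as a homomorphism.\<close>

definition twist :: "'g \<Rightarrow> complex" where "twist k = \<xi> (inv (coset_rep k) \<otimes> k)"

text \<open>With c the common representative, inv k l is the product of inv (inv c k) and inv c l.
  So the kernel \<xi>(inv k l) has rank one on each coset.\<close>

lemma character_twist:
  assumes k: "k \<in> carrier G" and l: "l \<in> carrier G" and H: "inv k \<otimes> l \<in> H"
  shows "\<xi> (inv k \<otimes> l) = cnj (twist k) * twist l"
proof -
  have eq: "coset_rep k = coset_rep l" using coset_rep_eq_iff[OF k l] H by simp
  let ?c = "coset_rep k"
  have "inv k \<otimes> l = inv (inv ?c \<otimes> k) \<otimes> (inv ?c \<otimes> l)"
    using inv_mult_cancel_left[OF coset_rep(1)[OF k] k l] by simp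
  hence "\<xi> (inv k \<otimes> l) = \<xi> (inv (inv ?c \<otimes> k)) * \<xi> (inv ?c \<otimes> l)"
    using coset_rep(2)[OF k] coset_rep(2)[OF l] eq subgroup.m_inv_closed[OF subgroup] character(1) by metis
  also have "\<xi> (inv (inv ?c \<otimes> k)) = cnj (\<xi> (inv ?c \<otimes> k))" using coset_rep(2)[OF k] by (rule character_inv)
  finally show ?thesis by (simp add: twist_def eq)
qed

lemma trace_adj_mult_monomial:
  assumes f: "continuous_on UNIV f" "g \<in> carrier G" and k: "continuous_on UNIV k" "h \<in> carrier G"
  shows "trace (adj B (monomial f g) \<otimes>\<^bsub>B\<^esub> monomial k h) =
    (if coset_rep g = coset_rep h then cnj (twist g) * twist h * E (\<lambda>x. cnj (f x) * k x) else 0)"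
proof -
  have "E (\<lambda>x. cnj (f (\<phi> g x)) * k (\<phi> g x)) = E (\<lambda>x. cnj (f x) * k x)"
    using mean_invariant[of g "\<lambda>x. cnj (f x) * k x"] f k by (simp add: continuous_on_mult continuous_on_cnj)
  thus ?thesis using f k
    by (simp add: monomial_adj monomial_mult trace_monomial coset_rep_eq_iff character_twist)
qed

text \<open>Grouping the support of \<open>a\<close> by cosets of \<open>H\<close> turns \<open>\<tau>(a\<^sup>*a)\<close> into a sum of terms \<open>E(\<bar>s\<bar>\<^sup>2)\<close>,
  because \<open>\<xi>(k\<^sup>-\<^sup>1 l)\<close> factors through the coset representative.\<close>

lemma trace_nonneg: assumes a: "a \<in> carrier B" shows "trace (adj B a \<otimes>\<^bsub>B\<^esub> a) \<in> \<real>\<^sub>\<ge>\<^sub>0"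
proof -
  note S = conv_carrierD[OF a]
  let ?S = "support a"
  define s where "s c x = (\<Sum>k\<in>{k\<in>?S. coset_rep k = c}. twist k * a k x)" for c x
  have cs: "continuous_on UNIV (s c)" for c
    unfolding s_def using S by (intro continuous_intros)
  have kS: "monomial (a k) k \<in> carrier B" if "k \<in> ?S" for k using S that by (intro monomial_closed) auto
  have "trace (adj B a \<otimes>\<^bsub>B\<^esub> a) = (\<Sum>l\<in>?S. trace (adj B a \<otimes>\<^bsub>B\<^esub> monomial (a l) l))"
    using a S by (intro additive_eq_sum_monomials) (auto simp: conv.r_distr trace_add)
  also have "\<dots> = (\<Sum>l\<in>?S. \<Sum>k\<in>?S. trace (adj B (monomial (a k) k) \<otimes>\<^bsub>B\<^esub> monomial (a l) l))"
    using S kS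
    by (intro sum.cong refl additive_eq_sum_monomials[where L = "\<lambda>b. trace (adj B b \<otimes>\<^bsub>B\<^esub> _)"])
       (auto simp: conv_adj_add conv.l_distr trace_add)
  also have "\<dots> = (\<Sum>l\<in>?S. \<Sum>k\<in>?S. if coset_rep k = coset_rep l
      then cnj (twist k) * twist l * E (\<lambda>x. cnj (a k x) * a l x) else 0)"
    using S by (intro sum.cong refl trace_adj_mult_monomial) auto
  also have "\<dots> = (\<Sum>l\<in>?S. \<Sum>k\<in>{k\<in>?S. coset_rep k = coset_rep l}.
      cnj (twist k) * twist l * E (\<lambda>x. cnj (a k x) * a l x))"
    by (rule sum.cong[OF refl], rule sum.inter_filter[symmetric], rule S(1))
  also have "\<dots> = (\<Sum>c\<in>coset_rep ` ?S. \<Sum>l\<in>{l\<in>?S. coset_rep l = c}. \<Sum>k\<in>{k\<in>?S. coset_rep k = coset_rep l}.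
      cnj (twist k) * twist l * E (\<lambda>x. cnj (a k x) * a l x))"
    by (rule sum.image_gen[OF S(1)])
  also have "\<dots> = (\<Sum>c\<in>coset_rep ` ?S. E (\<lambda>x. cnj (s c x) * s c x))"
  proof (rule sum.cong[OF refl])
    fix c assume "c \<in> coset_rep ` ?S"
    let ?C = "{k\<in>?S. coset_rep k = c}"
    have fin: "finite ?C" using S(1) by simp
    have "E (\<lambda>x. cnj (s c x) * s c x) =
        E (\<lambda>x. \<Sum>l\<in>?C. \<Sum>k\<in>?C. cnj (twist k) * twist l * (cnj (a k x) * a l x))"
      by (intro arg_cong[where f = E] ext)
         (simp add: s_def sum_distrib_left sum_distrib_right mult_ac, rule sum.swap)
    also have "\<dots> = (\<Sum>l\<in>?C. \<Sum>k\<in>?C. cnj (twist k) * twist l * E (\<lambda>x. cnj (a k x) * a l x))"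
      using S(3) fin by (simp add: mean_sum mean_scale continuous_on_sum continuous_on_mult continuous_on_cnj)
    finally show "(\<Sum>l\<in>?C. \<Sum>k\<in>{k\<in>?S. coset_rep k = coset_rep l}.
        cnj (twist k) * twist l * E (\<lambda>x. cnj (a k x) * a l x)) = E (\<lambda>x. cnj (s c x) * s c x)" by simp
  qed
  finally show ?thesis
    using mean_nonneg[OF cs] by (auto simp: complex_nonneg_Reals_iff intro!: sum_nonneg sum.neutral)
qed

lemma normalized_trace_trace: "normalized_trace B trace"
  unfolding normalized_trace_def positive_functional_def
  using trace_add trace_smult trace_nonneg trace_tracial subgroup.one_closed[OF subgroup]
  by (simp add: conv_simps(4) trace_monomial mean_one character_one)

end

section \<open>The invariant measure of a trace\<close>

context compact_abelian_system begin

lemma normalized_traceD: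
  assumes "normalized_trace B \<tau>"
  shows "positive_functional B \<tau>" "\<tau> (monomial (\<lambda>x. 1) \<one>) = 1"
    "a \<in> carrier B \<Longrightarrow> b \<in> carrier B \<Longrightarrow> \<tau> (a \<otimes>\<^bsub>B\<^esub> b) = \<tau> (b \<otimes>\<^bsub>B\<^esub> a)"
  using assms by (simp_all add: normalized_trace_def is_tracial_def conv_simps(4))

lemma act_orbit:
  assumes "y \<in> orbit G \<phi> x" "k \<in> carrier G" shows "\<phi> k y \<in> orbit G \<phi> x"
proof -
  obtain g where "g \<in> carrier G" "y = \<phi> g x" using assms(1) by (auto simp: orbit_def)
  hence "\<phi> k y = \<phi> (k \<otimes> g) x" "k \<otimes> g \<in> carrier G" using assms(2) by (simp_all add: act_mult)
  thus ?thesis unfolding orbit_def by blast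
qed

lemma self_in_orbit: "x \<in> orbit G \<phi> x"
  unfolding orbit_def using act_one[of x] by force

lemma functional_monomial:
  assumes pos: "positive_functional B \<tau>" and g: "g \<in> carrier G"
  shows "continuous_on UNIV f \<Longrightarrow> continuous_on UNIV k \<Longrightarrow>
      \<tau> (monomial (\<lambda>x. f x + k x) g) = \<tau> (monomial f g) + \<tau> (monomial k g)"
    and "continuous_on UNIV f \<Longrightarrow> \<tau> (monomial (\<lambda>x. c * f x) g) = c * \<tau> (monomial f g)"
  using conv.functional_add[OF pos, of "monomial f g" "monomial k g"]
    conv.functional_smult[OF pos, of "monomial f g" c] g
  by (simp_all add: monomial_add monomial_smult)

lemma functional_monomial_diff:
  assumes pos: "positive_functional B \<tau>" and "g \<in> carrier G" and "continuous_on UNIV f" "continuous_on UNIV k"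
  shows "\<tau> (monomial (\<lambda>x. f x - k x) g) = \<tau> (monomial f g) - \<tau> (monomial k g)"
  using functional_monomial(1)[OF assms(1-3), of "\<lambda>x. (-1) * k x"] functional_monomial(2)[OF assms(1,2,4), of "-1"] assms
  by (simp add: continuous_on_minus)

lemma functional_monomial_zero:
  assumes pos: "positive_functional B \<tau>" and "g \<in> carrier G" shows "\<tau> (monomial (\<lambda>x. 0) g) = 0"
  using functional_monomial(2)[OF assms, of "\<lambda>x. 0" 0] by simp

lemma functional_monomial_sum:
  assumes pos: "positive_functional B \<tau>" and g: "g \<in> carrier G"
    and fin: "finite I" "\<And>i. i \<in> I \<Longrightarrow> continuous_on UNIV (f i)"
  shows "\<tau> (monomial (\<lambda>x. \<Sum>i\<in>I. f i x) g) = (\<Sum>i\<in>I. \<tau> (monomial (f i) g))"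
  using fin by (induction I rule: finite_induct)
    (simp_all add: functional_monomial_zero[OF pos g] functional_monomial[OF pos g] continuous_on_sum)

text \<open>With r the square root of w, traciality rewrites \<tau>(w adj a a) as \<tau>(adj(a r) (a
  r)). Cutting a trace down by a nonnegative continuous function therefore preserves
  positivity.\<close>

lemma functional_weighted_nonneg:
  assumes tr: "normalized_trace B \<tau>" and w: "continuous_on UNIV w" "\<And>x. 0 \<le> w x" and a: "a \<in> carrier B"
  shows "\<tau> (monomial (\<lambda>x. of_real (w x)) \<one> \<otimes>\<^bsub>B\<^esub> (adj B a \<otimes>\<^bsub>B\<^esub> a)) \<in> \<real>\<^sub>\<ge>\<^sub>0"
proof -
  define r where "r = monomial (\<lambda>x. complex_of_real (sqrt (w x))) \<one>"
  have r: "r \<in> carrier B" unfolding r_def using w by (intro monomial_closed continuous_intros) auto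
  have adj_r: "adj B r = r" by (simp add: r_def monomial_adj)
  have rr: "r \<otimes>\<^bsub>B\<^esub> r = monomial (\<lambda>x. of_real (w x)) \<one>"
    using w(2) by (simp add: r_def monomial_mult flip: of_real_mult)
  have "\<tau> (adj B (a \<otimes>\<^bsub>B\<^esub> r) \<otimes>\<^bsub>B\<^esub> (a \<otimes>\<^bsub>B\<^esub> r)) = \<tau> (r \<otimes>\<^bsub>B\<^esub> (adj B a \<otimes>\<^bsub>B\<^esub> a \<otimes>\<^bsub>B\<^esub> r))"
    using a r by (simp add: conv.adj_mult adj_r conv.m_assoc)
  also have "\<dots> = \<tau> (adj B a \<otimes>\<^bsub>B\<^esub> a \<otimes>\<^bsub>B\<^esub> (r \<otimes>\<^bsub>B\<^esub> r))"
    using normalized_traceD(3)[OF tr, of r "adj B a \<otimes>\<^bsub>B\<^esub> a \<otimes>\<^bsub>B\<^esub> r"] a r by (simp add: conv.m_assoc)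
  also have "\<dots> = \<tau> (r \<otimes>\<^bsub>B\<^esub> r \<otimes>\<^bsub>B\<^esub> (adj B a \<otimes>\<^bsub>B\<^esub> a))"
    using a r by (intro normalized_traceD(3)[OF tr]) auto
  finally show ?thesis
    using conv.functional_nonneg[OF normalized_traceD(1)[OF tr], of "a \<otimes>\<^bsub>B\<^esub> r"] a r by (simp add: rr)
qed

text \<open>The working form of extremality. With c = \<sigma>(1) strictly between 0 and 1, \<tau>
  is the convex combination of \<sigma>/c and (\<tau> - \<sigma>)/(1 - c), both normalized traces.
  For c = 0 or c = 1 one of the two parts vanishes at 1, hence everywhere.\<close>

lemma extreme_trace_dominated:
  assumes ext: "extreme_trace B \<tau>" and \<sigma>: "positive_functional B \<sigma>" "is_tracial B \<sigma>"
    and diff: "positive_functional B (\<lambda>a. \<tau> a - \<sigma> a)" and a: "a \<in> carrier B"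
  shows "\<sigma> a = \<sigma> \<one>\<^bsub>B\<^esub> * \<tau> a"
proof -
  have tr: "normalized_trace B \<tau>" using ext by (simp add: extreme_trace_def)
  note \<tau> = tr[unfolded normalized_trace_def]
  define c where "c = Re (\<sigma> \<one>\<^bsub>B\<^esub>)"
  have \<sigma>1: "\<sigma> \<one>\<^bsub>B\<^esub> = of_real c" and c0: "0 \<le> c"
    using conv.functional_Re_nonneg[OF \<sigma>(1), of "\<one>\<^bsub>B\<^esub>"] conv.functional_Im_zero[OF \<sigma>(1), of "\<one>\<^bsub>B\<^esub>"]
    by (simp_all add: c_def complex_eq_iff)
  have c1: "c \<le> 1"
    using conv.functional_Re_nonneg[OF diff, of "\<one>\<^bsub>B\<^esub>"] \<tau> \<sigma>1 by simp
  have scaled: "normalized_trace B (\<lambda>a. of_real (1 / s) * \<rho> a)"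
    if \<rho>: "positive_functional B \<rho>" "is_tracial B \<rho>" "\<rho> \<one>\<^bsub>B\<^esub> = of_real s" "s > 0" for \<rho> s
  proof -
    have "of_real (1 / s) * z \<in> \<real>\<^sub>\<ge>\<^sub>0" if "z \<in> \<real>\<^sub>\<ge>\<^sub>0" for z :: complex
      using that \<rho>(4) by (auto simp: complex_nonneg_Reals_iff)
    thus ?thesis using \<rho>
      by (auto simp: normalized_trace_def positive_functional_def is_tracial_def distrib_left add_divide_distrib)
  qed
  have diff_tr: "is_tracial B (\<lambda>a. \<tau> a - \<sigma> a)" using \<sigma>(2) \<tau> by (auto simp: is_tracial_def)
  show ?thesis
  proof (cases "c = 0 \<or> c = 1")
    case True
    thus ?thesis
    proof
      assume "c = 0"
      thus ?thesis using conv.functional_eq_0_if_one_eq_0[OF \<sigma>(1) _ a] \<sigma>1 by simp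
    next
      assume "c = 1"
      thus ?thesis using conv.functional_eq_0_if_one_eq_0[OF diff _ a] \<sigma>1 \<tau> by simp
    qed
  next
    case False
    hence c: "0 < c" "c < 1" using c0 c1 by auto
    have "normalized_trace B (\<lambda>a. of_real (1 / (1 - c)) * (\<tau> a - \<sigma> a))"
      using \<sigma>1 \<tau> c by (intro scaled diff diff_tr) auto
    moreover have "normalized_trace B (\<lambda>a. of_real (1 / c) * \<sigma> a)"
      using \<sigma>1 c by (intro scaled \<sigma>) auto
    moreover have "\<tau> a = of_real (1 - c) * (of_real (1 / (1 - c)) * (\<tau> a - \<sigma> a)) + of_real c * (of_real (1 / c) * \<sigma> a)" for a
    proof -
      have 1: "complex_of_real (1 - c) * of_real (1 / (1 - c)) = 1" "complex_of_real c * of_real (1 / c) = 1"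
        using c by (simp_all flip: of_real_mult)
      show ?thesis by (simp only: 1 mult.assoc[symmetric] mult_1_left diff_add_cancel)
    qed
    ultimately have "of_real (1 / c) * \<sigma> a = \<tau> a"
      using extreme_traceD(2)[OF ext _ _ c] a by blast
    thus ?thesis using c by (simp add: \<sigma>1 field_simps)
  qed
qed

end

locale trace_measure = compact_abelian_system G \<phi>
  for G :: "('g, 'm) monoid_scheme" (structure)
    and \<phi> :: "'g \<Rightarrow> 'x::{t2_space, second_countable_topology} \<Rightarrow> 'x" +
  fixes \<tau> :: "('g \<Rightarrow> 'x \<Rightarrow> complex) \<Rightarrow> complex" and \<mu> :: "'x measure"
  assumes tr: "normalized_trace B \<tau>" and prob: "prob_space \<mu>" and sets_\<mu>: "sets \<mu> = sets borel"
    and trace_integral: "continuous_on UNIV f \<Longrightarrow> \<tau> (monomial f \<one>) = (\<integral>x. f x \<partial>\<mu>)"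

text \<open>On real functions \<tau> is real by Hermitian symmetry, and nonnegative on nonnegative
  ones by taking square roots, so the Riesz theorem applies. Complex functions follow from real and
  imaginary parts.\<close>

lemma (in compact_abelian_system) trace_measure_exists:
  assumes tr: "normalized_trace B \<tau>"
  obtains \<mu> where "trace_measure G \<phi> \<tau> \<mu>"
proof -
  note pos = normalized_traceD(1)[OF tr]
  define \<Lambda> where "\<Lambda> f = Re (\<tau> (monomial (\<lambda>x. of_real (f x)) \<one>))" for f :: "'x \<Rightarrow> real"
  have real_part: "\<tau> (monomial (\<lambda>x. of_real (f x)) \<one>) = of_real (\<Lambda> f)" if "continuous_on UNIV f" for f :: "'x \<Rightarrow> real"
  proof -
    have "monomial (\<lambda>x. of_real (f x)) \<one> \<in> carrier B" using that by (intro monomial_closed continuous_intros) auto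
    from conv.functional_adj[OF pos this] show ?thesis
      by (simp add: monomial_adj \<Lambda>_def complex_eq_iff)
  qed
  have "positive_mean \<Lambda>"
  proof
    show "compact (UNIV :: 'x set)" by (rule compact_space)
    show "\<Lambda> (\<lambda>x. f x + g x) = \<Lambda> f + \<Lambda> g" if "continuous_on UNIV f" "continuous_on UNIV g" for f g
      using functional_monomial(1)[OF pos one_closed, of "\<lambda>x. of_real (f x)" "\<lambda>x. of_real (g x)"] that
      by (simp add: \<Lambda>_def continuous_on_of_real)
    show "\<Lambda> (\<lambda>x. c * f x) = c * \<Lambda> f" if "continuous_on UNIV f" for c f
      using functional_monomial(2)[OF pos one_closed, of "\<lambda>x. of_real (f x)" "of_real c"] that
      by (simp add: \<Lambda>_def continuous_on_of_real)
    show "\<Lambda> (\<lambda>x. 1) = 1" using normalized_traceD(2)[OF tr] by (simp add: \<Lambda>_def)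
    show "0 \<le> \<Lambda> f" if "continuous_on UNIV f" "\<And>x. 0 \<le> f x" for f
      using functional_weighted_nonneg[OF tr that conv.one_closed] conv.functional_nonneg[OF pos] that
      by (simp add: \<Lambda>_def complex_nonneg_Reals_iff monomial_closed continuous_on_of_real)
  qed
  then obtain \<mu> where \<mu>: "prob_space \<mu>" "sets \<mu> = sets borel"
    and int: "\<And>f. continuous_on UNIV f \<Longrightarrow> (\<integral>x. f x \<partial>\<mu>) = \<Lambda> f"
    by (rule Riesz_representation) blast
  interpret prob_space \<mu> by fact
  have "\<tau> (monomial f \<one>) = (\<integral>x. f x \<partial>\<mu>)" if f: "continuous_on UNIV f" for f :: "'x \<Rightarrow> complex"
  proof -
    have c: "continuous_on UNIV (\<lambda>x. Re (f x))" "continuous_on UNIV (\<lambda>x. Im (f x))"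
      using f by (auto intro: continuous_intros)
    have i: "integrable \<mu> f"
      by (rule integrable_continuous_compact_UNIV[OF finite_measure_axioms \<mu>(2) compact_space f])
    have "\<tau> (monomial f \<one>) = \<tau> (monomial (\<lambda>x. of_real (Re (f x)) + \<i> * of_real (Im (f x))) \<one>)"
      by (simp flip: complex_eq)
    also have "\<dots> = of_real (\<integral>x. Re (f x) \<partial>\<mu>) + \<i> * of_real (\<integral>x. Im (f x) \<partial>\<mu>)"
      using c by (simp add: functional_monomial[OF pos one_closed] real_part int continuous_on_of_real continuous_on_mult)
    also have "\<dots> = (\<integral>x. f x \<partial>\<mu>)"
      using i by (simp add: complex_eq_iff)
    finally show ?thesis .
  qed
  thus ?thesis using tr \<mu> by (intro that[of \<mu>]) unfold_locales
qed

context trace_measure begin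

sublocale prob_space \<mu> by (rule prob)

lemma space_\<mu> [simp]: "space \<mu> = UNIV"
  using sets_eq_imp_space_eq[OF sets_\<mu>] by simp

lemma pos: "positive_functional B \<tau>"
  by (rule normalized_traceD(1)[OF tr])

lemma trace_commute: "a \<in> carrier B \<Longrightarrow> b \<in> carrier B \<Longrightarrow> \<tau> (a \<otimes>\<^bsub>B\<^esub> b) = \<tau> (b \<otimes>\<^bsub>B\<^esub> a)"
  by (rule normalized_traceD(3)[OF tr])

lemma integrable_continuous:
  "continuous_on UNIV f \<Longrightarrow> integrable \<mu> (f :: 'x \<Rightarrow> 'c::{banach, second_countable_topology})"
  by (rule integrable_continuous_compact_UNIV[OF finite_measure_axioms sets_\<mu> compact_space])

text \<open>Continuity of \<tau>(k c) in the L2(\<mu>)-norm of k. Every passage from continuous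
  functions to an indicator is controlled by this estimate.\<close>

lemma trace_Cauchy_Schwarz:
  assumes k: "continuous_on UNIV k" and c: "c \<in> carrier B"
  shows "(cmod (\<tau> (monomial k \<one> \<otimes>\<^bsub>B\<^esub> c)))\<^sup>2 \<le> (\<integral>x. (cmod (k x))\<^sup>2 \<partial>\<mu>) * Re (\<tau> (adj B c \<otimes>\<^bsub>B\<^esub> c))"
proof -
  let ?a = "monomial (\<lambda>x. cnj (k x)) \<one>"
  have a: "?a \<in> carrier B" using k by (intro monomial_closed continuous_intros) auto
  have "adj B ?a \<otimes>\<^bsub>B\<^esub> ?a = monomial (\<lambda>x. of_real ((cmod (k x))\<^sup>2)) \<one>"
    by (simp add: monomial_adj monomial_mult complex_norm_square del: of_real_power)
  moreover have "\<tau> (monomial (\<lambda>x. of_real ((cmod (k x))\<^sup>2)) \<one>) = (\<integral>x. of_real ((cmod (k x))\<^sup>2) \<partial>\<mu>)"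
    using k by (intro trace_integral continuous_intros)
  ultimately have "Re (\<tau> (adj B ?a \<otimes>\<^bsub>B\<^esub> ?a)) = (\<integral>x. (cmod (k x))\<^sup>2 \<partial>\<mu>)"
    by (simp del: of_real_power)
  thus ?thesis using conv.Cauchy_Schwarz_functional[OF pos a c] by (simp add: monomial_adj)
qed

lemma trace_monomial_bound:
  assumes f: "continuous_on UNIV f" and g: "g \<in> carrier G"
  shows "(cmod (\<tau> (monomial f g)))\<^sup>2 \<le> (\<integral>x. (cmod (f x))\<^sup>2 \<partial>\<mu>)"
  using trace_Cauchy_Schwarz[OF f, of "monomial (\<lambda>x. 1) g"] g normalized_traceD(2)[OF tr]
  by (simp add: monomial_mult monomial_adj)

lemma trace_mult_eq_0:
  assumes k: "continuous_on UNIV k" and c: "c \<in> carrier B" and AE: "AE x in \<mu>. k x = 0"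
  shows "\<tau> (monomial k \<one> \<otimes>\<^bsub>B\<^esub> c) = 0"
proof -
  have "(\<integral>x. (cmod (k x))\<^sup>2 \<partial>\<mu>) = 0"
    using AE by (intro integral_eq_zero_AE) auto
  thus ?thesis using trace_Cauchy_Schwarz[OF k c] by simp
qed

lemma trace_monomial_eq_0:
  assumes f: "continuous_on UNIV f" and g: "g \<in> carrier G" and AE: "AE x in \<mu>. f x = 0"
  shows "\<tau> (monomial f g) = 0"
  using trace_mult_eq_0[OF f _ AE, of "monomial (\<lambda>x. 1) g"] g by (simp add: monomial_mult)

lemma trace_mult_tendsto_0:
  assumes s: "\<And>n. continuous_on UNIV (s n)" "\<And>n x. cmod (s n x) \<le> K"
    and lim: "AE x in \<mu>. (\<lambda>n. s n x) \<longlonglongrightarrow> 0" and c: "c \<in> carrier B"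
  shows "(\<lambda>n. \<tau> (monomial (s n) \<one> \<otimes>\<^bsub>B\<^esub> c)) \<longlonglongrightarrow> 0"
proof -
  have "(\<lambda>n. \<integral>x. (cmod (s n x))\<^sup>2 \<partial>\<mu>) \<longlonglongrightarrow> (\<integral>x. 0 \<partial>\<mu>)"
  proof (rule integral_dominated_convergence[where w = "\<lambda>_. K\<^sup>2"])
    show "(\<lambda>x. (cmod (s n x))\<^sup>2) \<in> borel_measurable \<mu>" for n
      using s(1) by (intro borel_measurable_continuous_UNIV[OF sets_\<mu>] continuous_intros)
    show "AE x in \<mu>. (\<lambda>n. (cmod (s n x))\<^sup>2) \<longlonglongrightarrow> 0"
      using lim by eventually_elim (auto intro!: tendsto_eq_intros)
    show "AE x in \<mu>. norm ((cmod (s n x))\<^sup>2) \<le> K\<^sup>2" for n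
      using s(2) by (intro AE_I2) (simp add: power_mono)
  qed auto
  hence "(\<lambda>n. sqrt ((\<integral>x. (cmod (s n x))\<^sup>2 \<partial>\<mu>) * Re (\<tau> (adj B c \<otimes>\<^bsub>B\<^esub> c)))) \<longlonglongrightarrow> sqrt (0 * Re (\<tau> (adj B c \<otimes>\<^bsub>B\<^esub> c)))"
    by (intro tendsto_intros) simp
  hence lim0: "(\<lambda>n. sqrt ((\<integral>x. (cmod (s n x))\<^sup>2 \<partial>\<mu>) * Re (\<tau> (adj B c \<otimes>\<^bsub>B\<^esub> c)))) \<longlonglongrightarrow> 0"
    by simp
  show ?thesis
  proof (rule Lim_null_comparison[OF _ lim0], intro always_eventually allI)
    show "norm (\<tau> (monomial (s n) \<one> \<otimes>\<^bsub>B\<^esub> c)) \<le> sqrt ((\<integral>x. (cmod (s n x))\<^sup>2 \<partial>\<mu>) * Re (\<tau> (adj B c \<otimes>\<^bsub>B\<^esub> c)))" for n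
      using trace_Cauchy_Schwarz[OF s(1) c] by (rule real_le_rsqrt)
  qed
qed

text \<open>Conjugation by u_h translates f and leaves g alone, the group being abelian; a trace
  does not see conjugation.\<close>

lemma trace_monomial_act:
  assumes f: "continuous_on UNIV f" and g: "g \<in> carrier G" and h: "h \<in> carrier G"
  shows "\<tau> (monomial (\<lambda>x. f (\<phi> h x)) g) = \<tau> (monomial f g)"
proof -
  have "\<tau> (monomial (\<lambda>x. 1) (inv h) \<otimes>\<^bsub>B\<^esub> (monomial f g \<otimes>\<^bsub>B\<^esub> monomial (\<lambda>x. 1) h)) =
      \<tau> (monomial f g \<otimes>\<^bsub>B\<^esub> monomial (\<lambda>x. 1) h \<otimes>\<^bsub>B\<^esub> monomial (\<lambda>x. 1) (inv h))"
    using f g h by (intro trace_commute) auto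
  moreover have "inv h \<otimes> (g \<otimes> h) = g"
    using g h by (metis inv_closed inv_solve_left m_closed m_comm)
  moreover have "g \<otimes> h \<otimes> inv h = g" using g h by (simp add: m_assoc)
  ultimately show ?thesis using f g h by (simp add: monomial_mult)
qed

lemma integral_act:
  "continuous_on UNIV f \<Longrightarrow> h \<in> carrier G \<Longrightarrow> (\<integral>x. f (\<phi> h x) \<partial>\<mu>) = (\<integral>x. f x \<partial>\<mu>)" for f :: "'x \<Rightarrow> complex"
  using trace_monomial_act[of f \<one> h] trace_integral[of f] trace_integral[of "\<lambda>x. f (\<phi> h x)"]
  by (simp add: continuous_comp_act)

lemma invariant_measure: "\<mu> \<in> invariant_measures G \<phi>"
proof -
  have "distr \<mu> borel (\<phi> h) = \<mu>" if h: "h \<in> carrier G" for h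
  proof (rule prob_borel_eqI_integral[OF compact_space _ prob _ sets_\<mu>])
    have meas: "\<phi> h \<in> measurable \<mu> borel"
      by (rule borel_measurable_continuous_UNIV[OF sets_\<mu> continuous_act[OF h]])
    show "prob_space (distr \<mu> borel (\<phi> h))" by (rule prob_space_distr[OF meas])
    fix f :: "'x \<Rightarrow> real" assume f: "continuous_on UNIV f"
    have "(\<integral>x. f x \<partial>distr \<mu> borel (\<phi> h)) = (\<integral>x. f (\<phi> h x) \<partial>\<mu>)"
      using meas f by (intro integral_distr borel_measurable_continuous_onI)
    moreover have "complex_of_real (\<integral>x. f (\<phi> h x) \<partial>\<mu>) = complex_of_real (\<integral>x. f x \<partial>\<mu>)"
      using integral_act[of "\<lambda>x. complex_of_real (f x)" h] f h by (simp add: continuous_on_of_real)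
    ultimately show "(\<integral>x. f x \<partial>distr \<mu> borel (\<phi> h)) = (\<integral>x. f x \<partial>\<mu>)" by simp
  qed simp
  thus ?thesis using regular_borel_prob[OF compact_space prob sets_\<mu>] prob by (simp add: invariant_measures_def)
qed

text \<open>Traciality gives \<open>\<tau>((\<kappa> - \<kappa> \<circ> g\<^sup>-\<^sup>1) f u\<^sub>g) = 0\<close>; sums of such multiples of \<open>f\<close> converge to \<open>f\<close>
  away from the fixed points of \<open>g\<close>.\<close>

lemma trace_monomial_eq_0_if_fixed_null:
  assumes f: "continuous_on UNIV f" and g: "g \<in> carrier G" and null: "measure \<mu> {x. \<phi> g x = x} = 0"
  shows "\<tau> (monomial f g) = 0"
proof -
  obtain \<kappa> :: "nat \<Rightarrow> 'x \<Rightarrow> real" where \<kappa>: "\<And>i. continuous_on UNIV (\<kappa> i)"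
    and sep: "\<And>x y. x \<noteq> y \<Longrightarrow> \<exists>i. \<kappa> i x \<noteq> \<kappa> i y"
    by (rule countable_separating_family[OF compact_space]) blast
  define v where "v i x = \<kappa> i x - \<kappa> i (\<phi> (inv g) x)" for i x
  \<comment> \<open>s_n is a regularized form of \<delta>_n / \<delta>_n: the summand e_n = 1/(n+1)
    keeps the denominator positive and tends to 0. Thus s_n tends to 1 wherever some v_i is nonzero,
    that is, away from the fixed points of g.\<close>
  define \<delta> where "\<delta> n x = (\<Sum>i<n. (v i x)\<^sup>2)" for n x
  define e where "e n = 1 / (of_nat n + 1 :: real)" for n :: nat
  define s where "s n x = \<delta> n x / (\<delta> n x + e n)" for n x
  have cv: "continuous_on UNIV (v i)" for i
    unfolding v_def using \<kappa> g by (intro continuous_intros continuous_comp_act) auto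
  have c\<delta>: "continuous_on UNIV (\<delta> n)" for n unfolding \<delta>_def using cv by (intro continuous_intros)
  have \<delta>0: "0 \<le> \<delta> n x" for n x by (simp add: \<delta>_def sum_nonneg)
  have e0: "0 < e n" for n by (simp add: e_def)
  have pos_den: "\<delta> n x + e n > 0" for n x by (rule add_nonneg_pos[OF \<delta>0 e0])
  have nz: "\<delta> n x + e n \<noteq> 0" for n x by (rule pos_den[THEN less_imp_neq, symmetric])
  have cs: "continuous_on UNIV (s n)" for n
    unfolding s_def using c\<delta> nz by (intro continuous_intros) auto
  have one_s: "1 - s n x = e n / (\<delta> n x + e n)" for n x
    using nz by (simp add: s_def field_simps)
  have s01: "0 \<le> 1 - s n x" "1 - s n x \<le> 1" for n x
    unfolding one_s using pos_den \<delta>0 e0 by (auto simp: less_imp_le)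
  have lim: "(\<lambda>n. 1 - s n x) \<longlonglongrightarrow> 0" if "\<phi> g x \<noteq> x" for x
  proof -
    have "\<phi> (inv g) x \<noteq> x" using that g by (metis act_inv(2))
    then obtain i where "\<kappa> i x \<noteq> \<kappa> i (\<phi> (inv g) x)" using sep by metis
    hence v: "(v i x)\<^sup>2 > 0" by (simp add: v_def)
    have bound: "norm (1 - s n x) \<le> e n / (v i x)\<^sup>2" if "n > i" for n
    proof -
      have "(v i x)\<^sup>2 \<le> \<delta> n x" unfolding \<delta>_def using that by (intro member_le_sum) auto
      moreover have "0 \<le> 1 - s n x" by (rule s01)
      ultimately have "norm (1 - s n x) \<le> e n / (\<delta> n x + e n)" "e n / (\<delta> n x + e n) \<le> e n / (v i x)\<^sup>2"
        using e0[of n] v pos_den nz by (auto simp: one_s intro!: divide_left_mono mult_pos_pos)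
      thus ?thesis by (rule order_trans)
    qed
    have lim_e: "(\<lambda>n. e n / (v i x)\<^sup>2) \<longlonglongrightarrow> 0"
      unfolding e_def using tendsto_divide_zero[OF LIMSEQ_inverse_real_of_nat]
      by (simp add: inverse_eq_divide add.commute)
    show ?thesis
      by (rule Lim_null_comparison[OF eventually_mono[OF eventually_gt_at_top[of i]] lim_e]) (rule bound)
  qed
  have zero: "\<tau> (monomial (\<lambda>x. of_real (v i x) * F x) g) = 0" if F: "continuous_on UNIV F" for i F
  proof -
    have "\<tau> (monomial (\<lambda>x. of_real (\<kappa> i x)) \<one> \<otimes>\<^bsub>B\<^esub> monomial F g) = \<tau> (monomial F g \<otimes>\<^bsub>B\<^esub> monomial (\<lambda>x. of_real (\<kappa> i x)) \<one>)"
      using F g \<kappa> by (intro trace_commute monomial_closed continuous_intros) auto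
    hence "\<tau> (monomial (\<lambda>x. of_real (\<kappa> i x) * F x) g) = \<tau> (monomial (\<lambda>x. F x * of_real (\<kappa> i (\<phi> (inv g) x))) g)"
      using g by (simp add: monomial_mult)
    moreover have "\<tau> (monomial (\<lambda>x. of_real (\<kappa> i x) * F x - F x * of_real (\<kappa> i (\<phi> (inv g) x))) g) =
        \<tau> (monomial (\<lambda>x. of_real (\<kappa> i x) * F x) g) - \<tau> (monomial (\<lambda>x. F x * of_real (\<kappa> i (\<phi> (inv g) x))) g)"
      using F g \<kappa> by (intro functional_monomial_diff[OF pos] continuous_intros continuous_comp_act) auto
    ultimately show ?thesis by (simp add: v_def algebra_simps)
  qed
  have s_zero: "\<tau> (monomial (\<lambda>x. of_real (s n x) * f x) g) = 0" for n
  proof -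
    \<comment> \<open>Since \<delta>_n is the sum of the v_i^2, the product s_n f is a finite sum of
      multiples of the v_i, and each of these is killed by \<open>zero\<close>.\<close>
    have "of_real (s n x) * f x = (\<Sum>i<n. of_real (v i x) * (of_real (v i x / (\<delta> n x + e n)) * f x))" for x
    proof -
      have "s n x = (\<Sum>i<n. v i x * (v i x / (\<delta> n x + e n)))"
        by (simp add: s_def \<delta>_def power2_eq_square sum_divide_distrib)
      hence "complex_of_real (s n x) = (\<Sum>i<n. of_real (v i x) * of_real (v i x / (\<delta> n x + e n)))"
        by (simp only: of_real_sum of_real_mult)
      thus ?thesis by (simp only: sum_distrib_right mult.assoc)
    qed
    hence "\<tau> (monomial (\<lambda>x. of_real (s n x) * f x) g) =
        \<tau> (monomial (\<lambda>x. \<Sum>i<n. of_real (v i x) * (of_real (v i x / (\<delta> n x + e n)) * f x)) g)" by simp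
    also have "\<dots> = (\<Sum>i<n. \<tau> (monomial (\<lambda>x. of_real (v i x) * (of_real (v i x / (\<delta> n x + e n)) * f x)) g))"
      using cv c\<delta> nz f by (intro functional_monomial_sum[OF pos g] continuous_intros) auto
    also have "\<dots> = 0"
      using cv c\<delta> nz f by (intro sum.neutral ballI zero continuous_intros) auto
    finally show ?thesis .
  qed
  have closed: "closed {x. \<phi> g x = x}"
    using continuous_act[OF g] by (intro closed_Collect_eq continuous_intros)
  have AE: "AE x in \<mu>. \<phi> g x \<noteq> x"
  proof (rule AE_I[where N = "{x. \<phi> g x = x}"])
    show "emeasure \<mu> {x. \<phi> g x = x} = 0" using null by (simp add: emeasure_eq_measure)
    show "{x. \<phi> g x = x} \<in> sets \<mu>" unfolding sets_\<mu> using closed by simp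
  qed auto
  have "(\<lambda>n. \<tau> (monomial (\<lambda>x. of_real (1 - s n x)) \<one> \<otimes>\<^bsub>B\<^esub> monomial f g)) \<longlonglongrightarrow> 0"
  proof (rule trace_mult_tendsto_0[where K = 1])
    show "continuous_on UNIV (\<lambda>x. complex_of_real (1 - s n x))" for n using cs by (intro continuous_intros)
    show "cmod (of_real (1 - s n x)) \<le> 1" for n x
      unfolding norm_of_real abs_of_nonneg[OF s01(1)] by (rule s01)
    show "AE x in \<mu>. (\<lambda>n. complex_of_real (1 - s n x)) \<longlonglongrightarrow> 0"
      using AE
    proof eventually_elim
      fix x assume "\<phi> g x \<noteq> x"
      from tendsto_of_real[OF lim[OF this], where 'a = complex]
      show "(\<lambda>n. complex_of_real (1 - s n x)) \<longlonglongrightarrow> 0" by simp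
    qed
  qed (use f g in simp)
  moreover have "\<tau> (monomial (\<lambda>x. of_real (1 - s n x)) \<one> \<otimes>\<^bsub>B\<^esub> monomial f g) = \<tau> (monomial f g)" for n
  proof -
    have "monomial (\<lambda>x. of_real (1 - s n x)) \<one> \<otimes>\<^bsub>B\<^esub> monomial f g = monomial (\<lambda>x. f x - of_real (s n x) * f x) g"
      using g by (simp add: monomial_mult algebra_simps)
    moreover have "\<tau> (monomial (\<lambda>x. f x - of_real (s n x) * f x) g) =
        \<tau> (monomial f g) - \<tau> (monomial (\<lambda>x. of_real (s n x) * f x) g)"
      using f g cs by (intro functional_monomial_diff[OF pos] continuous_intros) auto
    ultimately show ?thesis by (simp add: s_zero)
  qed
  ultimately show ?thesis by (simp add: LIMSEQ_const_iff)
qed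

lemma AE_in_full: "F \<in> sets \<mu> \<Longrightarrow> measure \<mu> F = 1 \<Longrightarrow> AE x in \<mu>. x \<in> F"
  by (simp add: AE_in_set_eq_1)

text \<open>For g in the stabilizer, the translates of f by elements carrying x to each orbit point
  sum to a function that is constant on the orbit, hence \<mu>-almost everywhere, and all translates
  have the same trace. Any other g fixes no point of the orbit, because all its points have the same
  stabilizer; its fixed points are then \<mu>-null.\<close>

lemma trace_on_finite_orbit:
  assumes fin: "finite (orbit G \<phi> x)" and full: "measure \<mu> (orbit G \<phi> x) = 1"
    and f: "continuous_on UNIV f" and g: "g \<in> carrier G"
  shows "\<tau> (monomial f g) =
    (if g \<in> stabilizer G \<phi> x
     then \<tau> (monomial (\<lambda>x. 1) g) / of_nat (card (orbit G \<phi> x)) * (\<Sum>y\<in>orbit G \<phi> x. f y) else 0)"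
proof -
  let ?Q = "orbit G \<phi> x"
  note xQ = self_in_orbit[of x]
  have "?Q \<in> sets \<mu>" using fin unfolding sets_\<mu> by (intro borel_closed finite_imp_closed)
  hence AE: "AE y in \<mu>. y \<in> ?Q" using full by (rule AE_in_full)
  show ?thesis
  proof (cases "g \<in> stabilizer G \<phi> x")
    case True
    have "\<exists>h. h \<in> carrier G \<and> \<phi> h x = y" if "y \<in> ?Q" for y using that by (auto simp: orbit_def)
    then obtain h where h: "\<And>y. y \<in> ?Q \<Longrightarrow> h y \<in> carrier G" "\<And>y. y \<in> ?Q \<Longrightarrow> \<phi> (h y) x = y" by metis
    define F where "F z = (\<Sum>y\<in>?Q. f (\<phi> (h y) z))" for z
    have cF: "continuous_on UNIV F"
      unfolding F_def using h f by (intro continuous_intros continuous_comp_act)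
    have F_const: "F z = (\<Sum>y\<in>?Q. f y)" if zQ: "z \<in> ?Q" for z
    proof -
      obtain k where k: "k \<in> carrier G" "z = \<phi> k x" using zQ by (auto simp: orbit_def)
      have "F z = (\<Sum>y\<in>?Q. f (\<phi> k y))"
        unfolding F_def k(2) by (rule sum.cong) (simp_all add: act_commute[OF h(1) k(1)] h)
      also have "\<dots> = (\<Sum>y\<in>?Q. f y)"
      proof (rule sum.reindex_bij_witness[of _ "\<phi> (inv k)" "\<phi> k"])
      qed (use k in \<open>auto simp: act_orbit\<close>)
      finally show ?thesis .
    qed
    let ?S = "\<Sum>y\<in>?Q. f y"
    have "of_nat (card ?Q) * \<tau> (monomial f g) = (\<Sum>y\<in>?Q. \<tau> (monomial (\<lambda>z. f (\<phi> (h y) z)) g))"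
      using f g h by (simp add: trace_monomial_act)
    also have "\<dots> = \<tau> (monomial F g)"
      unfolding F_def using fin f g h by (intro functional_monomial_sum[OF pos, symmetric] continuous_comp_act)
    also have "\<dots> = \<tau> (monomial (\<lambda>z. ?S * 1) g)"
    proof -
      have "\<tau> (monomial (\<lambda>z. F z - ?S * 1) g) = 0"
        using AE cF g by (intro trace_monomial_eq_0 continuous_intros) (auto simp: F_const)
      thus ?thesis using functional_monomial_diff[OF pos g cF, of "\<lambda>z. ?S * 1"] by simp
    qed
    also have "\<dots> = ?S * \<tau> (monomial (\<lambda>z. 1) g)" by (rule functional_monomial(2)[OF pos g]) simp
    finally have "of_nat (card ?Q) * \<tau> (monomial f g) = ?S * \<tau> (monomial (\<lambda>z. 1) g)" .
    moreover have "card ?Q \<noteq> 0" using fin xQ by auto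
    ultimately show ?thesis using True by (simp add: field_simps)
  next
    case False
    have "measure \<mu> {y. \<phi> g y = y} = 0"
    proof -
      have "\<phi> g y \<noteq> y" if yQ: "y \<in> ?Q" for y
      proof
        assume "\<phi> g y = y"
        obtain k where k: "k \<in> carrier G" "y = \<phi> k x" using yQ by (auto simp: orbit_def)
        have "\<phi> k (\<phi> g x) = \<phi> k x" using \<open>\<phi> g y = y\<close> k act_commute[OF k(1) g] by simp
        hence "\<phi> g x = x" using act_eq_iff[OF k(1)] by simp
        thus False using False g by (simp add: stabilizer_def)
      qed
      hence "AE y in \<mu>. y \<notin> {y. \<phi> g y = y}" using AE by auto
      moreover have "{y. \<phi> g y = y} \<in> sets \<mu>"
        unfolding sets_\<mu> using continuous_act[OF g] by (intro borel_closed closed_Collect_eq continuous_intros)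
      ultimately show ?thesis using prob_eq_0 by blast
    qed
    thus ?thesis using trace_monomial_eq_0_if_fixed_null[OF f g] False by simp
  qed
qed

end

section \<open>Extreme traces\<close>

context trace_measure begin

lemma finite_in_sets: "finite F \<Longrightarrow> F \<in> sets \<mu>"
  unfolding sets_\<mu> by (intro borel_closed finite_imp_closed)

lemma trace_mult_cong_AE:
  assumes f: "continuous_on UNIV f" and k: "continuous_on UNIV k" and g: "g \<in> carrier G"
    and a: "a \<in> carrier B" and AE: "AE x in \<mu>. f x = k x"
  shows "\<tau> (monomial f g \<otimes>\<^bsub>B\<^esub> a) = \<tau> (monomial k g \<otimes>\<^bsub>B\<^esub> a)"
proof -
  let ?d = "\<lambda>x. f x - k x"
  have d: "continuous_on UNIV ?d" using f k by (intro continuous_intros)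
  have "monomial f g = monomial k g \<oplus>\<^bsub>B\<^esub> monomial ?d g" by (simp add: monomial_add)
  hence "\<tau> (monomial f g \<otimes>\<^bsub>B\<^esub> a) = \<tau> (monomial k g \<otimes>\<^bsub>B\<^esub> a) + \<tau> (monomial ?d g \<otimes>\<^bsub>B\<^esub> a)"
    using d k g a by (simp add: conv.l_distr conv.functional_add[OF pos])
  also have "monomial ?d g \<otimes>\<^bsub>B\<^esub> a = monomial ?d \<one> \<otimes>\<^bsub>B\<^esub> (monomial (\<lambda>x. 1) g \<otimes>\<^bsub>B\<^esub> a)"
    using conv.m_assoc[of "monomial ?d \<one>" "monomial (\<lambda>x. 1) g" a] d g a by (simp add: monomial_mult)
  also have "\<tau> \<dots> = 0" using AE d g a by (intro trace_mult_eq_0) auto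
  finally show ?thesis by simp
qed

text \<open>Cutting \<open>\<tau>\<close> down to \<open>F\<close> gives the positive tracial functional
  \<open>\<sigma>(a) = lim \<tau>((1 - k\<^sub>n) a) \<le> \<tau>\<close> with \<open>\<sigma>(1) = \<mu>(F)\<close>, where \<open>1 - k\<^sub>n\<close> decreases to the indicator of \<open>F\<close>.\<close>

lemma extreme_trace_measure_finite_invariant:
  assumes ext: "extreme_trace B \<tau>" and F: "finite F"
    and inv: "\<And>g y. g \<in> carrier G \<Longrightarrow> y \<in> F \<Longrightarrow> \<phi> g y \<in> F"
  shows "measure \<mu> F = 0 \<or> measure \<mu> F = 1"
proof -
  have oF: "open (- F)" using finite_imp_closed[OF F] by (simp add: open_Compl)
  obtain k :: "nat \<Rightarrow> 'x \<Rightarrow> real" where k: "increases_to_indicator k (- F)"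
    by (rule continuous_increasing_to_indicator_open[OF compact_space oF])
  note ck = increases_to_indicatorD(1)[OF k] and k0 = increases_to_indicatorD(2)[OF k]
    and k1 = increases_to_indicatorD(3)[OF k] and kF = increases_to_indicatorD(4)[OF k]
  have k_mono: "k i x \<le> k j x" if "i \<le> j" for i j x
    by (rule lift_Suc_mono_le[OF _ that]) (rule increases_to_indicatorD(6)[OF k])
  define I where "I n = (\<integral>x. k n x \<partial>\<mu>)" for n
  have I_lim: "I \<longlonglongrightarrow> measure \<mu> (- F)"
    unfolding I_def by (rule integral_tendsto_measure_open[OF prob sets_\<mu> k oF])
  define S where "S n = monomial (\<lambda>x. complex_of_real (1 - k n x)) \<one>" for n
  have SB: "S n \<in> carrier B" for n unfolding S_def using ck by (intro monomial_closed continuous_intros) auto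
  \<comment> \<open>The difference of two terms has modulus at most 1 and constant sign, so its
    square is at most its modulus. L2-distances are thus controlled by the convergent sequence of
    integrals, and \<tau>(S_n a) is Cauchy.\<close>
  have sq_le: "(\<integral>x. (cmod (of_real (k j x - k i x)))\<^sup>2 \<partial>\<mu>) \<le> \<bar>I j - I i\<bar>" for i j
  proof -
    have *: "(\<integral>x. (k j x - k i x)\<^sup>2 \<partial>\<mu>) \<le> I j - I i" if ij: "i \<le> j" for i j
    proof -
      have "(k j x - k i x)\<^sup>2 \<le> k j x - k i x" for x
      proof -
        have "0 \<le> k j x - k i x" "k j x - k i x \<le> 1"
          using k_mono[OF ij, of x] k0[of i x] k1[of j x] by linarith+
        thus ?thesis unfolding power2_eq_square using mult_left_mono[of "k j x - k i x" 1 "k j x - k i x"] by simp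
      qed
      hence "(\<integral>x. (k j x - k i x)\<^sup>2 \<partial>\<mu>) \<le> (\<integral>x. k j x - k i x \<partial>\<mu>)"
        using ck by (intro integral_mono integrable_continuous continuous_intros) auto
      thus ?thesis using integrable_continuous[OF ck] by (simp add: I_def)
    qed
    show ?thesis unfolding norm_of_real power2_abs
    proof (cases "i \<le> j")
      case False
      thus "(\<integral>x. (k j x - k i x)\<^sup>2 \<partial>\<mu>) \<le> \<bar>I j - I i\<bar>" using *[of j i] by (simp add: power2_commute)
    next
      case True
      thus "(\<integral>x. (k j x - k i x)\<^sup>2 \<partial>\<mu>) \<le> \<bar>I j - I i\<bar>" using *[of i j] by simp
    qed
  qed
  have conv: "convergent (\<lambda>n. \<tau> (S n \<otimes>\<^bsub>B\<^esub> a))" if a: "a \<in> carrier B" for a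
  proof (rule Cauchy_convergent, rule CauchyI)
    fix e :: real assume e: "e > 0"
    define C where "C = Re (\<tau> (adj B a \<otimes>\<^bsub>B\<^esub> a))"
    have C: "C \<ge> 0" unfolding C_def using conv.functional_Re_nonneg[OF pos a] .
    have "Cauchy I" using I_lim by (rule LIMSEQ_imp_Cauchy)
    moreover have "e\<^sup>2 / (C + 1) > 0" using e C by (intro divide_pos_pos) auto
    ultimately obtain N where N: "\<And>m n. m \<ge> N \<Longrightarrow> n \<ge> N \<Longrightarrow> \<bar>I m - I n\<bar> < e\<^sup>2 / (C + 1)"
      using CauchyD[of I "e\<^sup>2 / (C + 1)"] by (auto simp: real_norm_def)
    have "norm (\<tau> (S m \<otimes>\<^bsub>B\<^esub> a) - \<tau> (S n \<otimes>\<^bsub>B\<^esub> a)) < e" if mn: "m \<ge> N" "n \<ge> N" for m n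
    proof (rule power2_less_imp_less)
      let ?d = "\<lambda>x. complex_of_real (k n x - k m x)"
      have d: "continuous_on UNIV ?d" using ck by (intro continuous_intros)
      have "S m = S n \<oplus>\<^bsub>B\<^esub> monomial ?d \<one>" by (simp add: S_def monomial_add)
      hence "\<tau> (S m \<otimes>\<^bsub>B\<^esub> a) = \<tau> (S n \<otimes>\<^bsub>B\<^esub> a) + \<tau> (monomial ?d \<one> \<otimes>\<^bsub>B\<^esub> a)"
        using d SB a by (simp add: conv.l_distr conv.functional_add[OF pos])
      hence "(norm (\<tau> (S m \<otimes>\<^bsub>B\<^esub> a) - \<tau> (S n \<otimes>\<^bsub>B\<^esub> a)))\<^sup>2 = (cmod (\<tau> (monomial ?d \<one> \<otimes>\<^bsub>B\<^esub> a)))\<^sup>2" by simp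
      also have "\<dots> \<le> (\<integral>x. (cmod (?d x))\<^sup>2 \<partial>\<mu>) * C" unfolding C_def by (rule trace_Cauchy_Schwarz[OF d a])
      also have "\<dots> \<le> \<bar>I n - I m\<bar> * C" using C sq_le by (intro mult_right_mono)
      also have "\<dots> \<le> \<bar>I n - I m\<bar> * (C + 1)" by (intro mult_left_mono) auto
      also have "\<dots> < e\<^sup>2 / (C + 1) * (C + 1)" using C N[OF mn(2,1)] by (intro mult_strict_right_mono) auto
      also have "\<dots> = e\<^sup>2" using C by simp
      finally show "(norm (\<tau> (S m \<otimes>\<^bsub>B\<^esub> a) - \<tau> (S n \<otimes>\<^bsub>B\<^esub> a)))\<^sup>2 < e\<^sup>2" .
    qed (use e in simp)
    thus "\<exists>M. \<forall>m\<ge>M. \<forall>n\<ge>M. norm (\<tau> (S m \<otimes>\<^bsub>B\<^esub> a) - \<tau> (S n \<otimes>\<^bsub>B\<^esub> a)) < e" by blast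
  qed
  define \<sigma> where "\<sigma> a = lim (\<lambda>n. \<tau> (S n \<otimes>\<^bsub>B\<^esub> a))" for a
  have \<sigma>_lim: "(\<lambda>n. \<tau> (S n \<otimes>\<^bsub>B\<^esub> a)) \<longlonglongrightarrow> \<sigma> a" if "a \<in> carrier B" for a
    unfolding \<sigma>_def using conv[OF that] by (simp add: convergent_LIMSEQ_iff)
  have \<sigma>_eq: "\<sigma> a = z" if "(\<lambda>n. \<tau> (S n \<otimes>\<^bsub>B\<^esub> a)) \<longlonglongrightarrow> z" for a z
    unfolding \<sigma>_def using that by (rule limI)
  have rest_lim: "(\<lambda>n. \<tau> (monomial (\<lambda>x. of_real (k n x)) \<one> \<otimes>\<^bsub>B\<^esub> a)) \<longlonglongrightarrow> \<tau> a - \<sigma> a"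
    if a: "a \<in> carrier B" for a
  proof -
    have "\<tau> (monomial (\<lambda>x. of_real (k n x)) \<one> \<otimes>\<^bsub>B\<^esub> a) = \<tau> a - \<tau> (S n \<otimes>\<^bsub>B\<^esub> a)" for n
    proof -
      have kB: "monomial (\<lambda>x. complex_of_real (k n x)) \<one> \<in> carrier B"
        using ck by (intro monomial_closed continuous_intros) auto
      have "\<one>\<^bsub>B\<^esub> = S n \<oplus>\<^bsub>B\<^esub> monomial (\<lambda>x. of_real (k n x)) \<one>" by (simp add: S_def monomial_add conv_simps(4))
      hence "a = S n \<otimes>\<^bsub>B\<^esub> a \<oplus>\<^bsub>B\<^esub> monomial (\<lambda>x. of_real (k n x)) \<one> \<otimes>\<^bsub>B\<^esub> a"
        using conv.l_distr[OF SB[of n] kB a] conv.l_one[OF a] by simp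
      from arg_cong[OF this, of \<tau>] show ?thesis
        using SB kB a by (simp add: conv.functional_add[OF pos])
    qed
    thus ?thesis using tendsto_diff[OF tendsto_const \<sigma>_lim[OF a]] by simp
  qed
  have linear: "\<sigma> (a \<oplus>\<^bsub>B\<^esub> b) = \<sigma> a + \<sigma> b" "\<sigma> (c \<odot>\<^bsub>B\<^esub> a) = c * \<sigma> a"
    if "a \<in> carrier B" "b \<in> carrier B" for a b c
  proof -
    show "\<sigma> (a \<oplus>\<^bsub>B\<^esub> b) = \<sigma> a + \<sigma> b"
      using tendsto_add[OF \<sigma>_lim[OF that(1)] \<sigma>_lim[OF that(2)]] SB that
      by (intro \<sigma>_eq) (simp add: conv.r_distr conv.functional_add[OF pos])
    show "\<sigma> (c \<odot>\<^bsub>B\<^esub> a) = c * \<sigma> a"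
      using tendsto_mult_left[OF \<sigma>_lim[OF that(1)]] SB that
      by (intro \<sigma>_eq) (simp add: conv.smult_mult_right conv.functional_smult[OF pos])
  qed
  have \<sigma>_pos: "positive_functional B \<sigma>"
    unfolding positive_functional_def
  proof (intro conjI ballI allI)
    fix a assume a: "a \<in> carrier B"
    show "\<sigma> (adj B a \<otimes>\<^bsub>B\<^esub> a) \<in> \<real>\<^sub>\<ge>\<^sub>0"
    proof (rule Lim_in_closed_set[OF closed_nonneg_Reals_complex _ sequentially_bot \<sigma>_lim])
      show "\<forall>\<^sub>F n in sequentially. \<tau> (S n \<otimes>\<^bsub>B\<^esub> (adj B a \<otimes>\<^bsub>B\<^esub> a)) \<in> \<real>\<^sub>\<ge>\<^sub>0"
        unfolding S_def using ck k1
        by (intro always_eventually allI functional_weighted_nonneg[OF tr _ _ a] continuous_intros) auto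
    qed (use a in simp)
  qed (use linear in auto)
  have rest_pos: "positive_functional B (\<lambda>a. \<tau> a - \<sigma> a)"
    unfolding positive_functional_def
  proof (intro conjI ballI allI)
    fix a assume a: "a \<in> carrier B"
    show "\<tau> (adj B a \<otimes>\<^bsub>B\<^esub> a) - \<sigma> (adj B a \<otimes>\<^bsub>B\<^esub> a) \<in> \<real>\<^sub>\<ge>\<^sub>0"
    proof (rule Lim_in_closed_set[OF closed_nonneg_Reals_complex _ sequentially_bot rest_lim])
      show "\<forall>\<^sub>F n in sequentially. \<tau> (monomial (\<lambda>x. of_real (k n x)) \<one> \<otimes>\<^bsub>B\<^esub> (adj B a \<otimes>\<^bsub>B\<^esub> a)) \<in> \<real>\<^sub>\<ge>\<^sub>0"
        using ck k0 by (intro always_eventually allI functional_weighted_nonneg[OF tr _ _ a])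
    qed (use a in simp)
  qed (use linear in \<open>auto simp: conv.functional_add[OF pos] conv.functional_smult[OF pos] algebra_simps\<close>)
  \<comment> \<open>S_n commutes with f u_g up to the factor k_n(inv g x) - k_n(x), which tends to 0
    at every x because F is invariant. In the limit, this makes \<sigma> tracial.\<close>
  have comm: "(\<lambda>n. \<tau> (S n \<otimes>\<^bsub>B\<^esub> a \<otimes>\<^bsub>B\<^esub> b) - \<tau> (a \<otimes>\<^bsub>B\<^esub> S n \<otimes>\<^bsub>B\<^esub> b)) \<longlonglongrightarrow> 0"
    if "a \<in> carrier B" and b: "b \<in> carrier B" for a b
    using that(1)
  proof (induction rule: conv_induct)
    case (monomial f g)
    define s where "s n x = complex_of_real (k n (\<phi> (inv g) x) - k n x)" for n x
    have cs: "continuous_on UNIV (s n)" for n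
      unfolding s_def using ck monomial by (intro continuous_intros continuous_comp_act) auto
    have "\<tau> (S n \<otimes>\<^bsub>B\<^esub> monomial f g \<otimes>\<^bsub>B\<^esub> b) - \<tau> (monomial f g \<otimes>\<^bsub>B\<^esub> S n \<otimes>\<^bsub>B\<^esub> b) =
        \<tau> (monomial (s n) \<one> \<otimes>\<^bsub>B\<^esub> (monomial f g \<otimes>\<^bsub>B\<^esub> b))" for n
    proof -
      have fB: "monomial f g \<in> carrier B" "monomial (s n) \<one> \<in> carrier B" using monomial cs by auto
      have "S n \<otimes>\<^bsub>B\<^esub> monomial f g = monomial f g \<otimes>\<^bsub>B\<^esub> S n \<oplus>\<^bsub>B\<^esub> monomial (s n) \<one> \<otimes>\<^bsub>B\<^esub> monomial f g"
        using monomial by (simp add: S_def s_def monomial_mult monomial_add algebra_simps)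
      hence "S n \<otimes>\<^bsub>B\<^esub> monomial f g \<otimes>\<^bsub>B\<^esub> b =
          monomial f g \<otimes>\<^bsub>B\<^esub> S n \<otimes>\<^bsub>B\<^esub> b \<oplus>\<^bsub>B\<^esub> monomial (s n) \<one> \<otimes>\<^bsub>B\<^esub> monomial f g \<otimes>\<^bsub>B\<^esub> b"
        using fB SB b by (simp add: conv.l_distr)
      thus ?thesis using fB SB b by (simp add: conv.functional_add[OF pos] conv.m_assoc)
    qed
    moreover have "(\<lambda>n. \<tau> (monomial (s n) \<one> \<otimes>\<^bsub>B\<^esub> (monomial f g \<otimes>\<^bsub>B\<^esub> b))) \<longlonglongrightarrow> 0"
    proof (rule trace_mult_tendsto_0[OF cs])
      show "cmod (s n x) \<le> 1" for n x
        unfolding s_def norm_of_real using k0[of n x] k1[of n x] k0[of n "\<phi> (inv g) x"] k1[of n "\<phi> (inv g) x"]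
        by (intro abs_leI) linarith+
      have "\<phi> (inv g) x \<in> F \<longleftrightarrow> x \<in> F" for x
        using inv[of "inv g" x] inv[of g "\<phi> (inv g) x"] monomial(2) by auto
      hence "(\<lambda>n. k n (\<phi> (inv g) x) - k n x) \<longlonglongrightarrow> 0" for x
        using tendsto_diff[OF increases_to_indicator_tendsto[OF k, of "\<phi> (inv g) x"] increases_to_indicator_tendsto[OF k, of x]]
        by (simp add: indicator_def)
      thus "AE x in \<mu>. (\<lambda>n. s n x) \<longlonglongrightarrow> 0"
        unfolding s_def using tendsto_of_real[where 'a = complex] by (intro AE_I2) fastforce
    qed (use monomial b in auto)
    ultimately show ?case by simp
  next
    case (add a c)
    have "(\<lambda>n. (\<tau> (S n \<otimes>\<^bsub>B\<^esub> a \<otimes>\<^bsub>B\<^esub> b) - \<tau> (a \<otimes>\<^bsub>B\<^esub> S n \<otimes>\<^bsub>B\<^esub> b)) +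
        (\<tau> (S n \<otimes>\<^bsub>B\<^esub> c \<otimes>\<^bsub>B\<^esub> b) - \<tau> (c \<otimes>\<^bsub>B\<^esub> S n \<otimes>\<^bsub>B\<^esub> b))) \<longlonglongrightarrow> 0"
      using tendsto_add[OF add.IH] by simp
    thus ?case using add.hyps SB b
      by (simp add: conv.l_distr conv.r_distr conv.functional_add[OF pos] algebra_simps)
  qed
  have \<sigma>_tr: "is_tracial B \<sigma>"
    unfolding is_tracial_def
  proof (intro ballI)
    fix a b assume a: "a \<in> carrier B" and b: "b \<in> carrier B"
    have "\<tau> (S n \<otimes>\<^bsub>B\<^esub> (b \<otimes>\<^bsub>B\<^esub> a)) = \<tau> (a \<otimes>\<^bsub>B\<^esub> S n \<otimes>\<^bsub>B\<^esub> b)" for n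
      using trace_commute[of "S n \<otimes>\<^bsub>B\<^esub> b" a] SB[of n] a b by (simp add: conv.m_assoc)
    hence "(\<lambda>n. \<tau> (S n \<otimes>\<^bsub>B\<^esub> (a \<otimes>\<^bsub>B\<^esub> b)) - \<tau> (S n \<otimes>\<^bsub>B\<^esub> (b \<otimes>\<^bsub>B\<^esub> a))) \<longlonglongrightarrow> 0"
      using comm[OF a b] SB a b by (simp add: conv.m_assoc)
    moreover have "(\<lambda>n. \<tau> (S n \<otimes>\<^bsub>B\<^esub> (a \<otimes>\<^bsub>B\<^esub> b)) - \<tau> (S n \<otimes>\<^bsub>B\<^esub> (b \<otimes>\<^bsub>B\<^esub> a))) \<longlonglongrightarrow> \<sigma> (a \<otimes>\<^bsub>B\<^esub> b) - \<sigma> (b \<otimes>\<^bsub>B\<^esub> a)"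
      using a b by (intro tendsto_diff \<sigma>_lim) auto
    ultimately have "0 = \<sigma> (a \<otimes>\<^bsub>B\<^esub> b) - \<sigma> (b \<otimes>\<^bsub>B\<^esub> a)" by (rule LIMSEQ_unique)
    thus "\<sigma> (a \<otimes>\<^bsub>B\<^esub> b) = \<sigma> (b \<otimes>\<^bsub>B\<^esub> a)" by simp
  qed
  have dom: "\<sigma> a = \<sigma> \<one>\<^bsub>B\<^esub> * \<tau> a" if "a \<in> carrier B" for a
    by (rule extreme_trace_dominated[OF ext \<sigma>_pos \<sigma>_tr rest_pos that])
  have S_int: "\<tau> (S n) = of_real (1 - I n)" for n
  proof -
    have "\<tau> (S n) = (\<integral>x. complex_of_real (1 - k n x) \<partial>\<mu>)"
      unfolding S_def using ck by (intro trace_integral continuous_intros)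
    also have "\<dots> = of_real (\<integral>x. 1 - k n x \<partial>\<mu>)" by (rule integral_complex_of_real)
    also have "(\<integral>x. 1 - k n x \<partial>\<mu>) = 1 - I n"
      using integrable_continuous[OF ck] prob_space by (simp add: I_def)
    finally show ?thesis .
  qed
  have F_compl: "1 - measure \<mu> (- F) = measure \<mu> F"
    using prob_compl[OF finite_in_sets[OF F]] by (simp add: Compl_eq_Diff_UNIV)
  have S_lim: "(\<lambda>n. \<tau> (S n)) \<longlonglongrightarrow> of_real (measure \<mu> F)"
    unfolding S_int F_compl[symmetric] by (intro tendsto_intros I_lim)
  have \<sigma>1: "\<sigma> \<one>\<^bsub>B\<^esub> = of_real (measure \<mu> F)"
    using S_lim SB by (intro \<sigma>_eq) simp
  \<comment> \<open>The proportionality \<sigma> = \<mu>(F) \<tau> is tested on S_j. Here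
    \<sigma>(S_j) = \<mu>(F), as 1 - k_j is 1 on F, while \<tau>(S_j) tends to \<mu>(F). Hence
    \<mu>(F) equals its own square.\<close>
  have \<sigma>S: "\<sigma> (S j) = of_real (measure \<mu> F)" for j
  proof (rule \<sigma>_eq)
    have "(\<lambda>n. \<integral>x. (1 - k n x) * (1 - k j x) \<partial>\<mu>) \<longlonglongrightarrow> (\<integral>x. indicator F x \<partial>\<mu>)"
    proof (rule integral_tendsto_continuous[OF prob sets_\<mu>, where K = 1])
      show "continuous_on UNIV (\<lambda>x. (1 - k n x) * (1 - k j x))" for n using ck by (intro continuous_intros)
      show "norm ((1 - k n x) * (1 - k j x)) \<le> 1" for n x
        using k0 k1 by (simp add: abs_mult mult_le_one)
      show "(\<lambda>n. (1 - k n x) * (1 - k j x)) \<longlonglongrightarrow> indicator F x" for x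
      proof -
        have "(\<lambda>n. (1 - k n x) * (1 - k j x)) \<longlonglongrightarrow> (1 - indicator (- F) x) * (1 - k j x)"
          by (intro tendsto_intros increases_to_indicator_tendsto[OF k])
        moreover have "(1 - indicator (- F) x) * (1 - k j x) = (indicator F x :: real)"
          using kF[of x j] by (simp add: indicator_def)
        ultimately show ?thesis by simp
      qed
    qed
    hence "(\<lambda>n. \<integral>x. (1 - k n x) * (1 - k j x) \<partial>\<mu>) \<longlonglongrightarrow> measure \<mu> F"
      using finite_in_sets[OF F] by simp
    from tendsto_of_real[OF this, where 'a = complex]
    show "(\<lambda>n. \<tau> (S n \<otimes>\<^bsub>B\<^esub> S j)) \<longlonglongrightarrow> of_real (measure \<mu> F)"
    proof -
      have "\<tau> (S n \<otimes>\<^bsub>B\<^esub> S j) = of_real (\<integral>x. (1 - k n x) * (1 - k j x) \<partial>\<mu>)" for n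
      proof -
        have "S n \<otimes>\<^bsub>B\<^esub> S j = monomial (\<lambda>x. complex_of_real ((1 - k n x) * (1 - k j x))) \<one>"
          by (simp add: S_def monomial_mult)
        moreover have "\<tau> (monomial (\<lambda>x. complex_of_real ((1 - k n x) * (1 - k j x))) \<one>) =
            (\<integral>x. complex_of_real ((1 - k n x) * (1 - k j x)) \<partial>\<mu>)"
          using ck by (intro trace_integral continuous_intros)
        ultimately show ?thesis by (simp only: integral_complex_of_real)
      qed
      thus "(\<lambda>n. complex_of_real (\<integral>x. (1 - k n x) * (1 - k j x) \<partial>\<mu>)) \<longlonglongrightarrow> of_real (measure \<mu> F) \<Longrightarrow> ?thesis"
        by simp
    qed
  qed
  have "of_real (measure \<mu> F) * \<tau> (S j) = of_real (measure \<mu> F)" for j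
    using dom[OF SB[of j]] by (simp only: \<sigma>S \<sigma>1)
  hence "(\<lambda>j. of_real (measure \<mu> F) * \<tau> (S j)) \<longlonglongrightarrow> complex_of_real (measure \<mu> F)"
    by (simp only: tendsto_const)
  moreover have "(\<lambda>j. of_real (measure \<mu> F) * \<tau> (S j)) \<longlonglongrightarrow> of_real (measure \<mu> F) * of_real (measure \<mu> F)"
    by (intro tendsto_intros S_lim)
  ultimately have "complex_of_real (measure \<mu> F) = of_real (measure \<mu> F * measure \<mu> F)"
    using LIMSEQ_unique by fastforce
  hence "measure \<mu> F = measure \<mu> F * measure \<mu> F" by (simp only: of_real_eq_iff)
  thus ?thesis by auto
qed

text \<open>If \<open>\<mu>\<close> lives on a finite orbit, a unitary \<open>u\<^sub>g\<close> with \<open>g\<close> in the stabilizer is central as seen by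
  \<open>\<tau>\<close>. The functionals \<open>\<tau>(a (1 + \<omega> u\<^sub>g)(1 + \<omega> u\<^sub>g)\<^sup>*) / 4\<close> and the one for \<open>-\<omega>\<close> add up to \<open>\<tau>\<close>, so
  extremality, for \<open>\<omega> = 1\<close> and \<open>\<omega> = \<i>\<close>, makes \<open>u\<^sub>g\<close> act as a scalar.\<close>

lemma trace_stabilizer_central:
  assumes fin: "finite (orbit G \<phi> x)" and full: "measure \<mu> (orbit G \<phi> x) = 1"
    and g: "g \<in> stabilizer G \<phi> x" and a: "a \<in> carrier B" and b: "b \<in> carrier B"
  shows "\<tau> (a \<otimes>\<^bsub>B\<^esub> b \<otimes>\<^bsub>B\<^esub> monomial (\<lambda>x. 1) g) = \<tau> (b \<otimes>\<^bsub>B\<^esub> a \<otimes>\<^bsub>B\<^esub> monomial (\<lambda>x. 1) g)"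
proof -
  let ?u = "monomial (\<lambda>x::'x. 1 :: complex) g"
  have gG: "g \<in> carrier G" and gx: "\<phi> g x = x" using g by (auto simp: stabilizer_def)
  have u: "?u \<in> carrier B" using gG by simp
  have AE: "AE y in \<mu>. y \<in> orbit G \<phi> x" by (rule AE_in_full[OF finite_in_sets[OF fin] full])
  have fixed: "\<phi> (inv g) y = y" if yQ: "y \<in> orbit G \<phi> x" for y
  proof -
    obtain h where h: "h \<in> carrier G" "y = \<phi> h x" using yQ by (auto simp: orbit_def)
    have "\<phi> g y = y" using act_commute[OF gG h(1), of x] by (simp add: h(2) gx)
    thus ?thesis using act_inv(1)[OF gG, of y] by simp
  qed
  have swap: "\<tau> (a \<otimes>\<^bsub>B\<^esub> (b \<otimes>\<^bsub>B\<^esub> ?u)) = \<tau> (a \<otimes>\<^bsub>B\<^esub> (?u \<otimes>\<^bsub>B\<^esub> b))"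
    using b
  proof (induction rule: conv_induct)
    case (monomial f h)
    have cf: "continuous_on UNIV (\<lambda>x. f (\<phi> (inv g) x))" using monomial gG by (intro continuous_comp_act) auto
    have "\<tau> (a \<otimes>\<^bsub>B\<^esub> (monomial f h \<otimes>\<^bsub>B\<^esub> ?u)) = \<tau> (monomial f (h \<otimes> g) \<otimes>\<^bsub>B\<^esub> a)"
      using monomial gG a trace_commute[of a "monomial f (h \<otimes> g)"] by (simp add: monomial_mult)
    \<comment> \<open>The stabilizer acts trivially on the orbit, which carries all of \<mu>, so
      translating f by inv g changes it only on a null set.\<close>
    also have "\<dots> = \<tau> (monomial (\<lambda>x. f (\<phi> (inv g) x)) (h \<otimes> g) \<otimes>\<^bsub>B\<^esub> a)"
      using monomial gG a cf AE fixed by (intro trace_mult_cong_AE) auto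
    also have "\<dots> = \<tau> (a \<otimes>\<^bsub>B\<^esub> (?u \<otimes>\<^bsub>B\<^esub> monomial f h))"
      using monomial gG a cf trace_commute[of a "monomial (\<lambda>x. f (\<phi> (inv g) x)) (h \<otimes> g)"] m_comm[of g h]
      by (simp add: monomial_mult)
    finally show ?case .
  next
    case (add b c)
    thus ?case using a u by (simp add: conv.l_distr conv.r_distr conv.functional_add[OF pos])
  qed
  have "\<tau> (b \<otimes>\<^bsub>B\<^esub> a \<otimes>\<^bsub>B\<^esub> ?u) = \<tau> (a \<otimes>\<^bsub>B\<^esub> ?u \<otimes>\<^bsub>B\<^esub> b)"
    using trace_commute[of b "a \<otimes>\<^bsub>B\<^esub> ?u"] a b u by (simp add: conv.m_assoc)
  thus ?thesis using swap a b u by (simp add: conv.m_assoc)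
qed

lemma extreme_trace_multiplicative:
  assumes ext: "extreme_trace B \<tau>" and fin: "finite (orbit G \<phi> x)" and full: "measure \<mu> (orbit G \<phi> x) = 1"
    and g: "g \<in> stabilizer G \<phi> x" and a: "a \<in> carrier B"
  shows "\<tau> (a \<otimes>\<^bsub>B\<^esub> monomial (\<lambda>x. 1) g) = \<tau> (monomial (\<lambda>x. 1) g) * \<tau> a"
proof -
  have gG: "g \<in> carrier G" and gx: "\<phi> g x = x" using g by (auto simp: stabilizer_def)
  have g': "inv g \<in> stabilizer G \<phi> x" using gG gx act_inv(1)[OF gG, of x] by (simp add: stabilizer_def)
  let ?u = "monomial (\<lambda>x::'x. 1 :: complex) g" and ?v = "monomial (\<lambda>x::'x. 1 :: complex) (inv g)"
  have u: "?u \<in> carrier B" and v: "?v \<in> carrier B" using gG by auto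
  have uv: "?u \<otimes>\<^bsub>B\<^esub> ?v = \<one>\<^bsub>B\<^esub>" using gG by (simp add: monomial_mult conv_simps(4))
  have adj_u: "adj B ?u = ?v" using gG by (simp add: monomial_adj)
  \<comment> \<open>For |\<omega>| = 1 the product of 1 + \<omega> u and its adjoint is 2 + \<omega>
    u + cnj \<omega> v. The factor 1/4 makes the functionals for \<omega> and -\<omega> sum to
    \<tau>, so each is dominated by \<tau>.\<close>
  define \<sigma> where "\<sigma> \<omega> a = (2 * \<tau> a + \<omega> * \<tau> (a \<otimes>\<^bsub>B\<^esub> ?u) + cnj \<omega> * \<tau> (a \<otimes>\<^bsub>B\<^esub> ?v)) / 4" for \<omega> a
  have pos\<sigma>: "positive_functional B (\<sigma> \<omega>)" if \<omega>: "cmod \<omega> = 1" for \<omega>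
    unfolding positive_functional_def
  proof (intro conjI ballI allI)
    fix a assume a: "a \<in> carrier B"
    define w where "w = \<one>\<^bsub>B\<^esub> \<oplus>\<^bsub>B\<^esub> \<omega> \<odot>\<^bsub>B\<^esub> ?u"
    define c where "c = adj B a \<otimes>\<^bsub>B\<^esub> a"
    have w: "w \<in> carrier B" using u by (simp add: w_def)
    have c: "c \<in> carrier B" using a by (simp add: c_def)
    have adj_w: "adj B w = \<one>\<^bsub>B\<^esub> \<oplus>\<^bsub>B\<^esub> cnj \<omega> \<odot>\<^bsub>B\<^esub> ?v"
      unfolding w_def using u by (simp add: conv.adj_add conv.adj_smult adj_u)
    have \<omega>\<omega>: "\<omega> * cnj \<omega> = 1" using \<omega> by (simp flip: complex_norm_square)
    have "\<tau> (adj B (a \<otimes>\<^bsub>B\<^esub> w) \<otimes>\<^bsub>B\<^esub> (a \<otimes>\<^bsub>B\<^esub> w)) = \<tau> (adj B w \<otimes>\<^bsub>B\<^esub> (c \<otimes>\<^bsub>B\<^esub> w))"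
      using a w by (simp add: c_def conv.adj_mult conv.m_assoc)
    also have "\<dots> = \<tau> ((c \<otimes>\<^bsub>B\<^esub> w) \<otimes>\<^bsub>B\<^esub> adj B w)" using c w by (intro trace_commute) auto
    also have "c \<otimes>\<^bsub>B\<^esub> w = c \<oplus>\<^bsub>B\<^esub> \<omega> \<odot>\<^bsub>B\<^esub> (c \<otimes>\<^bsub>B\<^esub> ?u)"
      using c u by (simp add: w_def conv.r_distr conv.smult_mult_right)
    also have "(c \<oplus>\<^bsub>B\<^esub> \<omega> \<odot>\<^bsub>B\<^esub> (c \<otimes>\<^bsub>B\<^esub> ?u)) \<otimes>\<^bsub>B\<^esub> adj B w =
        (c \<oplus>\<^bsub>B\<^esub> \<omega> \<odot>\<^bsub>B\<^esub> (c \<otimes>\<^bsub>B\<^esub> ?u)) \<oplus>\<^bsub>B\<^esub> cnj \<omega> \<odot>\<^bsub>B\<^esub> (c \<otimes>\<^bsub>B\<^esub> ?v \<oplus>\<^bsub>B\<^esub> \<omega> \<odot>\<^bsub>B\<^esub> c)"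
      using c u v by (simp add: adj_w conv.r_distr conv.l_distr conv.smult_mult_right conv.smult_mult_left
          conv.m_assoc uv)
    also have "\<tau> \<dots> = 4 * \<sigma> \<omega> c"
      using c u v \<omega>\<omega> by (simp add: \<sigma>_def conv.functional_add[OF pos] conv.functional_smult[OF pos] algebra_simps)
    finally have "\<tau> (adj B (a \<otimes>\<^bsub>B\<^esub> w) \<otimes>\<^bsub>B\<^esub> (a \<otimes>\<^bsub>B\<^esub> w)) = 4 * \<sigma> \<omega> c" .
    moreover have "\<tau> (adj B (a \<otimes>\<^bsub>B\<^esub> w) \<otimes>\<^bsub>B\<^esub> (a \<otimes>\<^bsub>B\<^esub> w)) \<in> \<real>\<^sub>\<ge>\<^sub>0"
      using a w by (intro conv.functional_nonneg[OF pos]) auto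
    ultimately show "\<sigma> \<omega> (adj B a \<otimes>\<^bsub>B\<^esub> a) \<in> \<real>\<^sub>\<ge>\<^sub>0"
      by (simp add: c_def complex_nonneg_Reals_iff)
  qed (use u v in \<open>simp_all add: \<sigma>_def conv.l_distr conv.smult_mult_left conv.functional_add[OF pos]
      conv.functional_smult[OF pos] algebra_simps add_divide_distrib\<close>)
  have tr\<sigma>: "is_tracial B (\<sigma> \<omega>)" for \<omega>
    unfolding is_tracial_def
    using trace_stabilizer_central[OF fin full g] trace_stabilizer_central[OF fin full g'] trace_commute
    by (simp add: \<sigma>_def)
  have dom: "\<sigma> \<omega> a = \<sigma> \<omega> \<one>\<^bsub>B\<^esub> * \<tau> a" if "cmod \<omega> = 1" for \<omega>
  proof (rule extreme_trace_dominated[OF ext pos\<sigma>[OF that] tr\<sigma> _ a])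
    have "(\<lambda>a. \<tau> a - \<sigma> \<omega> a) = \<sigma> (- \<omega>)" by (auto simp: \<sigma>_def fun_eq_iff field_simps)
    thus "positive_functional B (\<lambda>a. \<tau> a - \<sigma> \<omega> a)" using pos\<sigma>[of "- \<omega>"] that by simp
  qed
  have one: "\<tau> \<one>\<^bsub>B\<^esub> = 1" using tr by (simp add: normalized_trace_def)
  have "\<omega> * \<tau> (a \<otimes>\<^bsub>B\<^esub> ?u) + cnj \<omega> * \<tau> (a \<otimes>\<^bsub>B\<^esub> ?v) = (\<omega> * \<tau> ?u + cnj \<omega> * \<tau> ?v) * \<tau> a"
    if "cmod \<omega> = 1" for \<omega>
  proof -
    have "4 * \<sigma> \<omega> a = (4 * \<sigma> \<omega> \<one>\<^bsub>B\<^esub>) * \<tau> a" using dom[OF that] by simp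
    moreover have "4 * \<sigma> \<omega> \<one>\<^bsub>B\<^esub> = 2 + (\<omega> * \<tau> ?u + cnj \<omega> * \<tau> ?v)"
      using u v by (simp add: \<sigma>_def one)
    moreover have "4 * \<sigma> \<omega> a = 2 * \<tau> a + (\<omega> * \<tau> (a \<otimes>\<^bsub>B\<^esub> ?u) + cnj \<omega> * \<tau> (a \<otimes>\<^bsub>B\<^esub> ?v))"
      by (simp add: \<sigma>_def)
    ultimately show ?thesis by (simp only: distrib_right add_left_cancel)
  qed
  \<comment> \<open>Dividing the equation for \<omega> = \<i> by \<i> and adding the one for
    \<omega> = 1 eliminates the terms with v.\<close>
  from this[of 1] this[of \<i>] show ?thesis
    by (auto simp: algebra_simps complex_eq_iff)
qed

text \<open>The character is g \<mapsto> \<tau>(u_g). It is multiplicative by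
  \<open>extreme_trace_multiplicative\<close>; combined with \<tau>(u_(inv g)) = cnj \<tau>(u_g),
  this gives modulus 1.\<close>

lemma extreme_trace_on_finite_orbit:
  assumes ext: "extreme_trace B \<tau>" and fin: "finite (orbit G \<phi> x)" and full: "measure \<mu> (orbit G \<phi> x) = 1"
  shows "\<exists>\<xi>\<in>discrete_dual (stabilizer_group G \<phi> x). \<forall>f g. continuous_on UNIV f \<and> g \<in> carrier G \<longrightarrow>
    \<tau> (monomial f g) = (if g \<in> stabilizer G \<phi> x
      then \<xi> g / of_nat (card (orbit G \<phi> x)) * (\<Sum>y\<in>orbit G \<phi> x. f y) else 0)"
proof -
  let ?H = "stabilizer G \<phi> x"
  define \<xi> where "\<xi> = restrict (\<lambda>g. \<tau> (monomial (\<lambda>x. 1) g)) ?H"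
  have HG: "g \<in> ?H \<Longrightarrow> g \<in> carrier G" and Hm: "g \<in> ?H \<Longrightarrow> h \<in> ?H \<Longrightarrow> g \<otimes> h \<in> ?H" for g h
    by (auto simp: stabilizer_def act_mult)
  have mult: "\<tau> (monomial (\<lambda>x. 1) (g \<otimes> h)) = \<tau> (monomial (\<lambda>x. 1) g) * \<tau> (monomial (\<lambda>x. 1) h)"
    if "g \<in> ?H" "h \<in> ?H" for g h
    using extreme_trace_multiplicative[OF ext fin full that(2), of "monomial (\<lambda>x. 1) g"] HG that
    by (simp add: monomial_mult)
  have unit: "cmod (\<tau> (monomial (\<lambda>x. 1) g)) = 1" if g: "g \<in> ?H" for g
  proof -
    have gG: "g \<in> carrier G" by (rule HG[OF g])
    have "inv g \<in> ?H" using g act_inv(1)[OF gG, of x] by (auto simp: stabilizer_def)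
    hence "\<tau> (monomial (\<lambda>x. 1) g) * \<tau> (monomial (\<lambda>x. 1) (inv g)) = 1"
      using mult[OF g, of "inv g"] gG normalized_traceD(2)[OF tr] by simp
    moreover have "\<tau> (monomial (\<lambda>x. 1) (inv g)) = cnj (\<tau> (monomial (\<lambda>x. 1) g))"
      using conv.functional_adj[OF pos, of "monomial (\<lambda>x. 1) g"] gG by (simp add: monomial_adj)
    ultimately have "complex_of_real ((cmod (\<tau> (monomial (\<lambda>x. 1) g)))\<^sup>2) = 1"
      by (simp only: complex_norm_square)
    hence "(cmod (\<tau> (monomial (\<lambda>x. 1) g)))\<^sup>2 = 1" by (simp only: of_real_eq_1_iff)
    thus ?thesis using power2_eq_imp_eq[of "cmod (\<tau> (monomial (\<lambda>x. 1) g))" 1] by simp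
  qed
  have "\<xi> \<in> discrete_dual (stabilizer_group G \<phi> x)"
    unfolding discrete_dual_def hom_def circle_group_def \<xi>_def
    using mult unit Hm by auto
  moreover have "\<forall>f g. continuous_on UNIV f \<and> g \<in> carrier G \<longrightarrow>
    \<tau> (monomial f g) = (if g \<in> ?H
      then \<xi> g / of_nat (card (orbit G \<phi> x)) * (\<Sum>y\<in>orbit G \<phi> x. f y) else 0)"
  proof (intro allI impI, elim conjE)
    fix f :: "'x \<Rightarrow> complex" and g assume "continuous_on UNIV f" "g \<in> carrier G"
    from trace_on_finite_orbit[OF fin full this] show "\<tau> (monomial f g) = (if g \<in> ?H
        then \<xi> g / of_nat (card (orbit G \<phi> x)) * (\<Sum>y\<in>orbit G \<phi> x. f y) else 0)"
      by (simp only: \<xi>_def restrict_apply if_True cong: if_cong)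
  qed
  ultimately show ?thesis by blast
qed

end

section \<open>Almost minimal actions\<close>

text \<open>After rotation by cnj z, two real parts at most 1 have weighted mean 1, so both equal 1;
  modulus at most 1 then leaves no imaginary part. This is what makes the traces attached to
  characters extreme.\<close>

lemma convex_combination_unit_eq:
  fixes z a b :: complex
  assumes z: "cmod z = 1" and a: "cmod a \<le> 1" and b: "cmod b \<le> 1" and t: "0 < t" "t < 1"
    and eq: "z = of_real (1 - t) * a + of_real t * b"
  shows "a = z"
proof -
  have zz: "cnj z * z = 1" using z by (metis complex_norm_square mult.commute of_real_1 one_power2)
  have "cnj z * z = of_real (1 - t) * (cnj z * a) + of_real t * (cnj z * b)"
    by (subst (2) eq) (simp add: algebra_simps)
  hence "1 = of_real (1 - t) * (cnj z * a) + of_real t * (cnj z * b)" using zz by simp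
  from arg_cong[OF this, of Re] have re: "1 = (1 - t) * Re (cnj z * a) + t * Re (cnj z * b)" by simp
  have le: "cmod (cnj z * a) \<le> 1" "cmod (cnj z * b) \<le> 1" using z a b by (simp_all add: norm_mult)
  have Re_le: "Re (cnj z * a) \<le> 1" "Re (cnj z * b) \<le> 1"
    using le complex_Re_le_cmod order_trans by blast+
  have "t * Re (cnj z * b) \<le> t * 1" using t Re_le by (intro mult_left_mono) auto
  hence "(1 - t) * 1 \<le> (1 - t) * Re (cnj z * a)" using re by simp
  hence "1 \<le> Re (cnj z * a)" using t by (subst (asm) mult_le_cancel_left_pos) auto
  hence R: "Re (cnj z * a) = 1" using Re_le by simp
  have "(Re (cnj z * a))\<^sup>2 + (Im (cnj z * a))\<^sup>2 \<le> 1"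
    using power_mono[OF le(1), of 2] by (simp add: cmod_power2)
  hence "Im (cnj z * a) = 0" using R by simp
  hence "cnj z * a = 1" using R by (simp only: complex_eq_iff one_complex.sel)
  moreover have "cnj z \<noteq> 0" using z by auto
  ultimately show "a = z" using zz by (metis mult_cancel_left)
qed

locale almost_minimal_system = compact_abelian_system G \<phi>
  for G :: "('g, 'm) monoid_scheme" (structure)
    and \<phi> :: "'g \<Rightarrow> 'x::{t2_space, second_countable_topology} \<Rightarrow> 'x" +
  assumes countable_group: "countable (carrier G)" and infinite_space: "infinite (UNIV :: 'x set)"
    and faithful: "faithful G \<phi>" and almost_minimal: "almost_minimal G \<phi>"
begin

lemma finite_if_closed_invariant:
  assumes "closed F" "F \<noteq> UNIV" "\<And>g y. g \<in> carrier G \<Longrightarrow> y \<in> F \<Longrightarrow> \<phi> g y \<in> F"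
  shows "finite F"
  using almost_minimal assms unfolding almost_minimal_def by blast

lemma fixed_points:
  assumes g: "g \<in> carrier G" "g \<noteq> \<one>"
  shows "finite {x. \<phi> g x = x}" and "h \<in> carrier G \<Longrightarrow> y \<in> {x. \<phi> g x = x} \<Longrightarrow> \<phi> h y \<in> {x. \<phi> g x = x}"
proof -
  show inv: "\<phi> h y \<in> {x. \<phi> g x = x}" if "h \<in> carrier G" "y \<in> {x. \<phi> g x = x}" for h y
    using that act_commute[OF g(1) that(1), of y] by simp
  show "finite {x. \<phi> g x = x}"
  proof (rule finite_if_closed_invariant[OF _ _ inv])
    show "closed {x. \<phi> g x = x}"
      using continuous_act[OF g(1)] by (intro closed_Collect_eq continuous_intros)
    show "{x. \<phi> g x = x} \<noteq> UNIV" using faithful g unfolding faithful_def by blast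
  qed
qed

text \<open>Makes the dual of the stabilizer depend on the orbit alone.\<close>

lemma orbit_representative:
  assumes "y \<in> orbit G \<phi> x"
  shows "orbit G \<phi> y = orbit G \<phi> x" "stabilizer G \<phi> y = stabilizer G \<phi> x"
proof -
  obtain k where k: "k \<in> carrier G" "y = \<phi> k x" using assms by (auto simp: orbit_def)
  have "x = \<phi> (inv k) y" "inv k \<in> carrier G" using k act_inv(1)[OF k(1), of x] by simp_all
  hence "x \<in> orbit G \<phi> y" unfolding orbit_def by blast
  then show "orbit G \<phi> y = orbit G \<phi> x"
    using act_orbit[OF assms] act_orbit[of x y] unfolding orbit_def[of G \<phi> x] orbit_def[of G \<phi> y] by blast
  show "stabilizer G \<phi> y = stabilizer G \<phi> x"
    unfolding stabilizer_def k(2) using act_eq_iff[OF k(1)] act_commute[OF _ k(1)] by auto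
qed

text \<open>If the group were finite, the orbit of an accumulation point x would be finite and would
  have a closed invariant neighbourhood missing some y. Almost minimality makes that neighbourhood
  finite, but it contains an open set around x, which is infinite.\<close>

lemma infinite_group: "infinite (carrier G)"
proof
  assume fin: "finite (carrier G)"
  obtain x :: 'x where x: "x islimpt UNIV"
    using Heine_Borel_imp_Bolzano_Weierstrass[OF compact_space infinite_space] by auto
  have fin_orbit: "finite (orbit G \<phi> x)"
  proof -
    have "orbit G \<phi> x = (\<lambda>g. \<phi> g x) ` carrier G" by (auto simp: orbit_def)
    thus ?thesis using fin by simp
  qed
  then obtain y where y: "y \<notin> orbit G \<phi> x" using infinite_space by (metis UNIV_eq_I)
  have op: "open (- orbit G \<phi> x)" using finite_imp_closed[OF fin_orbit] by (simp add: open_Compl)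
  obtain k :: "nat \<Rightarrow> 'x \<Rightarrow> real" where k: "increases_to_indicator k (- orbit G \<phi> x)"
    by (rule continuous_increasing_to_indicator_open[OF compact_space op])
  have "eventually (\<lambda>n. k n y = 1) sequentially" using increases_to_indicatorD(5)[OF k, of y] y by simp
  then obtain n where n: "k n y = 1" by (auto simp: eventually_sequentially)
  \<comment> \<open>Intersecting over the group makes F invariant. Finiteness of the group is what
    keeps W open; W contains x because \<open>k n\<close> vanishes on its orbit.\<close>
  define F where "F = (\<Inter>g\<in>carrier G. {z. k n (\<phi> g z) \<le> 1 / 2})"
  define W where "W = (\<Inter>g\<in>carrier G. {z. k n (\<phi> g z) < 1 / 2})"
  have ck: "continuous_on UNIV (\<lambda>z. k n (\<phi> g z))" if "g \<in> carrier G" for g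
    using increases_to_indicatorD(1)[OF k] that
    by (rule continuous_on_compose2[OF _ continuous_act]) auto
  have "finite F"
  proof (rule finite_if_closed_invariant)
    show "closed F" unfolding F_def using ck by (intro closed_INT ballI closed_Collect_le) auto
    have "y \<notin> F" unfolding F_def using n one_closed by (auto intro!: bexI[of _ \<one>])
    thus "F \<noteq> UNIV" by blast
    show "\<phi> g z \<in> F" if g: "g \<in> carrier G" and z: "z \<in> F" for g z
      unfolding F_def
    proof (intro INT_I CollectI)
      fix h assume h: "h \<in> carrier G"
      show "k n (\<phi> h (\<phi> g z)) \<le> 1 / 2"
        using z g h by (auto simp: F_def simp flip: act_mult)
    qed
  qed
  moreover have "open W" unfolding W_def using ck fin by (intro open_INT ballI open_Collect_less) auto
  moreover have "x \<in> W"
    unfolding W_def using increases_to_indicatorD(4)[OF k] act_orbit[OF self_in_orbit[of x]] by auto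
  moreover have "W \<subseteq> F" by (auto simp: W_def F_def less_imp_le)
  ultimately show False
    using x islimpt_eq_acc_point[of x UNIV] finite_subset by (metis inf_top_right)
qed

text \<open>An infinite group acts on a finite orbit with coincidences g x = h x, so x is fixed by
  some nontrivial element. Countably many elements with finitely many fixed points each leave
  countably many such x.\<close>

lemma countable_finite_orbits: "countable (finite_orbits G \<phi>)"
proof -
  let ?S = "\<Union>g\<in>carrier G - {\<one>}. {x. \<phi> g x = x}"
  have "finite_orbits G \<phi> \<subseteq> orbit G \<phi> ` ?S"
  proof
    fix Q assume Q: "Q \<in> finite_orbits G \<phi>"
    then obtain x where x: "Q = orbit G \<phi> x" "finite (orbit G \<phi> x)" by (auto simp: finite_orbits_def orbits_def)
    have "(\<lambda>g. \<phi> g x) ` carrier G = orbit G \<phi> x" by (auto simp: orbit_def)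
    hence "\<not> inj_on (\<lambda>g. \<phi> g x) (carrier G)" using x(2) infinite_group finite_imageD by metis
    then obtain g h where gh: "g \<in> carrier G" "h \<in> carrier G" "g \<noteq> h" "\<phi> g x = \<phi> h x"
      by (auto simp: inj_on_def)
    have "\<phi> (inv g \<otimes> h) x = x" using gh act_inv(1)[OF gh(1), of x] by (simp add: act_mult)
    moreover have "inv g \<otimes> h \<noteq> \<one>" using gh by (metis inv_closed inv_equality inv_inv)
    ultimately have "x \<in> ?S" using gh by (intro UN_I[of "inv g \<otimes> h"]) simp_all
    thus "Q \<in> orbit G \<phi> ` ?S" using x(1) by (rule rev_image_eqI)
  qed
  moreover have "countable ?S"
  proof (rule Countable_Set.countable_UN)
    show "countable (carrier G - {\<one>})" by (rule countable_Diff[OF countable_group])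
    show "countable {x. \<phi> g x = x}" if "g \<in> carrier G - {\<one>}" for g
      by (rule countable_finite[OF fixed_points(1)]) (use that in simp_all)
  qed
  ultimately show ?thesis by (rule countable_subset[OF _ countable_image])
qed

section \<open>Invariant measures and finite invariant sets\<close>

lemma invariant_measureD:
  fixes f :: "'x \<Rightarrow> complex"
  assumes "\<mu> \<in> invariant_measures G \<phi>"
  shows "prob_space \<mu>" "sets \<mu> = sets borel" "space \<mu> = UNIV"
    "g \<in> carrier G \<Longrightarrow> S \<in> sets borel \<Longrightarrow> emeasure \<mu> (\<phi> g -` S) = emeasure \<mu> S"
    "g \<in> carrier G \<Longrightarrow> continuous_on UNIV f \<Longrightarrow> (\<integral>x. f (\<phi> g x) \<partial>\<mu>) = (\<integral>x. f x \<partial>\<mu>)"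
proof -
  show s: "prob_space \<mu>" "sets \<mu> = sets borel" using assms by (auto simp: invariant_measures_def regular_borel_def)
  show sp: "space \<mu> = UNIV" using sets_eq_imp_space_eq[OF s(2)] by simp
  have d: "distr \<mu> borel (\<phi> g) = \<mu>" if "g \<in> carrier G" for g using assms that by (auto simp: invariant_measures_def)
  have m: "\<phi> g \<in> measurable \<mu> borel" if "g \<in> carrier G" for g
    by (rule borel_measurable_continuous_UNIV[OF s(2) continuous_act[OF that]])
  show "emeasure \<mu> (\<phi> g -` S) = emeasure \<mu> S" if "g \<in> carrier G" "S \<in> sets borel"
  proof -
    have "emeasure (distr \<mu> borel (\<phi> g)) S = emeasure \<mu> (\<phi> g -` S \<inter> space \<mu>)"
      by (rule emeasure_distr[OF m[OF that(1)] that(2)])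
    thus ?thesis unfolding d[OF that(1)] sp by simp
  qed
  show "(\<integral>x. f (\<phi> g x) \<partial>\<mu>) = (\<integral>x. f x \<partial>\<mu>)" if "g \<in> carrier G" "continuous_on UNIV f"
  proof -
    have "(\<integral>x. f x \<partial>distr \<mu> borel (\<phi> g)) = (\<integral>x. f (\<phi> g x) \<partial>\<mu>)"
      by (rule integral_distr[OF m[OF that(1)] borel_measurable_continuous_onI[OF that(2)]])
    thus ?thesis unfolding d[OF that(1)] by simp
  qed
qed

text \<open>Conditioning on an invariant set: intersecting with F commutes with taking preimages
  under the action.\<close>

lemma uniform_measure_invariant:
  assumes \<mu>: "\<mu> \<in> invariant_measures G \<phi>" and F: "F \<in> sets borel" "emeasure \<mu> F \<noteq> 0"
    and inv: "\<And>g y. g \<in> carrier G \<Longrightarrow> \<phi> g y \<in> F \<longleftrightarrow> y \<in> F"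
  shows "uniform_measure \<mu> F \<in> invariant_measures G \<phi>"
proof -
  note M = invariant_measureD[OF \<mu>]
  interpret prob_space \<mu> by (rule M(1))
  have P: "prob_space (uniform_measure \<mu> F)"
    using F by (intro prob_space_uniform_measure) auto
  have s: "sets (uniform_measure \<mu> F) = sets borel" using M(2) by simp
  have "distr (uniform_measure \<mu> F) borel (\<phi> g) = uniform_measure \<mu> F" if g: "g \<in> carrier G" for g
  proof (rule measure_eqI)
    show "sets (distr (uniform_measure \<mu> F) borel (\<phi> g)) = sets (uniform_measure \<mu> F)" using s by simp
    fix S assume "S \<in> sets (distr (uniform_measure \<mu> F) borel (\<phi> g))"
    hence S: "S \<in> sets borel" by simp
    have meas: "\<phi> g \<in> measurable (uniform_measure \<mu> F) borel"
      by (rule borel_measurable_continuous_UNIV[OF s continuous_act[OF g]])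
    have pre: "\<phi> g -` S \<in> sets \<mu>"
    proof -
      have "\<phi> g \<in> measurable \<mu> borel" by (rule borel_measurable_continuous_UNIV[OF M(2) continuous_act[OF g]])
      from measurable_sets[OF this S] show ?thesis by (simp add: M(3))
    qed
    have "emeasure (distr (uniform_measure \<mu> F) borel (\<phi> g)) S = emeasure (uniform_measure \<mu> F) (\<phi> g -` S)"
      using emeasure_distr[OF meas S] by (simp add: M(3))
    also have "\<dots> = emeasure \<mu> (F \<inter> \<phi> g -` S) / emeasure \<mu> F"
      using F M(2) pre by (intro emeasure_uniform_measure) auto
    also have "F \<inter> \<phi> g -` S = \<phi> g -` (F \<inter> S)" using inv[OF g] by auto
    also have "emeasure \<mu> (\<phi> g -` (F \<inter> S)) = emeasure \<mu> (F \<inter> S)" using F S by (intro M(4) g) auto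
    also have "emeasure \<mu> (F \<inter> S) / emeasure \<mu> F = emeasure (uniform_measure \<mu> F) S"
      using F S M(2) by (intro emeasure_uniform_measure[symmetric]) auto
    finally show "emeasure (distr (uniform_measure \<mu> F) borel (\<phi> g)) S = emeasure (uniform_measure \<mu> F) S" .
  qed
  thus ?thesis using regular_borel_prob[OF compact_space P s] P by (simp add: invariant_measures_def)
qed

lemma finite_invariant_iff:
  assumes "\<And>g y. g \<in> carrier G \<Longrightarrow> y \<in> F \<Longrightarrow> \<phi> g y \<in> F" and g: "g \<in> carrier G"
  shows "\<phi> g y \<in> F \<longleftrightarrow> y \<in> F"
  using assms(1)[of g y] assms(1)[of "inv g" "\<phi> g y"] g by auto

lemma full_support_open:
  assumes "\<mu> \<in> full_support_extreme_measures G \<phi>" "open U" "U \<noteq> {}"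
  shows "0 < emeasure \<mu> U"
  using assms by (auto simp: full_support_extreme_measures_def measure_support_def)

lemma full_support_extremeD:
  assumes "\<mu> \<in> full_support_extreme_measures G \<phi>"
  shows "\<mu> \<in> invariant_measures G \<phi>"
    and "\<And>M N t. M \<in> invariant_measures G \<phi> \<Longrightarrow> N \<in> invariant_measures G \<phi> \<Longrightarrow> 0 < t \<Longrightarrow> t < 1 \<Longrightarrow>
      (\<And>S. measure \<mu> S = (1 - t) * measure M S + t * measure N S) \<Longrightarrow> M = \<mu> \<and> N = \<mu>"
  using assms unfolding full_support_extreme_measures_def extreme_points_def by auto

text \<open>The complement of F is open and nonempty, so it has positive measure. If F did as well,
  \<mu> would be a proper mixture of its conditionings on F and on the complement; extremality
  identifies both with \<mu>, forcing \<mu>(F) = 1.\<close>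

lemma full_support_extreme_finite_null:
  assumes \<mu>: "\<mu> \<in> full_support_extreme_measures G \<phi>" and F: "finite F"
    and inv: "\<And>g y. g \<in> carrier G \<Longrightarrow> y \<in> F \<Longrightarrow> \<phi> g y \<in> F"
  shows "measure \<mu> F = 0"
proof (rule ccontr)
  assume nz: "measure \<mu> F \<noteq> 0"
  note iM = full_support_extremeD(1)[OF \<mu>]
  note M = invariant_measureD[OF iM]
  interpret prob_space \<mu> by (rule M(1))
  have sF1: "F \<in> sets borel" by (intro borel_closed finite_imp_closed F)
  note sF = sF1 borel_comp[OF sF1]
  have sF': "F \<in> sets \<mu>" "- F \<in> sets \<mu>" using sF M(2) by auto
  have "open (- F)" using finite_imp_closed[OF F] by (simp add: open_Compl)
  moreover have "- F \<noteq> {}" using F infinite_space by (metis Compl_empty_eq double_complement)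
  ultimately have pc: "emeasure \<mu> (- F) \<noteq> 0" using full_support_open[OF \<mu>] by fastforce
  have pF: "emeasure \<mu> F \<noteq> 0" using nz by (simp add: emeasure_eq_measure)
  define t where "t = measure \<mu> F"
  have c: "measure \<mu> (- F) = 1 - t"
    using prob_compl[OF sF'(1)] by (simp add: t_def M(3) Compl_eq_Diff_UNIV)
  have t: "0 < t" "t < 1"
    using nz pc c by (auto simp: t_def zero_less_measure_iff emeasure_eq_measure less_le)
  have invF: "\<phi> g y \<in> F \<longleftrightarrow> y \<in> F" if "g \<in> carrier G" for g y by (rule finite_invariant_iff[OF inv that])
  have "uniform_measure \<mu> (- F) = \<mu> \<and> uniform_measure \<mu> F = \<mu>"
  proof (rule full_support_extremeD(2)[OF \<mu> _ _ t])
    show "uniform_measure \<mu> (- F) \<in> invariant_measures G \<phi>"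
      by (rule uniform_measure_invariant[OF iM sF(2) pc]) (simp add: invF)
    show "uniform_measure \<mu> F \<in> invariant_measures G \<phi>"
      by (rule uniform_measure_invariant[OF iM sF(1) pF]) (simp add: invF)
    fix S
    show "measure \<mu> S = (1 - t) * measure (uniform_measure \<mu> (- F)) S + t * measure (uniform_measure \<mu> F) S"
    proof (cases "S \<in> sets \<mu>")
      case True
      have "measure (uniform_measure \<mu> (- F)) S = measure \<mu> (- F \<inter> S) / (1 - t)"
        "measure (uniform_measure \<mu> F) S = measure \<mu> (F \<inter> S) / t"
        using True pc pF c by (simp_all add: measure_uniform_measure t_def)
      moreover have "measure \<mu> S = measure \<mu> (- F \<inter> S) + measure \<mu> (F \<inter> S)"
      proof -
        have "measure \<mu> ((- F \<inter> S) \<union> (F \<inter> S)) = measure \<mu> (- F \<inter> S) + measure \<mu> (F \<inter> S)"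
          using True sF' by (intro finite_measure_Union) auto
        moreover have "(- F \<inter> S) \<union> (F \<inter> S) = S" by blast
        ultimately show ?thesis by simp
      qed
      ultimately show ?thesis using t by simp
    qed (simp add: measure_notin_sets)
  qed
  hence "measure \<mu> F = measure (uniform_measure \<mu> F) F" by simp
  also have "\<dots> = 1" using pF sF' nz by (simp add: measure_uniform_measure)
  finally show False using t by (simp add: t_def)
qed

section \<open>The two families of traces and a criterion for extremality\<close>

lemma twisted_mean_measure:
  assumes "\<mu> \<in> invariant_measures G \<phi>"
  shows "twisted_mean G \<phi> (\<lambda>f. \<integral>x. f x \<partial>\<mu>) {\<one>} (\<lambda>g. 1)"
proof -
  note M = invariant_measureD[OF assms]
  interpret prob_space \<mu> by (rule M(1))
  note int = integrable_continuous_compact_UNIV[OF finite_measure_axioms M(2) compact_space]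
  show ?thesis
  proof (intro twisted_mean.intro twisted_mean_axioms.intro compact_abelian_system_axioms)
    show "(\<integral>x. cnj (f x) * f x \<partial>\<mu>) \<in> \<real>\<^sub>\<ge>\<^sub>0" for f :: "'x \<Rightarrow> complex"
    proof -
      have "cnj (f x) * f x = of_real ((cmod (f x))\<^sup>2)" for x
        by (simp only: complex_norm_square mult.commute)
      hence "(\<integral>x. cnj (f x) * f x \<partial>\<mu>) = of_real (\<integral>x. (cmod (f x))\<^sup>2 \<partial>\<mu>)"
        by (simp only: integral_complex_of_real)
      thus ?thesis by simp
    qed
    show "subgroup {\<one>} G" by (rule triv_subgroup)
  qed (auto simp: int prob_space M(5))
qed

lemma twisted_mean_orbit:
  assumes fin: "finite (orbit G \<phi> x)" and \<xi>: "\<xi> \<in> discrete_dual (stabilizer_group G \<phi> x)"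
  shows "twisted_mean G \<phi> (\<lambda>f. (\<Sum>y\<in>orbit G \<phi> x. f y) / of_nat (card (orbit G \<phi> x))) (stabilizer G \<phi> x) \<xi>"
proof (intro twisted_mean.intro twisted_mean_axioms.intro compact_abelian_system_axioms)
  let ?Q = "orbit G \<phi> x" and ?H = "stabilizer G \<phi> x"
  have card: "card ?Q \<noteq> 0" using fin self_in_orbit[of x] by auto
  show "(\<Sum>y\<in>?Q. 1) / of_nat (card ?Q) = (1 :: complex)" using card by simp
  show "(\<Sum>y\<in>?Q. cnj (f y) * f y) / of_nat (card ?Q) \<in> \<real>\<^sub>\<ge>\<^sub>0" for f :: "'x \<Rightarrow> complex"
  proof -
    have "cnj (f y) * f y = of_real ((cmod (f y))\<^sup>2)" for y
      by (simp only: complex_norm_square mult.commute)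
    hence "(\<Sum>y\<in>?Q. cnj (f y) * f y) / of_nat (card ?Q) = of_real ((\<Sum>y\<in>?Q. (cmod (f y))\<^sup>2) / of_nat (card ?Q))"
      by (simp only: of_real_sum of_real_divide of_real_of_nat_eq)
    also have "\<dots> \<in> \<real>\<^sub>\<ge>\<^sub>0" by (simp only: nonneg_Reals_of_real_iff) (simp add: sum_nonneg)
    finally show ?thesis .
  qed
  show "(\<Sum>y\<in>?Q. f (\<phi> g y)) / of_nat (card ?Q) = (\<Sum>y\<in>?Q. f y) / of_nat (card ?Q)"
    if "g \<in> carrier G" for g and f :: "'x \<Rightarrow> complex"
  proof -
    have "(\<Sum>y\<in>?Q. f (\<phi> g y)) = (\<Sum>y\<in>?Q. f y)"
      by (rule sum.reindex_bij_witness[of _ "\<phi> (inv g)" "\<phi> g"]) (use that in \<open>auto simp: act_orbit\<close>)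
    thus ?thesis by simp
  qed
  show "subgroup ?H G"
    using group_action.stabilizer_subgroup[of G UNIV \<phi> x] action by (simp add: action_by_homeos_def)
  show "\<xi> (g \<otimes> h) = \<xi> g * \<xi> h" if "g \<in> ?H" "h \<in> ?H" for g h
    using \<xi> that by (auto simp: discrete_dual_def hom_def circle_group_def)
  show "cmod (\<xi> g) = 1" if "g \<in> ?H" for g
    using \<xi> that by (auto simp: discrete_dual_def hom_def circle_group_def)
  show "(\<Sum>y\<in>?Q. f y * k (\<phi> g y)) / of_nat (card ?Q) = (\<Sum>y\<in>?Q. f y * k y) / of_nat (card ?Q)"
    if "g \<in> ?H" for g and f k :: "'x \<Rightarrow> complex"
  proof -
    have "\<phi> g y = y" if "y \<in> ?Q" for y
      using orbit_representative(2)[OF that] \<open>g \<in> ?H\<close> by (auto simp: stabilizer_def)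
    thus ?thesis by simp
  qed
qed (auto simp: sum.distrib add_divide_distrib sum_distrib_left)

lemma functional_eq_if_monomial:
  assumes "\<And>a b. a \<in> carrier B \<Longrightarrow> b \<in> carrier B \<Longrightarrow> \<tau> (a \<oplus>\<^bsub>B\<^esub> b) = \<tau> a + \<tau> b"
    and "\<And>a b. a \<in> carrier B \<Longrightarrow> b \<in> carrier B \<Longrightarrow> \<sigma> (a \<oplus>\<^bsub>B\<^esub> b) = \<sigma> a + \<sigma> b"
    and "\<And>f g. continuous_on UNIV f \<Longrightarrow> g \<in> carrier G \<Longrightarrow> \<tau> (monomial f g) = \<sigma> (monomial f g)"
    and "a \<in> carrier B"
  shows "\<tau> a = (\<sigma> a :: complex)"
  using assms(4) by (induction rule: conv_induct) (simp_all add: assms(1-3))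

lemma normalized_trace_eqI:
  assumes "normalized_trace B \<tau>" "normalized_trace B \<sigma>"
    and "\<And>f g. continuous_on UNIV f \<Longrightarrow> g \<in> carrier G \<Longrightarrow> \<tau> (monomial f g) = \<sigma> (monomial f g)"
    and "a \<in> carrier B"
  shows "\<tau> a = \<sigma> a"
proof (rule functional_eq_if_monomial[of \<tau> \<sigma>])
qed (use assms normalized_traceD(1)[OF assms(1)] normalized_traceD(1)[OF assms(2)] in
  \<open>simp_all add: conv.functional_add\<close>)

lemma normalized_trace_mixture:
  assumes \<tau>: "normalized_trace B \<tau>" "normalized_trace B \<sigma>" "normalized_trace B \<rho>"
    and "\<And>f g. continuous_on UNIV f \<Longrightarrow> g \<in> carrier G \<Longrightarrow>
      \<tau> (monomial f g) = of_real (1 - t) * \<sigma> (monomial f g) + of_real t * \<rho> (monomial f g)"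
    and "a \<in> carrier B"
  shows "\<tau> a = of_real (1 - t) * \<sigma> a + of_real t * \<rho> a"
proof (rule functional_eq_if_monomial[of \<tau> "\<lambda>a. of_real (1 - t) * \<sigma> a + of_real t * \<rho> a"])
  show "\<tau> (monomial f g) = of_real (1 - t) * \<sigma> (monomial f g) + of_real t * \<rho> (monomial f g)"
    if "continuous_on UNIV f" "g \<in> carrier G" for f g using assms(4) that .
qed (simp_all add: assms(5) distrib_left conv.functional_add[OF normalized_traceD(1)[OF \<tau>(1)]]
  conv.functional_add[OF normalized_traceD(1)[OF \<tau>(2)]] conv.functional_add[OF normalized_traceD(1)[OF \<tau>(3)]])

text \<open>It suffices to identify the first component, and only on monomials: replacing t by 1 - t
  exchanges the roles of \<sigma> and \<rho>.\<close>

lemma twisted_trace_extremeI: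
  assumes \<tau>: "normalized_trace B \<tau>"
    and eq: "\<And>\<sigma> \<rho> t f g. normalized_trace B \<sigma> \<Longrightarrow> normalized_trace B \<rho> \<Longrightarrow> 0 < t \<Longrightarrow> t < 1 \<Longrightarrow>
      (\<And>a. a \<in> carrier B \<Longrightarrow> \<tau> a = of_real (1 - t) * \<sigma> a + of_real t * \<rho> a) \<Longrightarrow>
      continuous_on UNIV f \<Longrightarrow> g \<in> carrier G \<Longrightarrow> \<sigma> (monomial f g) = \<tau> (monomial f g)"
  shows "extreme_trace B \<tau>"
  unfolding extreme_trace_def
proof (intro conjI allI impI \<tau>, elim conjE)
  fix \<sigma> \<rho> :: "('g \<Rightarrow> 'x \<Rightarrow> complex) \<Rightarrow> complex" and t :: real
  assume tr: "normalized_trace B \<sigma>" "normalized_trace B \<rho>" and t: "0 < t" "t < 1"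
    and mix: "\<forall>a\<in>carrier B. \<tau> a = of_real (1 - t) * \<sigma> a + of_real t * \<rho> a"
  have mix': "\<tau> a = of_real (1 - (1 - t)) * \<rho> a + of_real (1 - t) * \<sigma> a" if "a \<in> carrier B" for a
    using bspec[OF mix that] by (simp add: add.commute)
  have "\<sigma> a = \<tau> a" if a: "a \<in> carrier B" for a
  proof (rule normalized_trace_eqI[OF tr(1) \<tau> _ a])
    show "\<sigma> (monomial f g) = \<tau> (monomial f g)" if "continuous_on UNIV f" "g \<in> carrier G" for f g
      by (rule eq[OF tr t bspec[OF mix] that])
  qed
  moreover have "\<rho> a = \<tau> a" if a: "a \<in> carrier B" for a
  proof (rule normalized_trace_eqI[OF tr(2) \<tau> _ a])
    show "\<rho> (monomial f g) = \<tau> (monomial f g)" if "continuous_on UNIV f" "g \<in> carrier G" for f g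
      using t by (intro eq[OF tr(2,1) _ _ mix' that]) auto
  qed
  ultimately show "\<forall>a\<in>carrier B. \<sigma> a = \<tau> a \<and> \<rho> a = \<tau> a" by blast
qed

end

section \<open>Classification of the extreme tracial states\<close>

context almost_minimal_system begin

definition measure_formula :: "'x measure \<Rightarrow> (('g \<Rightarrow> 'x \<Rightarrow> complex) \<Rightarrow> complex) \<Rightarrow> bool" where
  "measure_formula \<mu> \<tau> \<longleftrightarrow> (\<forall>f g. continuous_on UNIV f \<and> g \<in> carrier G \<longrightarrow>
     \<tau> (monomial f g) = (if g = \<one> then \<integral>x. f x \<partial>\<mu> else 0))"

definition orbit_formula :: "'x \<Rightarrow> ('g \<Rightarrow> complex) \<Rightarrow> (('g \<Rightarrow> 'x \<Rightarrow> complex) \<Rightarrow> complex) \<Rightarrow> bool" where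
  "orbit_formula x \<xi> \<tau> \<longleftrightarrow> (\<forall>f g. continuous_on UNIV f \<and> g \<in> carrier G \<longrightarrow>
     \<tau> (monomial f g) = (if g \<in> stabilizer G \<phi> x
       then \<xi> g / of_nat (card (orbit G \<phi> x)) * (\<Sum>y\<in>orbit G \<phi> x. f y) else 0))"

lemma measure_formulaD:
  "measure_formula \<mu> \<tau> \<Longrightarrow> continuous_on UNIV f \<Longrightarrow> g \<in> carrier G \<Longrightarrow>
     \<tau> (monomial f g) = (if g = \<one> then \<integral>x. f x \<partial>\<mu> else 0)"
  by (simp add: measure_formula_def)

lemma orbit_formulaD:
  "orbit_formula x \<xi> \<tau> \<Longrightarrow> continuous_on UNIV f \<Longrightarrow> g \<in> carrier G \<Longrightarrow>
     \<tau> (monomial f g) = (if g \<in> stabilizer G \<phi> x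
       then \<xi> g / of_nat (card (orbit G \<phi> x)) * (\<Sum>y\<in>orbit G \<phi> x. f y) else 0)"
  by (simp add: orbit_formula_def)

lemma measure_trace_exists:
  assumes "\<mu> \<in> invariant_measures G \<phi>"
  obtains \<tau> where "normalized_trace B \<tau>" "measure_formula \<mu> \<tau>"
proof -
  interpret T: twisted_mean G \<phi> "\<lambda>f. \<integral>x. f x \<partial>\<mu>" "{\<one>}" "\<lambda>g. 1"
    by (rule twisted_mean_measure[OF assms])
  show ?thesis
    by (rule that[OF T.normalized_trace_trace]) (simp add: measure_formula_def T.trace_monomial)
qed

lemma orbit_trace_exists:
  assumes "finite (orbit G \<phi> x)" "\<xi> \<in> discrete_dual (stabilizer_group G \<phi> x)"
  obtains \<tau> where "normalized_trace B \<tau>" "orbit_formula x \<xi> \<tau>"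
proof -
  interpret T: twisted_mean G \<phi> "\<lambda>f. (\<Sum>y\<in>orbit G \<phi> x. f y) / of_nat (card (orbit G \<phi> x))" "stabilizer G \<phi> x" \<xi>
    by (rule twisted_mean_orbit[OF assms])
  show ?thesis
    by (rule that[OF T.normalized_trace_trace]) (simp add: orbit_formula_def T.trace_monomial)
qed

lemma trace_measure_of_formula:
  assumes "normalized_trace B \<tau>" "measure_formula \<mu> \<tau>" "\<mu> \<in> invariant_measures G \<phi>"
  shows "trace_measure G \<phi> \<tau> \<mu>"
proof (intro trace_measure.intro trace_measure_axioms.intro compact_abelian_system_axioms assms(1)
    invariant_measureD(1,2)[OF assms(3)])
  show "\<tau> (monomial f \<one>) = (\<integral>x. f x \<partial>\<mu>)" if "continuous_on UNIV f" for f
    using measure_formulaD[OF assms(2) that one_closed] by simp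
qed

text \<open>The measures M and N of the two components mix to \<mu>, so M = \<mu> by extremality of
  \<mu>. For g \<noteq> e the fixed points of g are then M-null, and \<sigma> vanishes at f u_g just
  as \<tau> does.\<close>

lemma extreme_trace_if_measure_formula:
  assumes \<tau>: "normalized_trace B \<tau>" and formula: "measure_formula \<mu> \<tau>"
    and \<mu>: "\<mu> \<in> full_support_extreme_measures G \<phi>"
  shows "extreme_trace B \<tau>"
proof (rule twisted_trace_extremeI[OF \<tau>])
  fix \<sigma> \<rho> :: "('g \<Rightarrow> 'x \<Rightarrow> complex) \<Rightarrow> complex" and t :: real and f :: "'x \<Rightarrow> complex" and g
  assume tr: "normalized_trace B \<sigma>" "normalized_trace B \<rho>" and t: "0 < t" "t < 1"
    and mix: "\<And>a. a \<in> carrier B \<Longrightarrow> \<tau> a = of_real (1 - t) * \<sigma> a + of_real t * \<rho> a"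
    and f: "continuous_on UNIV f" and g: "g \<in> carrier G"
  obtain M where "trace_measure G \<phi> \<sigma> M" by (rule trace_measure_exists[OF tr(1)])
  then interpret M: trace_measure G \<phi> \<sigma> M .
  obtain N where "trace_measure G \<phi> \<rho> N" by (rule trace_measure_exists[OF tr(2)])
  then interpret N: trace_measure G \<phi> \<rho> N .
  note I = invariant_measureD[OF full_support_extremeD(1)[OF \<mu>]]
  have "(\<integral>x. k x \<partial>\<mu>) = (1 - t) * (\<integral>x. k x \<partial>M) + t * (\<integral>x. k x \<partial>N)"
    if k: "continuous_on UNIV k" for k :: "'x \<Rightarrow> real"
  proof -
    have ck: "continuous_on UNIV (\<lambda>x. complex_of_real (k x))" using k by (intro continuous_intros)
    have "\<tau> (monomial (\<lambda>x. of_real (k x)) \<one>) = of_real (\<integral>x. k x \<partial>\<mu>)"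
      using measure_formulaD[OF formula ck one_closed] by simp
    moreover have "\<sigma> (monomial (\<lambda>x. of_real (k x)) \<one>) = of_real (\<integral>x. k x \<partial>M)"
      using M.trace_integral[OF ck] by simp
    moreover have "\<rho> (monomial (\<lambda>x. of_real (k x)) \<one>) = of_real (\<integral>x. k x \<partial>N)"
      using N.trace_integral[OF ck] by simp
    ultimately have "complex_of_real (\<integral>x. k x \<partial>\<mu>) = of_real ((1 - t) * (\<integral>x. k x \<partial>M) + t * (\<integral>x. k x \<partial>N))"
      using mix[OF monomial_closed[OF ck one_closed]] by simp
    thus ?thesis by (simp only: of_real_eq_iff)
  qed
  hence "\<forall>S. measure \<mu> S = (1 - t) * measure M S + t * measure N S"
    using measure_mixture_iff_integral[OF compact_space M.prob M.sets_\<mu> N.prob N.sets_\<mu> I(1,2), of t] t by simp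
  hence M_eq: "M = \<mu>"
    using full_support_extremeD(2)[OF \<mu> M.invariant_measure N.invariant_measure t] by blast
  show "\<sigma> (monomial f g) = \<tau> (monomial f g)"
  proof (cases "g = \<one>")
    case True
    thus ?thesis using M.trace_integral[OF f] measure_formulaD[OF formula f g] by (simp add: M_eq)
  next
    case False
    have "measure \<mu> {x. \<phi> g x = x} = 0"
      by (rule full_support_extreme_finite_null[OF \<mu> fixed_points(1)[OF g False]])
        (rule fixed_points(2)[OF g False])
    thus ?thesis
      using M.trace_monomial_eq_0_if_fixed_null[OF f g] measure_formulaD[OF formula f g] False by (simp add: M_eq)
  qed
qed

lemma measure_eq_1_if_integrals_0:
  assumes "prob_space M" "sets M = sets borel" and F: "finite F"
    and zero: "\<And>k :: 'x \<Rightarrow> real. continuous_on UNIV k \<Longrightarrow> (\<And>x. 0 \<le> k x) \<Longrightarrow> (\<And>x. x \<in> F \<Longrightarrow> k x = 0) \<Longrightarrow>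
      (\<integral>x. k x \<partial>M) = 0"
  shows "measure M F = 1"
proof -
  interpret prob_space M by fact
  have oF: "open (- F)" using finite_imp_closed[OF F] by (simp add: open_Compl)
  obtain k :: "nat \<Rightarrow> 'x \<Rightarrow> real" where k: "increases_to_indicator k (- F)"
    by (rule continuous_increasing_to_indicator_open[OF compact_space oF])
  have "(\<integral>x. k n x \<partial>M) = 0" for n
    using increases_to_indicatorD(1,2,4)[OF k] by (intro zero) auto
  hence "measure M (- F) = 0"
    using integral_tendsto_measure_open[OF assms(1,2) k oF] by (simp add: LIMSEQ_const_iff)
  moreover have "F \<in> sets M" unfolding assms(2) by (intro borel_closed finite_imp_closed F)
  moreover have "space M = UNIV" using sets_eq_imp_space_eq[OF assms(2)] by simp
  ultimately show ?thesis using prob_compl[of F] by (simp add: Compl_eq_Diff_UNIV)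
qed

text \<open>A nonnegative function vanishing on the orbit has integral 0 under both component
  measures, so both live on the orbit and \<sigma> is determined by its values at u_g for g in the
  stabilizer. Those values lie in the unit disc and mix to the unimodular \<xi>(g), hence equal
  it.\<close>

lemma extreme_trace_if_orbit_formula:
  assumes \<tau>: "normalized_trace B \<tau>" and formula: "orbit_formula x \<xi> \<tau>"
    and fin: "finite (orbit G \<phi> x)" and \<xi>: "\<xi> \<in> discrete_dual (stabilizer_group G \<phi> x)"
  shows "extreme_trace B \<tau>"
proof (rule twisted_trace_extremeI[OF \<tau>])
  let ?Q = "orbit G \<phi> x"
  have card: "card ?Q \<noteq> 0" using fin self_in_orbit[of x] by auto
  have \<xi>1: "\<xi> \<one> = 1"
  proof -
    interpret T: twisted_mean G \<phi> "\<lambda>f. (\<Sum>y\<in>?Q. f y) / of_nat (card ?Q)" "stabilizer G \<phi> x" \<xi>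
      by (rule twisted_mean_orbit[OF fin \<xi>])
    show ?thesis by (rule T.character_one)
  qed
  fix \<sigma> \<rho> :: "('g \<Rightarrow> 'x \<Rightarrow> complex) \<Rightarrow> complex" and t :: real and f :: "'x \<Rightarrow> complex" and g
  assume tr: "normalized_trace B \<sigma>" "normalized_trace B \<rho>" and t: "0 < t" "t < 1"
    and mix: "\<And>a. a \<in> carrier B \<Longrightarrow> \<tau> a = of_real (1 - t) * \<sigma> a + of_real t * \<rho> a"
    and f: "continuous_on UNIV f" and g: "g \<in> carrier G"
  obtain M where "trace_measure G \<phi> \<sigma> M" by (rule trace_measure_exists[OF tr(1)])
  then interpret M: trace_measure G \<phi> \<sigma> M .
  obtain N where "trace_measure G \<phi> \<rho> N" by (rule trace_measure_exists[OF tr(2)])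
  then interpret N: trace_measure G \<phi> \<rho> N .
  have zero: "(\<integral>x. k x \<partial>M) = 0 \<and> (\<integral>x. k x \<partial>N) = 0"
    if k: "continuous_on UNIV k" "\<And>x. 0 \<le> k x" "\<And>x. x \<in> ?Q \<Longrightarrow> k x = 0" for k :: "'x \<Rightarrow> real"
  proof -
    have ck: "continuous_on UNIV (\<lambda>x. complex_of_real (k x))" using k(1) by (intro continuous_intros)
    have "\<tau> (monomial (\<lambda>x. of_real (k x)) \<one>) = 0"
      using orbit_formulaD[OF formula ck one_closed] k(3) by simp
    moreover have "\<sigma> (monomial (\<lambda>x. of_real (k x)) \<one>) = of_real (\<integral>x. k x \<partial>M)"
      using M.trace_integral[OF ck] by simp
    moreover have "\<rho> (monomial (\<lambda>x. of_real (k x)) \<one>) = of_real (\<integral>x. k x \<partial>N)"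
      using N.trace_integral[OF ck] by simp
    ultimately have "complex_of_real ((1 - t) * (\<integral>x. k x \<partial>M) + t * (\<integral>x. k x \<partial>N)) = of_real 0"
      using mix[OF monomial_closed[OF ck one_closed]] by simp
    hence sum0: "(1 - t) * (\<integral>x. k x \<partial>M) + t * (\<integral>x. k x \<partial>N) = 0" by (simp only: of_real_eq_iff)
    have "0 \<le> (\<integral>x. k x \<partial>M)" "0 \<le> (\<integral>x. k x \<partial>N)" using k(2) by (auto intro: Bochner_Integration.integral_nonneg)
    hence "0 \<le> (1 - t) * (\<integral>x. k x \<partial>M)" "0 \<le> t * (\<integral>x. k x \<partial>N)" using t by auto
    hence "(1 - t) * (\<integral>x. k x \<partial>M) = 0" "t * (\<integral>x. k x \<partial>N) = 0" using sum0 by linarith+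
    thus ?thesis using t by simp
  qed
  have full: "measure M ?Q = 1" "measure N ?Q = 1"
    using measure_eq_1_if_integrals_0[OF M.prob M.sets_\<mu> fin] measure_eq_1_if_integrals_0[OF N.prob N.sets_\<mu> fin] zero
    by auto
  have \<tau>u: "\<tau> (monomial (\<lambda>x. 1) g) = (if g \<in> stabilizer G \<phi> x then \<xi> g else 0)"
    using orbit_formulaD[OF formula _ g, of "\<lambda>x. 1"] card by simp
  have u: "\<sigma> (monomial (\<lambda>x. 1) g) = \<xi> g" if gH: "g \<in> stabilizer G \<phi> x"
  proof (rule convex_combination_unit_eq[OF _ _ _ t])
    show "cmod (\<xi> g) = 1" using \<xi> gH by (auto simp: discrete_dual_def hom_def circle_group_def)
    have "(cmod (\<sigma> (monomial (\<lambda>x. 1) g)))\<^sup>2 \<le> 1\<^sup>2" "(cmod (\<rho> (monomial (\<lambda>x. 1) g)))\<^sup>2 \<le> 1\<^sup>2"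
      using M.trace_monomial_bound[of "\<lambda>x. 1" g] N.trace_monomial_bound[of "\<lambda>x. 1" g] g
      by (simp_all add: M.prob_space[unfolded M.space_\<mu>] N.prob_space[unfolded N.space_\<mu>])
    thus "cmod (\<sigma> (monomial (\<lambda>x. 1) g)) \<le> 1" "cmod (\<rho> (monomial (\<lambda>x. 1) g)) \<le> 1"
      by (auto intro: power2_le_imp_le)
    show "\<xi> g = of_real (1 - t) * \<sigma> (monomial (\<lambda>x. 1) g) + of_real t * \<rho> (monomial (\<lambda>x. 1) g)"
      using mix[of "monomial (\<lambda>x. 1) g"] \<tau>u gH g by simp
  qed
  show "\<sigma> (monomial f g) = \<tau> (monomial f g)"
    unfolding M.trace_on_finite_orbit[OF fin full(1) f g] orbit_formulaD[OF formula f g]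
    by (simp only: u cong: if_cong)
qed

lemma extreme_trace_classification:
  assumes ext: "extreme_trace B \<tau>"
  shows "(\<exists>\<mu>\<in>full_support_extreme_measures G \<phi>. measure_formula \<mu> \<tau>) \<or>
    (\<exists>x \<xi>. finite (orbit G \<phi> x) \<and> \<xi> \<in> discrete_dual (stabilizer_group G \<phi> x) \<and> orbit_formula x \<xi> \<tau>)"
proof -
  have tr: "normalized_trace B \<tau>" using ext by (simp add: extreme_trace_def)
  obtain \<mu> where "trace_measure G \<phi> \<tau> \<mu>" by (rule trace_measure_exists[OF tr])
  then interpret M: trace_measure G \<phi> \<tau> \<mu> .
  note I = invariant_measureD[OF M.invariant_measure]
  show ?thesis
  proof (cases "\<exists>F. finite F \<and> (\<forall>g\<in>carrier G. \<forall>y\<in>F. \<phi> g y \<in> F) \<and> measure \<mu> F \<noteq> 0")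
    case True
    then obtain F where F: "finite F" "\<And>g y. g \<in> carrier G \<Longrightarrow> y \<in> F \<Longrightarrow> \<phi> g y \<in> F" "measure \<mu> F \<noteq> 0"
      by blast
    \<comment> \<open>A charged finite set has a charged point. Its orbit stays inside F, so it is
      finite and charged, and by extremality has full measure.\<close>
    have "measure \<mu> F = (\<Sum>y\<in>F. measure \<mu> {y})"
      using F(1) M.finite_in_sets by (intro M.finite_measure_eq_sum_singleton) auto
    then obtain y where y: "y \<in> F" "measure \<mu> {y} \<noteq> 0" using F(3) by (metis sum.neutral)
    have QF: "orbit G \<phi> y \<subseteq> F" using F(2) y(1) by (auto simp: orbit_def)
    hence fin: "finite (orbit G \<phi> y)" using F(1) by (rule finite_subset)
    have "measure \<mu> {y} \<le> measure \<mu> (orbit G \<phi> y)"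
      using self_in_orbit[of y] M.finite_in_sets[OF fin] by (intro M.finite_measure_mono) auto
    hence "measure \<mu> (orbit G \<phi> y) \<noteq> 0" using y(2) measure_nonneg[of \<mu> "{y}"] by linarith
    hence "measure \<mu> (orbit G \<phi> y) = 1"
      using M.extreme_trace_measure_finite_invariant[OF ext fin] act_orbit by blast
    from M.extreme_trace_on_finite_orbit[OF ext fin this] show ?thesis
      using fin unfolding orbit_formula_def by blast
  next
    case False
    hence null: "measure \<mu> F = 0" if "finite F" "\<And>g y. g \<in> carrier G \<Longrightarrow> y \<in> F \<Longrightarrow> \<phi> g y \<in> F" for F
      using that by blast
    have formula: "measure_formula \<mu> \<tau>"
      unfolding measure_formula_def
    proof (intro allI impI, elim conjE)
      fix f :: "'x \<Rightarrow> complex" and g assume f: "continuous_on UNIV f" and g: "g \<in> carrier G"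
      show "\<tau> (monomial f g) = (if g = \<one> then \<integral>x. f x \<partial>\<mu> else 0)"
      proof (cases "g = \<one>")
        case True
        thus ?thesis using M.trace_integral[OF f] by simp
      next
        case False
        have "measure \<mu> {x. \<phi> g x = x} = 0"
          by (rule null[OF fixed_points(1)[OF g False]]) (rule fixed_points(2)[OF g False])
        thus ?thesis using M.trace_monomial_eq_0_if_fixed_null[OF f g] False by simp
      qed
    qed
    have support: "0 < emeasure \<mu> U" if U: "open U" "x \<in> U" for U x
    proof (rule ccontr)
      assume "\<not> 0 < emeasure \<mu> U"
      hence U0: "emeasure \<mu> U = 0" by simp
      have pre_open: "open (\<phi> g -` U)" if "g \<in> carrier G" for g
        using continuous_act[OF that] U(1) by (simp add: continuous_on_open_vimage)
      \<comment> \<open>The saturation of a null open set is null because the group is countable.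
        Its complement is closed, invariant and proper, hence finite, yet has measure 1, contrary to
        \<open>null\<close>.\<close>
      define W where "W = (\<Union>g\<in>carrier G. \<phi> g -` U)"
      have W: "open W" unfolding W_def using pre_open by blast
      have "W \<in> null_sets \<mu>"
        unfolding W_def
      proof (rule null_sets_UN'[OF countable_group])
        show "\<phi> g -` U \<in> null_sets \<mu>" if "g \<in> carrier G" for g
          using I(4)[OF that, of U] U(1) U0 pre_open[OF that] M.sets_\<mu> by (simp add: null_sets_def)
      qed
      hence "measure \<mu> W = 0" by (simp add: null_sets_def M.emeasure_eq_measure)
      moreover have "W \<in> sets \<mu>" unfolding M.sets_\<mu> using W by simp
      ultimately have "measure \<mu> (- W) = 1" using M.prob_compl[of W] by (simp add: Compl_eq_Diff_UNIV)
      moreover have inv: "\<phi> g y \<in> - W" if g: "g \<in> carrier G" and y: "y \<in> - W" for g y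
      proof
        assume "\<phi> g y \<in> W"
        then obtain h where h: "h \<in> carrier G" "\<phi> h (\<phi> g y) \<in> U" by (auto simp: W_def)
        hence "\<phi> (h \<otimes> g) y \<in> U" "h \<otimes> g \<in> carrier G" using g by (simp_all add: act_mult)
        hence "y \<in> W" unfolding W_def by blast
        thus False using y by blast
      qed
      moreover have "finite (- W)"
      proof (rule finite_if_closed_invariant[OF _ _ inv])
        show "closed (- W)" using W by (simp add: closed_Compl)
        have "x \<in> W" unfolding W_def using U(2) by (intro UN_I[of \<one>]) auto
        thus "- W \<noteq> UNIV" by blast
      qed
      ultimately show False using null[of "- W"] by simp
    qed
    have extreme: "M' = \<mu> \<and> N' = \<mu>"
      if MN: "M' \<in> invariant_measures G \<phi>" "N' \<in> invariant_measures G \<phi>" and t: "0 < t" "t < 1"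
        and mix: "\<forall>S. measure \<mu> S = (1 - t) * measure M' S + t * measure N' S" for M' N' and t :: real
    proof -
      note M' = invariant_measureD[OF MN(1)] and N' = invariant_measureD[OF MN(2)]
      \<comment> \<open>A decomposition of \<mu> is lifted to one of \<tau>: every invariant measure
        defines a trace supported at the identity, and \<tau> has this form by
        \<open>formula\<close>. Extremality of \<tau> then returns equality of the
        integrals.\<close>
      obtain \<sigma> where \<sigma>: "normalized_trace B \<sigma>" "measure_formula M' \<sigma>" by (rule measure_trace_exists[OF MN(1)])
      obtain \<rho> where \<rho>: "normalized_trace B \<rho>" "measure_formula N' \<rho>" by (rule measure_trace_exists[OF MN(2)])
      interpret M': trace_measure G \<phi> \<sigma> M' by (rule trace_measure_of_formula[OF \<sigma> MN(1)])
      interpret N': trace_measure G \<phi> \<rho> N' by (rule trace_measure_of_formula[OF \<rho> MN(2)])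
      have real_mix: "(\<integral>x. k x \<partial>\<mu>) = (1 - t) * (\<integral>x. k x \<partial>M') + t * (\<integral>x. k x \<partial>N')"
        if "continuous_on UNIV k" for k :: "'x \<Rightarrow> real"
        using measure_mixture_iff_integral[OF compact_space M'(1,2) N'(1,2) I(1,2), of t] t mix that by simp
      have complex_mix: "(\<integral>x. f x \<partial>\<mu>) = of_real (1 - t) * (\<integral>x. f x \<partial>M') + of_real t * (\<integral>x. f x \<partial>N')"
        if f: "continuous_on UNIV f" for f :: "'x \<Rightarrow> complex"
      proof -
        have c: "continuous_on UNIV (\<lambda>x. Re (f x))" "continuous_on UNIV (\<lambda>x. Im (f x))"
          using f by (auto intro: continuous_intros)
        have i: "integrable \<mu> f" "integrable M' f" "integrable N' f"
          by (rule M.integrable_continuous[OF f], rule M'.integrable_continuous[OF f], rule N'.integrable_continuous[OF f])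
        show ?thesis
        proof (rule complex_eqI)
          show "Re (\<integral>x. f x \<partial>\<mu>) = Re (of_real (1 - t) * (\<integral>x. f x \<partial>M') + of_real t * (\<integral>x. f x \<partial>N'))"
            using real_mix[OF c(1)] i by simp
          show "Im (\<integral>x. f x \<partial>\<mu>) = Im (of_real (1 - t) * (\<integral>x. f x \<partial>M') + of_real t * (\<integral>x. f x \<partial>N'))"
            using real_mix[OF c(2)] i by simp
        qed
      qed
      have mono_mix: "\<tau> (monomial f g) = of_real (1 - t) * \<sigma> (monomial f g) + of_real t * \<rho> (monomial f g)"
        if "continuous_on UNIV f" "g \<in> carrier G" for f g
        using measure_formulaD[OF formula that] measure_formulaD[OF \<sigma>(2) that] measure_formulaD[OF \<rho>(2) that]
          complex_mix[OF that(1)] by simp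
      have mixB: "\<tau> a = of_real (1 - t) * \<sigma> a + of_real t * \<rho> a" if "a \<in> carrier B" for a
        by (rule normalized_trace_mixture[OF tr \<sigma>(1) \<rho>(1) mono_mix that])
      note eq = extreme_traceD[OF ext \<sigma>(1) \<rho>(1) t mixB]
      have int_eq: "(\<integral>x. k x \<partial>M') = (\<integral>x. k x \<partial>\<mu>)" "(\<integral>x. k x \<partial>N') = (\<integral>x. k x \<partial>\<mu>)"
        if k: "continuous_on UNIV k" for k :: "'x \<Rightarrow> real"
      proof -
        have ck: "continuous_on UNIV (\<lambda>x. complex_of_real (k x))" using k by (intro continuous_intros)
        have kB: "monomial (\<lambda>x. complex_of_real (k x)) \<one> \<in> carrier B" using ck by simp
        have "complex_of_real (\<integral>x. k x \<partial>M') = of_real (\<integral>x. k x \<partial>\<mu>)"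
          using eq(1)[OF _ kB] M'.trace_integral[OF ck] M.trace_integral[OF ck] by simp
        thus "(\<integral>x. k x \<partial>M') = (\<integral>x. k x \<partial>\<mu>)" by (simp only: of_real_eq_iff)
        have "complex_of_real (\<integral>x. k x \<partial>N') = of_real (\<integral>x. k x \<partial>\<mu>)"
          using eq(2)[OF _ kB] N'.trace_integral[OF ck] M.trace_integral[OF ck] by simp
        thus "(\<integral>x. k x \<partial>N') = (\<integral>x. k x \<partial>\<mu>)" by (simp only: of_real_eq_iff)
      qed
      show ?thesis
        using prob_borel_eqI_integral[OF compact_space M'(1) I(1) M'(2) I(2) int_eq(1)]
          prob_borel_eqI_integral[OF compact_space N'(1) I(1) N'(2) I(2) int_eq(2)] by blast
    qed
    have "\<mu> \<in> full_support_extreme_measures G \<phi>"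
      unfolding full_support_extreme_measures_def extreme_points_def measure_support_def
      using M.invariant_measure extreme support by auto
    thus ?thesis using formula by blast
  qed
qed

end

section \<open>Transfer to the crossed product\<close>

context almost_minimal_system begin

lemma crossed_product_eq: "crossed_product G \<phi> = env.A"
  by (simp add: crossed_product_def)

lemma cp_fun_mult_unitary:
  assumes "continuous_on UNIV f" "g \<in> carrier G"
  shows "cp_fun G \<phi> f \<otimes>\<^bsub>crossed_product G \<phi>\<^esub> cp_unitary G \<phi> g = env.emb (monomial f g)"
proof -
  have "cp_fun G \<phi> f = env.emb (monomial f \<one>)" "cp_unitary G \<phi> g = env.emb (monomial (\<lambda>x. 1) g)"
    by (simp_all only: cp_fun_def cp_unitary_def cp_embed_def monomial_def)
  thus ?thesis
    using env.emb_hom(2)[of "monomial f \<one>" "monomial (\<lambda>x. 1) g"] assms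
    by (simp add: crossed_product_eq monomial_mult)
qed

lemma is_tau_measure_iff:
  "is_tau_measure G \<phi> \<mu> T \<longleftrightarrow> T \<in> states env.A \<and> measure_formula \<mu> (\<lambda>a. T (env.emb a))"
  unfolding is_tau_measure_def measure_formula_def crossed_product_eq[symmetric]
  by (auto simp: cp_fun_mult_unitary)

lemma is_tau_orbit_iff:
  "is_tau_orbit G \<phi> x \<xi> T \<longleftrightarrow> T \<in> states env.A \<and> orbit_formula x \<xi> (\<lambda>a. T (env.emb a))"
  unfolding is_tau_orbit_def orbit_formula_def crossed_product_eq[symmetric]
  by (auto simp: cp_fun_mult_unitary)

lemma states_eq_if_monomial:
  assumes T: "T \<in> states env.A" and S: "S \<in> states env.A"
    and eq: "\<And>f g. continuous_on UNIV f \<Longrightarrow> g \<in> carrier G \<Longrightarrow> T (env.emb (monomial f g)) = S (env.emb (monomial f g))"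
  shows "T = S"
proof (rule env.states_eqI[OF T S])
  fix a assume a: "a \<in> carrier B"
  show "T (env.emb a) = S (env.emb a)"
    by (rule functional_eq_if_monomial[of "\<lambda>a. T (env.emb a)" "\<lambda>a. S (env.emb a)", OF _ _ eq a])
      (rule conv.functional_add[OF env.states_emb_positive[OF T]] conv.functional_add[OF env.states_emb_positive[OF S]];
       assumption)+
qed

lemma tau_measure_unique:
  assumes T: "is_tau_measure G \<phi> \<mu> T" and S: "is_tau_measure G \<phi> \<mu> S" shows "T = S"
proof (rule states_eq_if_monomial)
  note T = T[unfolded is_tau_measure_iff] and S = S[unfolded is_tau_measure_iff]
  show "T \<in> states env.A" "S \<in> states env.A" using T S by auto
  show "T (env.emb (monomial f g)) = S (env.emb (monomial f g))" if "continuous_on UNIV f" "g \<in> carrier G" for f g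
    using measure_formulaD[OF conjunct2[OF T] that] measure_formulaD[OF conjunct2[OF S] that] by (rule trans[OF _ sym])
qed

lemma tau_orbit_unique:
  assumes T: "is_tau_orbit G \<phi> x \<xi> T" and S: "is_tau_orbit G \<phi> x \<xi> S" shows "T = S"
proof (rule states_eq_if_monomial)
  note T = T[unfolded is_tau_orbit_iff] and S = S[unfolded is_tau_orbit_iff]
  show "T \<in> states env.A" "S \<in> states env.A" using T S by auto
  show "T (env.emb (monomial f g)) = S (env.emb (monomial f g))" if "continuous_on UNIV f" "g \<in> carrier G" for f g
    using orbit_formulaD[OF conjunct2[OF T] that] orbit_formulaD[OF conjunct2[OF S] that] by (rule trans[OF _ sym])
qed

lemma tracial_states_imp_states: "T \<in> tracial_states env.A \<Longrightarrow> T \<in> states env.A"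
  by (simp add: tracial_states_def)

lemma tau_measure_extreme_exists:
  assumes \<mu>: "\<mu> \<in> full_support_extreme_measures G \<phi>"
  shows "\<exists>T. is_tau_measure G \<phi> \<mu> T \<and> T \<in> extreme_points (\<lambda>\<tau>. \<tau>) (tracial_states (crossed_product G \<phi>))"
proof -
  obtain \<tau> where \<tau>: "normalized_trace B \<tau>" "measure_formula \<mu> \<tau>"
    by (rule measure_trace_exists[OF full_support_extremeD(1)[OF \<mu>]])
  note T = env.extend_trace(1,2)[OF \<tau>(1)]
  have formula: "measure_formula \<mu> (\<lambda>a. env.extend_functional \<tau> (env.emb a))"
    using \<tau>(2) by (simp add: measure_formula_def T(2))
  have "extreme_trace B (\<lambda>a. env.extend_functional \<tau> (env.emb a))"
    by (rule extreme_trace_if_measure_formula[OF env.tracial_states_emb[OF T(1)] formula \<mu>])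
  thus ?thesis using T(1) formula
    by (intro exI[of _ "env.extend_functional \<tau>"])
       (simp add: is_tau_measure_iff env.extreme_tracial_states_iff crossed_product_eq tracial_states_imp_states)
qed

lemma tau_orbit_extreme_exists:
  assumes fin: "finite (orbit G \<phi> x)" and \<xi>: "\<xi> \<in> discrete_dual (stabilizer_group G \<phi> x)"
  shows "\<exists>T. is_tau_orbit G \<phi> x \<xi> T \<and> T \<in> extreme_points (\<lambda>\<tau>. \<tau>) (tracial_states (crossed_product G \<phi>))"
proof -
  obtain \<tau> where \<tau>: "normalized_trace B \<tau>" "orbit_formula x \<xi> \<tau>"
    by (rule orbit_trace_exists[OF fin \<xi>])
  note T = env.extend_trace(1,2)[OF \<tau>(1)]
  have formula: "orbit_formula x \<xi> (\<lambda>a. env.extend_functional \<tau> (env.emb a))"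
    using \<tau>(2) by (simp add: orbit_formula_def T(2))
  have "extreme_trace B (\<lambda>a. env.extend_functional \<tau> (env.emb a))"
    by (rule extreme_trace_if_orbit_formula[OF env.tracial_states_emb[OF T(1)] formula fin \<xi>])
  thus ?thesis using T(1) formula
    by (intro exI[of _ "env.extend_functional \<tau>"])
       (simp add: is_tau_orbit_iff env.extreme_tracial_states_iff crossed_product_eq tracial_states_imp_states)
qed

lemma extreme_tracial_state_cases:
  assumes "T \<in> extreme_points (\<lambda>\<tau>. \<tau>) (tracial_states (crossed_product G \<phi>))"
  obtains \<mu> where "\<mu> \<in> full_support_extreme_measures G \<phi>" "is_tau_measure G \<phi> \<mu> T"
  | x \<xi> where "finite (orbit G \<phi> x)" "\<xi> \<in> discrete_dual (stabilizer_group G \<phi> x)" "is_tau_orbit G \<phi> x \<xi> T"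
proof -
  have T: "T \<in> states env.A" "extreme_trace B (\<lambda>a. T (env.emb a))"
    using assms by (simp_all add: env.extreme_tracial_states_iff crossed_product_eq tracial_states_imp_states)
  from extreme_trace_classification[OF T(2)] show ?thesis
    using T(1) that unfolding is_tau_measure_iff is_tau_orbit_iff by blast
qed

lemma tau_measure_inj:
  assumes \<mu>: "\<mu> \<in> full_support_extreme_measures G \<phi>" "\<nu> \<in> full_support_extreme_measures G \<phi>"
    and T: "is_tau_measure G \<phi> \<mu> T" "is_tau_measure G \<phi> \<nu> T"
  shows "\<mu> = \<nu>"
proof (rule prob_borel_eqI_integral[OF compact_space])
  note I = invariant_measureD[OF full_support_extremeD(1)[OF \<mu>(1)]]
  note J = invariant_measureD[OF full_support_extremeD(1)[OF \<mu>(2)]]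
  show "prob_space \<mu>" "prob_space \<nu>" "sets \<mu> = sets borel" "sets \<nu> = sets borel" using I J by auto
  fix k :: "'x \<Rightarrow> real" assume k: "continuous_on UNIV k"
  have ck: "continuous_on UNIV (\<lambda>x. complex_of_real (k x))" using k by (intro continuous_intros)
  have "complex_of_real (\<integral>x. k x \<partial>\<mu>) = of_real (\<integral>x. k x \<partial>\<nu>)"
    using measure_formulaD[OF conjunct2[OF T(1)[unfolded is_tau_measure_iff]] ck one_closed]
      measure_formulaD[OF conjunct2[OF T(2)[unfolded is_tau_measure_iff]] ck one_closed] by simp
  thus "(\<integral>x. k x \<partial>\<mu>) = (\<integral>x. k x \<partial>\<nu>)" by (simp only: of_real_eq_iff)
qed

lemma tau_orbit_at_one:
  assumes fin: "finite (orbit G \<phi> x)" and \<xi>: "\<xi> \<in> discrete_dual (stabilizer_group G \<phi> x)"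
    and T: "is_tau_orbit G \<phi> x \<xi> T" and f: "continuous_on UNIV f"
  shows "T (env.emb (monomial f \<one>)) = (\<Sum>y\<in>orbit G \<phi> x. f y) / of_nat (card (orbit G \<phi> x))"
proof -
  interpret M: twisted_mean G \<phi> "\<lambda>f. (\<Sum>y\<in>orbit G \<phi> x. f y) / of_nat (card (orbit G \<phi> x))" "stabilizer G \<phi> x" \<xi>
    by (rule twisted_mean_orbit[OF fin \<xi>])
  have "\<one> \<in> stabilizer G \<phi> x" by (simp add: stabilizer_def)
  thus ?thesis
    using orbit_formulaD[OF conjunct2[OF T[unfolded is_tau_orbit_iff]] f one_closed] M.character_one by simp
qed

text \<open>On C(X) the orbit trace is the average over the orbit, which would give the orbit
  \<mu>-measure 1, while \<mu> vanishes on finite invariant sets.\<close>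

lemma tau_orbit_ne_measure:
  assumes fin: "finite (orbit G \<phi> x)" and \<xi>: "\<xi> \<in> discrete_dual (stabilizer_group G \<phi> x)"
    and T: "is_tau_orbit G \<phi> x \<xi> T" and \<mu>: "\<mu> \<in> full_support_extreme_measures G \<phi>"
  shows "\<not> is_tau_measure G \<phi> \<mu> T"
proof
  assume T': "is_tau_measure G \<phi> \<mu> T"
  note I = invariant_measureD[OF full_support_extremeD(1)[OF \<mu>]]
  have "measure \<mu> (orbit G \<phi> x) = 1"
  proof (rule measure_eq_1_if_integrals_0[OF I(1,2) fin])
    fix k :: "'x \<Rightarrow> real" assume k: "continuous_on UNIV k" "\<And>y. y \<in> orbit G \<phi> x \<Longrightarrow> k y = 0"
    have ck: "continuous_on UNIV (\<lambda>x. complex_of_real (k x))" using k(1) by (intro continuous_intros)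
    have "complex_of_real (\<integral>x. k x \<partial>\<mu>) = of_real 0"
      using measure_formulaD[OF conjunct2[OF T'[unfolded is_tau_measure_iff]] ck one_closed]
        tau_orbit_at_one[OF fin \<xi> T ck] k(2) by simp
    thus "(\<integral>x. k x \<partial>\<mu>) = 0" by (simp only: of_real_eq_iff)
  qed
  moreover have "measure \<mu> (orbit G \<phi> x) = 0"
    by (rule full_support_extreme_finite_null[OF \<mu> fin]) (rule act_orbit)
  ultimately show False by simp
qed

text \<open>The orbit is read off from C(X): a nonnegative function vanishing on one orbit and equal
  to 1 at a point of the other would have two different averages. The character is then read off
  from the u_g.\<close>

lemma tau_orbit_inj:
  assumes fin: "finite (orbit G \<phi> x)" "finite (orbit G \<phi> y)"
    and \<xi>: "\<xi> \<in> discrete_dual (stabilizer_group G \<phi> x)" "\<zeta> \<in> discrete_dual (stabilizer_group G \<phi> y)"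
    and T: "is_tau_orbit G \<phi> x \<xi> T" "is_tau_orbit G \<phi> y \<zeta> T"
  shows "orbit G \<phi> x = orbit G \<phi> y" "\<xi> = \<zeta>"
proof -
  let ?Q = "orbit G \<phi> x" and ?R = "orbit G \<phi> y"
  have card: "card ?Q \<noteq> 0" using fin(1) self_in_orbit[of x] by auto
  have "x \<in> ?R"
  proof (rule ccontr)
    assume x: "x \<notin> ?R"
    have oR: "open (- ?R)" using finite_imp_closed[OF fin(2)] by (simp add: open_Compl)
    obtain k :: "nat \<Rightarrow> 'x \<Rightarrow> real" where k: "increases_to_indicator k (- ?R)"
      by (rule continuous_increasing_to_indicator_open[OF compact_space oR])
    have "eventually (\<lambda>n. k n x = 1) sequentially" using increases_to_indicatorD(5)[OF k, of x] x by simp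
    then obtain n where n: "k n x = 1" by (auto simp: eventually_sequentially)
    have ck: "continuous_on UNIV (\<lambda>x. complex_of_real (k n x))"
      using increases_to_indicatorD(1)[OF k] by (intro continuous_intros)
    have "T (env.emb (monomial (\<lambda>x. of_real (k n x)) \<one>)) = 0"
      using tau_orbit_at_one[OF fin(2) \<xi>(2) T(2) ck] increases_to_indicatorD(4)[OF k] by simp
    hence "(\<Sum>z\<in>?Q. complex_of_real (k n z)) = 0"
      using tau_orbit_at_one[OF fin(1) \<xi>(1) T(1) ck] card by simp
    hence "complex_of_real (\<Sum>z\<in>?Q. k n z) = of_real 0" by (simp only: of_real_sum of_real_0)
    hence "(\<Sum>z\<in>?Q. k n z) = 0" by (simp only: of_real_eq_iff)
    moreover have "k n x \<le> (\<Sum>z\<in>?Q. k n z)"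
      using increases_to_indicatorD(2)[OF k] by (intro member_le_sum self_in_orbit fin(1)) auto
    ultimately show False using n by simp
  qed
  note rep = orbit_representative[OF this]
  then show "?Q = ?R" by simp
  have H: "stabilizer G \<phi> x = stabilizer G \<phi> y" by (rule rep(2))
  show "\<xi> = \<zeta>"
  proof (rule extensionalityI)
    show "\<xi> \<in> extensional (stabilizer G \<phi> x)" "\<zeta> \<in> extensional (stabilizer G \<phi> x)"
      using \<xi> by (auto simp: discrete_dual_def H)
    fix g assume g: "g \<in> stabilizer G \<phi> x"
    hence gG: "g \<in> carrier G" by (simp add: stabilizer_def)
    show "\<xi> g = \<zeta> g"
      using orbit_formulaD[OF conjunct2[OF T(1)[unfolded is_tau_orbit_iff]] _ gG, of "\<lambda>x. 1"]
        orbit_formulaD[OF conjunct2[OF T(2)[unfolded is_tau_orbit_iff]] _ gG, of "\<lambda>x. 1"] g card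
      by (simp add: H rep(1))
  qed
qed

lemma is_tau_orbit_cong:
  assumes "orbit G \<phi> x = orbit G \<phi> y" shows "is_tau_orbit G \<phi> x \<xi> T \<longleftrightarrow> is_tau_orbit G \<phi> y \<xi> T"
proof -
  have "x \<in> orbit G \<phi> y" using self_in_orbit[of x] assms by simp
  thus ?thesis using orbit_representative(2)[of x y] by (simp add: is_tau_orbit_def assms)
qed

section \<open>Assembling the bijection\<close>

lemma extreme_tracial_states_bij:
  defines "D \<equiv> (SIGMA Q:finite_orbits G \<phi>. \<Union>x\<in>Q. discrete_dual (stabilizer_group G \<phi> x)) <+>
      full_support_extreme_measures G \<phi>"
    and "K \<equiv> extreme_points (\<lambda>\<tau>. \<tau>) (tracial_states (crossed_product G \<phi>))"
  obtains \<Phi> where "bij_betw \<Phi> D K"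
    and "\<And>\<mu>. \<mu> \<in> full_support_extreme_measures G \<phi> \<Longrightarrow> is_tau_measure G \<phi> \<mu> (\<Phi> (Inr \<mu>))"
    and "\<And>x \<xi>. orbit G \<phi> x \<in> finite_orbits G \<phi> \<Longrightarrow> \<xi> \<in> discrete_dual (stabilizer_group G \<phi> x) \<Longrightarrow>
      is_tau_orbit G \<phi> x \<xi> (\<Phi> (Inl (orbit G \<phi> x, \<xi>)))"
proof -
  have "\<exists>T. is_tau_measure G \<phi> \<mu> T \<and> T \<in> K" if "\<mu> \<in> full_support_extreme_measures G \<phi>" for \<mu>
    using tau_measure_extreme_exists[OF that] by (simp add: K_def)
  then obtain t where t: "\<And>\<mu>. \<mu> \<in> full_support_extreme_measures G \<phi> \<Longrightarrow> is_tau_measure G \<phi> \<mu> (t \<mu>)"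
    "\<And>\<mu>. \<mu> \<in> full_support_extreme_measures G \<phi> \<Longrightarrow> t \<mu> \<in> K" by metis
  \<comment> \<open>The domain is indexed by orbits, whereas the formula for the trace is stated at
    a point; \<open>is_tau_orbit_cong\<close> removes the dependence on the chosen one.\<close>
  define pt where "pt Q = (SOME x. orbit G \<phi> x = Q)" for Q
  have pt: "orbit G \<phi> (pt (orbit G \<phi> x)) = orbit G \<phi> x" for x
    unfolding pt_def by (rule someI[of _ x]) simp
  have finite_orbitsD: "\<exists>x. Q = orbit G \<phi> x \<and> finite (orbit G \<phi> x)" if "Q \<in> finite_orbits G \<phi>" for Q
    using that by (auto simp: finite_orbits_def orbits_def)
  have "\<exists>T. is_tau_orbit G \<phi> (pt Q) \<xi> T \<and> T \<in> K"
    if "Q \<in> finite_orbits G \<phi>" "\<xi> \<in> discrete_dual (stabilizer_group G \<phi> (pt Q))" for Q \<xi>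
  proof -
    have "finite (orbit G \<phi> (pt Q))" using finite_orbitsD[OF that(1)] pt by auto
    from tau_orbit_extreme_exists[OF this that(2)] show ?thesis by (simp add: K_def)
  qed
  then obtain s where s: "\<And>Q \<xi>. Q \<in> finite_orbits G \<phi> \<Longrightarrow> \<xi> \<in> discrete_dual (stabilizer_group G \<phi> (pt Q)) \<Longrightarrow>
      is_tau_orbit G \<phi> (pt Q) \<xi> (s Q \<xi>)"
    "\<And>Q \<xi>. Q \<in> finite_orbits G \<phi> \<Longrightarrow> \<xi> \<in> discrete_dual (stabilizer_group G \<phi> (pt Q)) \<Longrightarrow> s Q \<xi> \<in> K" by metis
  define \<Phi> where "\<Phi> z = (case z of Inl (Q, \<xi>) \<Rightarrow> s Q \<xi> | Inr \<mu> \<Rightarrow> t \<mu>)" for z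
  have stab: "stabilizer G \<phi> (pt (orbit G \<phi> x)) = stabilizer G \<phi> x" for x
    using orbit_representative(2)[of "pt (orbit G \<phi> x)" x] self_in_orbit[of "pt (orbit G \<phi> x)"] pt by simp
  \<comment> \<open>The union over the points of Q has a single distinct member, since stabilizers
    are constant on orbits.\<close>
  have D_Inl: "Inl (Q, \<xi>) \<in> D \<longleftrightarrow> Q \<in> finite_orbits G \<phi> \<and> \<xi> \<in> discrete_dual (stabilizer_group G \<phi> (pt Q))" for Q \<xi>
  proof -
    have "(\<Union>x\<in>Q. discrete_dual (stabilizer_group G \<phi> x)) = discrete_dual (stabilizer_group G \<phi> (pt Q))"
      if Q: "Q \<in> finite_orbits G \<phi>"
    proof -
      obtain x where x: "Q = orbit G \<phi> x" using finite_orbitsD[OF Q] by blast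
      have "stabilizer G \<phi> y = stabilizer G \<phi> (pt Q)" if "y \<in> Q" for y
        using orbit_representative(2)[of y x] that stab[of x] by (simp add: x)
      thus ?thesis using self_in_orbit[of x] by (auto simp: x)
    qed
    thus ?thesis by (auto simp: D_def)
  qed
  have D_Inr: "Inr \<mu> \<in> D \<longleftrightarrow> \<mu> \<in> full_support_extreme_measures G \<phi>" for \<mu>
    by (auto simp: D_def)
  have fin_pt: "finite (orbit G \<phi> (pt Q))" "orbit G \<phi> (pt Q) = Q" if "Q \<in> finite_orbits G \<phi>" for Q
    using finite_orbitsD[OF that] pt by auto
  have tau_Inl: "is_tau_orbit G \<phi> (pt Q) \<xi> (\<Phi> (Inl (Q, \<xi>)))" if "Inl (Q, \<xi>) \<in> D" for Q \<xi>
    using s(1) that by (simp add: \<Phi>_def D_Inl)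
  have tau_Inr: "is_tau_measure G \<phi> \<mu> (\<Phi> (Inr \<mu>))" if "Inr \<mu> \<in> D" for \<mu>
    using t(1) that by (simp add: \<Phi>_def D_Inr)
  have D_cases: "(\<exists>Q \<xi>. z = Inl (Q, \<xi>)) \<or> (\<exists>\<mu>. z = Inr \<mu>)" for z :: "('x set \<times> ('g \<Rightarrow> complex)) + 'x measure"
    by (metis sum.exhaust surj_pair)
  have inj_mixed: "\<Phi> (Inl (Q, \<xi>)) \<noteq> \<Phi> (Inr \<mu>)" if "Inl (Q, \<xi>) \<in> D" "Inr \<mu> \<in> D" for Q \<xi> \<mu>
  proof -
    have Q: "Q \<in> finite_orbits G \<phi>" "\<xi> \<in> discrete_dual (stabilizer_group G \<phi> (pt Q))" using that(1) by (auto simp: D_Inl)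
    show ?thesis
      using tau_orbit_ne_measure[OF fin_pt(1)[OF Q(1)] Q(2) tau_Inl[OF that(1)], of \<mu>] tau_Inr[OF that(2)] that(2)
      by (metis D_Inr)
  qed
  have inj: "inj_on \<Phi> D"
  proof (rule inj_onI)
    fix z w assume z: "z \<in> D" and w: "w \<in> D" and eq: "\<Phi> z = \<Phi> w"
    consider (ll) Q \<xi> R \<zeta> where "z = Inl (Q, \<xi>)" "w = Inl (R, \<zeta>)" | (rr) \<mu> \<nu> where "z = Inr \<mu>" "w = Inr \<nu>"
      | (lr) Q \<xi> \<mu> where "z = Inl (Q, \<xi>)" "w = Inr \<mu>" | (rl) Q \<xi> \<mu> where "z = Inr \<mu>" "w = Inl (Q, \<xi>)"
      using D_cases[of z] D_cases[of w] by blast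
    thus "z = w"
    proof cases
      case ll
      have Q: "Q \<in> finite_orbits G \<phi>" "\<xi> \<in> discrete_dual (stabilizer_group G \<phi> (pt Q))"
        and R: "R \<in> finite_orbits G \<phi>" "\<zeta> \<in> discrete_dual (stabilizer_group G \<phi> (pt R))"
        using z w by (auto simp: ll D_Inl)
      have T: "is_tau_orbit G \<phi> (pt Q) \<xi> (\<Phi> z)" "is_tau_orbit G \<phi> (pt R) \<zeta> (\<Phi> z)"
        using tau_Inl[of Q \<xi>] tau_Inl[of R \<zeta>] z w unfolding eq by (simp_all add: ll eq[unfolded ll])
      from tau_orbit_inj[OF fin_pt(1)[OF Q(1)] fin_pt(1)[OF R(1)] Q(2) R(2) T]
      show ?thesis by (simp add: ll fin_pt(2)[OF Q(1)] fin_pt(2)[OF R(1)])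
    next
      case rr
      have "is_tau_measure G \<phi> \<mu> (\<Phi> z)" "is_tau_measure G \<phi> \<nu> (\<Phi> z)"
        using tau_Inr[of \<mu>] tau_Inr[of \<nu>] z w unfolding eq by (simp_all add: rr eq[unfolded rr])
      thus ?thesis using tau_measure_inj[of \<mu> \<nu>] z w by (simp add: rr D_Inr)
    next
      case lr
      thus ?thesis using inj_mixed z w eq by blast
    next
      case rl
      thus ?thesis using inj_mixed z w eq by metis
    qed
  qed
  have image: "\<Phi> ` D = K"
  proof
    show "\<Phi> ` D \<subseteq> K"
    proof
      fix T assume "T \<in> \<Phi> ` D"
      then obtain z where z: "z \<in> D" "T = \<Phi> z" by blast
      from D_cases[of z] show "T \<in> K"
        using z s(2) t(2) by (auto simp: \<Phi>_def D_Inl D_Inr)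
    qed
    show "K \<subseteq> \<Phi> ` D"
    proof
      fix T assume "T \<in> K"
      hence T: "T \<in> extreme_points (\<lambda>\<tau>. \<tau>) (tracial_states (crossed_product G \<phi>))" by (simp add: K_def)
      from T show "T \<in> \<Phi> ` D"
      proof (cases rule: extreme_tracial_state_cases)
        case (1 \<mu>)
        have "T = \<Phi> (Inr \<mu>)" using tau_measure_unique[OF 1(2) tau_Inr] 1(1) by (simp add: D_Inr)
        moreover have "Inr \<mu> \<in> D" using 1(1) by (simp add: D_Inr)
        ultimately show ?thesis by (rule image_eqI)
      next
        case (2 x \<xi>)
        let ?Q = "orbit G \<phi> x"
        have "?Q \<in> finite_orbits G \<phi>" using 2(1) by (auto simp: finite_orbits_def orbits_def)
        hence Q: "Inl (?Q, \<xi>) \<in> D" using 2(2) by (simp add: D_Inl stab)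
        have "is_tau_orbit G \<phi> (pt ?Q) \<xi> T" using 2(3) is_tau_orbit_cong[OF pt] by simp
        hence "T = \<Phi> (Inl (?Q, \<xi>))" using tau_Inl[OF Q] by (rule tau_orbit_unique)
        thus ?thesis using Q by (rule image_eqI)
      qed
    qed
  qed
  show ?thesis
  proof (rule that)
    show "bij_betw \<Phi> D K" using inj image by (simp add: bij_betw_def)
    show "is_tau_measure G \<phi> \<mu> (\<Phi> (Inr \<mu>))" if "\<mu> \<in> full_support_extreme_measures G \<phi>" for \<mu>
      using tau_Inr that by (simp add: D_Inr)
    show "is_tau_orbit G \<phi> x \<xi> (\<Phi> (Inl (orbit G \<phi> x, \<xi>)))"
      if "orbit G \<phi> x \<in> finite_orbits G \<phi>" "\<xi> \<in> discrete_dual (stabilizer_group G \<phi> x)" for x \<xi>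
      using tau_Inl[of "orbit G \<phi> x" \<xi>] that is_tau_orbit_cong[OF pt] by (simp add: D_Inl stab)
  qed
qed

end

theorem proposition2p7:
  fixes G :: "'g monoid"
    and \<phi> :: "'g \<Rightarrow> 'x::{t2_space, second_countable_topology} \<Rightarrow> 'x"
  assumes "comm_group G" and "countable (carrier G)"
    and "infinite (UNIV :: 'x set)" and "compact (UNIV :: 'x set)"
    and "action_by_homeos G \<phi>" and "faithful G \<phi>" and "almost_minimal G \<phi>"
  shows "countable (finite_orbits G \<phi>) \<and>
    (\<forall>\<mu>\<in>full_support_extreme_measures G \<phi>. \<exists>!\<tau>. is_tau_measure G \<phi> \<mu> \<tau>) \<and>
    (\<forall>x \<xi>. orbit G \<phi> x \<in> finite_orbits G \<phi> \<and> \<xi> \<in> discrete_dual (stabilizer_group G \<phi> x) \<longrightarrow>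
       (\<exists>!\<tau>. is_tau_orbit G \<phi> x \<xi> \<tau>)) \<and>
    (\<exists>\<Phi>. bij_betw \<Phi>
        ((SIGMA Q:finite_orbits G \<phi>. \<Union>x\<in>Q. discrete_dual (stabilizer_group G \<phi> x)) <+>
         full_support_extreme_measures G \<phi>)
        (extreme_points (\<lambda>\<tau>. \<tau>) (tracial_states (crossed_product G \<phi>))) \<and>
      (\<forall>\<mu>\<in>full_support_extreme_measures G \<phi>. is_tau_measure G \<phi> \<mu> (\<Phi> (Inr \<mu>))) \<and>
      (\<forall>x \<xi>. orbit G \<phi> x \<in> finite_orbits G \<phi> \<and> \<xi> \<in> discrete_dual (stabilizer_group G \<phi> x) \<longrightarrow>
         is_tau_orbit G \<phi> x \<xi> (\<Phi> (Inl (orbit G \<phi> x, \<xi>)))))"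
proof -
  interpret almost_minimal_system G \<phi>
    using assms by (intro almost_minimal_system.intro almost_minimal_system_axioms.intro
        compact_abelian_system.intro compact_abelian_system_axioms.intro)
  obtain \<Phi> where \<Phi>: "bij_betw \<Phi>
      ((SIGMA Q:finite_orbits G \<phi>. \<Union>x\<in>Q. discrete_dual (stabilizer_group G \<phi> x)) <+>
         full_support_extreme_measures G \<phi>)
      (extreme_points (\<lambda>\<tau>. \<tau>) (tracial_states (crossed_product G \<phi>)))"
    and measures: "\<And>\<mu>. \<mu> \<in> full_support_extreme_measures G \<phi> \<Longrightarrow> is_tau_measure G \<phi> \<mu> (\<Phi> (Inr \<mu>))"
    and orbits: "\<And>x \<xi>. orbit G \<phi> x \<in> finite_orbits G \<phi> \<Longrightarrow> \<xi> \<in> discrete_dual (stabilizer_group G \<phi> x) \<Longrightarrow>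
      is_tau_orbit G \<phi> x \<xi> (\<Phi> (Inl (orbit G \<phi> x, \<xi>)))"
    by (rule extreme_tracial_states_bij) (rule that)
  show ?thesis
  proof (intro conjI ballI allI impI countable_finite_orbits exI[of _ \<Phi>] \<Phi>; (elim conjE)?)
    fix \<mu> assume "\<mu> \<in> full_support_extreme_measures G \<phi>"
    note T = measures[OF this]
    show "\<exists>!\<tau>. is_tau_measure G \<phi> \<mu> \<tau>" using T tau_measure_unique[OF _ T] by (rule ex1I)
    show "is_tau_measure G \<phi> \<mu> (\<Phi> (Inr \<mu>))" by (rule T)
  next
    fix x \<xi> assume "orbit G \<phi> x \<in> finite_orbits G \<phi>" "\<xi> \<in> discrete_dual (stabilizer_group G \<phi> x)"
    note T = orbits[OF this]
    show "\<exists>!\<tau>. is_tau_orbit G \<phi> x \<xi> \<tau>" using T tau_orbit_unique[OF _ T] by (rule ex1I)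
    show "is_tau_orbit G \<phi> x \<xi> (\<Phi> (Inl (orbit G \<phi> x, \<xi>)))" by (rule T)
  qed
qed

end
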